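(* Let $1\le q<2$ and $\mathcal F_q=\{f\in\mathcal W_q[0,1]:\|f\|_{[q]}\le1\}$. Let $\widehat\beta_n(f)$ be the least squares estimator of $\beta\in\mathbb R$ in the regression model $Y_j=\beta f(j/n)+X_j$, $j=1,\dots,n$, where $X_1,X_2,\dots$ is a short-memory linear process $X_i=\sum_{j=0}^\infty\psi_j\eta_{i-j}$, and let $$W_n(f):=\frac1{\sqrt n}\sum_{j=1}^nf^2\Big(\frac jn\Big)\big[\widehat\beta_n(f)-\beta\big],\qquad f\in\mathcal F_q.$$ Then there exists a version of the isonormal Gaussian process $\nu$ restricted to $\mathcal F_q$ with values in a separable subset of $\ell^\infty(\mathcal F_q)$, which is measurable for the Borel sets on its range, and $$W_n\xrightarrow{\mathscr D^*}\sigma_\eta A_\psi\,\nu\qquad\text{in }\ell^\infty(\mathcal F_q)\text{ as }n\to\infty .$$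
   Context: Short-memory linear process: $(\eta_j)_{j\in\mathbb Z}$ are i.i.d. real random variables on a probability space $(\Omega,\mathcal A,\mathsf P)$ with mean zero and finite variance $\sigma_\eta^2=\mathsf E\eta_1^2\neq0$ ($\sigma_\eta>0$); $(\psi_j)_{j\ge0}$ are real numbers with $\sum_{j\ge0}|\psi_j|<\infty$ and $A_\psi:=\sum_{j\ge0}\psi_j\ne0$; and $X_i=\sum_{j=0}^\infty\psi_j\eta_{i-j}$ for $i\in\mathbb Z$. Least squares estimator: for $f:[0,1]\to\mathbb R$ and $Y_j=\beta f(j/n)+X_j$, $\widehat\beta_n(f)=\big(\sum_{j=1}^nf^2(j/n)\big)^{-1}\sum_{j=1}^nY_jf(j/n)$, so that $\sum_{j=1}^nf^2(j/n)\,[\widehat\beta_n(f)-\beta]=\sum_{j=1}^nX_jf(j/n)$. If $\sum_{j=1}^nf^2(j/n)=0$, $\widehat\beta_n(f)$ is assigned an arbitrary real value (the identity still holds, both sides being $0$). $q$-variation: $v_q(g)=\sup\{\sum_{i=1}^m|g(t_i)-g(t_{i-1})|^q:0=t_0<\dots<t_m=1,\ m\ge1\}$; $\mathcal W_q[0,1]$ is the set of $g:[0,1]\to\mathbb R$ with $v_q(g)<\infty$, with norm $\|g\|_{[q]}=\sup_{t\in[0,1]}|g(t)|+v_q(g)^{1/q}$. $\ell^\infty(\mathcal F)$: the Banach space of bounded functions $\mu:\mathcal F\to\mathbb R$ with norm $\|\mu\|_{\mathcal F}=\sup_{f\in\mathcal F}|\mu(f)|$. Isonormal Gaussian process $\nu$: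 a centred Gaussian process indexed by $f\in\mathcal L^2([0,1],\lambda)$ ($\lambda$ Lebesgue measure) with $\mathsf E[\nu(f)\nu(g)]=\int_0^1fg\,d\lambda$. Convergence in outer distribution: let $\mathbb E$ be a metric space, let $Z_n$ be (arbitrary) functions from probability spaces $(\Omega_n,\mathcal A_n,P_n)$ into $\mathbb E$, $n\ge0$, where $Z_0$ takes values in a separable subset of $\mathbb E$ and is measurable for the Borel sets on its range. Then $Z_n\xrightarrow{\mathscr D^*}Z_0$ means $\lim_{n\to\infty}E^*h(Z_n)=Eh(Z_0)$ for every bounded continuous $h:\mathbb E\to\mathbb R$, where $E^*T=\inf\{EU:U\text{ measurable},\ EU\text{ exists},\ U\ge T\}$ is the outer integral. *)

theory Defs
  imports "HOL-Probability.Probability"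
begin

text \<open>
  A function on the unit interval is a function of type \<open>real \<Rightarrow> real\<close> in
  \<open>extensional {0..1}\<close>, so that distinct elements differ at some point of the interval.
\<close>

definition qvar_sums :: "real \<Rightarrow> (real \<Rightarrow> real) \<Rightarrow> real set" where
  "qvar_sums q g = {\<Sum>i=1..m. \<bar>g (t i) - g (t (i - 1))\<bar> powr q | m t.
     1 \<le> m \<and> t 0 = 0 \<and> t m = 1 \<and> (\<forall>i<m. t i < t (Suc i))}"

text \<open>The real supremum is only meaningful if \<open>qvar_sums q g\<close> is bounded above.\<close>

definition qvar :: "real \<Rightarrow> (real \<Rightarrow> real) \<Rightarrow> real" where
  "qvar q g = Sup (qvar_sums q g)"

definition qvar_space :: "real \<Rightarrow> (real \<Rightarrow> real) set" where
  "qvar_space q = {g \<in> extensional {0..1}. bdd_above (qvar_sums q g)}"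

definition qvar_norm :: "real \<Rightarrow> (real \<Rightarrow> real) \<Rightarrow> real" where
  "qvar_norm q g = (SUP t\<in>{0..1}. \<bar>g t\<bar>) + qvar q g powr (1 / q)"

definition qvar_ball :: "real \<Rightarrow> (real \<Rightarrow> real) set" where
  "qvar_ball q = {f \<in> qvar_space q. qvar_norm q f \<le> 1}"

text \<open>
  The series defining \<open>X i\<close> converges almost surely; \<open>X i\<close> may be any random variable that is
  almost surely equal to its sum.
\<close>

definition short_memory_linear_process ::
  "'a measure \<Rightarrow> (int \<Rightarrow> 'a \<Rightarrow> real) \<Rightarrow> real \<Rightarrow> (nat \<Rightarrow> real) \<Rightarrow> (int \<Rightarrow> 'a \<Rightarrow> real) \<Rightarrow> bool" where
  "short_memory_linear_process M \<eta> \<sigma> \<psi> X \<longleftrightarrow>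
     prob_space M \<and>
     prob_space.indep_vars M (\<lambda>_. borel) \<eta> UNIV \<and>
     (\<forall>j. distr M borel (\<eta> j) = distr M borel (\<eta> 1)) \<and>
     integrable M (\<eta> 1) \<and> (\<integral>\<omega>. \<eta> 1 \<omega> \<partial>M) = 0 \<and>
     integrable M (\<lambda>\<omega>. (\<eta> 1 \<omega>)\<^sup>2) \<and> (\<integral>\<omega>. (\<eta> 1 \<omega>)\<^sup>2 \<partial>M) = \<sigma>\<^sup>2 \<and> 0 < \<sigma> \<and>
     summable (\<lambda>j. \<bar>\<psi> j\<bar>) \<and> (\<Sum>j. \<psi> j) \<noteq> 0 \<and>
     (\<forall>i. X i \<in> borel_measurable M \<and>
          (AE \<omega> in M. (\<lambda>j. \<psi> j * \<eta> (i - int j) \<omega>) sums X i \<omega>))"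

text \<open>
  \<open>b\<close> is a value of the least squares estimator from the observations \<open>y 1, \<dots>, y n\<close>;
  it is unconstrained if the design vector vanishes.
\<close>

definition is_lse :: "nat \<Rightarrow> (real \<Rightarrow> real) \<Rightarrow> (nat \<Rightarrow> real) \<Rightarrow> real \<Rightarrow> bool" where
  "is_lse n f y b \<longleftrightarrow>
     ((\<Sum>j=1..n. (f (real j / real n))\<^sup>2) \<noteq> 0 \<longrightarrow>
      b = inverse (\<Sum>j=1..n. (f (real j / real n))\<^sup>2) * (\<Sum>j=1..n. y j * f (real j / real n)))"

text \<open>Constants are regarded as (degenerate) Gaussian random variables.\<close>

definition gaussian_rv :: "'a measure \<Rightarrow> ('a \<Rightarrow> real) \<Rightarrow> bool" where
  "gaussian_rv M Z \<longleftrightarrow> Z \<in> borel_measurable M \<and>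
     ((\<exists>c. AE \<omega> in M. Z \<omega> = c) \<or>
      (\<exists>\<mu> s. 0 < s \<and> distributed M lborel Z (normal_density \<mu> s)))"

definition centred_gaussian_process ::
  "'a measure \<Rightarrow> 'i set \<Rightarrow> ('i \<Rightarrow> 'a \<Rightarrow> real) \<Rightarrow> bool" where
  "centred_gaussian_process M T Z \<longleftrightarrow>
     (\<forall>S c. finite S \<and> S \<subseteq> T \<longrightarrow> gaussian_rv M (\<lambda>\<omega>. \<Sum>t\<in>S. c t * Z t \<omega>)) \<and>
     (\<forall>t\<in>T. (\<integral>\<omega>. Z t \<omega> \<partial>M) = 0)"

definition L2_unit :: "(real \<Rightarrow> real) set" where
  "L2_unit = {f \<in> extensional {0..1}. f \<in> borel_measurable (lebesgue_on {0..1}) \<and>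
     integrable (lebesgue_on {0..1}) (\<lambda>x. (f x)\<^sup>2)}"

definition isonormal_process ::
  "'a measure \<Rightarrow> ((real \<Rightarrow> real) \<Rightarrow> 'a \<Rightarrow> real) \<Rightarrow> bool" where
  "isonormal_process M \<nu> \<longleftrightarrow>
     prob_space M \<and> centred_gaussian_process M L2_unit \<nu> \<and>
     (\<forall>f\<in>L2_unit. \<forall>g\<in>L2_unit.
        (\<integral>\<omega>. \<nu> f \<omega> * \<nu> g \<omega> \<partial>M) = (\<integral>x. f x * g x \<partial>lebesgue_on {0..1}))"

definition version_on ::
  "'a measure \<Rightarrow> 'i set \<Rightarrow> ('i \<Rightarrow> 'a \<Rightarrow> real) \<Rightarrow> ('i \<Rightarrow> 'a \<Rightarrow> real) \<Rightarrow> bool" where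
  "version_on M T Z Z' \<longleftrightarrow>
     (\<forall>t\<in>T. Z' t \<in> borel_measurable M \<and> (AE \<omega> in M. Z' t \<omega> = Z t \<omega>))"

text \<open>Bounded functions on \<open>F\<close> (extensional outside of \<open>F\<close>) with the supremum distance.\<close>

abbreviation linfty :: "'i set \<Rightarrow> ('i \<Rightarrow> real) metric" where
  "linfty F \<equiv> funspace F euclidean_metric"

text \<open>Since \<open>e2ennreal\<close> maps negative numbers to \<open>0\<close>, these are the integrals of the positive and
  of the negative part; the expectation exists if at least one of them is finite.\<close>

definition ereal_expectation_exists :: "'a measure \<Rightarrow> ('a \<Rightarrow> ereal) \<Rightarrow> bool" where
  "ereal_expectation_exists M U \<longleftrightarrow>
     (\<integral>\<^sup>+\<omega>. e2ennreal (U \<omega>) \<partial>M) < \<infinity> \<or> (\<integral>\<^sup>+\<omega>. e2ennreal (- U \<omega>) \<partial>M) < \<infinity>"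

definition ereal_expectation :: "'a measure \<Rightarrow> ('a \<Rightarrow> ereal) \<Rightarrow> ereal" where
  "ereal_expectation M U =
     enn2ereal (\<integral>\<^sup>+\<omega>. e2ennreal (U \<omega>) \<partial>M) - enn2ereal (\<integral>\<^sup>+\<omega>. e2ennreal (- U \<omega>) \<partial>M)"

definition outer_expectation :: "'a measure \<Rightarrow> ('a \<Rightarrow> real) \<Rightarrow> ereal" where
  "outer_expectation M T = Inf {ereal_expectation M U | U.
     U \<in> borel_measurable M \<and> ereal_expectation_exists M U \<and>
     (\<forall>\<omega>\<in>space M. ereal (T \<omega>) \<le> U \<omega>)}"

definition topology_borel :: "'e topology \<Rightarrow> 'e measure" where
  "topology_borel X = sigma (topspace X) {U. openin X U}"

definition separable_borel_valued :: "'a measure \<Rightarrow> 'e metric \<Rightarrow> ('a \<Rightarrow> 'e) \<Rightarrow> bool" where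
  "separable_borel_valued P E Z \<longleftrightarrow>
     (\<exists>S. S \<subseteq> mspace E \<and> separable_space (subtopology (mtopology_of E) S) \<and> Z ` space P \<subseteq> S) \<and>
     Z \<in> measurable P (topology_borel (subtopology (mtopology_of E) (Z ` space P)))"

definition converges_outer_distr ::
  "'e metric \<Rightarrow> (nat \<Rightarrow> 'a measure) \<Rightarrow> (nat \<Rightarrow> 'a \<Rightarrow> 'e) \<Rightarrow> 'b measure \<Rightarrow> ('b \<Rightarrow> 'e) \<Rightarrow> bool" where
  "converges_outer_distr E P Z P0 Z0 \<longleftrightarrow>
     (\<forall>n. prob_space (P n) \<and> Z n ` space (P n) \<subseteq> mspace E) \<and>
     prob_space P0 \<and> separable_borel_valued P0 E Z0 \<and>
     (\<forall>h. continuous_map (mtopology_of E) euclideanreal h \<and> bounded (h ` mspace E) \<longrightarrow>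
        (\<lambda>n. outer_expectation (P n) (\<lambda>\<omega>. h (Z n \<omega>)))
          \<longlonglongrightarrow> ereal (\<integral>\<omega>. h (Z0 \<omega>) \<partial>P0))"

end

theory Submission
  imports Defs
begin

text \<open>
  The proof is a quantitative chaining argument that replaces both the maximal inequalities and the
  entropy bounds of the general theory. Cut the unit interval into \<open>16 ^ k\<close> cells and replace
  \<open>f\<close> by its value at the right end point of the cell. The error of one refinement step is
  a sum of products \<open>d * x\<close>, where \<open>d\<close> is an increment of \<open>f\<close> and \<open>x\<close> a partial sum over a cell, and
  \<open>d * \<bar>x\<bar> \<le> u * (d powr q + x\<^sup>2) + x ^ 4 / u ^ s\<close>. The increments of \<open>f\<close> contribute at most a constant,
  uniformly over the ball, since its \<open>q\<close>-variation is bounded; the remaining terms do not depend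
  on \<open>f\<close> and have small expectation when \<open>u\<close> decays geometrically in \<open>k\<close>. Truncation provides the
  fourth moments. The same bound applies to the innovations and to a Gaussian family, and
  it is linear in the shifted sequences of innovations, so that it passes to the linear process
  with the weights \<open>\<bar>\<psi> i\<bar>\<close>.

  It remains to treat the \<open>16 ^ K\<close> block sums for fixed \<open>K\<close>. Telescoping shows that the block sums
  of the linear process and \<open>\<Sum>\<psi>\<close> times those of the innovations differ by a term that vanishes in
  mean, and the latter are independent and obey the central limit theorem. For Lipschitz test
  functions all these errors add up; arbitrary bounded continuous test functions are limits of
  monotone sequences of Lipschitz functions.
\<close>

section \<open>Deterministic chaining over the variation ball\<close>

text \<open>Only second moments of the innovations are available, while the chaining inequality asks
  for fourth moments at every level; hence the truncation level is lowered together with the mesh.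
  With truncation at sqrt n / 2 ^ k and cells of about n / 16 ^ k points, the normalised block sums
  of level k have total fourth moment of order 1 / 4 ^ k, and the total squared bias caused by
  truncation is of order 4 ^ k / 16 ^ k; the base 16 keeps it bounded. The weight u =
  \<open>chain_ratio q ^ k\<close> is such that dividing by \<open>u ^ young_exp q\<close> costs
  only the factor 2 ^ k, which leaves the summable 1 / 2 ^ k. The condition q < 2 enters as 1 / q +
  1 / 2 > 1: for small d and x the product d * \<bar>x\<bar> is of smaller order than
  \<open>d powr q + x\<^sup>2\<close>, and the quartic term is charged only when \<bar>x\<bar> is
  not too small. The empirical path need not be measurable for the supremum distance. All errors are
  therefore bounded by measurable majorants that do not depend on \<open>f\<close>, and outer
  expectations are squeezed between ordinary ones.\<close>

definition young_exp :: "real \<Rightarrow> nat" where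
  "young_exp q = nat \<lceil>3 * (1 + 2 / (2 - q))\<rceil>"

text \<open>If d is at most u * \<bar>x\<bar>, the square pays for the product; if \<bar>x\<bar> is
  at most u * d powr (q - 1), the variation term does. Otherwise the reversed inequalities bound d
  below by u powr (2 / (2 - q)) and then \<bar>x\<bar> below by u powr (1 + 2 / (2 - q)). The
  exponent \<open>young_exp\<close> comes from the cube of this bound, rounded up, so that
  \<bar>x\<bar> is at most \<open>x ^ 4 / u ^ young_exp q\<close>.\<close>

lemma young_quartic:
  fixes q u d x :: real
  assumes q: "1 \<le> q" "q < 2" and u: "0 < u" "u \<le> 1" and d: "0 \<le> d" "d \<le> 1"
  shows "d * \<bar>x\<bar> \<le> u * (d powr q + x\<^sup>2) + x ^ 4 / u ^ young_exp q"
proof -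
  let ?s = "young_exp q"
  have nn: "0 \<le> u * d powr q" "0 \<le> u * x\<^sup>2" "0 \<le> x ^ 4 / u ^ ?s"
    using u by auto
  then have nn': "0 \<le> u * (d powr q + x\<^sup>2)" by (simp add: distrib_left)
  consider "d \<le> u * \<bar>x\<bar>" | "\<bar>x\<bar> \<le> u * d powr (q - 1)"
    | "u * \<bar>x\<bar> < d" "u * d powr (q - 1) < \<bar>x\<bar>" by linarith
  then show ?thesis
  proof cases
    case 1
    then have "d * \<bar>x\<bar> \<le> u * \<bar>x\<bar> * \<bar>x\<bar>" by (rule mult_right_mono) auto
    also have "\<dots> = u * x\<^sup>2" by (simp add: power2_eq_square mult.assoc)
    finally show ?thesis using nn by (simp add: algebra_simps)
  next
    case 2
    have "d * \<bar>x\<bar> \<le> d * (u * d powr (q - 1))" using 2 d by (intro mult_left_mono)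
    also have "\<dots> = u * d powr q"
    proof (cases "d = 0")
      case False
      then have "d powr q = d powr (1 + (q - 1))" by simp
      also have "\<dots> = d * d powr (q - 1)" using False d by (subst powr_add) auto
      finally show ?thesis by simp
    qed (use q in auto)
    finally show ?thesis using nn by (simp add: algebra_simps)
  next
    case 3
    have dpos: "0 < d" using 3 u by (smt (verit) mult_nonneg_nonneg abs_ge_zero)
    \<comment> \<open>Chaining the two inequalities of this case through \<bar>x\<bar> eliminates it
      and leaves a condition on d alone.\<close>
    have "u * (u * d powr (q - 1)) < d" using 3 u
      by (meson mult_less_cancel_left_pos order_less_trans)
    moreover have "d powr (q - 1) = d / d powr (2 - q)"
    proof -
      have "d powr (q - 1) * d powr (2 - q) = d powr 1"
        by (subst powr_add [symmetric]) simp
      then show ?thesis using dpos by (simp add: field_simps)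
    qed
    ultimately have "u\<^sup>2 < d powr (2 - q)" using dpos
      by (simp add: field_simps power2_eq_square)
    then have "(u\<^sup>2) powr (1 / (2 - q)) < (d powr (2 - q)) powr (1 / (2 - q))"
      using u q by (intro powr_less_mono2) auto
    also have "\<dots> = d" using q dpos by (simp add: powr_powr)
    also have "(u\<^sup>2) powr (1 / (2 - q)) = u powr (2 / (2 - q))"
      using u by (simp add: powr_powr flip: powr_numeral)
    finally have d_gt: "u powr (2 / (2 - q)) < d" .
    have "d \<le> d powr (q - 1)" using powr_mono'[of "q - 1" 1 d] q d dpos by simp
    then have "u * d \<le> \<bar>x\<bar>" using 3 u
      by (meson mult_left_mono order_less_imp_le order_trans)
    then have "u powr (1 + 2 / (2 - q)) \<le> \<bar>x\<bar>"
      using d_gt u by (smt (verit) mult_left_mono powr_add powr_one)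
    then have "(u powr (1 + 2 / (2 - q))) powr 3 \<le> \<bar>x\<bar> powr 3"
      by (intro powr_mono2) auto
    then have "u powr (3 * (1 + 2 / (2 - q))) \<le> \<bar>x\<bar> ^ 3"
      using 3 u by (simp add: powr_powr mult.commute flip: powr_numeral)
    moreover have "u ^ ?s \<le> u powr (3 * (1 + 2 / (2 - q)))"
    proof -
      have "3 * (1 + 2 / (2 - q)) \<le> real ?s"
        unfolding young_exp_def by linarith
      then have "u powr real ?s \<le> u powr (3 * (1 + 2 / (2 - q)))"
        using u by (intro powr_mono') auto
      then show ?thesis using u by (simp add: powr_realpow)
    qed
    ultimately have "u ^ ?s * \<bar>x\<bar> \<le> \<bar>x\<bar> ^ 3 * \<bar>x\<bar>" by (intro mult_right_mono) auto
    also have "\<dots> = x ^ 4" by (simp add: power_even_abs_numeral numeral_eq_Suc)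
    finally have "\<bar>x\<bar> \<le> x ^ 4 / u ^ ?s" using u by (simp add: field_simps)
    moreover have "d * \<bar>x\<bar> \<le> \<bar>x\<bar>" using d by (simp add: mult_left_le_one_le)
    ultimately show ?thesis using nn' by linarith
  qed
qed

lemma qvar_sums_weak_partition:
  fixes x :: "nat \<Rightarrow> real"
  assumes "0 \<le> x 0" "x m \<le> 1" "\<And>i. i < m \<Longrightarrow> x i \<le> x (Suc i)"
  shows "\<exists>v\<in>qvar_sums q g. (\<Sum>i=1..m. \<bar>g (x i) - g (x (i - 1))\<bar> powr q) \<le> v"
proof -
  \<comment> \<open>The induction runs over prefixes, with strict partitions that start at 0 and end
    at x k; the end point 1 is adjoined only afterwards.\<close>
  have "\<exists>m' t. t 0 = 0 \<and> t m' = x k \<and> (\<forall>i<m'. t i < t (Suc i)) \<and>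
      (\<Sum>i=1..k. \<bar>g (x i) - g (x (i - 1))\<bar> powr q) \<le> (\<Sum>i=1..m'. \<bar>g (t i) - g (t (i - 1))\<bar> powr q)"
    if "k \<le> m" for k
    using that
  proof (induction k)
    case 0
    show ?case
    proof (cases "x 0 = 0")
      case True
      then show ?thesis by (intro exI[of _ 0] exI[of _ "\<lambda>_. 0"]) auto
    next
      case False
      then show ?thesis using assms(1)
        by (intro exI[of _ 1] exI[of _ "\<lambda>i. if i = 0 then 0 else x 0"]) auto
    qed
  next
    case (Suc k)
    then obtain m' t where t: "t 0 = 0" "t m' = x k" "\<forall>i<m'. t i < t (Suc i)"
      "(\<Sum>i=1..k. \<bar>g (x i) - g (x (i - 1))\<bar> powr q) \<le> (\<Sum>i=1..m'. \<bar>g (t i) - g (t (i - 1))\<bar> powr q)"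
      by auto
    show ?case
    proof (cases "x (Suc k) = x k")
      case True
      then show ?thesis using t by (intro exI[of _ m'] exI[of _ t]) auto
    next
      case False
      define t' where "t' = t(Suc m' := x (Suc k))"
      have "(\<Sum>i=1..m'. \<bar>g (t' i) - g (t' (i - 1))\<bar> powr q) = (\<Sum>i=1..m'. \<bar>g (t i) - g (t (i - 1))\<bar> powr q)"
        by (intro sum.cong) (auto simp: t'_def)
      moreover have "x k < x (Suc k)" using False assms(3)[of k] Suc.prems by auto
      ultimately show ?thesis using t
        by (intro exI[of _ "Suc m'"] exI[of _ t']) (auto simp: t'_def less_Suc_eq)
    qed
  qed
  from this[of m] obtain m' t where t: "t 0 = 0" "t m' = x m" "\<forall>i<m'. t i < t (Suc i)"
      "(\<Sum>i=1..m. \<bar>g (x i) - g (x (i - 1))\<bar> powr q) \<le> (\<Sum>i=1..m'. \<bar>g (t i) - g (t (i - 1))\<bar> powr q)"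
    by auto
  show ?thesis
  proof (cases "x m = 1")
    case True
    then have "1 \<le> m'" using t by (cases m') auto
    then have "(\<Sum>i=1..m'. \<bar>g (t i) - g (t (i - 1))\<bar> powr q) \<in> qvar_sums q g"
      unfolding qvar_sums_def using t(1-3) True by (intro CollectI exI[of _ m'] exI[of _ t]) simp
    then show ?thesis using t(4) by (rule bexI[rotated])
  next
    case False
    define t' where "t' = t(Suc m' := 1)"
    have "(\<Sum>i=1..m'. \<bar>g (t' i) - g (t' (i - 1))\<bar> powr q) = (\<Sum>i=1..m'. \<bar>g (t i) - g (t (i - 1))\<bar> powr q)"
      by (intro sum.cong) (auto simp: t'_def)
    then have "(\<Sum>i=1..m. \<bar>g (x i) - g (x (i - 1))\<bar> powr q)
        \<le> (\<Sum>i=1..Suc m'. \<bar>g (t' i) - g (t' (i - 1))\<bar> powr q)"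
      using t(4) by simp (smt (verit) powr_ge_zero)
    moreover have "(\<Sum>i=1..Suc m'. \<bar>g (t' i) - g (t' (i - 1))\<bar> powr q) \<in> qvar_sums q g"
      unfolding qvar_sums_def
      using t(1-3) False assms(2)
      by (intro CollectI exI[of _ "Suc m'"] exI[of _ t']) (auto simp: t'_def less_Suc_eq)
    ultimately show ?thesis by (rule bexI)
  qed
qed

text \<open>\<open>qvar_norm\<close> is built from real suprema, which say nothing unless the sets
  are bounded above. For the variation sums this is part of \<open>qvar_space\<close>; for
  \<bar>f\<bar> it must first be derived from the variation between 0 and t.\<close>

lemma qvar_ball_props:
  assumes f: "f \<in> qvar_ball q" and q: "1 \<le> q"
  shows qvar_ball_abs_le: "t \<in> {0..1} \<Longrightarrow> \<bar>f t\<bar> \<le> 1"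
    and qvar_ball_sums_le: "v \<in> qvar_sums q f \<Longrightarrow> v \<le> 1"
proof -
  have bdd: "bdd_above (qvar_sums q f)" and norm: "qvar_norm q f \<le> 1"
    using f by (auto simp: qvar_ball_def qvar_space_def)
  then obtain B where B: "\<And>v. v \<in> qvar_sums q f \<Longrightarrow> v \<le> B" by (auto simp: bdd_above_def)
  have qvar_ge: "v \<le> qvar q f" if "v \<in> qvar_sums q f" for v
    unfolding qvar_def using that bdd by (rule cSup_upper)
  have "\<bar>f t\<bar> \<le> \<bar>f 0\<bar> + max B 1" if t: "t \<in> {0..1}" for t
  proof -
    obtain v where v: "v \<in> qvar_sums q f" "\<bar>f t - f 0\<bar> powr q \<le> v"
      using qvar_sums_weak_partition[of "\<lambda>i. if i = 0 then 0 else t" 1 q f] t by auto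
    \<comment> \<open>\<open>B\<close> bounds the q-th power of the increment; an increment above 1
      is at most its q-th power.\<close>
    have "\<bar>f t - f 0\<bar> \<le> max B 1"
    proof (rule ccontr)
      assume *: "\<not> ?thesis"
      then have "\<bar>f t - f 0\<bar> powr 1 \<le> \<bar>f t - f 0\<bar> powr q" using q by (intro powr_mono) auto
      then show False using v B * by fastforce
    qed
    then show ?thesis by linarith
  qed
  then have bdd_f: "bdd_above ((\<lambda>t. \<bar>f t\<bar>) ` {0..1})" by (rule bdd_aboveI2)
  have sup0: "0 \<le> (SUP t\<in>{0..1}. \<bar>f t\<bar>)"
    by (rule cSUP_upper2[OF bdd_f, of 0]) auto
  have "(SUP t\<in>{0..1}. \<bar>f t\<bar>) \<le> 1" using norm unfolding qvar_norm_def by (smt (verit) powr_ge_zero)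
  then show "\<bar>f t\<bar> \<le> 1" if "t \<in> {0..1}"
    using cSUP_upper[OF that bdd_f] by linarith
  have qn: "0 \<le> qvar q f"
  proof -
    obtain v where v: "v \<in> qvar_sums q f" "0 \<le> v"
      using qvar_sums_weak_partition[of "\<lambda>i. 0" 0 q f] by auto
    then show ?thesis using qvar_ge by fastforce
  qed
  have "qvar q f powr (1 / q) \<le> 1" using norm sup0 unfolding qvar_norm_def by linarith
  then have "qvar q f \<le> 1"
    using q qn powr_less_mono2[of "1 / q" 1 "qvar q f"] by fastforce
  then show "v \<le> 1" if "v \<in> qvar_sums q f" using qvar_ge[OF that] by linarith
qed

text \<open>Sorting the two points inside each cell and listing cell after cell gives an increasing
  sample of 2 * N points. The wanted increments are every second increment of it, those with odd
  index.\<close>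

lemma qvar_ball_cells:
  fixes y y' :: "nat \<Rightarrow> real"
  assumes f: "f \<in> qvar_ball q" and q: "1 \<le> q" and N: "0 < N"
    and y: "\<And>m. m < N \<Longrightarrow> y m \<in> {real m / N .. real (Suc m) / N}"
    and y': "\<And>m. m < N \<Longrightarrow> y' m \<in> {real m / N .. real (Suc m) / N}"
  shows "(\<Sum>m<N. \<bar>f (y m) - f (y' m)\<bar> powr q) \<le> 1"
proof -
  define x where "x i = (if even i then min (y (i div 2)) (y' (i div 2)) else max (y (i div 2)) (y' (i div 2)))"
    for i :: nat
  have "x 0 \<ge> 0" using y[of 0] y'[of 0] N by (auto simp: x_def)
  moreover have "x (2 * N - 1) \<le> 1"
  proof -
    have "odd (2 * N - 1)" "(2 * N - 1) div 2 = N - 1" using N by auto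
    then show ?thesis using y[of "N - 1"] y'[of "N - 1"] N by (auto simp: x_def)
  qed
  moreover have "x i \<le> x (Suc i)" if "i < 2 * N - 1" for i
  proof (cases "even i")
    case True
    then show ?thesis by (auto simp: x_def)
  next
    case False
    then obtain k where k: "i = 2 * k + 1" by (auto elim: oddE)
    have "x i \<le> real (Suc k) / N" using k that y[of k] y'[of k] by (auto simp: x_def)
    moreover have "real (Suc k) / N \<le> x (Suc i)" using k that y[of "Suc k"] y'[of "Suc k"]
      by (auto simp: x_def)
    ultimately show ?thesis by linarith
  qed
  ultimately obtain v where v: "v \<in> qvar_sums q f"
    "(\<Sum>i=1..2*N-1. \<bar>f (x i) - f (x (i - 1))\<bar> powr q) \<le> v"
    using qvar_sums_weak_partition[of x "2*N-1" q f] by auto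
  have "(\<Sum>m<N. \<bar>f (y m) - f (y' m)\<bar> powr q) =
      (\<Sum>i\<in>(\<lambda>m. 2 * m + 1) ` {..<N}. \<bar>f (x i) - f (x (i - 1))\<bar> powr q)"
    by (subst sum.reindex) (auto simp: inj_on_def x_def min_def max_def abs_minus_commute intro!: sum.cong)
  also have "\<dots> \<le> (\<Sum>i=1..2*N-1. \<bar>f (x i) - f (x (i - 1))\<bar> powr q)"
    by (intro sum_mono2) auto
  also have "\<dots> \<le> 1" using v qvar_ball_sums_le[OF f q v(1)] by linarith
  finally show ?thesis .
qed

section \<open>Design points grouped by grid cells\<close>

text \<open>The index of the cell \<open>{m / N <.. (m + 1) / N}\<close> that contains \<open>j / n\<close>, for \<open>1 \<le> j \<le> n\<close>.\<close>

definition cidx :: "nat \<Rightarrow> nat \<Rightarrow> nat \<Rightarrow> nat" where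
  "cidx N n j = (N * j - 1) div n"

definition blk :: "nat \<Rightarrow> nat \<Rightarrow> nat \<Rightarrow> nat set" where
  "blk N n m = {j\<in>{1..n}. cidx N n j = m}"

lemma cidx_less:
  assumes "j \<in> {1..n}" "0 < N" shows "cidx N n j < N"
proof -
  have "N * j \<le> N * n" "0 < N * j" using assms by auto
  then have "N * j - 1 < N * n" by linarith
  then show ?thesis unfolding cidx_def by (rule less_mult_imp_div_less)
qed

lemma sum_blk: "0 < N \<Longrightarrow> (\<Sum>j=1..n. g j) = (\<Sum>m<N. \<Sum>j\<in>blk N n m. g j)"
  unfolding blk_def by (rule sum.group[symmetric]) (auto simp: cidx_less)

text \<open>The divisions by n and by 16 commute, and (16 * a - 1) div 16 = a - 1 for truncated
  subtraction. The parent of cell l is therefore l div 16.\<close>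

lemma cidx_nested:
  assumes "1 \<le> j" shows "cidx (16 * N) n j div 16 = cidx N n j"
proof -
  have "(16 * N * j - 1) div n div 16 = (16 * N * j - 1) div 16 div n"
    by (metis div_mult2_eq mult.commute)
  moreover have "(16 * N * j - 1) div 16 = N * j - 1"
    by (cases "N * j") (simp_all add: mult.assoc)
  ultimately show ?thesis by (simp add: cidx_def)
qed

text \<open>After clearing denominators, j lies in cell m iff m * n < N * j \<le> Suc m * n. That
  blocks are intervals gives their size and later lets shifted block sums telescope
  (\<open>sum_shift_diff_abs_le\<close>).\<close>

lemma blk_eq:
  assumes "0 < N" "m < N" shows "blk N n m = {m * n div N <.. Suc m * n div N}"
proof (cases "n = 0")
  case True then show ?thesis by (auto simp: blk_def)
next
  case False
  show ?thesis
  proof (intro set_eqI)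
    fix j
    have 1: "cidx N n j = m \<longleftrightarrow> m * n < N * j \<and> N * j \<le> Suc m * n" if "1 \<le> j"
    proof -
      have "0 < N * j" using that assms by simp
      \<comment> \<open>Writing N * j as a successor removes the truncated subtraction of
        \<open>cidx\<close>.\<close>
      then obtain x where x: "N * j = Suc x" by (metis gr0_implies_Suc)
      have "x div n = m \<longleftrightarrow> m * n \<le> x \<and> x < Suc m * n"
        using False dividend_less_times_div[of n x] times_div_less_eq_dividend[of n x] div_nat_eqI[of n m x]
        by (auto simp: mult.commute)
      then show ?thesis using x by (simp add: cidx_def less_Suc_eq_le Suc_le_eq)
    qed
    have 2: "m * n < N * j \<longleftrightarrow> m * n div N < j" using assms
      by (subst div_less_iff_less_mult) (simp_all add: mult.commute)
    have 3: "N * j \<le> Suc m * n \<longleftrightarrow> j \<le> Suc m * n div N" using assms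
      by (subst less_eq_div_iff_mult_less_eq) (simp_all add: mult.commute)
    have "Suc m * n \<le> N * n" using assms by (intro mult_right_mono) auto
    then have "Suc m * n div N \<le> N * n div N" by (rule div_le_mono)
    then have 4: "Suc m * n div N \<le> n" using assms by simp
    show "j \<in> blk N n m \<longleftrightarrow> j \<in> {m * n div N <.. Suc m * n div N}"
      using 1 2 3 4 by (auto simp: blk_def)
  qed
qed

lemma real_div_bounds:
  assumes "0 < N" shows "real (a div N) \<le> real a / N" "real a / N < real (a div N) + 1"
proof -
  have "real a = real (a div N) * N + real (a mod N)"
    by (metis div_mult_mod_eq of_nat_add of_nat_mult)
  moreover have "real (a mod N) < N" using assms by simp
  ultimately show "real (a div N) \<le> real a / N" "real a / N < real (a div N) + 1"
    using assms by (auto simp: field_simps)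
qed

lemma card_blk_le:
  assumes "0 < N" "m < N" shows "real (card (blk N n m)) \<le> n / N + 1"
proof -
  have "real (card (blk N n m)) \<le> real (Suc m * n) / N - real (m * n) / N + 1"
    using real_div_bounds(1)[OF assms(1), of "Suc m * n"] real_div_bounds(2)[OF assms(1), of "m * n"]
      div_le_mono[of "m * n" "Suc m * n" N]
    by (simp only: blk_eq[OF assms] card_greaterThanAtMost) (simp add: of_nat_diff)
  also have "\<dots> = n / N + 1" using assms by (simp add: field_simps)
  finally show ?thesis .
qed

lemma card_blk_le_1:
  assumes "0 < N" "m < N" "n \<le> N" shows "card (blk N n m) \<le> 1"
proof -
  have "Suc m * n div N \<le> (m * n + N) div N" using assms by (intro div_le_mono) auto
  then show ?thesis using assms by (simp only: blk_eq[OF assms(1,2)] card_greaterThanAtMost) simp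
qed

lemma sum_card_blk: "0 < N \<Longrightarrow> (\<Sum>m<N. card (blk N n m)) = n"
  using sum_blk[of N "\<lambda>_. 1 :: nat" n] by simp

lemma point_in_cell:
  assumes "j \<in> blk N n m" "0 < N" "m < N"
  shows "real j / n \<in> {real m / N .. real (Suc m) / N}"
proof -
  have n: "0 < n" using assms(1) by (auto simp: blk_def)
  have "j \<in> {m * n div N <.. Suc m * n div N}" using assms blk_eq by auto
  then have "m * n \<le> N * j" "N * j \<le> Suc m * n" using assms
    by (metis div_less_iff_less_mult greaterThanAtMost_iff less_imp_le mult.commute,
        metis greaterThanAtMost_iff less_eq_div_iff_mult_less_eq mult.commute assms(2))
  then have "real (m * n) \<le> real (N * j)" "real (N * j) \<le> real (Suc m * n)"
    unfolding of_nat_le_iff by auto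
  then show ?thesis using n assms by (auto simp: field_simps)
qed

text \<open>\<open>c\<close> bounds the contribution of the \<open>q\<close>-variation, so that the bound does not depend on the function.\<close>

definition chain_bound :: "real \<Rightarrow> real \<Rightarrow> real \<Rightarrow> nat set \<Rightarrow> (nat \<Rightarrow> real) \<Rightarrow> real" where
  "chain_bound q c u J S = u * (c + (\<Sum>m\<in>J. (S m)\<^sup>2)) + (\<Sum>m\<in>J. S m ^ 4) / u ^ young_exp q"

lemma chain_bound_nonneg: "0 \<le> c \<Longrightarrow> 0 < u \<Longrightarrow> 0 \<le> chain_bound q c u J S"
  unfolding chain_bound_def
  by (intro add_nonneg_nonneg mult_nonneg_nonneg divide_nonneg_nonneg sum_nonneg) auto

lemma sum_le_chain_bound:
  assumes q: "1 \<le> q" "q < 2" and u: "0 < u" "u \<le> 1"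
    and d: "\<And>m. m \<in> J \<Longrightarrow> 0 \<le> d m" "\<And>m. m \<in> J \<Longrightarrow> d m \<le> 1" "(\<Sum>m\<in>J. d m powr q) \<le> c"
  shows "(\<Sum>m\<in>J. d m * \<bar>S m\<bar>) \<le> chain_bound q c u J S"
proof -
  have "(\<Sum>m\<in>J. d m * \<bar>S m\<bar>) \<le> (\<Sum>m\<in>J. u * (d m powr q + (S m)\<^sup>2) + S m ^ 4 / u ^ young_exp q)"
    by (intro sum_mono young_quartic q u d)
  also have "\<dots> = u * ((\<Sum>m\<in>J. d m powr q) + (\<Sum>m\<in>J. (S m)\<^sup>2)) + (\<Sum>m\<in>J. S m ^ 4) / u ^ young_exp q"
    by (simp add: sum.distrib sum_distrib_left sum_divide_distrib distrib_left)
  also have "\<dots> \<le> chain_bound q c u J S"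
    unfolding chain_bound_def using u d by (intro add_right_mono mult_left_mono) auto
  finally show ?thesis .
qed

text \<open>The right end point of cell m at level k. It is also the tag of the last child of that
  cell, with index 16 * m + 15 at level Suc k.\<close>

abbreviation (input) tag :: "nat \<Rightarrow> nat \<Rightarrow> real" where
  "tag k m \<equiv> real (Suc m) / 16 ^ k"

text \<open>The single cell N = 1 gives the bound 1, where the supremum norm alone would give 2;
  \<open>young_quartic\<close> asks for increments of size at most 1.\<close>

lemma qvar_ball_diff_le_1:
  assumes f: "f \<in> qvar_ball q" and q: "1 \<le> q" and "s \<in> {0..1}" "t \<in> {0..1}"
  shows "\<bar>f s - f t\<bar> \<le> 1"
proof -
  have "\<bar>f s - f t\<bar> powr q \<le> 1"
    using qvar_ball_cells[OF f q, of 1 "\<lambda>_. s" "\<lambda>_. t"] assms(3,4) by auto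
  then show ?thesis using q powr_less_mono2[of q 1 "\<bar>f s - f t\<bar>"] by fastforce
qed

text \<open>Children are grouped by their position r inside the parent. For fixed r there is one
  pair of points per parent cell, so \<open>qvar_ball_cells\<close> bounds that part by 1; the
  constant is the number of children.\<close>

lemma qvar_ball_children:
  assumes f: "f \<in> qvar_ball q" and q: "1 \<le> q"
  shows "(\<Sum>m<16 ^ Suc k. \<bar>f (tag (Suc k) m) - f (tag k (m div 16))\<bar> powr q) \<le> 16"
proof -
  have "(\<Sum>m<16 ^ Suc k. \<bar>f (tag (Suc k) m) - f (tag k (m div 16))\<bar> powr q)
      = (\<Sum>l<16 ^ k. \<Sum>r<16. \<bar>f (tag (Suc k) (l * 16 + r)) - f (tag k l)\<bar> powr q)"
  proof -
    have "(\<Sum>m<16 ^ k * 16. \<bar>f (tag (Suc k) m) - f (tag k (m div 16))\<bar> powr q)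
      = (\<Sum>l<16 ^ k. \<Sum>m\<in>{l * 16..<l * 16 + 16}. \<bar>f (tag (Suc k) m) - f (tag k (m div 16))\<bar> powr q)"
      by (rule sum.nat_group[symmetric])
    also have "\<dots> = (\<Sum>l<16 ^ k. \<Sum>r<16. \<bar>f (tag (Suc k) (l * 16 + r)) - f (tag k l)\<bar> powr q)"
    proof (rule sum.cong[OF refl])
      fix l
      show "(\<Sum>m\<in>{l * 16..<l * 16 + 16}. \<bar>f (tag (Suc k) m) - f (tag k (m div 16))\<bar> powr q)
         = (\<Sum>r<16. \<bar>f (tag (Suc k) (l * 16 + r)) - f (tag k l)\<bar> powr q)"
        using sum.shift_bounds_nat_ivl[of "\<lambda>m. \<bar>f (tag (Suc k) m) - f (tag k (m div 16))\<bar> powr q" 0 "l*16" 16]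
        by (simp add: lessThan_atLeast0 add.commute)
    qed
    finally show ?thesis by (simp add: mult.commute)
  qed
  also have "\<dots> = (\<Sum>r<16. \<Sum>l<16 ^ k. \<bar>f (tag (Suc k) (l * 16 + r)) - f (tag k l)\<bar> powr q)"
    by (rule sum.swap)
  also have "\<dots> \<le> (\<Sum>r<(16::nat). 1)"
  proof (rule sum_mono)
    fix r :: nat assume r: "r \<in> {..<16}"
    show "(\<Sum>l<16 ^ k. \<bar>f (tag (Suc k) (l * 16 + r)) - f (tag k l)\<bar> powr q) \<le> 1"
      using r by (intro qvar_ball_cells[OF f q]) (auto simp: field_simps)
  qed
  finally show ?thesis by simp
qed

lemma chain_step_fine:
  assumes f: "f \<in> qvar_ball q" and q: "1 \<le> q" "q < 2" and u: "0 < u" "u \<le> 1"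
  shows "\<bar>\<Sum>m<16 ^ Suc k. (f (tag (Suc k) m) - f (tag k (m div 16))) * S m\<bar>
    \<le> chain_bound q 16 u {..<16 ^ Suc k} S"
proof -
  have "\<bar>\<Sum>m<16 ^ Suc k. (f (tag (Suc k) m) - f (tag k (m div 16))) * S m\<bar>
    \<le> (\<Sum>m<16 ^ Suc k. \<bar>f (tag (Suc k) m) - f (tag k (m div 16))\<bar> * \<bar>S m\<bar>)"
    by (rule order_trans[OF sum_abs]) (simp add: abs_mult)
  also have "\<dots> \<le> chain_bound q 16 u {..<16 ^ Suc k} S"
  proof (rule sum_le_chain_bound[OF q u])
    fix m :: nat assume m: "m \<in> {..<16 ^ Suc k}"
    then have "m div 16 < 16 ^ k" by auto
    then have "Suc (m div 16) \<le> 16 ^ k" "Suc m \<le> 16 ^ Suc k" using m by auto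
    then have "real (Suc (m div 16)) \<le> 16 ^ k" "real (Suc m) \<le> 16 ^ Suc k"
      by (metis of_nat_le_iff of_nat_numeral of_nat_power)+
    then show "\<bar>f (tag (Suc k) m) - f (tag k (m div 16))\<bar> \<le> 1"
      by (intro qvar_ball_diff_le_1[OF f q(1)]) auto
  qed (use qvar_ball_children[OF f q(1)] in auto)
  finally show ?thesis .
qed

text \<open>
  All design points of a cell are handled at once by the point of the cell at which \<open>f\<close> deviates
  most from its value at the right end point.
\<close>

lemma chain_step_rest:
  assumes f: "f \<in> qvar_ball q" and q: "1 \<le> q" "q < 2" and u: "0 < u" "u \<le> 1"
  shows "\<bar>\<Sum>j=1..n. (f (real j / n) - f (tag k (cidx (16 ^ k) n j))) * b j\<bar>
    \<le> chain_bound q 16 u {..<16 ^ k} (\<lambda>m. \<Sum>j\<in>blk (16 ^ k) n m. \<bar>b j\<bar>)"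
proof -
  let ?N = "16 ^ k :: nat"
  have "\<exists>y. y \<in> {real m / ?N .. real (Suc m) / ?N} \<and>
      (\<forall>j\<in>blk ?N n m. \<bar>f (real j / n) - f (tag k m)\<bar> \<le> \<bar>f y - f (tag k m)\<bar>)"
    if "m < ?N" for m
  proof (cases "blk ?N n m = {}")
    case True
    then show ?thesis by (intro exI[of _ "real m / ?N"]) (auto simp: field_simps)
  next
    case False
    have fin: "finite (blk ?N n m)" by (auto simp: blk_def)
    obtain i where i: "i \<in> blk ?N n m"
      "\<forall>j\<in>blk ?N n m. \<bar>f (real j / n) - f (tag k m)\<bar> \<le> \<bar>f (real i / n) - f (tag k m)\<bar>"
    proof -
      let ?F = "\<lambda>j. \<bar>f (real j / n) - f (tag k m)\<bar>"
      have "Max (?F ` blk ?N n m) \<in> ?F ` blk ?N n m" using fin False by (intro Max_in) auto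
      moreover have "?F j \<le> Max (?F ` blk ?N n m)" if "j \<in> blk ?N n m" for j
        using fin that by (intro Max_ge) auto
      ultimately show ?thesis using that by (smt (verit) image_iff)
    qed
    then show ?thesis using point_in_cell[OF i(1) _ that] by (intro exI[of _ "real i / n"]) auto
  qed
  then obtain y where y: "\<And>m. m < ?N \<Longrightarrow> y m \<in> {real m / ?N .. real (Suc m) / ?N}"
    "\<And>m j. m < ?N \<Longrightarrow> j \<in> blk ?N n m \<Longrightarrow> \<bar>f (real j / n) - f (tag k m)\<bar> \<le> \<bar>f (y m) - f (tag k m)\<bar>"
    by metis
  have "\<bar>\<Sum>j=1..n. (f (real j / n) - f (tag k (cidx (16 ^ k) n j))) * b j\<bar>
    \<le> (\<Sum>j=1..n. \<bar>f (real j / n) - f (tag k (cidx (16 ^ k) n j))\<bar> * \<bar>b j\<bar>)"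
    by (rule order_trans[OF sum_abs]) (simp add: abs_mult)
  also have "\<dots> = (\<Sum>m<?N. \<Sum>j\<in>blk ?N n m. \<bar>f (real j / n) - f (tag k (cidx (16 ^ k) n j))\<bar> * \<bar>b j\<bar>)"
    by (rule sum_blk) simp
  also have "\<dots> = (\<Sum>m<?N. \<Sum>j\<in>blk ?N n m. \<bar>f (real j / n) - f (tag k m)\<bar> * \<bar>b j\<bar>)"
    by (intro sum.cong refl) (auto simp: blk_def)
  also have "\<dots> \<le> (\<Sum>m<?N. \<Sum>j\<in>blk ?N n m. \<bar>f (y m) - f (tag k m)\<bar> * \<bar>b j\<bar>)"
    by (intro sum_mono mult_right_mono y) auto
  also have "\<dots> = (\<Sum>m<?N. \<bar>f (y m) - f (tag k m)\<bar> * \<bar>\<Sum>j\<in>blk ?N n m. \<bar>b j\<bar>\<bar>)"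
    by (simp add: sum_distrib_left sum_nonneg)
  also have "\<dots> \<le> chain_bound q 16 u {..<16 ^ k} (\<lambda>m. \<Sum>j\<in>blk (16 ^ k) n m. \<bar>b j\<bar>)"
  proof (rule sum_le_chain_bound[OF q u])
    fix m assume m: "m \<in> {..<?N}"
    then have "Suc m \<le> ?N" by auto
    then have *: "real (Suc m) \<le> 16 ^ k"
      by (metis of_nat_le_iff of_nat_numeral of_nat_power)
    then have "y m \<in> {0..1}" using y(1)[of m] m
      by (auto intro: order_trans[of _ "real m / 16 ^ k"] order_trans[of _ "(1 + real m) / 16 ^ k"])
    then show "\<bar>f (y m) - f (tag k m)\<bar> \<le> 1"
      using * by (intro qvar_ball_diff_le_1[OF f q(1)]) auto
  next
    have "(\<Sum>m<?N. \<bar>f (y m) - f (tag k m)\<bar> powr q) \<le> 1"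
      using y(1) by (intro qvar_ball_cells[OF f q(1)]) (auto simp: field_simps)
    \<comment> \<open>The larger constant lets this step share \<open>chain_bound q 16\<close> with
      \<open>chain_step_fine\<close>.\<close>
    then show "(\<Sum>m<?N. \<bar>f (y m) - f (tag k m)\<bar> powr q) \<le> 16" by simp
  qed auto
  finally show ?thesis .
qed

section \<open>Chaining bounds for independent innovations\<close>

context prob_space
begin

section \<open>Moments of sums of bounded independent variables\<close>

lemma integrable_bounded:
  assumes "X \<in> borel_measurable M" "\<And>\<omega>. \<omega> \<in> space M \<Longrightarrow> \<bar>X \<omega>\<bar> \<le> (T :: real)"
  shows "integrable M X"
  using assms by (intro integrable_const_bound[of _ T]) auto

lemma expectation_mult_powers:
  fixes X Y :: "'a \<Rightarrow> real"
  assumes ind: "indep_var borel X borel Y"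
    and X: "\<And>\<omega>. \<omega> \<in> space M \<Longrightarrow> \<bar>X \<omega>\<bar> \<le> A" and Y: "\<And>\<omega>. \<omega> \<in> space M \<Longrightarrow> \<bar>Y \<omega>\<bar> \<le> B"
  shows "expectation (\<lambda>\<omega>. X \<omega> ^ i * Y \<omega> ^ k) = expectation (\<lambda>\<omega>. X \<omega> ^ i) * expectation (\<lambda>\<omega>. Y \<omega> ^ k)"
proof -
  have [measurable]: "X \<in> borel_measurable M" "Y \<in> borel_measurable M"
    using ind indep_var_rv1 indep_var_rv2 by auto
  have "indep_var borel ((\<lambda>x. x ^ i) \<circ> X) borel ((\<lambda>x. x ^ k) \<circ> Y)"
    by (intro indep_var_compose[OF ind]) auto
  moreover have "\<bar>X \<omega> ^ i\<bar> \<le> A ^ i" "\<bar>Y \<omega> ^ k\<bar> \<le> B ^ k" if "\<omega> \<in> space M" for \<omega>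
    using power_mono[OF X[OF that], of i] power_mono[OF Y[OF that], of k] by (auto simp: power_abs)
  then have "integrable M (\<lambda>\<omega>. X \<omega> ^ i)" "integrable M (\<lambda>\<omega>. Y \<omega> ^ k)"
    by (auto intro!: integrable_bounded)
  ultimately show ?thesis
    using indep_var_lebesgue_integral by (force simp: o_def)
qed

text \<open>When a term c is added to the partial sum S, independence and centring remove every
  product in (c + S) ^ 4 that contains a first power, leaving the fourth moments of c and S and six
  times the product of their second moments. The fourth moment of c is at most
  \<open>T\<^sup>2 * v\<close>, and the mixed term \<open>6 * card F * v\<^sup>2\<close> fits into
  the increase of \<open>3 * (card F)\<^sup>2 * v\<^sup>2\<close> when the cardinality grows by
  one.\<close>

lemma centred_sum_moments:
  fixes c :: "'i \<Rightarrow> 'a \<Rightarrow> real" and T v :: real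
  assumes fin: "finite J" and ind: "indep_vars (\<lambda>_. borel) c J"
    and bd: "\<And>j \<omega>. j \<in> J \<Longrightarrow> \<omega> \<in> space M \<Longrightarrow> \<bar>c j \<omega>\<bar> \<le> T"
    and mean: "\<And>j. j \<in> J \<Longrightarrow> expectation (c j) = 0"
    and var: "\<And>j. j \<in> J \<Longrightarrow> expectation (\<lambda>\<omega>. (c j \<omega>)\<^sup>2) \<le> v"
  shows "expectation (\<lambda>\<omega>. \<Sum>j\<in>J. c j \<omega>) = 0 \<and>
    expectation (\<lambda>\<omega>. (\<Sum>j\<in>J. c j \<omega>)\<^sup>2) \<le> card J * v \<and>
    expectation (\<lambda>\<omega>. (\<Sum>j\<in>J. c j \<omega>) ^ 4) \<le> card J * (T\<^sup>2 * v) + 3 * (card J)\<^sup>2 * v\<^sup>2"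
  using assms
proof (induction J rule: finite_induct)
  case (insert x F)
  let ?S = "\<lambda>\<omega>. \<Sum>j\<in>F. c j \<omega>"
  have meas[measurable]: "\<And>j. j \<in> insert x F \<Longrightarrow> c j \<in> borel_measurable M"
    using insert.prems(1) unfolding indep_vars_def by auto
  have [measurable]: "c x \<in> borel_measurable M" "?S \<in> borel_measurable M" by (auto intro!: borel_measurable_sum)
  have IH: "expectation ?S = 0" "expectation (\<lambda>\<omega>. (?S \<omega>)\<^sup>2) \<le> card F * v"
    "expectation (\<lambda>\<omega>. ?S \<omega> ^ 4) \<le> card F * (T\<^sup>2 * v) + 3 * (card F)\<^sup>2 * v\<^sup>2"
    using insert.IH insert.prems indep_vars_subset[OF insert.prems(1), of F] by auto
  have ind: "indep_var borel (c x) borel ?S"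
    using insert.hyps insert.prems(1) by (intro indep_vars_sum) auto
  define B where "B = (\<Sum>j\<in>F. T)"
  have Sb: "\<bar>?S \<omega>\<bar> \<le> B" if "\<omega> \<in> space M" for \<omega>
    unfolding B_def using insert.prems(2) that by (intro order_trans[OF sum_abs] sum_mono) auto
  have cb: "\<bar>c x \<omega>\<bar> \<le> T" if "\<omega> \<in> space M" for \<omega> using insert.prems(2) that by auto
  have E: "expectation (\<lambda>\<omega>. c x \<omega> ^ i * ?S \<omega> ^ k) = expectation (\<lambda>\<omega>. c x \<omega> ^ i) * expectation (\<lambda>\<omega>. ?S \<omega> ^ k)"
    for i k by (rule expectation_mult_powers[OF ind cb Sb])
  have int: "integrable M (\<lambda>\<omega>. c x \<omega> ^ i * ?S \<omega> ^ k)" for i k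
  proof (rule integrable_bounded)
    fix \<omega> assume w: "\<omega> \<in> space M"
    have "\<bar>c x \<omega>\<bar> ^ i * \<bar>?S \<omega>\<bar> ^ k \<le> T ^ i * B ^ k"
      using cb[OF w] Sb[OF w] by (intro mult_mono power_mono) auto
    then show "\<bar>c x \<omega> ^ i * ?S \<omega> ^ k\<bar> \<le> T ^ i * B ^ k" by (simp add: abs_mult power_abs)
  qed measurable
  have "0 \<le> expectation (\<lambda>\<omega>. (c x \<omega>)\<^sup>2)" by (intro Bochner_Integration.integral_nonneg) auto
  then have v0: "0 \<le> v" by (rule order_trans) (rule insert.prems(4), simp)
  have Ec: "expectation (c x) = 0" "expectation (\<lambda>\<omega>. (c x \<omega>)\<^sup>2) \<le> v"
    using insert.prems by auto
  have c4: "expectation (\<lambda>\<omega>. c x \<omega> ^ 4) \<le> T\<^sup>2 * v"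
  proof -
    have "expectation (\<lambda>\<omega>. c x \<omega> ^ 4) \<le> expectation (\<lambda>\<omega>. T\<^sup>2 * (c x \<omega>)\<^sup>2)"
    proof (rule integral_mono)
      fix \<omega> assume w: "\<omega> \<in> space M"
      have "(c x \<omega>)\<^sup>2 \<le> T\<^sup>2" using cb[OF w] by (metis abs_le_square_iff abs_of_nonneg abs_ge_zero order_trans)
      then have "(c x \<omega>)\<^sup>2 * (c x \<omega>)\<^sup>2 \<le> T\<^sup>2 * (c x \<omega>)\<^sup>2" by (intro mult_right_mono) auto
      then show "c x \<omega> ^ 4 \<le> T\<^sup>2 * (c x \<omega>)\<^sup>2" by (simp flip: power_add)
    qed (use int[of 4 0] int[of 2 0] in auto)
    also have "\<dots> = T\<^sup>2 * expectation (\<lambda>\<omega>. (c x \<omega>)\<^sup>2)" by simp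
    also have "\<dots> \<le> T\<^sup>2 * v" using Ec by (intro mult_left_mono) auto
    finally show ?thesis .
  qed
  have sum_eq: "(\<Sum>j\<in>insert x F. c j \<omega>) = c x \<omega> + ?S \<omega>" for \<omega>
    using insert.hyps by simp
  have card: "card (insert x F) = Suc (card F)" using insert.hyps by simp
  have 1: "expectation (\<lambda>\<omega>. c x \<omega> + ?S \<omega>) = 0"
    using int[of 1 0] int[of 0 1] Ec IH by simp
  have e2: "(c x \<omega> + ?S \<omega>)\<^sup>2 = c x \<omega> ^ 2 * ?S \<omega> ^ 0 + 2 * (c x \<omega> ^ 1 * ?S \<omega> ^ 1) + c x \<omega> ^ 0 * ?S \<omega> ^ 2" for \<omega>
    by (simp add: power2_eq_square algebra_simps)
  have "expectation (\<lambda>\<omega>. (c x \<omega> + ?S \<omega>)\<^sup>2) = expectation (\<lambda>\<omega>. (c x \<omega>)\<^sup>2) + expectation (\<lambda>\<omega>. (?S \<omega>)\<^sup>2)"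
    unfolding e2
    apply (subst Bochner_Integration.integral_add, (intro Bochner_Integration.integrable_add integrable_mult_right int)+)
    apply (subst Bochner_Integration.integral_add, (intro Bochner_Integration.integrable_add integrable_mult_right int)+)
    using E[of 1 1] Ec by simp
  then have 2: "expectation (\<lambda>\<omega>. (c x \<omega> + ?S \<omega>)\<^sup>2) \<le> Suc (card F) * v"
    using Ec IH by (simp add: distrib_right)
  have e4: "(c x \<omega> + ?S \<omega>) ^ 4 = (c x \<omega> ^ 4 * ?S \<omega> ^ 0 + 4 * (c x \<omega> ^ 3 * ?S \<omega> ^ 1)) +
      (6 * (c x \<omega> ^ 2 * ?S \<omega> ^ 2) + (4 * (c x \<omega> ^ 1 * ?S \<omega> ^ 3) + c x \<omega> ^ 0 * ?S \<omega> ^ 4))" for \<omega>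
    by (simp add: numeral_eq_Suc algebra_simps)
  have "expectation (\<lambda>\<omega>. (c x \<omega> + ?S \<omega>) ^ 4) = expectation (\<lambda>\<omega>. c x \<omega> ^ 4) +
      6 * (expectation (\<lambda>\<omega>. (c x \<omega>)\<^sup>2) * expectation (\<lambda>\<omega>. (?S \<omega>)\<^sup>2)) + expectation (\<lambda>\<omega>. ?S \<omega> ^ 4)"
    unfolding e4
    apply (subst Bochner_Integration.integral_add, (intro Bochner_Integration.integrable_add integrable_mult_right int)+)
    apply (subst Bochner_Integration.integral_add, (intro Bochner_Integration.integrable_add integrable_mult_right int)+)
    apply (subst Bochner_Integration.integral_add, (intro Bochner_Integration.integrable_add integrable_mult_right int)+)
    apply (subst Bochner_Integration.integral_add, (intro Bochner_Integration.integrable_add integrable_mult_right int)+)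
    using E[of 1 3] E[of 3 1] E[of 2 2] Ec IH(1) by simp
  also have "\<dots> \<le> T\<^sup>2 * v + 6 * (v * (card F * v)) + (card F * (T\<^sup>2 * v) + 3 * (card F)\<^sup>2 * v\<^sup>2)"
    using c4 Ec IH v0 by (intro add_mono mult_left_mono mult_mono) (auto intro!: Bochner_Integration.integral_nonneg)
  also have "\<dots> \<le> Suc (card F) * (T\<^sup>2 * v) + 3 * (Suc (card F))\<^sup>2 * v\<^sup>2"
    by (simp add: algebra_simps power2_eq_square)
  finally have 4: "expectation (\<lambda>\<omega>. (c x \<omega> + ?S \<omega>) ^ 4) \<le> Suc (card F) * (T\<^sup>2 * v) + 3 * (Suc (card F))\<^sup>2 * v\<^sup>2" .
  show ?case unfolding sum_eq card using 1 2 4 by simp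
qed simp

text \<open>Truncated innovations are no longer centred, so a bias \<mu> per term is allowed.
  Recentring doubles the bound \<open>T\<close>, whence the factor 4; the bias returns through
  \<open>(x + y)\<^sup>2 \<le> 2 * x\<^sup>2 + 2 * y\<^sup>2\<close>, applied twice for the fourth
  power.\<close>

lemma sum_moments:
  fixes b :: "'i \<Rightarrow> 'a \<Rightarrow> real" and T v \<mu> :: real
  assumes fin: "finite J" and ind: "indep_vars (\<lambda>_. borel) b J"
    and bd: "\<And>j \<omega>. j \<in> J \<Longrightarrow> \<omega> \<in> space M \<Longrightarrow> \<bar>b j \<omega>\<bar> \<le> T"
    and mean: "\<And>j. j \<in> J \<Longrightarrow> \<bar>expectation (b j)\<bar> \<le> \<mu>"
    and var: "\<And>j. j \<in> J \<Longrightarrow> expectation (\<lambda>\<omega>. (b j \<omega>)\<^sup>2) \<le> v"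
  shows sum_moment2: "expectation (\<lambda>\<omega>. (\<Sum>j\<in>J. b j \<omega>)\<^sup>2) \<le> card J * v + (card J * \<mu>)\<^sup>2"
    and sum_moment4: "expectation (\<lambda>\<omega>. (\<Sum>j\<in>J. b j \<omega>) ^ 4)
      \<le> 8 * (card J * (4 * T\<^sup>2 * v) + 3 * (card J)\<^sup>2 * v\<^sup>2) + 8 * (card J * \<mu>) ^ 4"
    and sum_bounded: "\<And>\<omega>. \<omega> \<in> space M \<Longrightarrow> \<bar>\<Sum>j\<in>J. b j \<omega>\<bar> \<le> card J * T"
    and sum_measurable: "(\<lambda>\<omega>. \<Sum>j\<in>J. b j \<omega>) \<in> borel_measurable M"
proof -
  have meas[measurable]: "\<And>j. j \<in> J \<Longrightarrow> b j \<in> borel_measurable M"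
    using ind unfolding indep_vars_def by auto
  define c where "c j \<omega> = b j \<omega> - expectation (b j)" for j \<omega>
  define e where "e = (\<Sum>j\<in>J. expectation (b j))"
  have intb: "integrable M (b j)" "integrable M (\<lambda>\<omega>. (b j \<omega>)\<^sup>2)" if "j \<in> J" for j
  proof -
    show "integrable M (b j)" using bd that by (intro integrable_bounded) auto
    have "\<bar>(b j \<omega>)\<^sup>2\<bar> \<le> T\<^sup>2" if "\<omega> \<in> space M" for \<omega>
      using power_mono[OF bd[OF \<open>j \<in> J\<close> that], of 2] by auto
    then show "integrable M (\<lambda>\<omega>. (b j \<omega>)\<^sup>2)" using that by (intro integrable_bounded) auto
  qed
  have indc: "indep_vars (\<lambda>_. borel) c J"
    unfolding c_def by (rule indep_vars_compose2[OF ind]) auto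
  have Ec: "expectation (c j) = 0" "expectation (\<lambda>\<omega>. (c j \<omega>)\<^sup>2) \<le> v"
    and cbd: "\<And>\<omega>. \<omega> \<in> space M \<Longrightarrow> \<bar>c j \<omega>\<bar> \<le> 2 * T" if "j \<in> J" for j
  proof -
    show "expectation (c j) = 0" unfolding c_def using intb[OF that] by (simp add: prob_space)
    have "expectation (\<lambda>\<omega>. (c j \<omega>)\<^sup>2) = variance (b j)" by (simp add: c_def)
    also have "\<dots> \<le> v"
      using var[OF that] intb[OF that] zero_le_power2[of "expectation (b j)"] by (subst variance_eq) linarith+
    finally show "expectation (\<lambda>\<omega>. (c j \<omega>)\<^sup>2) \<le> v" .
    have "\<bar>expectation (b j)\<bar> \<le> expectation (\<lambda>\<omega>. \<bar>b j \<omega>\<bar>)" by (rule integral_abs_bound)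
    also have "\<dots> \<le> expectation (\<lambda>_. T)"
      using intb[OF that] bd[OF that] by (intro integral_mono) auto
    finally have "\<bar>expectation (b j)\<bar> \<le> T" by (simp add: prob_space)
    then show "\<bar>c j \<omega>\<bar> \<le> 2 * T" if "\<omega> \<in> space M" for \<omega>
      using bd[OF \<open>j \<in> J\<close> that] unfolding c_def by linarith
  qed
  note C = centred_sum_moments[OF fin indc cbd Ec]
  let ?S = "\<lambda>\<omega>. \<Sum>j\<in>J. c j \<omega>"
  have mS[measurable]: "?S \<in> borel_measurable M" unfolding c_def by measurable
  have eq: "(\<Sum>j\<in>J. b j \<omega>) = ?S \<omega> + e" for \<omega>
    unfolding c_def e_def by (simp add: sum_subtractf)
  have Sb: "\<bar>?S \<omega>\<bar> \<le> card J * (2 * T)" if "\<omega> \<in> space M" for \<omega>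
    using cbd that by (intro order_trans[OF sum_abs] sum_bounded_above) auto
  have intS: "integrable M (\<lambda>\<omega>. ?S \<omega> ^ k)" for k
  proof (rule integrable_bounded)
    show "\<bar>?S \<omega> ^ k\<bar> \<le> (card J * (2 * T)) ^ k" if "\<omega> \<in> space M" for \<omega>
      using power_mono[OF Sb[OF that], of k] by (simp add: power_abs)
  qed measurable
  have eb: "\<bar>e\<bar> \<le> card J * \<mu>"
    unfolding e_def using mean by (intro order_trans[OF sum_abs] sum_bounded_above) auto
  have e2: "e\<^sup>2 \<le> (card J * \<mu>)\<^sup>2" "e ^ 4 \<le> (card J * \<mu>) ^ 4"
    using power_mono[OF eb, of 2] power_mono[OF eb, of 4] by (auto simp: power_even_abs_numeral)
  have "expectation (\<lambda>\<omega>. (\<Sum>j\<in>J. b j \<omega>)\<^sup>2) = expectation (\<lambda>\<omega>. (?S \<omega>)\<^sup>2 + 2 * e * ?S \<omega> + e\<^sup>2)"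
    unfolding eq by (simp add: power2_eq_square algebra_simps)
  also have "\<dots> = expectation (\<lambda>\<omega>. (?S \<omega>)\<^sup>2) + e\<^sup>2"
    using intS[of 1] intS[of 2] C by (simp add: prob_space)
  finally show "expectation (\<lambda>\<omega>. (\<Sum>j\<in>J. b j \<omega>)\<^sup>2) \<le> card J * v + (card J * \<mu>)\<^sup>2"
    using C e2 by linarith
  have "expectation (\<lambda>\<omega>. (\<Sum>j\<in>J. b j \<omega>) ^ 4) \<le> expectation (\<lambda>\<omega>. 8 * ?S \<omega> ^ 4 + 8 * e ^ 4)"
  proof (rule integral_mono)
    fix \<omega>
    have sq: "(x + y)\<^sup>2 \<le> 2 * x\<^sup>2 + 2 * y\<^sup>2" for x y :: real
      using zero_le_power2[of "x - y"] by (simp add: power2_eq_square algebra_simps)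
    have "(?S \<omega> + e) ^ 4 = ((?S \<omega> + e)\<^sup>2)\<^sup>2" by simp
    also have "\<dots> \<le> (2 * (?S \<omega>)\<^sup>2 + 2 * e\<^sup>2)\<^sup>2" by (intro power_mono sq) auto
    also have "\<dots> \<le> 2 * (2 * (?S \<omega>)\<^sup>2)\<^sup>2 + 2 * (2 * e\<^sup>2)\<^sup>2" by (rule sq)
    also have "\<dots> = 8 * ?S \<omega> ^ 4 + 8 * e ^ 4" by (simp add: power_mult_distrib)
    finally show "(\<Sum>j\<in>J. b j \<omega>) ^ 4 \<le> 8 * ?S \<omega> ^ 4 + 8 * e ^ 4" unfolding eq .
  next
    show "integrable M (\<lambda>\<omega>. (\<Sum>j\<in>J. b j \<omega>) ^ 4)" unfolding eq
    proof (rule integrable_bounded)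
      show "\<bar>(?S \<omega> + e) ^ 4\<bar> \<le> (card J * (2 * T) + \<bar>e\<bar>) ^ 4" if "\<omega> \<in> space M" for \<omega>
        using Sb[OF that] unfolding power_abs by (intro power_mono) auto
    qed measurable
  qed (use intS in auto)
  also have "\<dots> = 8 * expectation (\<lambda>\<omega>. ?S \<omega> ^ 4) + 8 * e ^ 4"
    using intS[of 4] by (simp add: prob_space)
  also have "\<dots> \<le> 8 * (card J * ((2 * T)\<^sup>2 * v) + 3 * (card J)\<^sup>2 * v\<^sup>2) + 8 * (card J * \<mu>) ^ 4"
    using C e2 by (intro add_mono mult_left_mono) auto
  finally show "expectation (\<lambda>\<omega>. (\<Sum>j\<in>J. b j \<omega>) ^ 4)
      \<le> 8 * (card J * (4 * T\<^sup>2 * v) + 3 * (card J)\<^sup>2 * v\<^sup>2) + 8 * (card J * \<mu>) ^ 4"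
    by (simp add: power_mult_distrib)
  show "\<bar>\<Sum>j\<in>J. b j \<omega>\<bar> \<le> card J * T" if "\<omega> \<in> space M" for \<omega>
    using bd that by (intro order_trans[OF sum_abs] sum_bounded_above) auto
  show "(\<lambda>\<omega>. \<Sum>j\<in>J. b j \<omega>) \<in> borel_measurable M" by measurable
qed

text \<open>One factor \<open>card (B m)\<close> is summed over the blocks to n, and all others are
  bounded by L. The biases contribute \<open>n * L * \<mu>\<^sup>2\<close> to the second moments,
  which is what \<kappa> controls, and \<open>n * L ^ 3 * \<mu> ^ 4 = (L / n) * (n * L *
  \<mu>\<^sup>2)\<^sup>2\<close>, up to the factor 8, to the fourth.\<close>

lemma block_moments:
  fixes b :: "nat \<Rightarrow> 'a \<Rightarrow> real" and T v \<mu> \<kappa> :: real and L :: real and n N :: nat and B :: "nat \<Rightarrow> nat set"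
  assumes n: "0 < n" and ind: "indep_vars (\<lambda>_. borel) b {1..n}"
    and bd: "\<And>j \<omega>. j \<in> {1..n} \<Longrightarrow> \<omega> \<in> space M \<Longrightarrow> \<bar>b j \<omega>\<bar> \<le> T"
    and mean: "\<And>j. j \<in> {1..n} \<Longrightarrow> \<bar>expectation (b j)\<bar> \<le> \<mu>"
    and var: "\<And>j. j \<in> {1..n} \<Longrightarrow> expectation (\<lambda>\<omega>. (b j \<omega>)\<^sup>2) \<le> v / n"
    and B: "\<And>m. m < N \<Longrightarrow> B m \<subseteq> {1..n}" "(\<Sum>m<N. card (B m)) = n"
      "\<And>m. m < N \<Longrightarrow> real (card (B m)) \<le> L" and L: "n * L * \<mu>\<^sup>2 \<le> \<kappa>" and v: "0 \<le> v" and L0: "0 \<le> L"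
  defines "S \<equiv> \<lambda>m \<omega>. \<Sum>j\<in>B m. b j \<omega>"
  shows block_moment2: "(\<Sum>m<N. expectation (\<lambda>\<omega>. (S m \<omega>)\<^sup>2)) \<le> v + \<kappa>"
    and block_moment4: "(\<Sum>m<N. expectation (\<lambda>\<omega>. S m \<omega> ^ 4)) \<le> 8 * (4 * T\<^sup>2 * v + 3 * (L / n) * v\<^sup>2 + (L / n) * \<kappa>\<^sup>2)"
    and block_integrable: "\<And>m k. m < N \<Longrightarrow> integrable M (\<lambda>\<omega>. S m \<omega> ^ k)"
proof -
  have fin: "finite (B m)" if "m < N" for m using B(1)[OF that] finite_subset by blast
  have indB: "indep_vars (\<lambda>_. borel) b (B m)" if "m < N" for m
    using ind B(1)[OF that] by (rule indep_vars_subset)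
  have bdB: "\<And>j \<omega>. j \<in> B m \<Longrightarrow> \<omega> \<in> space M \<Longrightarrow> \<bar>b j \<omega>\<bar> \<le> T"
    "\<And>j. j \<in> B m \<Longrightarrow> \<bar>expectation (b j)\<bar> \<le> \<mu>"
    "\<And>j. j \<in> B m \<Longrightarrow> expectation (\<lambda>\<omega>. (b j \<omega>)\<^sup>2) \<le> v / n" if "m < N" for m
    using bd mean var B(1)[OF that] by auto
  have SM: "expectation (\<lambda>\<omega>. (S m \<omega>)\<^sup>2) \<le> card (B m) * (v / n) + (card (B m) * \<mu>)\<^sup>2"
    "expectation (\<lambda>\<omega>. S m \<omega> ^ 4)
      \<le> 8 * (card (B m) * (4 * T\<^sup>2 * (v / n)) + 3 * (card (B m))\<^sup>2 * (v / n)\<^sup>2) + 8 * (card (B m) * \<mu>) ^ 4"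
    "\<And>\<omega>. \<omega> \<in> space M \<Longrightarrow> \<bar>S m \<omega>\<bar> \<le> card (B m) * T" "S m \<in> borel_measurable M" if "m < N" for m
    unfolding S_def
    using sum_moment2[OF fin[OF that] indB[OF that] bdB[OF that]]
      sum_moment4[OF fin[OF that] indB[OF that] bdB[OF that]]
      sum_bounded[OF fin[OF that] indB[OF that] bdB[OF that]]
      sum_measurable[OF fin[OF that] indB[OF that] bdB[OF that]] by blast+
  have sumc: "(\<Sum>m<N. real (card (B m))) = n" using B(2) by (metis of_nat_sum)
  have cL: "real (card (B m)) \<le> L" if "m < N" for m using B(3)[OF that] by simp
  have "(\<Sum>m<N. expectation (\<lambda>\<omega>. (S m \<omega>)\<^sup>2)) \<le> (\<Sum>m<N. card (B m) * (v / n) + card (B m) * (L * \<mu>\<^sup>2))"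
  proof (rule sum_mono)
    fix m assume m: "m \<in> {..<N}"
    have "(card (B m) * \<mu>)\<^sup>2 = card (B m) * (card (B m) * \<mu>\<^sup>2)" by (simp add: power2_eq_square)
    also have "\<dots> \<le> card (B m) * (L * \<mu>\<^sup>2)" using m cL by (intro mult_left_mono mult_right_mono) auto
    finally show "expectation (\<lambda>\<omega>. (S m \<omega>)\<^sup>2) \<le> card (B m) * (v / n) + card (B m) * (L * \<mu>\<^sup>2)"
      using SM(1)[of m] m by auto
  qed
  also have "\<dots> = (\<Sum>m<N. real (card (B m))) * (v / n + L * \<mu>\<^sup>2)"
    by (simp only: sum_distrib_right distrib_left sum.distrib)
  also have "\<dots> \<le> v + \<kappa>" unfolding sumc using n L by (simp add: distrib_left mult.assoc)
  finally show "(\<Sum>m<N. expectation (\<lambda>\<omega>. (S m \<omega>)\<^sup>2)) \<le> v + \<kappa>" .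
  have "(\<Sum>m<N. expectation (\<lambda>\<omega>. S m \<omega> ^ 4))
    \<le> (\<Sum>m<N. card (B m) * (8 * (4 * T\<^sup>2 * (v / n) + 3 * (L * (v / n)\<^sup>2)) + 8 * (L ^ 3 * \<mu> ^ 4)))"
  proof (rule sum_mono)
    fix m assume m: "m \<in> {..<N}"
    have 2: "(card (B m))\<^sup>2 * (v / n)\<^sup>2 \<le> card (B m) * (L * (v / n)\<^sup>2)"
    proof -
      have "(card (B m))\<^sup>2 * (v / n)\<^sup>2 = card (B m) * (card (B m) * (v / n)\<^sup>2)" by (simp add: power2_eq_square)
      also have "\<dots> \<le> card (B m) * (L * (v / n)\<^sup>2)" using m cL by (intro mult_left_mono mult_right_mono) auto
      finally show ?thesis .
    qed
    have "(card (B m) * \<mu>) ^ 4 = card (B m) * (real (card (B m)) ^ 3 * \<mu> ^ 4)"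
      by (simp add: power_mult_distrib numeral_eq_Suc)
    also have "\<dots> \<le> card (B m) * (L ^ 3 * \<mu> ^ 4)" using m cL
      by (intro mult_left_mono mult_right_mono power_mono) auto
    finally have 3: "(card (B m) * \<mu>) ^ 4 \<le> card (B m) * (L ^ 3 * \<mu> ^ 4)" .
    show "expectation (\<lambda>\<omega>. S m \<omega> ^ 4) \<le> card (B m) * (8 * (4 * T\<^sup>2 * (v / n) + 3 * (L * (v / n)\<^sup>2)) + 8 * (L ^ 3 * \<mu> ^ 4))"
      using SM(2)[of m] m 2 3 by (simp add: algebra_simps)
  qed
  also have "\<dots> = n * (8 * (4 * T\<^sup>2 * (v / n) + 3 * (L * (v / n)\<^sup>2)) + 8 * (L ^ 3 * \<mu> ^ 4))"
    by (simp only: sum_distrib_right[symmetric] sumc)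
  also have "\<dots> = 8 * (4 * T\<^sup>2 * v + 3 * (L / n) * v\<^sup>2 + (L / n) * (n * L * \<mu>\<^sup>2)\<^sup>2)"
    using n by (simp add: field_simps power2_eq_square numeral_eq_Suc)
  also have "\<dots> \<le> 8 * (4 * T\<^sup>2 * v + 3 * (L / n) * v\<^sup>2 + (L / n) * \<kappa>\<^sup>2)"
    using L L0 by (intro mult_left_mono add_left_mono power_mono) auto
  finally show "(\<Sum>m<N. expectation (\<lambda>\<omega>. S m \<omega> ^ 4)) \<le> 8 * (4 * T\<^sup>2 * v + 3 * (L / n) * v\<^sup>2 + (L / n) * \<kappa>\<^sup>2)" .
  show "integrable M (\<lambda>\<omega>. S m \<omega> ^ k)" if m: "m < N" for m k
  proof (rule integrable_bounded)
    show "\<bar>S m \<omega> ^ k\<bar> \<le> (card (B m) * T) ^ k" if "\<omega> \<in> space M" for \<omega>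
      unfolding power_abs using SM(3)[OF m that] by (intro power_mono) auto
    show "(\<lambda>\<omega>. S m \<omega> ^ k) \<in> borel_measurable M"
      using SM(4)[OF m] by measurable
  qed
qed

end

section \<open>Truncation and the uniform chaining majorant\<close>

definition trunc :: "real \<Rightarrow> real \<Rightarrow> real" where
  "trunc \<tau> x = (if \<bar>x\<bar> \<le> \<tau> then x else 0)"

lemma trunc_measurable [measurable]: "trunc \<tau> \<in> borel_measurable borel"
  unfolding trunc_def[abs_def] by measurable

lemma trunc_tail: "0 < \<tau> \<Longrightarrow> \<bar>x - trunc \<tau> x\<bar> \<le> x\<^sup>2 * indicator {x. \<tau> < \<bar>x\<bar>} x / \<tau>"
  unfolding trunc_def by (auto simp: field_simps power2_eq_square abs_mult_self_eq[symmetric, of x]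
      intro!: mult_right_mono simp del: abs_mult_self_eq)

lemma abs_trunc_le: "\<bar>trunc \<tau> x\<bar> \<le> \<bar>x\<bar>" "0 \<le> \<tau> \<Longrightarrow> \<bar>trunc \<tau> x\<bar> \<le> \<tau>"
  by (auto simp: trunc_def)

text \<open>The truncation sends large values to 0 rather than to the boundary, so the difference of
  two levels is 0 or x itself, the latter exactly when \<tau> < \<bar>x\<bar> \<le> \<tau>' (for x
  not 0). All three bounds follow.\<close>

lemma trunc_diff:
  assumes "0 < \<tau>" "\<tau> \<le> \<tau>'"
  shows "\<bar>trunc \<tau>' x - trunc \<tau> x\<bar> \<le> \<bar>x\<bar>" "\<bar>trunc \<tau>' x - trunc \<tau> x\<bar> \<le> \<tau>'"
    "\<bar>trunc \<tau>' x - trunc \<tau> x\<bar> \<le> \<bar>x - trunc \<tau> x\<bar>"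
  using assms by (auto simp: trunc_def)

text \<open>Chosen such that \<open>(chain_ratio q ^ k) ^ young_exp q = 1 / 2 ^ k\<close>.\<close>

definition chain_ratio :: "real \<Rightarrow> real" where
  "chain_ratio q = (1 / 2) powr (1 / young_exp q)"

lemma chain_ratio:
  assumes "1 \<le> q" "q < 2"
  shows "0 < chain_ratio q" "chain_ratio q < 1" "(chain_ratio q ^ k) ^ young_exp q = (1 / 2) ^ k"
proof -
  have "0 < 3 * (1 + 2 / (2 - q))" using assms by (simp add: field_simps)
  then have s: "0 < young_exp q" unfolding young_exp_def by simp
  show "0 < chain_ratio q" "chain_ratio q < 1"
    using s powr_less_mono2[of "1 / young_exp q" "1 / 2" 1] by (simp_all add: chain_ratio_def)
  have "chain_ratio q ^ young_exp q = chain_ratio q powr real (young_exp q)"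
    by (rule powr_realpow[symmetric]) (simp add: chain_ratio_def)
  also have "\<dots> = 1 / 2" using s by (simp add: chain_ratio_def powr_powr)
  finally show "(chain_ratio q ^ k) ^ young_exp q = (1 / 2) ^ k"
    by (metis power_mult mult.commute)
qed

text \<open>Here \<kappa> covers the squared bias in the two regimes of \<open>iid_chaining\<close>:
  \<open>68 * v\<^sup>2\<close>, with 68 = 17 * 4, for cells with at most 17 * n / 16 ^ k points,
  and v at the finest level, where a cell holds at most one point. The summands of the constant are
  the variation bound 16, the second moments v + \<kappa>, and the fourth moments with L / n at most
  17 / 4 ^ k, where 51 = 3 * 17.\<close>

definition chain_const :: "real \<Rightarrow> real" where
  "chain_const v = (let \<kappa> = 68 * v\<^sup>2 + v in 16 + v + \<kappa> + 8 * (4 * v + 51 * v\<^sup>2 + 17 * \<kappa>\<^sup>2))"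

context prob_space
begin

text \<open>By the choice of \<open>chain_ratio\<close>, division by \<open>u ^ young_exp q\<close>
  is multiplication by 2 ^ k, so fourth moments of order 1 / 4 ^ k still leave 1 / 2 ^ k.\<close>

lemma chain_bound_expectation:
  assumes q: "1 \<le> q" "q < 2"
    and int: "\<And>m i. m \<in> J \<Longrightarrow> integrable M (\<lambda>\<omega>. S m \<omega> ^ i)"
    and S2: "(\<Sum>m\<in>J. expectation (\<lambda>\<omega>. (S m \<omega>)\<^sup>2)) \<le> A"
    and S4: "(\<Sum>m\<in>J. expectation (\<lambda>\<omega>. S m \<omega> ^ 4)) \<le> B / 4 ^ k"
  defines "u \<equiv> chain_ratio q ^ k"
  shows "integrable M (\<lambda>\<omega>. chain_bound q c u J (\<lambda>m. S m \<omega>))"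
    and "expectation (\<lambda>\<omega>. chain_bound q c u J (\<lambda>m. S m \<omega>)) \<le> (c + A) * u + B / 2 ^ k"
proof -
  have u: "0 < u" and us: "u ^ young_exp q = (1 / 2) ^ k"
    using chain_ratio[OF q] by (auto simp: u_def)
  show "integrable M (\<lambda>\<omega>. chain_bound q c u J (\<lambda>m. S m \<omega>))"
    unfolding chain_bound_def using int by auto
  have "expectation (\<lambda>\<omega>. chain_bound q c u J (\<lambda>m. S m \<omega>)) =
      u * (c + (\<Sum>m\<in>J. expectation (\<lambda>\<omega>. (S m \<omega>)\<^sup>2))) + (\<Sum>m\<in>J. expectation (\<lambda>\<omega>. S m \<omega> ^ 4)) * 2 ^ k"
    unfolding chain_bound_def us using int
    by (simp add: prob_space power_divide)
  also have "\<dots> \<le> u * (c + A) + B / 4 ^ k * 2 ^ k"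
    using S2 S4 u by (intro add_mono mult_left_mono mult_right_mono) auto
  also have "B / 4 ^ k * 2 ^ k = B / 2 ^ k"
  proof -
    have "(4::real) ^ k = 2 ^ k * 2 ^ k" by (simp flip: power_mult_distrib)
    then show ?thesis by simp
  qed
  finally show "expectation (\<lambda>\<omega>. chain_bound q c u J (\<lambda>m. S m \<omega>)) \<le> (c + A) * u + B / 2 ^ k"
    by (simp add: mult.commute)
qed

lemma level_bound:
  fixes b :: "nat \<Rightarrow> 'a \<Rightarrow> real" and L :: real
  assumes q: "1 \<le> q" "q < 2" and n: "0 < n" and ind: "indep_vars (\<lambda>_. borel) b {1..n}"
    and bd: "\<And>j \<omega>. j \<in> {1..n} \<Longrightarrow> \<omega> \<in> space M \<Longrightarrow> \<bar>b j \<omega>\<bar> \<le> 1 / 2 ^ k"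
    and mean: "\<And>j. j \<in> {1..n} \<Longrightarrow> \<bar>expectation (b j)\<bar> \<le> \<mu>"
    and var: "\<And>j. j \<in> {1..n} \<Longrightarrow> expectation (\<lambda>\<omega>. (b j \<omega>)\<^sup>2) \<le> v / n"
    and L: "\<And>m. m < 16 ^ k \<Longrightarrow> card (blk (16 ^ k) n m) \<le> L" "0 \<le> L" "L / n \<le> 17 / 4 ^ k"
      "n * L * \<mu>\<^sup>2 \<le> 68 * v\<^sup>2 + v"
    and v: "0 \<le> v"
  defines "\<Xi> \<equiv> \<lambda>\<omega>. chain_bound q 16 (chain_ratio q ^ k) {..<16 ^ k} (\<lambda>m. \<Sum>j\<in>blk (16 ^ k) n m. b j \<omega>)"
  shows "integrable M \<Xi>" "expectation \<Xi> \<le> chain_const v * (chain_ratio q ^ k + 1 / 2 ^ k)"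
proof -
  let ?N = "16 ^ k :: nat" and ?\<kappa> = "68 * v\<^sup>2 + v"
  have sub: "blk ?N n m \<subseteq> {1..n}" for m by (auto simp: blk_def)
  have sumc: "(\<Sum>m<?N. card (blk ?N n m)) = n" by (rule sum_card_blk) simp
  note BM = n ind bd mean var sub sumc L(1) L(4) v L(2)
  have S2: "(\<Sum>m<?N. expectation (\<lambda>\<omega>. (\<Sum>j\<in>blk ?N n m. b j \<omega>)\<^sup>2)) \<le> v + ?\<kappa>"
    by (rule block_moment2[OF BM]) auto
  have int: "integrable M (\<lambda>\<omega>. (\<Sum>j\<in>blk ?N n m. b j \<omega>) ^ i)" if "m \<in> {..<?N}" for m i
    using that by (intro block_integrable[OF BM]) auto
  have "(\<Sum>m<?N. expectation (\<lambda>\<omega>. (\<Sum>j\<in>blk ?N n m. b j \<omega>) ^ 4))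
      \<le> 8 * (4 * (1 / 2 ^ k)\<^sup>2 * v + 3 * (L / n) * v\<^sup>2 + (L / n) * ?\<kappa>\<^sup>2)"
    by (rule block_moment4[OF BM]) auto
  also have "\<dots> \<le> 8 * (4 * (1 / 2 ^ k)\<^sup>2 * v + 3 * (17 / 4 ^ k) * v\<^sup>2 + (17 / 4 ^ k) * ?\<kappa>\<^sup>2)"
    using L(3) by (intro mult_left_mono add_mono mult_right_mono order_refl) auto
  also have "\<dots> = 8 * (4 * v + 51 * v\<^sup>2 + 17 * ?\<kappa>\<^sup>2) / 4 ^ k"
  proof -
    have "(1 / 2 ^ k)\<^sup>2 = (1 / 4 ^ k :: real)"
      by (simp add: power_divide power2_eq_square flip: power_mult_distrib)
    then show ?thesis by (simp add: field_simps)
  qed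
  finally have S4: "(\<Sum>m<?N. expectation (\<lambda>\<omega>. (\<Sum>j\<in>blk ?N n m. b j \<omega>) ^ 4))
      \<le> 8 * (4 * v + 51 * v\<^sup>2 + 17 * ?\<kappa>\<^sup>2) / 4 ^ k" .
  show "integrable M \<Xi>" unfolding \<Xi>_def by (rule chain_bound_expectation(1)[OF q int S2 S4])
  have "expectation \<Xi> \<le> (16 + (v + ?\<kappa>)) * chain_ratio q ^ k + 8 * (4 * v + 51 * v\<^sup>2 + 17 * ?\<kappa>\<^sup>2) / 2 ^ k"
    unfolding \<Xi>_def by (rule chain_bound_expectation(2)[OF q int S2 S4])
  also have "\<dots> \<le> chain_const v * chain_ratio q ^ k + chain_const v * (1 / 2 ^ k)"
  proof (rule add_mono)
    show "(16 + (v + ?\<kappa>)) * chain_ratio q ^ k \<le> chain_const v * chain_ratio q ^ k"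
      using v chain_ratio(1)[OF q] by (intro mult_right_mono) (auto simp: chain_const_def Let_def)
    have "8 * (4 * v + 51 * v\<^sup>2 + 17 * ?\<kappa>\<^sup>2) \<le> chain_const v"
      using v by (auto simp: chain_const_def Let_def)
    then show "8 * (4 * v + 51 * v\<^sup>2 + 17 * ?\<kappa>\<^sup>2) / 2 ^ k \<le> chain_const v * (1 / 2 ^ k)"
      by (simp add: divide_right_mono)
  qed
  finally show "expectation \<Xi> \<le> chain_const v * (chain_ratio q ^ k + 1 / 2 ^ k)"
    by (simp add: distrib_left)
qed

text \<open>As x is centred, the mean of its truncation is minus the mean of the removed part. The
  first bound, with the tail of the second moment, serves the coarsest level, whose contribution
  must vanish as n grows; at the other levels the order 1 / \<tau> is enough.\<close>

lemma truncated_moments: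
  fixes x :: "'a \<Rightarrow> real"
  assumes [measurable]: "x \<in> borel_measurable M" and sq: "integrable M (\<lambda>\<omega>. (x \<omega>)\<^sup>2)"
    and mean: "expectation x = 0" and var: "expectation (\<lambda>\<omega>. (x \<omega>)\<^sup>2) = v" and \<tau>: "0 < \<tau>"
  shows "expectation (\<lambda>\<omega>. \<bar>x \<omega> - trunc \<tau> (x \<omega>)\<bar>)
      \<le> expectation (\<lambda>\<omega>. (x \<omega>)\<^sup>2 * indicator {x. \<tau> < \<bar>x\<bar>} (x \<omega>)) / \<tau>" (is ?A)
    and "expectation (\<lambda>\<omega>. \<bar>x \<omega> - trunc \<tau> (x \<omega>)\<bar>) \<le> v / \<tau>" (is ?B)
    and "\<bar>expectation (\<lambda>\<omega>. trunc \<tau> (x \<omega>))\<bar> \<le> v / \<tau>" (is ?C)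
    and "integrable M (\<lambda>\<omega>. x \<omega> - trunc \<tau> (x \<omega>))" (is ?D)
    and "integrable M x" (is ?E)
proof -
  have intx: ?E using sq by (rule square_integrable_imp_integrable[rotated]) measurable
  have intt: "integrable M (\<lambda>\<omega>. trunc \<tau> (x \<omega>))"
    by (rule Bochner_Integration.integrable_bound[OF intx]) (auto simp: abs_trunc_le)
  show ?E by (rule intx)
  show ?D using intx intt by simp
  have int2: "integrable M (\<lambda>\<omega>. (x \<omega>)\<^sup>2 * indicator {x. \<tau> < \<bar>x\<bar>} (x \<omega>))"
    by (rule Bochner_Integration.integrable_bound[OF sq]) (auto simp: indicator_def)
  have "expectation (\<lambda>\<omega>. \<bar>x \<omega> - trunc \<tau> (x \<omega>)\<bar>)
      \<le> expectation (\<lambda>\<omega>. (x \<omega>)\<^sup>2 * indicator {x. \<tau> < \<bar>x\<bar>} (x \<omega>) / \<tau>)"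
    using intx intt int2 trunc_tail[OF \<tau>] by (intro integral_mono) auto
  then show ?A by simp
  also have "\<dots> \<le> expectation (\<lambda>\<omega>. (x \<omega>)\<^sup>2) / \<tau>"
    using \<tau> int2 sq by (intro divide_right_mono integral_mono) (auto simp: indicator_def)
  finally show ?B unfolding var .
  have "expectation (\<lambda>\<omega>. trunc \<tau> (x \<omega>)) = - expectation (\<lambda>\<omega>. x \<omega> - trunc \<tau> (x \<omega>))"
    using intx intt mean by simp
  also have "\<bar>\<dots>\<bar> \<le> expectation (\<lambda>\<omega>. \<bar>x \<omega> - trunc \<tau> (x \<omega>)\<bar>)"
    unfolding abs_minus_cancel by (rule integral_abs_bound)
  finally show ?C using \<open>?B\<close> by linarith
qed

text \<open>Mesh and truncation are refined together. Summation by parts over the levels from K to L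
  leaves four kinds of terms: the innovations above sqrt n / 2 ^ K, a change of tag times an
  innovation truncated at the finer level, the current approximation error of f times a change of
  truncation, and a remainder at level L. The first is bounded in mean through \<delta>, the others
  by \<open>chain_bound\<close>, whose expectations are dominated by geometric series.\<close>

lemma iid_chaining:
  fixes a :: "nat \<Rightarrow> 'a \<Rightarrow> real"
  assumes q: "1 \<le> q" "q < 2" and nK: "16 ^ K \<le> n"
    and ind: "indep_vars (\<lambda>_. borel) a {1..n}"
    and sq: "\<And>j. j \<in> {1..n} \<Longrightarrow> integrable M (\<lambda>\<omega>. (a j \<omega>)\<^sup>2)"
    and mean: "\<And>j. j \<in> {1..n} \<Longrightarrow> expectation (a j) = 0"
    and var: "\<And>j. j \<in> {1..n} \<Longrightarrow> expectation (\<lambda>\<omega>. (a j \<omega>)\<^sup>2) = v"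
    and tail: "\<And>j. j \<in> {1..n} \<Longrightarrow>
      expectation (\<lambda>\<omega>. (a j \<omega>)\<^sup>2 * indicator {x. sqrt n / 2 ^ K < \<bar>x\<bar>} (a j \<omega>)) \<le> \<delta>"
  shows "\<exists>\<Xi>. integrable M \<Xi> \<and> (\<forall>\<omega>. 0 \<le> \<Xi> \<omega>) \<and>
    (\<forall>\<omega>\<in>space M. \<forall>f\<in>qvar_ball q.
      \<bar>\<Sum>j=1..n. (f (real j / n) - f (tag K (cidx (16 ^ K) n j))) * a j \<omega>\<bar> / sqrt n \<le> \<Xi> \<omega>) \<and>
    expectation \<Xi> \<le> 2 ^ K * \<delta> + 2 * chain_const v * (chain_ratio q ^ K / (1 - chain_ratio q) + 2 / 2 ^ K)"
proof -
  have n: "0 < n" using nK by (meson less_le_trans zero_less_numeral zero_less_power)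
  have v: "0 \<le> v" using var[of 1] n
    by (metis Bochner_Integration.integral_nonneg atLeastAtMost_iff le_refl less_one not_le zero_le_power2)
  \<comment> \<open>The least level with at least n cells. Minimality gives 16 ^ L \<le> 16 * n, so
    a cell of any level k \<le> L holds at most n / 16 ^ k + 1 \<le> 17 * n / 16 ^ k points.\<close>
  define L where "L = (LEAST L. n \<le> 16 ^ L)"
  have nL: "n \<le> 16 ^ L"
    unfolding L_def by (rule LeastI[of _ n]) (simp add: less_exp less_imp_le self_le_ge2_pow)
  have KL: "K \<le> L"
  proof (rule ccontr)
    assume "\<not> K \<le> L"
    then have "(16::nat) ^ L < 16 ^ K" by simp
    then show False using nL nK by linarith
  qed
  have L_le: "16 ^ k \<le> 16 * n" if "k \<le> L" for k
  proof -
    have "(16::nat) ^ L \<le> 16 * n"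
    proof (cases L)
      case (Suc l)
      then have "\<not> n \<le> 16 ^ l" unfolding L_def using not_less_Least[of l "\<lambda>L. n \<le> 16 ^ L"] by simp
      then show ?thesis using Suc by simp
    qed (use n in simp)
    moreover have "(16::nat) ^ k \<le> 16 ^ L" using that by (intro power_increasing) auto
    ultimately show ?thesis by linarith
  qed
  have L_le': "(16::real) ^ k \<le> 16 * n" if "k \<le> L" for k
    using L_le[OF that] by (metis (mono_tags) of_nat_le_iff of_nat_mult of_nat_numeral of_nat_power)
  \<comment> \<open>Level \<open>k\<close> uses the innovations truncated at \<open>\<tau> k\<close>, which keeps the fourth moments of the block sums
    of order \<open>1 / 4 ^ k\<close>. From level \<open>L\<close> on, a cell contains at most one design point.\<close>
  define \<tau> where "\<tau> k = sqrt n / 2 ^ k" for k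
  have \<tau>: "0 < \<tau> k" "\<tau> (Suc k) \<le> \<tau> k" for k using n by (auto simp: \<tau>_def field_simps)
  define g where "g k = trunc (\<tau> k)" for k
  have [measurable]: "g k \<in> borel_measurable borel" for k by (simp add: g_def)
  define \<rho> where "\<rho> = chain_ratio q"
  note \<rho> = chain_ratio[OF q, folded \<rho>_def]
  define cb where "cb k \<phi> \<omega> = chain_bound q 16 (\<rho> ^ k) {..<16 ^ k} (\<lambda>m. \<Sum>j\<in>blk (16 ^ k) n m. \<phi> (a j \<omega>) / sqrt n)"
    for k \<phi> \<omega>
  have meas[measurable]: "\<And>j. j \<in> {1..n} \<Longrightarrow> a j \<in> borel_measurable M"
    using ind unfolding indep_vars_def by auto
  have LB: "integrable M (cb k \<phi>) \<and> expectation (cb k \<phi>) \<le> chain_const v * (\<rho> ^ k + 1 / 2 ^ k)"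
    if [measurable]: "\<phi> \<in> borel_measurable borel" and ph: "\<And>x. \<bar>\<phi> x\<bar> \<le> \<tau> k" "\<And>x. \<bar>\<phi> x\<bar> \<le> \<bar>x\<bar>"
      and mu: "\<And>j. j \<in> {1..n} \<Longrightarrow> \<bar>expectation (\<lambda>\<omega>. \<phi> (a j \<omega>))\<bar> \<le> \<mu>"
      and l: "\<And>m. m < 16 ^ k \<Longrightarrow> card (blk (16 ^ k) n m) \<le> l" "0 \<le> l" "l / n \<le> 17 / 4 ^ k"
        "l * \<mu>\<^sup>2 \<le> 68 * v\<^sup>2 + v" for \<phi> k \<mu> and l :: real
  proof -
    let ?b = "\<lambda>j \<omega>. \<phi> (a j \<omega>) / sqrt n"
    have indb: "indep_vars (\<lambda>_. borel) ?b {1..n}" by (rule indep_vars_compose2[OF ind]) auto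
    have bd: "\<bar>?b j \<omega>\<bar> \<le> 1 / 2 ^ k" for j \<omega>
      using ph(1)[of "a j \<omega>"] n by (simp add: \<tau>_def field_simps)
    have mn: "\<bar>expectation (?b j)\<bar> \<le> \<mu> / sqrt n" if "j \<in> {1..n}" for j
      using mu[OF that] n by (simp add: divide_right_mono)
    have vr: "expectation (\<lambda>\<omega>. (?b j \<omega>)\<^sup>2) \<le> v / n" if j: "j \<in> {1..n}" for j
    proof -
      have ph2: "(\<phi> x)\<^sup>2 \<le> x\<^sup>2" for x using ph(2)[of x] by (simp add: abs_le_square_iff)
      have "integrable M (\<lambda>\<omega>. (\<phi> (a j \<omega>))\<^sup>2)"
        by (rule Bochner_Integration.integrable_bound[OF sq[OF j]]) (use j ph2 in auto)
      then have "expectation (\<lambda>\<omega>. (\<phi> (a j \<omega>))\<^sup>2) \<le> v"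
        unfolding var[OF j, symmetric] using sq[OF j] ph2 by (intro integral_mono) auto
      then show ?thesis using n by (simp add: power_divide divide_right_mono)
    qed
    have "n * l * (\<mu> / sqrt n)\<^sup>2 \<le> 68 * v\<^sup>2 + v" using l(4) n by (simp add: power_divide)
    then show ?thesis
      using level_bound[OF q n indb bd mn vr l(1-3) _ v] unfolding cb_def[abs_def] \<rho>_def by auto
  qed
  \<comment> \<open>The bound v / \<tau> (Suc k) on the mean suits both functions used at level k:
    \<open>g k\<close>, whose mean is at most v / \<tau> k, and the truncation increment
    \<open>h k\<close>, whose mean is bounded by that of the part removed at \<tau> (Suc k).\<close>
  have LB': "integrable M (cb k \<phi>) \<and> expectation (cb k \<phi>) \<le> chain_const v * (\<rho> ^ k + 1 / 2 ^ k)"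
    if \<phi>: "\<phi> \<in> borel_measurable borel" "\<And>x. \<bar>\<phi> x\<bar> \<le> \<tau> k" "\<And>x. \<bar>\<phi> x\<bar> \<le> \<bar>x\<bar>"
      and mu: "\<And>j. j \<in> {1..n} \<Longrightarrow> \<bar>expectation (\<lambda>\<omega>. \<phi> (a j \<omega>))\<bar> \<le> v / \<tau> (Suc k)" and k: "k \<le> L" for \<phi> k
  proof (rule LB[OF \<phi> mu])
    fix m :: nat assume "m < 16 ^ k"
    then have "real (card (blk (16 ^ k) n m)) \<le> n / 16 ^ k + 1"
      using card_blk_le[of "16 ^ k" m n] by simp
    also have "\<dots> \<le> n / 16 ^ k + 16 * n / 16 ^ k" using L_le'[OF k] by (simp add: field_simps)
    finally show "real (card (blk (16 ^ k) n m)) \<le> 17 * n / 16 ^ k" by simp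
  next
    have "17 * n / 16 ^ k / n = 17 / (16::real) ^ k" using n by simp
    also have "\<dots> \<le> 17 / 4 ^ k" by (intro divide_left_mono power_mono) auto
    finally show "17 * n / 16 ^ k / n \<le> 17 / (4::real) ^ k" .
    have "17 * n / 16 ^ k * (v / \<tau> (Suc k))\<^sup>2 = 68 * v\<^sup>2 * ((2 ^ k)\<^sup>2 / 16 ^ k)"
      using n by (simp add: \<tau>_def power_divide power_mult_distrib)
    also have "(2 ^ k)\<^sup>2 / 16 ^ k = (1 / 4 :: real) ^ k"
      by (simp add: power2_eq_square power_divide flip: power_mult_distrib power_divide)
    also have "68 * v\<^sup>2 * (1 / 4) ^ k \<le> 68 * v\<^sup>2 * 1" by (intro mult_left_mono power_le_one) auto
    finally show "17 * n / 16 ^ k * (v / \<tau> (Suc k))\<^sup>2 \<le> 68 * v\<^sup>2 + v" using v by simp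
  qed auto
  have TM: "expectation (\<lambda>\<omega>. \<bar>a j \<omega> - g k (a j \<omega>)\<bar>)
      \<le> expectation (\<lambda>\<omega>. (a j \<omega>)\<^sup>2 * indicator {x. \<tau> k < \<bar>x\<bar>} (a j \<omega>)) / \<tau> k"
    "expectation (\<lambda>\<omega>. \<bar>a j \<omega> - g k (a j \<omega>)\<bar>) \<le> v / \<tau> k"
    "\<bar>expectation (\<lambda>\<omega>. g k (a j \<omega>))\<bar> \<le> v / \<tau> k"
    "integrable M (\<lambda>\<omega>. a j \<omega> - g k (a j \<omega>))" "integrable M (a j)" if "j \<in> {1..n}" for j k
    using truncated_moments[OF meas sq mean var \<tau>(1), OF that that that that] unfolding g_def by blast+
  have D: "integrable M (cb (Suc k) (g (Suc k))) \<and>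
      expectation (cb (Suc k) (g (Suc k))) \<le> chain_const v * (\<rho> ^ Suc k + 1 / 2 ^ Suc k)" if "Suc k \<le> L" for k
  proof (rule LB'[OF _ _ _ _ that])
    show "\<bar>g (Suc k) x\<bar> \<le> \<tau> (Suc k)" "\<bar>g (Suc k) x\<bar> \<le> \<bar>x\<bar>" for x
      using abs_trunc_le \<tau>[of "Suc k"] by (auto simp: g_def)
    show "\<bar>expectation (\<lambda>\<omega>. g (Suc k) (a j \<omega>))\<bar> \<le> v / \<tau> (Suc (Suc k))" if "j \<in> {1..n}" for j
      by (rule order_trans[OF TM(3)[OF that]]) (use v \<tau> in \<open>auto intro!: divide_left_mono\<close>)
  qed simp
  \<comment> \<open>\<open>chain_step_rest\<close> takes absolute values inside the blocks, so these
    summands are nonnegative and not centred; it is the order 1 / \<tau> of their mean that keeps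
    the block sums under control.\<close>
  define h where "h k x = \<bar>g k x - g (Suc k) x\<bar>" for k x
  have [measurable]: "h k \<in> borel_measurable borel" for k unfolding h_def by measurable
  have R: "integrable M (cb k (h k)) \<and> expectation (cb k (h k)) \<le> chain_const v * (\<rho> ^ k + 1 / 2 ^ k)"
    if "k \<le> L" for k
  proof (rule LB'[OF _ _ _ _ that])
    show "\<bar>h k x\<bar> \<le> \<tau> k" "\<bar>h k x\<bar> \<le> \<bar>x\<bar>" for x
      using trunc_diff[OF \<tau>(1) \<tau>(2)] by (auto simp: h_def g_def)
    show "\<bar>expectation (\<lambda>\<omega>. h k (a j \<omega>))\<bar> \<le> v / \<tau> (Suc k)" if j: "j \<in> {1..n}" for j
    proof -
      have hle: "h k x \<le> \<bar>x - g (Suc k) x\<bar>" for x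
        using trunc_diff(3)[OF \<tau>(1) \<tau>(2)] by (auto simp: h_def g_def)
      have "integrable M (\<lambda>\<omega>. h k (a j \<omega>))"
        by (rule Bochner_Integration.integrable_bound[OF TM(4)[OF j, of "Suc k"]])
          (use j hle in \<open>auto simp: h_def\<close>)
      then have "expectation (\<lambda>\<omega>. h k (a j \<omega>)) \<le> expectation (\<lambda>\<omega>. \<bar>a j \<omega> - g (Suc k) (a j \<omega>)\<bar>)"
        using TM(4)[OF j] hle by (intro integral_mono) auto
      moreover have "0 \<le> expectation (\<lambda>\<omega>. h k (a j \<omega>))"
        by (intro Bochner_Integration.integral_nonneg) (simp add: h_def)
      ultimately show ?thesis using TM(2)[OF j, of "Suc k"] by linarith
    qed
  qed simp
  \<comment> \<open>At the finest level the mean of \<bar>g L\<bar> is only bounded by sqrt v, but a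
    block has at most one point, so the bias condition holds with block size 1 and costs v.\<close>
  have T: "integrable M (cb L (\<lambda>x. \<bar>g L x\<bar>)) \<and>
      expectation (cb L (\<lambda>x. \<bar>g L x\<bar>)) \<le> chain_const v * (\<rho> ^ L + 1 / 2 ^ L)"
  proof (rule LB)
    show "\<bar>\<bar>g L x\<bar>\<bar> \<le> \<tau> L" "\<bar>\<bar>g L x\<bar>\<bar> \<le> \<bar>x\<bar>" for x
      using abs_trunc_le \<tau>[of L] by (auto simp: g_def)
    show "\<bar>expectation (\<lambda>\<omega>. \<bar>g L (a j \<omega>)\<bar>)\<bar> \<le> sqrt v" if j: "j \<in> {1..n}" for j
    proof -
      have int: "integrable M (\<lambda>\<omega>. \<bar>a j \<omega>\<bar>)" using TM(5)[OF j] by simp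
      have "\<bar>expectation (\<lambda>\<omega>. \<bar>g L (a j \<omega>)\<bar>)\<bar> \<le> expectation (\<lambda>\<omega>. \<bar>\<bar>g L (a j \<omega>)\<bar>\<bar>)"
        by (rule integral_abs_bound)
      also have "\<dots> \<le> expectation (\<lambda>\<omega>. \<bar>a j \<omega>\<bar>)"
      proof (rule integral_mono[OF _ int])
        show "integrable M (\<lambda>\<omega>. \<bar>\<bar>g L (a j \<omega>)\<bar>\<bar>)"
          by (rule Bochner_Integration.integrable_bound[OF int]) (use j in \<open>auto simp: g_def abs_trunc_le\<close>)
      qed (auto simp: g_def abs_trunc_le)
      also have "\<dots> \<le> sqrt v"
      proof (rule real_le_rsqrt)
        have "0 \<le> variance (\<lambda>\<omega>. \<bar>a j \<omega>\<bar>)" by (intro Bochner_Integration.integral_nonneg) simp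
        also have "\<dots> = v - (expectation (\<lambda>\<omega>. \<bar>a j \<omega>\<bar>))\<^sup>2"
          using var[OF j] sq[OF j] int by (subst variance_eq) auto
        finally show "(expectation (\<lambda>\<omega>. \<bar>a j \<omega>\<bar>))\<^sup>2 \<le> v" by simp
      qed
      finally show ?thesis .
    qed
    show "real (card (blk (16 ^ L) n m)) \<le> 1" if "m < 16 ^ L" for m
      using card_blk_le_1[OF _ that nL] by simp
    have "1 / n \<le> 16 / (16::real) ^ L" using L_le'[of L] n by (simp add: field_simps)
    also have "\<dots> \<le> 17 / 4 ^ L" by (intro frac_le power_mono) auto
    finally show "1 / n \<le> 17 / (4::real) ^ L" .
    show "1 * (sqrt v)\<^sup>2 \<le> 68 * v\<^sup>2 + v" using v by simp
  qed auto
  define \<Xi> where "\<Xi> \<omega> = (\<Sum>j=1..n. \<bar>a j \<omega> - g K (a j \<omega>)\<bar>) / sqrt n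
    + (\<Sum>k\<in>{K..<L}. cb (Suc k) (g (Suc k)) \<omega> + cb k (h k) \<omega>) + cb L (\<lambda>x. \<bar>g L x\<bar>) \<omega>" for \<omega>
  have intD: "integrable M (cb (Suc k) (g (Suc k)))" "integrable M (cb k (h k))" if "k \<in> {K..<L}" for k
    using that D[of k] R[of k] by auto
  have int\<Xi>: "integrable M \<Xi>"
    unfolding \<Xi>_def[abs_def] using T intD TM(4)
    by (intro Bochner_Integration.integrable_add integrable_divide_zero
        Bochner_Integration.integrable_sum integrable_abs) auto
  have \<Xi>0: "0 \<le> \<Xi> \<omega>" for \<omega>
    unfolding \<Xi>_def cb_def using \<rho>
    by (intro add_nonneg_nonneg divide_nonneg_nonneg sum_nonneg chain_bound_nonneg) auto
  have maj: "\<bar>\<Sum>j=1..n. (f (real j / n) - f (tag K (cidx (16 ^ K) n j))) * a j \<omega>\<bar> / sqrt n \<le> \<Xi> \<omega>"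
    if w: "\<omega> \<in> space M" and f: "f \<in> qvar_ball q" for \<omega> f
  proof -
    define r where "r k j = f (real j / n) - f (tag k (cidx (16 ^ k) n j))" for k j
    let ?x = "\<lambda>j. a j \<omega>"
    \<comment> \<open>Summation by parts: the summands over k are the negative increments of the
      product \<open>r k j * g k (?x j)\<close>.\<close>
    have tele: "r K j * ?x j = r K j * (?x j - g K (?x j))
        + (\<Sum>k\<in>{K..<L}. (r k j - r (Suc k) j) * g (Suc k) (?x j) + r k j * (g k (?x j) - g (Suc k) (?x j)))
        + r L j * g L (?x j)" for j
    proof -
      have "(\<Sum>k\<in>{K..<L}. (r k j - r (Suc k) j) * g (Suc k) (?x j) + r k j * (g k (?x j) - g (Suc k) (?x j)))
        = (\<Sum>k\<in>{K..<L}. - (r (Suc k) j * g (Suc k) (?x j) - r k j * g k (?x j)))"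
        by (intro sum.cong) (auto simp: algebra_simps)
      also have "\<dots> = r K j * g K (?x j) - r L j * g L (?x j)"
        unfolding sum_negf sum_Suc_diff'[OF KL, of "\<lambda>k. r k j * g k (?x j)"] by simp
      finally show ?thesis by (simp add: algebra_simps)
    qed
    have dec: "(\<Sum>j=1..n. r K j * ?x j) / sqrt n = (\<Sum>j=1..n. r K j * (?x j - g K (?x j))) / sqrt n
        + (\<Sum>k\<in>{K..<L}. (\<Sum>j=1..n. (r k j - r (Suc k) j) * (g (Suc k) (?x j) / sqrt n))
            + (\<Sum>j=1..n. r k j * ((g k (?x j) - g (Suc k) (?x j)) / sqrt n)))
        + (\<Sum>j=1..n. r L j * (g L (?x j) / sqrt n))"
      unfolding tele sum.distrib sum.swap[of _ "{K..<L}"]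
      by (simp add: add_divide_distrib sum_divide_distrib sum.distrib)
    have "\<bar>(\<Sum>j=1..n. r K j * ?x j) / sqrt n\<bar> \<le> \<Xi> \<omega>"
    proof -
      have r1: "\<bar>r K j\<bar> \<le> 1" if "j \<in> {1..n}" for j
      proof -
        have "Suc (cidx (16 ^ K) n j) \<le> 16 ^ K" using cidx_less[OF that, of "16 ^ K"] by simp
        then have "real (Suc (cidx (16 ^ K) n j)) \<le> 16 ^ K"
          by (metis of_nat_le_iff of_nat_numeral of_nat_power)
        then show ?thesis using that unfolding r_def
          by (intro qvar_ball_diff_le_1[OF f q(1)]) (auto simp: field_simps)
      qed
      have "\<bar>\<Sum>j=1..n. r K j * (?x j - g K (?x j))\<bar> \<le> (\<Sum>j=1..n. 1 * \<bar>?x j - g K (?x j)\<bar>)"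
        unfolding abs_mult using r1
        by (intro order_trans[OF sum_abs] sum_mono) (auto simp: abs_mult intro!: mult_left_le_one_le)
      then have A: "\<bar>(\<Sum>j=1..n. r K j * (?x j - g K (?x j))) / sqrt n\<bar> \<le> (\<Sum>j=1..n. \<bar>?x j - g K (?x j)\<bar>) / sqrt n"
        using n by (simp add: divide_right_mono)
      have u: "0 < \<rho> ^ k" "\<rho> ^ k \<le> 1" for k using \<rho> by (auto intro: power_le_one)
      have B: "\<bar>\<Sum>j=1..n. (r k j - r (Suc k) j) * (g (Suc k) (?x j) / sqrt n)\<bar> \<le> cb (Suc k) (g (Suc k)) \<omega>" for k
      proof -
      have "(\<Sum>j=1..n. (r k j - r (Suc k) j) * (g (Suc k) (?x j) / sqrt n))
        = (\<Sum>m<16 ^ Suc k. \<Sum>j\<in>blk (16 ^ Suc k) n m. (r k j - r (Suc k) j) * (g (Suc k) (?x j) / sqrt n))"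
        by (rule sum_blk) simp
      \<comment> \<open>The value f (j / n) cancels in \<open>r k j - r (Suc k) j\<close>, so the
        difference is constant on a block and multiplies a signed block sum.\<close>
      also have "\<dots> = (\<Sum>m<16 ^ Suc k. (f (tag (Suc k) m) - f (tag k (m div 16))) *
          (\<Sum>j\<in>blk (16 ^ Suc k) n m. g (Suc k) (?x j) / sqrt n))"
      proof (intro sum.cong refl)
        fix m
        have "r k j - r (Suc k) j = f (tag (Suc k) m) - f (tag k (m div 16))" if "j \<in> blk (16 ^ Suc k) n m" for j
          using that cidx_nested[of j "16 ^ k" n] by (auto simp: r_def blk_def)
        then show "(\<Sum>j\<in>blk (16 ^ Suc k) n m. (r k j - r (Suc k) j) * (g (Suc k) (?x j) / sqrt n))
          = (f (tag (Suc k) m) - f (tag k (m div 16))) * (\<Sum>j\<in>blk (16 ^ Suc k) n m. g (Suc k) (?x j) / sqrt n)"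
          unfolding sum_distrib_left by (intro sum.cong) auto
      qed
      also have "\<bar>\<dots>\<bar> \<le> cb (Suc k) (g (Suc k)) \<omega>"
        unfolding cb_def by (rule chain_step_fine[OF f q u])
      finally show ?thesis .
      qed
      have C: "\<bar>\<Sum>j=1..n. r k j * ((g k (?x j) - g (Suc k) (?x j)) / sqrt n)\<bar> \<le> cb k (h k) \<omega>" for k
        using chain_step_rest[OF f q u[of k], of n k "\<lambda>j. (g k (?x j) - g (Suc k) (?x j)) / sqrt n"]
        unfolding cb_def r_def h_def by simp
      have E: "\<bar>\<Sum>j=1..n. r L j * (g L (?x j) / sqrt n)\<bar> \<le> cb L (\<lambda>x. \<bar>g L x\<bar>) \<omega>"
        using chain_step_rest[OF f q u[of L], of n L "\<lambda>j. g L (?x j) / sqrt n"]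
        unfolding cb_def r_def by simp
      have "\<bar>\<Sum>k\<in>{K..<L}. y k + z k\<bar> \<le> (\<Sum>k\<in>{K..<L}. y' k + z' k)"
        if "\<And>k. \<bar>y k\<bar> \<le> y' k" "\<And>k. \<bar>z k\<bar> \<le> z' k" for y z y' z' :: "nat \<Rightarrow> real"
        by (intro order_trans[OF sum_abs] sum_mono order_trans[OF abs_triangle_ineq] add_mono that)
      note S = this[of "\<lambda>k. \<Sum>j=1..n. (r k j - r (Suc k) j) * (g (Suc k) (?x j) / sqrt n)" "\<lambda>k. cb (Suc k) (g (Suc k)) \<omega>"
        "\<lambda>k. \<Sum>j=1..n. r k j * ((g k (?x j) - g (Suc k) (?x j)) / sqrt n)" "\<lambda>k. cb k (h k) \<omega>", OF B C]
      have "\<bar>x + y + z\<bar> \<le> x' + y' + z'" if "\<bar>x\<bar> \<le> x'" "\<bar>y\<bar> \<le> y'" "\<bar>z\<bar> \<le> z'" for x y z x' y' z' :: real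
        using that by linarith
      from this[OF A S E] show ?thesis unfolding dec \<Xi>_def .
    qed
    then show ?thesis unfolding r_def by simp
  qed
  have C0: "0 \<le> chain_const v" using v by (simp add: chain_const_def Let_def)
  have "expectation \<Xi> = (\<Sum>j=1..n. expectation (\<lambda>\<omega>. \<bar>a j \<omega> - g K (a j \<omega>)\<bar>)) / sqrt n
    + (\<Sum>k\<in>{K..<L}. expectation (cb (Suc k) (g (Suc k))) + expectation (cb k (h k)))
    + expectation (cb L (\<lambda>x. \<bar>g L x\<bar>))"
  proof -
    have iA: "integrable M (\<lambda>\<omega>. \<bar>a j \<omega> - g K (a j \<omega>)\<bar>)" if "j \<in> {1..n}" for j
      using TM(4)[OF that] by (rule integrable_abs)
    have iB: "integrable M (\<lambda>\<omega>. cb (Suc k) (g (Suc k)) \<omega> + cb k (h k) \<omega>)" if "k \<in> {K..<L}" for k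
      using intD[OF that] by (rule Bochner_Integration.integrable_add)
    have 1: "expectation \<Xi> = expectation (\<lambda>\<omega>. (\<Sum>j=1..n. \<bar>a j \<omega> - g K (a j \<omega>)\<bar>) / sqrt n)
      + expectation (\<lambda>\<omega>. \<Sum>k\<in>{K..<L}. cb (Suc k) (g (Suc k)) \<omega> + cb k (h k) \<omega>)
      + expectation (cb L (\<lambda>x. \<bar>g L x\<bar>))"
    proof -
      have add: "expectation (\<lambda>\<omega>. x \<omega> + y \<omega> + z \<omega>) = expectation x + expectation y + expectation z"
        if "integrable M x" "integrable M y" "integrable M z" for x y z :: "'a \<Rightarrow> real"
        using that by simp
      show ?thesis unfolding \<Xi>_def[abs_def]
        using T iA iB by (intro add integrable_divide_zero Bochner_Integration.integrable_sum) blast+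
    qed
    have 2: "expectation (\<lambda>\<omega>. \<Sum>k\<in>{K..<L}. cb (Suc k) (g (Suc k)) \<omega> + cb k (h k) \<omega>)
      = (\<Sum>k\<in>{K..<L}. expectation (cb (Suc k) (g (Suc k))) + expectation (cb k (h k)))"
      using iB intD by (subst Bochner_Integration.integral_sum) (auto intro!: sum.cong)
    have 3: "expectation (\<lambda>\<omega>. (\<Sum>j=1..n. \<bar>a j \<omega> - g K (a j \<omega>)\<bar>) / sqrt n)
      = (\<Sum>j=1..n. expectation (\<lambda>\<omega>. \<bar>a j \<omega> - g K (a j \<omega>)\<bar>)) / sqrt n"
      using iA by (simp add: Bochner_Integration.integral_sum)
    show ?thesis unfolding 1 2 3 ..
  qed
  also have "\<dots> \<le> 2 ^ K * \<delta> + (\<Sum>k\<in>{K..<L}. chain_const v * (\<rho> ^ Suc k + 1 / 2 ^ Suc k) + chain_const v * (\<rho> ^ k + 1 / 2 ^ k))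
    + chain_const v * (\<rho> ^ L + 1 / 2 ^ L)"
  proof (intro add_mono sum_mono)
    have "(\<Sum>j=1..n. expectation (\<lambda>\<omega>. \<bar>a j \<omega> - g K (a j \<omega>)\<bar>)) \<le> (\<Sum>j=1..n. \<delta> / \<tau> K)"
    proof (rule sum_mono)
      fix j assume j: "j \<in> {1..n}"
      show "expectation (\<lambda>\<omega>. \<bar>a j \<omega> - g K (a j \<omega>)\<bar>) \<le> \<delta> / \<tau> K"
        using TM(1)[OF j, of K] tail[OF j] \<tau>(1)[of K] unfolding \<tau>_def
        by (meson divide_right_mono less_imp_le order_trans)
    qed
    then have "(\<Sum>j=1..n. expectation (\<lambda>\<omega>. \<bar>a j \<omega> - g K (a j \<omega>)\<bar>)) / sqrt n \<le> (n * (\<delta> / \<tau> K)) / sqrt n"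
      by (intro divide_right_mono) auto
    also have "\<dots> = 2 ^ K * \<delta>" using n by (simp add: \<tau>_def field_simps)
    finally show "(\<Sum>j=1..n. expectation (\<lambda>\<omega>. \<bar>a j \<omega> - g K (a j \<omega>)\<bar>)) / sqrt n \<le> 2 ^ K * \<delta>" .
  qed (use D R T in auto)
  also have "\<dots> \<le> 2 ^ K * \<delta> + 2 * chain_const v * (\<rho> ^ K / (1 - \<rho>) + 2 / 2 ^ K)"
  proof -
    define w where "w k = \<rho> ^ k + 1 / 2 ^ k" for k
    have w0: "0 \<le> w k" for k using \<rho> by (simp add: w_def)
    have geo: "(\<Sum>k\<in>{K..L}. w k) \<le> \<rho> ^ K / (1 - \<rho>) + 2 / 2 ^ K"
    proof -
      have "(\<Sum>k\<in>{K..L}. x ^ k) \<le> x ^ K / (1 - x)" if "0 < x" "x < 1" for x :: real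
        using that KL sum_gp[of x K L] by (simp add: divide_right_mono)
      from this[of \<rho>] this[of "1/2"] show ?thesis
        using \<rho> by (simp add: w_def sum.distrib power_one_over)
    qed
    \<comment> \<open>Each level occurs at most twice: as the target of a tag refinement, and as the
      level of a truncation step or of the remainder.\<close>
    have "(\<Sum>k\<in>{K..<L}. w (Suc k) + w k) + w L \<le> 2 * (\<Sum>k\<in>{K..L}. w k)"
    proof -
      have "(\<Sum>k\<in>{K..<L}. w (Suc k)) = (\<Sum>k\<in>{Suc K..L}. w k)"
        using sum.shift_bounds_Suc_ivl[of w K L] by (simp add: atLeastLessThanSuc_atLeastAtMost)
      also have "\<dots> \<le> (\<Sum>k\<in>{K..L}. w k)" using w0 by (intro sum_mono2) auto
      finally have "(\<Sum>k\<in>{K..<L}. w (Suc k)) \<le> (\<Sum>k\<in>{K..L}. w k)" .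
      moreover have "(\<Sum>k\<in>{K..<L}. w k) + w L = (\<Sum>k\<in>{K..L}. w k)"
        using KL by (simp add: sum.last_plus)
      ultimately show ?thesis by (simp add: sum.distrib)
    qed
    then have "(\<Sum>k\<in>{K..<L}. w (Suc k) + w k) + w L \<le> 2 * (\<rho> ^ K / (1 - \<rho>) + 2 / 2 ^ K)"
      using mult_left_mono[OF geo, of 2] by (meson order_trans zero_le_numeral)
    then have "chain_const v * ((\<Sum>k\<in>{K..<L}. w (Suc k) + w k) + w L)
        \<le> chain_const v * (2 * (\<rho> ^ K / (1 - \<rho>) + 2 / 2 ^ K))"
      using C0 by (rule mult_left_mono)
    moreover have "chain_const v * ((\<Sum>k\<in>{K..<L}. w (Suc k) + w k) + w L)
        = (\<Sum>k\<in>{K..<L}. chain_const v * w (Suc k) + chain_const v * w k) + chain_const v * w L"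
      by (simp only: distrib_left sum_distrib_left)
    moreover have "chain_const v * (2 * x) = 2 * chain_const v * x" for x by simp
    ultimately show ?thesis by (simp only: w_def)
  qed
  finally show ?thesis unfolding \<rho>_def using int\<Xi> \<Xi>0 maj by blast
qed

end

section \<open>Outer expectations and Lipschitz test functions\<close>

lemma ereal_expectation_real:
  assumes "integrable M V"
  shows "ereal_expectation M (\<lambda>\<omega>. ereal (V \<omega>)) = ereal (\<integral>\<omega>. V \<omega> \<partial>M)"
    and "ereal_expectation_exists M (\<lambda>\<omega>. ereal (V \<omega>))"
proof -
  have fin: "(\<integral>\<^sup>+\<omega>. ennreal (V \<omega>) \<partial>M) < \<infinity>" "(\<integral>\<^sup>+\<omega>. ennreal (- V \<omega>) \<partial>M) < \<infinity>"
    using assms by (auto simp: real_integrable_def top.not_eq_extremum)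
  then have "enn2ereal (\<integral>\<^sup>+\<omega>. ennreal (V \<omega>) \<partial>M) = ereal (enn2real (\<integral>\<^sup>+\<omega>. ennreal (V \<omega>) \<partial>M))"
    "enn2ereal (\<integral>\<^sup>+\<omega>. ennreal (- V \<omega>) \<partial>M) = ereal (enn2real (\<integral>\<^sup>+\<omega>. ennreal (- V \<omega>) \<partial>M))"
    by (metis enn2ereal_ennreal enn2real_nonneg ennreal_enn2real infinity_ennreal_def)+
  then show "ereal_expectation M (\<lambda>\<omega>. ereal (V \<omega>)) = ereal (\<integral>\<omega>. V \<omega> \<partial>M)"
    by (simp add: ereal_expectation_def real_lebesgue_integral_def[OF assms])
  show "ereal_expectation_exists M (\<lambda>\<omega>. ereal (V \<omega>))"
    using fin by (simp add: ereal_expectation_exists_def)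
qed

lemma ereal_expectation_mono:
  assumes "\<And>\<omega>. \<omega> \<in> space M \<Longrightarrow> V \<omega> \<le> U \<omega>"
  shows "ereal_expectation M V \<le> ereal_expectation M U"
  unfolding ereal_expectation_def
proof (rule ereal_minus_mono)
  show "enn2ereal (\<integral>\<^sup>+\<omega>. e2ennreal (V \<omega>) \<partial>M) \<le> enn2ereal (\<integral>\<^sup>+\<omega>. e2ennreal (U \<omega>) \<partial>M)"
    unfolding less_eq_ennreal.rep_eq[symmetric] using assms by (intro nn_integral_mono e2ennreal_mono)
  show "enn2ereal (\<integral>\<^sup>+\<omega>. e2ennreal (- U \<omega>) \<partial>M) \<le> enn2ereal (\<integral>\<^sup>+\<omega>. e2ennreal (- V \<omega>) \<partial>M)"
    unfolding less_eq_ennreal.rep_eq[symmetric] using assms by (intro nn_integral_mono e2ennreal_mono) auto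
qed

lemma outer_expectation_mono:
  assumes "\<And>\<omega>. \<omega> \<in> space M \<Longrightarrow> S \<omega> \<le> T \<omega>"
  shows "outer_expectation M S \<le> outer_expectation M T"
  unfolding outer_expectation_def
proof (intro Inf_superset_mono Collect_mono impI)
  fix x assume "\<exists>U. x = ereal_expectation M U \<and> U \<in> borel_measurable M \<and>
    ereal_expectation_exists M U \<and> (\<forall>\<omega>\<in>space M. ereal (T \<omega>) \<le> U \<omega>)"
  then show "\<exists>U. x = ereal_expectation M U \<and> U \<in> borel_measurable M \<and>
    ereal_expectation_exists M U \<and> (\<forall>\<omega>\<in>space M. ereal (S \<omega>) \<le> U \<omega>)"
    using assms by (metis ereal_less_eq(3) order_trans)
qed

lemma outer_expectation_le:
  assumes "integrable M U" "\<And>\<omega>. \<omega> \<in> space M \<Longrightarrow> T \<omega> \<le> U \<omega>"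
  shows "outer_expectation M T \<le> ereal (\<integral>\<omega>. U \<omega> \<partial>M)"
  unfolding outer_expectation_def
  using assms ereal_expectation_real[OF assms(1)]
  by (intro Inf_lower CollectI exI[of _ "\<lambda>\<omega>. ereal (U \<omega>)"]) auto

lemma outer_expectation_ge:
  assumes "integrable M V" "\<And>\<omega>. \<omega> \<in> space M \<Longrightarrow> V \<omega> \<le> T \<omega>"
  shows "ereal (\<integral>\<omega>. V \<omega> \<partial>M) \<le> outer_expectation M T"
  unfolding outer_expectation_def ereal_expectation_real(1)[OF assms(1), symmetric]
proof (rule Inf_greatest, clarify)
  fix U assume "\<forall>\<omega>\<in>space M. ereal (T \<omega>) \<le> U \<omega>"
  then show "ereal_expectation M (\<lambda>\<omega>. ereal (V \<omega>)) \<le> ereal_expectation M U"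
    using assms(2) by (intro ereal_expectation_mono) (meson ereal_less_eq(3) order_trans)
qed

text \<open>The function \<open>T\<close> need not be measurable; it is enclosed between
  \<open>Y - R\<close> and \<open>Y + R\<close>. The enclosure can fail only on a null set, which
  also takes up the points where \<open>R\<close> is infinite; there - B and B serve as bounds,
  without effect on the expectations.\<close>

lemma (in prob_space) outer_expectation_approx:
  fixes T Y :: "'a \<Rightarrow> real"
  assumes T: "\<And>\<omega>. \<omega> \<in> space M \<Longrightarrow> \<bar>T \<omega>\<bar> \<le> B"
    and Y: "Y \<in> borel_measurable M" "\<And>\<omega>. \<omega> \<in> space M \<Longrightarrow> \<bar>Y \<omega>\<bar> \<le> B"
    and R: "R \<in> borel_measurable M" "(\<integral>\<^sup>+\<omega>. R \<omega> \<partial>M) \<le> ennreal r" "0 \<le> r"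
    and TY: "AE \<omega> in M. ennreal \<bar>T \<omega> - Y \<omega>\<bar> \<le> R \<omega>"
  shows "ereal (expectation Y - r) \<le> outer_expectation M T"
    and "outer_expectation M T \<le> ereal (expectation Y + r)"
proof -
  have "(\<integral>\<^sup>+\<omega>. R \<omega> \<partial>M) \<noteq> \<infinity>" using R(2) by (auto simp: top_unique)
  then have "AE \<omega> in M. R \<omega> \<noteq> \<infinity>" using R(1) by (rule nn_integral_PInf_AE[rotated])
  with TY have "AE \<omega> in M. ennreal \<bar>T \<omega> - Y \<omega>\<bar> \<le> R \<omega> \<and> R \<omega> \<noteq> \<infinity>" by eventually_elim auto
  then obtain N where N: "{\<omega>\<in>space M. \<not> (ennreal \<bar>T \<omega> - Y \<omega>\<bar> \<le> R \<omega> \<and> R \<omega> \<noteq> \<infinity>)} \<subseteq> N"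
    "emeasure M N = 0" "N \<in> sets M" by (rule AE_E)
  note [measurable] = Y(1) R(1) N(3)
  have ok: "\<bar>T \<omega> - Y \<omega>\<bar> \<le> enn2real (R \<omega>)" if "\<omega> \<in> space M" "\<omega> \<notin> N" for \<omega>
  proof -
    have "ennreal \<bar>T \<omega> - Y \<omega>\<bar> \<le> R \<omega>" "R \<omega> < \<infinity>" using N that by (auto simp: top.not_eq_extremum)
    then show ?thesis by (metis abs_ge_zero enn2real_ennreal enn2real_mono infinity_ennreal_def)
  qed
  have AEN: "AE \<omega> in M. \<omega> \<notin> N" using N by (intro AE_not_in) auto
  have Ri: "integrable M (\<lambda>\<omega>. enn2real (R \<omega>))" "expectation (\<lambda>\<omega>. enn2real (R \<omega>)) \<le> r"
  proof -
    have "(\<integral>\<^sup>+\<omega>. ennreal (enn2real (R \<omega>)) \<partial>M) \<le> (\<integral>\<^sup>+\<omega>. R \<omega> \<partial>M)"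
      by (intro nn_integral_mono) (simp add: ennreal_enn2real_if)
    also have "\<dots> \<le> ennreal r" by (rule R)
    finally have *: "(\<integral>\<^sup>+\<omega>. ennreal (enn2real (R \<omega>)) \<partial>M) \<le> ennreal r" .
    then show 1: "integrable M (\<lambda>\<omega>. enn2real (R \<omega>))"
      by (intro integrableI_nonneg) (auto simp: top_unique intro: order.strict_trans1)
    show "expectation (\<lambda>\<omega>. enn2real (R \<omega>)) \<le> r"
      using * R(3) by (subst (asm) nn_integral_eq_integral[OF 1]) auto
  qed
  have Yi: "integrable M Y" using Y by (intro integrable_const_bound[of _ B]) auto
  define U where "U \<omega> = (if \<omega> \<in> N then B else Y \<omega> + enn2real (R \<omega>))" for \<omega>
  define V where "V \<omega> = (if \<omega> \<in> N then - B else Y \<omega> - enn2real (R \<omega>))" for \<omega>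
  have AEU: "AE \<omega> in M. Y \<omega> + enn2real (R \<omega>) = U \<omega>" "AE \<omega> in M. Y \<omega> - enn2real (R \<omega>) = V \<omega>"
    using AEN by (auto simp: U_def V_def)
  have [measurable]: "U \<in> borel_measurable M" "V \<in> borel_measurable M"
    unfolding U_def V_def by measurable
  have U: "integrable M U" "expectation U = expectation Y + expectation (\<lambda>\<omega>. enn2real (R \<omega>))"
    using Yi Ri AEU(1) integrable_cong_AE[OF _ _ AEU(1)] integral_cong_AE[OF _ _ AEU(1)] by auto
  have V: "integrable M V" "expectation V = expectation Y - expectation (\<lambda>\<omega>. enn2real (R \<omega>))"
    using Yi Ri AEU(2) integrable_cong_AE[OF _ _ AEU(2)] integral_cong_AE[OF _ _ AEU(2)] by auto
  have "V \<omega> \<le> T \<omega> \<and> T \<omega> \<le> U \<omega>" if "\<omega> \<in> space M" for \<omega>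
    using ok[OF that] T[OF that] by (auto simp: U_def V_def)
  then have UV: "\<And>\<omega>. \<omega> \<in> space M \<Longrightarrow> V \<omega> \<le> T \<omega>" "\<And>\<omega>. \<omega> \<in> space M \<Longrightarrow> T \<omega> \<le> U \<omega>" by auto
  have "ereal (expectation Y - r) \<le> ereal (expectation V)" using V Ri by simp
  also have "\<dots> \<le> outer_expectation M T" by (rule outer_expectation_ge[OF V(1) UV(1)])
  finally show "ereal (expectation Y - r) \<le> outer_expectation M T" .
  have "outer_expectation M T \<le> ereal (expectation U)" by (rule outer_expectation_le[OF U(1) UV(2)])
  also have "\<dots> \<le> ereal (expectation Y + r)" using U Ri by simp
  finally show "outer_expectation M T \<le> ereal (expectation Y + r)" .
qed

section \<open>Borel measurability and Lipschitz test functions\<close>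

lemma separable_borel_valued_in_mspace:
  "separable_borel_valued P E Z \<Longrightarrow> \<omega> \<in> space P \<Longrightarrow> Z \<omega> \<in> mspace E"
  unfolding separable_borel_valued_def by auto

lemma topology_borel_open:
  assumes "openin X U" shows "U \<in> sets (topology_borel X)"
  unfolding topology_borel_def using assms
  by (subst sets_measure_of) (auto dest: openin_subset)

lemma separable_borel_valued_measurable:
  assumes Z: "separable_borel_valued P E Z" and h: "continuous_map (mtopology_of E) euclideanreal h"
  shows "(\<lambda>\<omega>. h (Z \<omega>)) \<in> borel_measurable P"
proof (rule borel_measurableI)
  fix S :: "real set" assume S: "open S"
  let ?X = "subtopology (mtopology_of E) (Z ` space P)"
  have "openin ?X {x \<in> topspace ?X. h x \<in> S}"
    by (rule openin_continuous_map_preimage[OF continuous_map_from_subtopology[OF h]]) (use S in simp)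
  from topology_borel_open[OF this] have "Z -` {x \<in> topspace ?X. h x \<in> S} \<inter> space P \<in> sets P"
    using Z unfolding separable_borel_valued_def by (intro measurable_sets[of Z P]) auto
  also have "Z -` {x \<in> topspace ?X. h x \<in> S} \<inter> space P = (\<lambda>\<omega>. h (Z \<omega>)) -` S \<inter> space P"
    using separable_borel_valued_in_mspace[OF Z] by auto
  finally show "(\<lambda>\<omega>. h (Z \<omega>)) -` S \<inter> space P \<in> sets P" .
qed

lemma lipschitz_continuous_map:
  assumes "\<And>x y. x \<in> mspace E \<Longrightarrow> y \<in> mspace E \<Longrightarrow> \<bar>h x - h y\<bar> \<le> L * mdist E x y"
  shows "continuous_map (mtopology_of E) euclideanreal h"
proof -
  have "Lipschitz_continuous_map E euclidean_metric h"
    unfolding Lipschitz_continuous_map_def using assms by (auto simp: dist_real_def)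
  from Lipschitz_continuous_imp_continuous_map[OF this] show ?thesis by simp
qed

text \<open>The Lipschitz functions \<open>lip_lower E h m\<close> increase to \<open>h\<close> if \<open>h\<close> is continuous and bounded below.\<close>

definition lip_lower :: "'e metric \<Rightarrow> ('e \<Rightarrow> real) \<Rightarrow> nat \<Rightarrow> 'e \<Rightarrow> real" where
  "lip_lower E h m x = (INF y\<in>mspace E. h y + m * mdist E x y)"

lemma lip_lower:
  assumes h: "continuous_map (mtopology_of E) euclideanreal h"
    and B: "\<forall>x\<in>mspace E. \<bar>h x\<bar> \<le> B"
  shows "x \<in> mspace E \<Longrightarrow> lip_lower E h m x \<le> h x"
    and "x \<in> mspace E \<Longrightarrow> - B \<le> lip_lower E h m x"
    and "x \<in> mspace E \<Longrightarrow> y \<in> mspace E \<Longrightarrow> \<bar>lip_lower E h m x - lip_lower E h m y\<bar> \<le> m * mdist E x y"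
    and "x \<in> mspace E \<Longrightarrow> (\<lambda>m. lip_lower E h m x) \<longlonglongrightarrow> h x"
proof -
  have bdd: "bdd_below ((\<lambda>y. h y + real m * mdist E x y) ` mspace E)" for x and m :: nat
  proof (rule bdd_belowI2[of _ "- B"])
    fix y assume "y \<in> mspace E"
    then have "- B \<le> h y" using B by (auto simp: abs_le_iff)
    moreover have "0 \<le> real m * mdist E x y" by simp
    ultimately show "- B \<le> h y + real m * mdist E x y" by linarith
  qed
  have le: "lip_lower E h m x \<le> h y + m * mdist E x y" if "y \<in> mspace E" for x y m
    unfolding lip_lower_def by (rule cINF_lower[OF bdd that])
  show *: "lip_lower E h m x \<le> h x" if "x \<in> mspace E" for x m
    using le[OF that, of m x] mdist_zero[OF that that] by simp
  show lower: "- B \<le> lip_lower E h m x" if "x \<in> mspace E" for x m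
    unfolding lip_lower_def
  proof (rule cINF_greatest)
    fix y assume "y \<in> mspace E"
    then have "- B \<le> h y" using B by (auto simp: abs_le_iff)
    moreover have "0 \<le> real m * mdist E x y" by simp
    ultimately show "- B \<le> h y + real m * mdist E x y" by linarith
  qed (use that in auto)
  have lip: "lip_lower E h m x \<le> lip_lower E h m y + m * mdist E x y"
    if x: "x \<in> mspace E" and y: "y \<in> mspace E" for x y m
  proof -
    have "lip_lower E h m x - m * mdist E x y \<le> lip_lower E h m y"
      unfolding lip_lower_def[of E h m y]
    proof (rule cINF_greatest)
      fix z assume z: "z \<in> mspace E"
      have "m * mdist E x z \<le> m * (mdist E x y + mdist E y z)"
        using mdist_triangle[OF x y z] by (intro mult_left_mono) auto
      then show "lip_lower E h m x - m * mdist E x y \<le> h z + m * mdist E y z"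
        using le[OF z, of m x] by (simp add: distrib_left)
    qed (use y in auto)
    then show ?thesis by linarith
  qed
  show "\<bar>lip_lower E h m x - lip_lower E h m y\<bar> \<le> m * mdist E x y" if "x \<in> mspace E" "y \<in> mspace E" for x y m
    using lip[OF that, of m] lip[OF that(2,1), of m] by (simp add: mdist_commute abs_le_iff)
  show "(\<lambda>m. lip_lower E h m x) \<longlonglongrightarrow> h x" if x: "x \<in> mspace E" for x
  proof (rule LIMSEQ_I)
    fix e :: real assume e: "0 < e"
    interpret Metric_space "mspace E" "mdist E" by simp
    have "openin (mtopology_of E) {y \<in> topspace (mtopology_of E). h y \<in> {h x - e / 2<..}}"
      using h by (rule openin_continuous_map_preimage) (simp add: open_openin[symmetric])
    then obtain \<delta> where d: "0 < \<delta>" "mball x \<delta> \<subseteq> {y \<in> mspace E. h x - e / 2 < h y}"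
      using x e unfolding mtopology_of_def openin_mtopology by auto
    \<comment> \<open>Outside the ball of radius \<delta> the penalty m * \<delta> has to exceed the
      oscillation 2 * B of h; inside it the continuity of h is enough.\<close>
    obtain m0 :: nat where m0: "2 * B / \<delta> < m0" using reals_Archimedean2 by blast
    show "\<exists>m0. \<forall>m\<ge>m0. norm (lip_lower E h m x - h x) < e"
    proof (intro exI allI impI)
      fix m assume m: "m0 \<le> m"
      have "h x - e / 2 \<le> lip_lower E h m x" unfolding lip_lower_def
      proof (rule cINF_greatest)
        fix y assume y: "y \<in> mspace E"
        show "h x - e / 2 \<le> h y + m * mdist E x y"
        proof (cases "mdist E x y < \<delta>")
          case True
          then have "h x - e / 2 < h y" using d x y by (auto simp: mball_def)
          moreover have "0 \<le> real m * mdist E x y" by simp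
          ultimately show ?thesis by linarith
        next
          case False
          have "2 * B < m0 * \<delta>" using m0 d by (simp add: field_simps)
          also have "\<dots> \<le> m * mdist E x y" using m False d by (intro mult_mono) auto
          finally show ?thesis using bspec[OF B x] bspec[OF B y] e by linarith
        qed
      qed (use x in auto)
      then show "norm (lip_lower E h m x - h x) < e" using *[OF x, of m] e by simp
    qed
  qed
qed

lemma lip_lower_expectation:
  assumes P: "prob_space P" and Z: "separable_borel_valued P E Z"
    and h: "continuous_map (mtopology_of E) euclideanreal h"
    and B: "\<forall>x\<in>mspace E. \<bar>h x\<bar> \<le> B"
  shows "(\<lambda>m. \<integral>\<omega>. lip_lower E h m (Z \<omega>) \<partial>P) \<longlonglongrightarrow> (\<integral>\<omega>. h (Z \<omega>) \<partial>P)"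
proof -
  interpret prob_space P by fact
  note L = lip_lower[OF h B]
  have Zm: "Z \<omega> \<in> mspace E" if "\<omega> \<in> space P" for \<omega> using separable_borel_valued_in_mspace[OF Z that] .
  show ?thesis
  proof (rule integral_dominated_convergence[where w = "\<lambda>_. B"])
    show "(\<lambda>\<omega>. h (Z \<omega>)) \<in> borel_measurable P" by (rule separable_borel_valued_measurable[OF Z h])
    show "(\<lambda>\<omega>. lip_lower E h m (Z \<omega>)) \<in> borel_measurable P" for m
      by (rule separable_borel_valued_measurable[OF Z lipschitz_continuous_map[OF L(3)]]) auto
    show "AE \<omega> in P. (\<lambda>m. lip_lower E h m (Z \<omega>)) \<longlonglongrightarrow> h (Z \<omega>)"
      using L(4) Zm by auto
    show "AE \<omega> in P. norm (lip_lower E h m (Z \<omega>)) \<le> B" for m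
    proof (rule AE_I2)
      fix \<omega> assume "\<omega> \<in> space P"
      then show "norm (lip_lower E h m (Z \<omega>)) \<le> B"
        using L(1,2)[OF Zm, of \<omega> m] bspec[OF B Zm, of \<omega>] by (simp add: abs_le_iff)
    qed
  qed simp
qed

text \<open>Outer expectations are monotone but not linear, so h is bracketed from both sides: by
  \<open>lip_lower\<close> of h from below and by minus \<open>lip_lower\<close> of - h from above.
  Under the limit law the expectations of both brackets tend to that of h.\<close>

lemma converges_outer_distrI_lipschitz:
  assumes P: "\<And>n. prob_space (P n)" "\<And>n. Z n ` space (P n) \<subseteq> mspace E"
    and P0: "prob_space P0" and Z0: "separable_borel_valued P0 E Z0"
    and lip: "\<And>h L B. (\<And>x y. x \<in> mspace E \<Longrightarrow> y \<in> mspace E \<Longrightarrow> \<bar>h x - h y\<bar> \<le> L * mdist E x y) \<Longrightarrow>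
      (\<And>x. x \<in> mspace E \<Longrightarrow> \<bar>h x\<bar> \<le> B) \<Longrightarrow> 0 \<le> L \<Longrightarrow>
      (\<lambda>n. outer_expectation (P n) (\<lambda>\<omega>. h (Z n \<omega>))) \<longlonglongrightarrow> ereal (\<integral>\<omega>. h (Z0 \<omega>) \<partial>P0)"
  shows "converges_outer_distr E P Z P0 Z0"
  unfolding converges_outer_distr_def
proof (intro conjI allI impI P P0 Z0)
  fix h assume "continuous_map (mtopology_of E) euclideanreal h \<and> bounded (h ` mspace E)"
  then obtain B where h: "continuous_map (mtopology_of E) euclideanreal h"
    and B: "\<forall>x\<in>mspace E. \<bar>h x\<bar> \<le> B" unfolding bounded_iff by auto
  let ?h' = "\<lambda>x. - h x"
  have h': "continuous_map (mtopology_of E) euclideanreal ?h'" using h by (rule continuous_map_minus)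
  have B': "\<forall>x\<in>mspace E. \<bar>?h' x\<bar> \<le> B" using B by simp
  note L = lip_lower[OF h B] and L' = lip_lower[OF h' B']
  have ZE: "Z n \<omega> \<in> mspace E" if "\<omega> \<in> space (P n)" for n \<omega> using P(2) that by blast
  have lo: "(\<lambda>n. outer_expectation (P n) (\<lambda>\<omega>. lip_lower E h m (Z n \<omega>)))
      \<longlonglongrightarrow> ereal (\<integral>\<omega>. lip_lower E h m (Z0 \<omega>) \<partial>P0)" for m
  proof (rule lip[where L = m and B = B])
    show "\<bar>lip_lower E h m x\<bar> \<le> B" if "x \<in> mspace E" for x
      using L(1,2)[OF that, of m] bspec[OF B that] by (simp add: abs_le_iff)
  qed (use L in simp_all)
  have up: "(\<lambda>n. outer_expectation (P n) (\<lambda>\<omega>. - lip_lower E ?h' m (Z n \<omega>)))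
      \<longlonglongrightarrow> ereal (\<integral>\<omega>. - lip_lower E ?h' m (Z0 \<omega>) \<partial>P0)" for m
  proof (rule lip[where L = m and B = B])
    show "\<bar>- lip_lower E ?h' m x - - lip_lower E ?h' m y\<bar> \<le> m * mdist E x y"
      if "x \<in> mspace E" "y \<in> mspace E" for x y using L'(3)[OF that, of m] by (simp add: abs_minus_commute)
    show "\<bar>- lip_lower E ?h' m x\<bar> \<le> B" if "x \<in> mspace E" for x
      using L'(1,2)[OF that, of m] bspec[OF B that] by (simp add: abs_le_iff)
  qed simp
  show "(\<lambda>n. outer_expectation (P n) (\<lambda>\<omega>. h (Z n \<omega>))) \<longlonglongrightarrow> ereal (\<integral>\<omega>. h (Z0 \<omega>) \<partial>P0)"
  proof (rule order_tendstoI)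
    fix a assume a: "a < ereal (\<integral>\<omega>. h (Z0 \<omega>) \<partial>P0)"
    have "(\<lambda>m. ereal (\<integral>\<omega>. lip_lower E h m (Z0 \<omega>) \<partial>P0)) \<longlonglongrightarrow> ereal (\<integral>\<omega>. h (Z0 \<omega>) \<partial>P0)"
      using lip_lower_expectation[OF P0 Z0 h B] by simp
    from order_tendstoD(1)[OF this a] obtain m where "a < ereal (\<integral>\<omega>. lip_lower E h m (Z0 \<omega>) \<partial>P0)"
      by (auto simp: eventually_sequentially)
    from order_tendstoD(1)[OF lo this]
    show "\<forall>\<^sub>F n in sequentially. a < outer_expectation (P n) (\<lambda>\<omega>. h (Z n \<omega>))"
      by eventually_elim (erule less_le_trans, intro outer_expectation_mono L(1) ZE)
  next
    fix a assume a: "ereal (\<integral>\<omega>. h (Z0 \<omega>) \<partial>P0) < a"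
    have "(\<lambda>m. - (\<integral>\<omega>. lip_lower E ?h' m (Z0 \<omega>) \<partial>P0)) \<longlonglongrightarrow> - (\<integral>\<omega>. ?h' (Z0 \<omega>) \<partial>P0)"
      by (intro tendsto_minus lip_lower_expectation[OF P0 Z0 h' B'])
    then have "(\<lambda>m. ereal (\<integral>\<omega>. - lip_lower E ?h' m (Z0 \<omega>) \<partial>P0)) \<longlonglongrightarrow> ereal (\<integral>\<omega>. h (Z0 \<omega>) \<partial>P0)"
      by simp
    from order_tendstoD(2)[OF this a] obtain m where "ereal (\<integral>\<omega>. - lip_lower E ?h' m (Z0 \<omega>) \<partial>P0) < a"
      by (auto simp: eventually_sequentially)
    from order_tendstoD(2)[OF up this]
    show "\<forall>\<^sub>F n in sequentially. outer_expectation (P n) (\<lambda>\<omega>. h (Z n \<omega>)) < a"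
    proof eventually_elim
      case (elim n)
      have "outer_expectation (P n) (\<lambda>\<omega>. h (Z n \<omega>)) \<le> outer_expectation (P n) (\<lambda>\<omega>. - lip_lower E ?h' m (Z n \<omega>))"
        using L'(1)[OF ZE, of _ n m] by (intro outer_expectation_mono) (simp add: le_minus_iff)
      then show ?case using elim by (rule le_less_trans)
    qed
  qed
qed

text \<open>Preimages of an open set under the limit are obtained by exhausting the open set from
  inside. A countable set that approximates every \<open>Zk\<close> also approximates the limit, and
  its closure is the separable set required.\<close>

lemma separable_borel_valued_limit:
  fixes E :: "'e metric" and Zk :: "nat \<Rightarrow> 'b \<Rightarrow> 'e"
  assumes Z: "\<And>\<omega>. \<omega> \<in> space P \<Longrightarrow> Z \<omega> \<in> mspace E"
    and Zk: "\<And>k \<omega>. \<omega> \<in> space P \<Longrightarrow> Zk k \<omega> \<in> mspace E"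
    and meas: "\<And>k U. openin (mtopology_of E) U \<Longrightarrow> Zk k -` U \<inter> space P \<in> sets P"
    and lim: "\<And>\<omega>. \<omega> \<in> space P \<Longrightarrow> (\<lambda>k. mdist E (Zk k \<omega>) (Z \<omega>)) \<longlonglongrightarrow> 0"
    and C: "countable C" "C \<subseteq> mspace E"
    and dense: "\<And>k \<omega> e. \<omega> \<in> space P \<Longrightarrow> 0 < e \<Longrightarrow> \<exists>c\<in>C. mdist E (Zk k \<omega>) c < e"
  shows "separable_borel_valued P E Z"
proof -
  interpret Metric_space "mspace E" "mdist E" by simp
  have top: "mtopology_of E = mtopology" by (simp add: mtopology_of_def)
  have near: "\<exists>c\<in>C. mdist E (Z \<omega>) c < e" if w: "\<omega> \<in> space P" and e: "0 < e" for \<omega> e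
  proof -
    have "\<forall>\<^sub>F k in sequentially. mdist E (Zk k \<omega>) (Z \<omega>) < e / 2"
      by (rule order_tendstoD(2)[OF lim[OF w]]) (use e in simp)
    then obtain k where k: "mdist E (Zk k \<omega>) (Z \<omega>) < e / 2" by (auto simp: eventually_sequentially)
    obtain c where c: "c \<in> C" "mdist E (Zk k \<omega>) c < e / 2" using dense[OF w, of "e / 2" k] e by auto
    have "mdist E (Z \<omega>) c \<le> mdist E (Z \<omega>) (Zk k \<omega>) + mdist E (Zk k \<omega>) c"
      using Z[OF w] Zk[OF w] C c by (intro triangle) auto
    then show ?thesis using k c commute[of "Z \<omega>" "Zk k \<omega>"] by (intro bexI[of _ c]) auto
  qed
  let ?S = "mtopology closure_of C"
  have "separable_space (subtopology mtopology ?S)"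
    unfolding separable_space_def
  proof (intro exI[of _ C] conjI)
    have CS: "C \<subseteq> ?S" using C by (simp add: closure_of_subset)
    then show "C \<subseteq> topspace (subtopology mtopology ?S)" using C by auto
    show "subtopology mtopology ?S closure_of C = topspace (subtopology mtopology ?S)"
      using CS closure_of_subset_topspace[of mtopology C]
      by (simp add: closure_of_subtopology inf.absorb2 inf.absorb_iff2)
  qed (rule C)
  moreover have "Z ` space P \<subseteq> ?S"
  proof (intro image_subsetI)
    fix \<omega> assume w: "\<omega> \<in> space P"
    show "Z \<omega> \<in> ?S" unfolding metric_closure_of using Z[OF w] near[OF w] C
      by (auto simp: mball_def)
  qed
  moreover have "?S \<subseteq> mspace E" using closure_of_subset_topspace[of mtopology C] by simp
  moreover have "Z \<in> measurable P (topology_borel (subtopology mtopology (Z ` space P)))"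
    unfolding topology_borel_def
  proof (rule measurable_sigma_sets)
    let ?X = "subtopology mtopology (Z ` space P)"
    show sub: "{U. openin ?X U} \<subseteq> Pow (topspace ?X)" using openin_subset by blast
    show "sets (sigma (topspace ?X) {U. openin ?X U}) = sigma_sets (topspace ?X) {U. openin ?X U}"
      using sub by (rule sets_measure_of)
    show "Z \<in> space P \<rightarrow> topspace ?X" using Z by auto
    fix V assume "V \<in> {U. openin ?X U}"
    then obtain U where U: "openin mtopology U" "V = U \<inter> Z ` space P" by (auto simp: openin_subtopology)
    \<comment> \<open>Points of U with a margin above 1 / Suc m. The strict inequality keeps
      \<open>U' m\<close> open, and the margin prevents limits of its points from leaving U: Z lies
      in U iff for some m all late \<open>Zk\<close> lie in \<open>U' m\<close>.\<close>
    define U' where "U' m = {x \<in> mspace E. \<exists>s>1 / Suc m. mball x s \<subseteq> U}" for m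
    have U': "openin mtopology (U' m)" for m
      unfolding openin_mtopology
    proof (intro conjI allI impI)
      fix x assume "x \<in> U' m"
      then obtain s where s: "x \<in> mspace E" "1 / Suc m < s" "mball x s \<subseteq> U" by (auto simp: U'_def)
      have "mball x (s - 1 / Suc m) \<subseteq> U' m"
      proof
        fix y assume y: "y \<in> mball x (s - 1 / Suc m)"
        have "mball y (s - mdist E x y) \<subseteq> mball x s" using y s
          by (intro mball_subset) (auto simp: commute)
        then show "y \<in> U' m" using y s unfolding U'_def
          by (auto intro!: exI[of _ "s - mdist E x y"])
      qed
      then show "\<exists>r>0. mball x r \<subseteq> U' m" using s by (intro exI[of _ "s - 1 / Suc m"]) auto
    qed (auto simp: U'_def)
    have "Z -` V \<inter> space P = (\<Union>m. \<Union>K. \<Inter>k\<in>{K..}. (Zk k -` U' m \<inter> space P))"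
    proof (intro set_eqI iffI)
      fix \<omega> assume "\<omega> \<in> Z -` V \<inter> space P"
      then have w: "\<omega> \<in> space P" "Z \<omega> \<in> U" using U by auto
      then obtain r where r: "0 < r" "mball (Z \<omega>) r \<subseteq> U" using U unfolding openin_mtopology by auto
      obtain m where m: "1 / Suc m < r / 2" using nat_approx_posE[of "r / 2"] r by auto
      have "\<forall>\<^sub>F k in sequentially. mdist E (Zk k \<omega>) (Z \<omega>) < r / 2"
        by (rule order_tendstoD(2)[OF lim[OF w(1)]]) (use r in simp)
      then obtain K where K: "\<And>k. K \<le> k \<Longrightarrow> mdist E (Zk k \<omega>) (Z \<omega>) < r / 2"
        by (auto simp: eventually_sequentially)
      have "Zk k \<omega> \<in> U' m" if "K \<le> k" for k
      proof -
        have "mball (Zk k \<omega>) (r / 2) \<subseteq> mball (Z \<omega>) r"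
          using K[OF that] Z[OF w(1)] Zk[OF w(1)] by (intro mball_subset) auto
        then show ?thesis using r m Zk[OF w(1)] unfolding U'_def by (auto intro!: exI[of _ "r / 2"])
      qed
      then show "\<omega> \<in> (\<Union>m. \<Union>K. \<Inter>k\<in>{K..}. (Zk k -` U' m \<inter> space P))" using w by blast
    next
      fix \<omega> assume "\<omega> \<in> (\<Union>m. \<Union>K. \<Inter>k\<in>{K..}. (Zk k -` U' m \<inter> space P))"
      then obtain m K where K: "\<And>k. K \<le> k \<Longrightarrow> Zk k \<omega> \<in> U' m" and w: "\<omega> \<in> space P" by auto
      have "\<forall>\<^sub>F k in sequentially. mdist E (Zk k \<omega>) (Z \<omega>) < 1 / Suc m"
        by (rule order_tendstoD(2)[OF lim[OF w]]) simp
      then obtain K' where "\<And>k. K' \<le> k \<Longrightarrow> mdist E (Zk k \<omega>) (Z \<omega>) < 1 / Suc m"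
        by (auto simp: eventually_sequentially)
      then have *: "mdist E (Zk (max K K') \<omega>) (Z \<omega>) < 1 / Suc m" by simp
      have "Zk (max K K') \<omega> \<in> U' m" using K by simp
      then obtain s where "1 / Suc m < s" "mball (Zk (max K K') \<omega>) s \<subseteq> U" by (auto simp: U'_def)
      then have "Z \<omega> \<in> U" using * Z[OF w] Zk[OF w] by (auto simp: mball_def subset_iff)
      then show "\<omega> \<in> Z -` V \<inter> space P" using w U by auto
    qed
    also have "\<dots> \<in> sets P"
    proof -
      have A: "(\<Inter>k\<in>{K..}. (Zk k -` U' m \<inter> space P)) \<in> sets P" for m and K :: nat
        using meas[unfolded top, OF U'] by (intro sets.countable_INT') auto
      show ?thesis by (intro sets.countable_UN image_subsetI A)
    qed
    finally show "Z -` V \<inter> space P \<in> sets P" .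
  qed
  ultimately show ?thesis unfolding separable_borel_valued_def top by blast
qed

section \<open>Construction of the isonormal process\<close>

text \<open>A subsequence converges almost everywhere. Fatou's lemma along it turns the Cauchy bound
  between \<open>Y k\<close> and \<open>Y (r i)\<close> into a bound on the distance from
  \<open>Y k\<close> to the limit.\<close>

lemma (in prob_space) L1_complete:
  fixes Y :: "nat \<Rightarrow> 'a \<Rightarrow> real"
  assumes int: "\<And>n. integrable M (Y n)"
    and cau: "\<And>e. 0 < e \<Longrightarrow> \<exists>N. \<forall>i\<ge>N. \<forall>j\<ge>N. expectation (\<lambda>\<omega>. \<bar>Y i \<omega> - Y j \<omega>\<bar>) < e"
  shows "\<exists>Z. integrable M Z \<and> (\<lambda>n. expectation (\<lambda>\<omega>. \<bar>Y n \<omega> - Z \<omega>\<bar>)) \<longlonglongrightarrow> 0"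
proof -
  have "\<exists>N. \<forall>i\<ge>N. \<forall>j\<ge>N. (LINT x|M. norm (Y i x - Y j x)) < e" if "0 < e" for e
    using cau[OF that] by simp
  from cauchy_L1_AE_cauchy_subseq[OF int this] obtain r where
    r: "strict_mono r" "AE x in M. Cauchy (\<lambda>i. Y (r i) x)" by auto
  define Z where "Z x = lim (\<lambda>i. Y (r i) x)" for x
  have [measurable]: "Y n \<in> borel_measurable M" for n using int by auto
  have [measurable]: "Z \<in> borel_measurable M" unfolding Z_def by measurable
  have lim: "AE x in M. (\<lambda>i. Y (r i) x) \<longlonglongrightarrow> Z x"
    using r(2) by eventually_elim (simp add: Z_def Cauchy_convergent convergent_LIMSEQ_iff[symmetric])
  have key: "\<exists>N. \<forall>k\<ge>N. (\<integral>\<^sup>+x. ennreal \<bar>Y k x - Z x\<bar> \<partial>M) \<le> ennreal e" if e: "0 < e" for e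
  proof -
    obtain N where N: "\<And>i j. N \<le> i \<Longrightarrow> N \<le> j \<Longrightarrow> expectation (\<lambda>\<omega>. \<bar>Y i \<omega> - Y j \<omega>\<bar>) < e"
      using cau[OF e] by auto
    have "(\<integral>\<^sup>+x. ennreal \<bar>Y k x - Z x\<bar> \<partial>M) \<le> ennreal e" if k: "N \<le> k" for k
    proof -
      have "(\<integral>\<^sup>+x. ennreal \<bar>Y k x - Z x\<bar> \<partial>M) = (\<integral>\<^sup>+x. liminf (\<lambda>i. ennreal \<bar>Y k x - Y (r i) x\<bar>) \<partial>M)"
      proof (rule nn_integral_cong_AE)
        show "AE x in M. ennreal \<bar>Y k x - Z x\<bar> = liminf (\<lambda>i. ennreal \<bar>Y k x - Y (r i) x\<bar>)"
          using lim
        proof eventually_elim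
          case (elim x)
          have "(\<lambda>i. ennreal \<bar>Y k x - Y (r i) x\<bar>) \<longlonglongrightarrow> ennreal \<bar>Y k x - Z x\<bar>"
            by (intro tendsto_intros elim)
          from lim_imp_Liminf[OF _ this] show ?case by simp
        qed
      qed
      also have "\<dots> \<le> liminf (\<lambda>i. \<integral>\<^sup>+x. ennreal \<bar>Y k x - Y (r i) x\<bar> \<partial>M)"
        by (rule nn_integral_liminf) measurable
      also have "\<dots> \<le> limsup (\<lambda>i. \<integral>\<^sup>+x. ennreal \<bar>Y k x - Y (r i) x\<bar> \<partial>M)"
        by (rule Liminf_le_Limsup) simp
      also have "\<dots> \<le> ennreal e"
      proof (rule Limsup_bounded)
        show "\<forall>\<^sub>F i in sequentially. (\<integral>\<^sup>+x. ennreal \<bar>Y k x - Y (r i) x\<bar> \<partial>M) \<le> ennreal e"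
        proof (rule eventually_sequentiallyI)
          fix i assume "N \<le> i"
          then have "N \<le> r i" using seq_suble[OF r(1), of i] by linarith
          then have "expectation (\<lambda>\<omega>. \<bar>Y k \<omega> - Y (r i) \<omega>\<bar>) < e" using N k by blast
          then show "(\<integral>\<^sup>+x. ennreal \<bar>Y k x - Y (r i) x\<bar> \<partial>M) \<le> ennreal e"
            using int by (subst nn_integral_eq_integral) (auto intro!: ennreal_leI)
        qed
      qed
      finally show ?thesis .
    qed
    then show ?thesis by blast
  qed
  obtain N where N: "(\<integral>\<^sup>+x. ennreal \<bar>Y N x - Z x\<bar> \<partial>M) \<le> ennreal 1" using key[of 1] by auto
  have "integrable M (\<lambda>x. Y N x - Z x)"
  proof (rule integrableI_bounded)
    show "(\<integral>\<^sup>+x. ennreal (norm (Y N x - Z x)) \<partial>M) < \<infinity>"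
      using N by (simp add: order.strict_trans1)
  qed measurable
  from Bochner_Integration.integrable_diff[OF int[of N] this] have Zi: "integrable M Z" by simp
  moreover have "(\<lambda>n. expectation (\<lambda>\<omega>. \<bar>Y n \<omega> - Z \<omega>\<bar>)) \<longlonglongrightarrow> 0"
  proof (rule LIMSEQ_I)
    fix e :: real assume e: "0 < e"
    then obtain N where N: "\<And>k. N \<le> k \<Longrightarrow> (\<integral>\<^sup>+x. ennreal \<bar>Y k x - Z x\<bar> \<partial>M) \<le> ennreal (e / 2)"
      using key[of "e / 2"] by auto
    have "norm (expectation (\<lambda>\<omega>. \<bar>Y k \<omega> - Z \<omega>\<bar>) - 0) < e" if "N \<le> k" for k
      using N[OF that] int Zi e by (subst (asm) nn_integral_eq_integral) auto
    then show "\<exists>N. \<forall>k\<ge>N. norm (expectation (\<lambda>\<omega>. \<bar>Y k \<omega> - Z \<omega>\<bar>) - 0) < e" by blast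
  qed
  ultimately show ?thesis by blast
qed

section \<open>Centred normal laws\<close>

text \<open>
  Centred normal variables with variance \<open>v\<close>, including \<open>v = 0\<close>; characteristic functions make sums
  and limits immediate.
\<close>

definition normal0 :: "'a measure \<Rightarrow> ('a \<Rightarrow> real) \<Rightarrow> real \<Rightarrow> bool" where
  "normal0 M Z v \<longleftrightarrow> Z \<in> borel_measurable M \<and>
    (\<forall>t. char (distr M borel Z) t = complex_of_real (exp (- (t\<^sup>2 * v) / 2)))"

context prob_space
begin

lemma char_distr_eq:
  "Z \<in> borel_measurable M \<Longrightarrow> char (distr M borel Z) t = (CLINT \<omega>|M. iexp (t * Z \<omega>))"
  by (simp add: char_def integral_distr)

lemma normal0_standardize:
  assumes "normal0 M Z v" "0 < v"
  shows "distr M borel (\<lambda>\<omega>. Z \<omega> / sqrt v) = std_normal_distribution"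
proof (rule Levy_uniqueness)
  have [measurable]: "Z \<in> borel_measurable M" using assms by (simp add: normal0_def)
  show "char (distr M borel (\<lambda>\<omega>. Z \<omega> / sqrt v)) = char std_normal_distribution"
  proof
    fix t
    have "char (distr M borel (\<lambda>\<omega>. Z \<omega> / sqrt v)) t = char (distr M borel Z) (t / sqrt v)"
      by (simp add: char_distr_eq)
    also have "\<dots> = char std_normal_distribution t"
      using assms by (simp add: normal0_def char_std_normal_distribution power_divide)
    finally show "char (distr M borel (\<lambda>\<omega>. Z \<omega> / sqrt v)) t = char std_normal_distribution t" .
  qed
  show "real_distribution (distr M borel (\<lambda>\<omega>. Z \<omega> / sqrt v))" by (intro real_distribution_distr) measurable
qed (rule real_dist_normal_dist)

lemma normal0_zero:
  assumes "normal0 M Z 0" shows "AE \<omega> in M. Z \<omega> = 0"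
proof -
  have [measurable]: "Z \<in> borel_measurable M" using assms by (simp add: normal0_def)
  have "distr M borel Z = distr M borel (\<lambda>_. 0)"
  proof (rule Levy_uniqueness)
    show "char (distr M borel Z) = char (distr M borel (\<lambda>_. 0))"
    proof
      fix t
      have "char (distr M borel (\<lambda>_. 0)) t = 1" by (subst char_distr_eq) (auto simp: prob_space)
      then show "char (distr M borel Z) t = char (distr M borel (\<lambda>_. 0)) t" using assms by (simp add: normal0_def)
    qed
    show "real_distribution (distr M borel Z)" by (intro real_distribution_distr) measurable
    show "real_distribution (distr M borel (\<lambda>_. 0))" by (intro real_distribution_distr) measurable
  qed
  moreover have "AE x in distr M borel (\<lambda>_. 0 :: real). x = 0"
    by (subst AE_distr_iff) auto
  ultimately have "AE x in distr M borel Z. x = 0" by (simp only:)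
  then show ?thesis by (subst (asm) AE_distr_iff) auto
qed

lemma normal0_moments:
  assumes Z: "normal0 M Z v" and v: "0 \<le> v"
  shows normal0_integrable: "integrable M (\<lambda>\<omega>. Z \<omega> ^ k)"
    and normal0_mean: "expectation Z = 0"
    and normal0_variance: "expectation (\<lambda>\<omega>. (Z \<omega>)\<^sup>2) = v"
    and normal0_fourth: "expectation (\<lambda>\<omega>. Z \<omega> ^ 4) = 3 * v\<^sup>2"
proof -
  have [measurable]: "Z \<in> borel_measurable M" using Z by (simp add: normal0_def)
  have "integrable M (\<lambda>\<omega>. Z \<omega> ^ k) \<and> expectation Z = 0 \<and> expectation (\<lambda>\<omega>. (Z \<omega>)\<^sup>2) = v \<and>
    expectation (\<lambda>\<omega>. Z \<omega> ^ 4) = 3 * v\<^sup>2" for k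
  proof (cases "v = 0")
    case True
    then have Z0: "AE \<omega> in M. Z \<omega> = 0" using normal0_zero Z by simp
    have "AE \<omega> in M. Z \<omega> ^ k = 0 ^ k" for k using Z0 by eventually_elim simp
    then have "integrable M (\<lambda>\<omega>. Z \<omega> ^ k)" "expectation (\<lambda>\<omega>. Z \<omega> ^ k) = 0 ^ k" for k
      using integrable_cong_AE[of "\<lambda>\<omega>. Z \<omega> ^ k" M "\<lambda>_. 0 ^ k"] integral_cong_AE[of "\<lambda>\<omega>. Z \<omega> ^ k" M "\<lambda>_. 0 ^ k"]
      by (auto simp: prob_space)
    from this(1)[of k] this(2)[of 1] this(2)[of 2] this(2)[of 4] show ?thesis using True by simp
  next
    case False
    then have v: "0 < v" using v by simp
    let ?W = "\<lambda>\<omega>. Z \<omega> / sqrt v"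
    note D = normal0_standardize[OF Z v]
    have W: "integrable M (\<lambda>\<omega>. ?W \<omega> ^ k)" for k
      using integrable_std_normal_distribution_moment[of k] unfolding D[symmetric]
      by (subst (asm) integrable_distr_eq) auto
    have WE: "expectation (\<lambda>\<omega>. ?W \<omega> ^ k) = (LINT x|std_normal_distribution. x ^ k)" for k
      unfolding D[symmetric] by (subst integral_distr) auto
    have ZW: "Z \<omega> ^ k = sqrt v ^ k * ?W \<omega> ^ k" for \<omega> k
      using v by (simp add: power_divide)
    have "integrable M (\<lambda>\<omega>. Z \<omega> ^ k)" unfolding ZW using W by (rule integrable_mult_right)
    moreover have E: "expectation (\<lambda>\<omega>. Z \<omega> ^ k) = sqrt v ^ k * (LINT x|std_normal_distribution. x ^ k)" for k
      unfolding ZW WE[symmetric] by (rule integral_mult_right_zero)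
    moreover have "sqrt v ^ 4 = v\<^sup>2" using v
      by (metis abs_of_pos even_numeral numeral_times_numeral power2_eq_square power_mult
          real_sqrt_abs real_sqrt_pow2 semiring_norm(11,12) less_imp_le mult_2 numeral_Bit0)
    ultimately show ?thesis
      using E[of 1] E[of 2] E[of 4] v integral_std_normal_distribution_moment_odd[of 1]
        std_normal_distribution_even_moments(1)[of 1] std_normal_distribution_even_moments(1)[of 2]
      by (simp add: fact_numeral)
  qed
  then show "integrable M (\<lambda>\<omega>. Z \<omega> ^ k)" "expectation Z = 0" "expectation (\<lambda>\<omega>. (Z \<omega>)\<^sup>2) = v"
    "expectation (\<lambda>\<omega>. Z \<omega> ^ 4) = 3 * v\<^sup>2" by auto
qed

lemma normal0_gaussian_rv:
  assumes Z: "normal0 M Z v" and v: "0 \<le> v"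
  shows "gaussian_rv M Z"
proof -
  have [measurable]: "Z \<in> borel_measurable M" using Z by (simp add: normal0_def)
  show ?thesis
  proof (cases "v = 0")
    case True
    then show ?thesis using normal0_zero Z unfolding gaussian_rv_def by auto
  next
    case False
    then have v: "0 < sqrt v" "0 < v" using v by simp_all
    have "distr M lborel (\<lambda>\<omega>. Z \<omega> / sqrt v) = distr M borel (\<lambda>\<omega>. Z \<omega> / sqrt v)"
      by (rule distr_cong) auto
    then have "distributed M lborel (\<lambda>\<omega>. (Z \<omega> - 0) / sqrt v) std_normal_density"
      using normal0_standardize[OF Z v(2)] by (simp add: distributed_def)
    then have "distributed M lborel Z (normal_density 0 (sqrt v))"
      using normal_standard_normal_convert[OF v(1), of Z 0] by simp
    then show ?thesis unfolding gaussian_rv_def using v by auto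
  qed
qed

text \<open>The Cauchy-Schwarz inequality, read off from the nonnegative variance of
  \<bar>Z\<bar>.\<close>

lemma normal0_abs_expectation:
  assumes Z: "normal0 M Z v" and v: "0 \<le> v"
  shows "expectation (\<lambda>\<omega>. \<bar>Z \<omega>\<bar>) \<le> sqrt v"
proof (rule real_le_rsqrt)
  have int: "integrable M (\<lambda>\<omega>. \<bar>Z \<omega>\<bar>)" "integrable M (\<lambda>\<omega>. (\<bar>Z \<omega>\<bar>)\<^sup>2)"
    using normal0_integrable[OF Z v, of 1] normal0_integrable[OF Z v, of 2] by auto
  have "0 \<le> variance (\<lambda>\<omega>. \<bar>Z \<omega>\<bar>)" by (intro Bochner_Integration.integral_nonneg) simp
  also have "\<dots> = v - (expectation (\<lambda>\<omega>. \<bar>Z \<omega>\<bar>))\<^sup>2"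
    using normal0_variance[OF Z v] int by (subst variance_eq) auto
  finally show "(expectation (\<lambda>\<omega>. \<bar>Z \<omega>\<bar>))\<^sup>2 \<le> v" by simp
qed

text \<open>As a function of x, iexp (t * x) is Lipschitz with constant \<bar>t\<bar>, so L1
  convergence gives convergence of characteristic functions; convergence of the variances identifies
  the limit.\<close>

lemma normal0_L1_limit:
  assumes Y: "\<And>n. normal0 M (Y n) (v n)" and Z: "Z \<in> borel_measurable M"
    and L1: "\<And>n. integrable M (\<lambda>\<omega>. Y n \<omega> - Z \<omega>)" "(\<lambda>n. expectation (\<lambda>\<omega>. \<bar>Y n \<omega> - Z \<omega>\<bar>)) \<longlonglongrightarrow> 0"
    and v: "v \<longlonglongrightarrow> w"
  shows "normal0 M Z w"
  unfolding normal0_def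
proof (intro conjI Z allI)
  fix t
  note [measurable] = Z
  have [measurable]: "Y n \<in> borel_measurable M" for n using Y by (simp add: normal0_def)
  have iexp_lip: "cmod (iexp x - iexp y) \<le> \<bar>x - y\<bar>" for x y
  proof -
    have "iexp x - iexp y = iexp y * (iexp (x - y) - 1)"
      by (simp add: algebra_simps flip: exp_add)
    then have "cmod (iexp x - iexp y) = cmod (iexp (x - y) - 1)" by (simp add: norm_mult)
    also have "\<dots> \<le> \<bar>x - y\<bar>" using iexp_approx1[of "x - y" 0] by simp
    finally show ?thesis .
  qed
  have "(\<lambda>n. char (distr M borel (Y n)) t) \<longlonglongrightarrow> char (distr M borel Z) t"
  proof (rule LIM_zero_cancel, rule Lim_null_comparison)
    show "\<forall>\<^sub>F n in sequentially. norm (char (distr M borel (Y n)) t - char (distr M borel Z) t)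
        \<le> \<bar>t\<bar> * expectation (\<lambda>\<omega>. \<bar>Y n \<omega> - Z \<omega>\<bar>)"
    proof (rule always_eventually, rule allI)
      fix n
      have i: "integrable M (\<lambda>\<omega>. iexp (t * Y n \<omega>))" "integrable M (\<lambda>\<omega>. iexp (t * Z \<omega>))"
        by (auto intro!: integrable_iexp)
      have "char (distr M borel (Y n)) t - char (distr M borel Z) t
          = (CLINT \<omega>|M. iexp (t * Y n \<omega>) - iexp (t * Z \<omega>))"
        using i by (simp add: char_distr_eq)
      also have "norm \<dots> \<le> expectation (\<lambda>\<omega>. norm (iexp (t * Y n \<omega>) - iexp (t * Z \<omega>)))"
        by (rule integral_norm_bound)
      also have "\<dots> \<le> expectation (\<lambda>\<omega>. \<bar>t\<bar> * \<bar>Y n \<omega> - Z \<omega>\<bar>)"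
      proof (rule integral_mono)
        fix \<omega>
        show "cmod (iexp (t * Y n \<omega>) - iexp (t * Z \<omega>)) \<le> \<bar>t\<bar> * \<bar>Y n \<omega> - Z \<omega>\<bar>"
          using iexp_lip[of "t * Y n \<omega>" "t * Z \<omega>"] by (simp add: abs_mult flip: right_diff_distrib)
      qed (use i L1(1) in auto)
      finally show "norm (char (distr M borel (Y n)) t - char (distr M borel Z) t)
        \<le> \<bar>t\<bar> * expectation (\<lambda>\<omega>. \<bar>Y n \<omega> - Z \<omega>\<bar>)" by simp
    qed
    show "(\<lambda>n. \<bar>t\<bar> * expectation (\<lambda>\<omega>. \<bar>Y n \<omega> - Z \<omega>\<bar>)) \<longlonglongrightarrow> 0"
      using tendsto_mult_right_zero[OF L1(2)] by simp
  qed
  moreover have "(\<lambda>n. char (distr M borel (Y n)) t) \<longlonglongrightarrow> complex_of_real (exp (- (t\<^sup>2 * w) / 2))"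
    using Y unfolding normal0_def by (auto intro!: tendsto_intros v)
  ultimately show "char (distr M borel Z) t = complex_of_real (exp (- (t\<^sup>2 * w) / 2))"
    by (rule LIMSEQ_unique)
qed

lemma normal0_sum:
  assumes fin: "finite J" and ind: "indep_vars (\<lambda>_. borel) \<xi> J"
    and std: "\<And>i. i \<in> J \<Longrightarrow> distr M borel (\<xi> i) = std_normal_distribution"
  shows "normal0 M (\<lambda>\<omega>. \<Sum>i\<in>J. c i * \<xi> i \<omega>) (\<Sum>i\<in>J. (c i)\<^sup>2)"
  unfolding normal0_def
proof (intro conjI allI)
  have meas[measurable]: "\<And>j. j \<in> J \<Longrightarrow> \<xi> j \<in> borel_measurable M"
    using ind unfolding indep_vars_def by auto
  show "(\<lambda>\<omega>. \<Sum>i\<in>J. c i * \<xi> i \<omega>) \<in> borel_measurable M" by measurable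
  fix t
  have "char (distr M borel (\<lambda>\<omega>. \<Sum>i\<in>J. c i * \<xi> i \<omega>)) t = (\<Prod>i\<in>J. char (distr M borel (\<lambda>\<omega>. c i * \<xi> i \<omega>)) t)"
    by (rule char_distr_sum) (rule indep_vars_compose2[OF ind], simp)
  also have "\<dots> = (\<Prod>i\<in>J. complex_of_real (exp (- (t\<^sup>2 * (c i)\<^sup>2) / 2)))"
  proof (rule prod.cong[OF refl])
    fix i assume i: "i \<in> J"
    have "char (distr M borel (\<lambda>\<omega>. c i * \<xi> i \<omega>)) t = char (distr M borel (\<xi> i)) (t * c i)"
      using i by (simp add: char_distr_eq mult.assoc)
    then show "char (distr M borel (\<lambda>\<omega>. c i * \<xi> i \<omega>)) t = complex_of_real (exp (- (t\<^sup>2 * (c i)\<^sup>2) / 2))"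
      using std[OF i] by (simp add: char_std_normal_distribution power_mult_distrib)
  qed
  also have "\<dots> = complex_of_real (exp (- (t\<^sup>2 * (\<Sum>i\<in>J. (c i)\<^sup>2)) / 2))"
    using exp_sum[OF fin, of "\<lambda>i. - (t\<^sup>2 * (c i)\<^sup>2) / 2"]
    by (simp add: sum_distrib_left sum_divide_distrib sum_negf flip: of_real_prod)
  finally show "char (distr M borel (\<lambda>\<omega>. \<Sum>i\<in>J. c i * \<xi> i \<omega>)) t = complex_of_real (exp (- (t\<^sup>2 * (\<Sum>i\<in>J. (c i)\<^sup>2)) / 2))" .
qed

end

section \<open>Dyadic projections in L2 of the unit interval\<close>

abbreviation unit_leb :: "real measure" where "unit_leb \<equiv> lebesgue_on {0..1}"

text \<open>Left-open like the cells of \<open>cidx\<close>, so that a tag belongs to the cell it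
  represents. The point 0 lies in no cell, which is why the indicators sum to 1 only on {0<..1} and
  integrands are compared almost everywhere.\<close>

definition dcell :: "nat \<Rightarrow> nat \<Rightarrow> real set" where
  "dcell N m = {real m / N <.. real (Suc m) / N}"

lemma prob_space_unit_leb: "prob_space unit_leb"
  by (intro prob_spaceI) (simp add: emeasure_restrict_space space_restrict_space)

lemma dcell_subset: "m < N \<Longrightarrow> dcell N m \<subseteq> {0..1}"
proof
  fix x assume m: "m < N" and x: "x \<in> dcell N m"
  have "real m / N \<ge> 0" "real (Suc m) / N \<le> 1" using m by auto
  then show "x \<in> {0..1}" using x unfolding dcell_def greaterThanAtMost_iff atLeastAtMost_iff by linarith
qed

lemma sets_dcell [measurable]: "m < N \<Longrightarrow> dcell N m \<in> sets unit_leb"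
  using dcell_subset[of m N] by (subst sets_restrict_space_iff) (auto simp: dcell_def)

lemma measure_dcell: "m < N \<Longrightarrow> measure unit_leb (dcell N m) = 1 / N"
  using dcell_subset[of m N]
  by (subst measure_restrict_space) (auto simp: dcell_def field_simps)

definition cint :: "nat \<Rightarrow> nat \<Rightarrow> (real \<Rightarrow> real) \<Rightarrow> real" where
  "cint N m f = (\<integral>x. f x * indicator (dcell N m) x \<partial>unit_leb)"

lemma sum_indicator_dcell:
  fixes x :: real
  assumes "x \<in> {0<..1}" "0 < N"
  shows "(\<Sum>m<N. indicator (dcell N m) x) = (1 :: real)"
proof -
  \<comment> \<open>A point x lies in the left-open cell m exactly when \<lceil>x * N\<rceil> = m +
    1.\<close>
  define m where "m = nat (\<lceil>x * N\<rceil> - 1)"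
  have pos: "0 < x * N" "x * N \<le> N" using assms by (auto simp: mult_le_cancel_right1)
  then have c: "1 \<le> \<lceil>x * N\<rceil>" "\<lceil>x * N\<rceil> \<le> N" by (auto simp: ceiling_le_iff)
  then have mi: "int m = \<lceil>x * N\<rceil> - 1" unfolding m_def by simp
  then have mN: "m < N" and mr: "real m = \<lceil>x * N\<rceil> - 1" using c by linarith+
  have in_iff: "x \<in> dcell N m' \<longleftrightarrow> m' = m" for m'
  proof -
    have "x \<in> dcell N m' \<longleftrightarrow> real m' < x * N \<and> x * N \<le> real m' + 1"
      using assms by (simp add: dcell_def field_simps)
    also have "\<dots> \<longleftrightarrow> \<lceil>x * N\<rceil> = int m' + 1" by (simp add: ceiling_eq_iff)
    also have "\<dots> \<longleftrightarrow> m' = m" using mi by auto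
    finally show ?thesis .
  qed
  have "(\<Sum>m'<N. indicator (dcell N m') x) = (\<Sum>m'<N. if m' = m then 1 else 0 :: real)"
    by (intro sum.cong) (auto simp: indicator_def in_iff)
  also have "\<dots> = 1" using mN by (subst sum.delta) auto
  finally show ?thesis .
qed

lemma AE_unit_leb_pos: "AE x in unit_leb. x \<in> {0<..1}"
proof -
  have "AE x in lebesgue. x \<noteq> (0::real)"
    by (rule AE_completion) (rule AE_lborel_singleton)
  then have "AE x in lebesgue. x \<in> {0..1} \<longrightarrow> x \<in> {0<..1::real}"
    by eventually_elim auto
  then show ?thesis by (subst AE_restrict_space_iff) auto
qed

lemma square_integrable_L1:
  fixes f :: "real \<Rightarrow> real"
  assumes "f \<in> borel_measurable unit_leb" "integrable unit_leb (\<lambda>x. (f x)\<^sup>2)"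
  shows "integrable unit_leb f"
proof -
  interpret prob_space unit_leb by (rule prob_space_unit_leb)
  show ?thesis by (rule square_integrable_imp_integrable[OF assms])
qed

text \<open>\<open>L2_unit\<close> without extensionality, a condition that pointwise sums and
  differences of its members need not satisfy.\<close>

definition L2m :: "(real \<Rightarrow> real) set" where
  "L2m = {f \<in> borel_measurable unit_leb. integrable unit_leb (\<lambda>x. (f x)\<^sup>2)}"

lemma L2mD:
  assumes "f \<in> L2m"
  shows "f \<in> borel_measurable unit_leb" "integrable unit_leb (\<lambda>x. (f x)\<^sup>2)" "integrable unit_leb f"
proof -
  show 1: "f \<in> borel_measurable unit_leb" "integrable unit_leb (\<lambda>x. (f x)\<^sup>2)"
    using assms by (simp_all add: L2m_def)
  show "integrable unit_leb f" by (rule square_integrable_L1[OF 1])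
qed

lemma L2m_mult:
  assumes "f \<in> L2m" "g \<in> L2m" shows "integrable unit_leb (\<lambda>x. f x * g x)"
proof (rule Bochner_Integration.integrable_bound)
  show "integrable unit_leb (\<lambda>x. (f x)\<^sup>2 + (g x)\<^sup>2)"
    by (intro Bochner_Integration.integrable_add L2mD(2) assms)
  have "\<bar>a * b\<bar> \<le> a\<^sup>2 + b\<^sup>2" for a b :: real
  proof -
    have "2 * \<bar>a * b\<bar> \<le> a\<^sup>2 + b\<^sup>2" using sum_squares_bound[of "\<bar>a\<bar>" "\<bar>b\<bar>"] by (simp add: abs_mult)
    moreover have "0 \<le> \<bar>a * b\<bar>" by simp
    ultimately show ?thesis by linarith
  qed
  then show "AE x in unit_leb. norm (f x * g x) \<le> norm ((f x)\<^sup>2 + (g x)\<^sup>2)" by auto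
  show "(\<lambda>x. f x * g x) \<in> borel_measurable unit_leb" by (intro borel_measurable_times L2mD(1) assms)
qed

lemma L2m_add [intro]: assumes "f \<in> L2m" "g \<in> L2m" shows "(\<lambda>x. f x + g x) \<in> L2m"
proof -
  have "integrable unit_leb (\<lambda>x. (f x)\<^sup>2 + 2 * (f x * g x) + (g x)\<^sup>2)"
    by (intro Bochner_Integration.integrable_add integrable_mult_right L2mD(2) L2m_mult assms)
  then have "integrable unit_leb (\<lambda>x. (f x + g x)\<^sup>2)" by (simp add: power2_sum algebra_simps)
  then show ?thesis using L2mD(1)[OF assms(1)] L2mD(1)[OF assms(2)] by (simp add: L2m_def borel_measurable_add)
qed

lemma L2m_cmult [intro]: assumes "f \<in> L2m" shows "(\<lambda>x. c * f x) \<in> L2m"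
  using L2mD[OF assms] by (simp add: L2m_def power_mult_distrib)

lemma L2m_diff [intro]: assumes "f \<in> L2m" "g \<in> L2m" shows "(\<lambda>x. f x - g x) \<in> L2m"
  using L2m_add[OF assms(1) L2m_cmult[OF assms(2), of "-1"]] by simp

lemma L2m_sum [intro]: "(\<And>i. i \<in> S \<Longrightarrow> f i \<in> L2m) \<Longrightarrow> (\<lambda>x. \<Sum>i\<in>S. f i x) \<in> L2m"
proof (induction S rule: infinite_finite_induct)
  case (insert i F) then show ?case using L2m_add[of "f i" "\<lambda>x. \<Sum>i\<in>F. f i x"] by simp
qed (auto simp: L2m_def)

lemma L2m_bounded:
  assumes "f \<in> borel_measurable unit_leb" "\<And>x. x \<in> {0..1} \<Longrightarrow> \<bar>f x\<bar> \<le> B"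
  shows "f \<in> L2m"
proof -
  interpret prob_space unit_leb by (rule prob_space_unit_leb)
  have "integrable unit_leb (\<lambda>x. (f x)\<^sup>2)"
  proof (rule integrable_const_bound[of _ "B\<^sup>2"])
    show "AE x in unit_leb. norm ((f x)\<^sup>2) \<le> B\<^sup>2"
    proof (rule AE_I2)
      fix x assume "x \<in> space unit_leb"
      then have "\<bar>f x\<bar> ^ 2 \<le> B ^ 2" using assms(2) by (intro power_mono) (auto simp: space_restrict_space)
      then show "norm ((f x)\<^sup>2) \<le> B\<^sup>2" by simp
    qed
  qed (rule borel_measurable_power[OF assms(1)])
  then show ?thesis using assms by (simp add: L2m_def)
qed

definition sqn :: "(real \<Rightarrow> real) \<Rightarrow> real" where "sqn f = (\<integral>x. (f x)\<^sup>2 \<partial>unit_leb)"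

text \<open>For square integrable f, the squared L2 norm of the orthogonal projection onto the
  functions that are constant on the 2 ^ k dyadic cells.\<close>

definition qproj :: "nat \<Rightarrow> (real \<Rightarrow> real) \<Rightarrow> real" where
  "qproj k f = (\<Sum>m<2 ^ k. 2 ^ k * (cint (2 ^ k) m f)\<^sup>2)"

lemma cint_linear:
  assumes "f \<in> L2m" "g \<in> L2m" "m < N"
  shows cint_add: "cint N m (\<lambda>x. f x + g x) = cint N m f + cint N m g"
    and cint_diff: "cint N m (\<lambda>x. f x - g x) = cint N m f - cint N m g"
    and cint_cmult: "cint N m (\<lambda>x. c * f x) = c * cint N m f"
proof -
  have int: "integrable unit_leb (\<lambda>x. h x * indicator (dcell N m) x)" if "h \<in> L2m" for h
    using L2mD(3)[OF that] assms(3) by (intro integrable_real_mult_indicator) auto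
  show "cint N m (\<lambda>x. f x + g x) = cint N m f + cint N m g"
    "cint N m (\<lambda>x. f x - g x) = cint N m f - cint N m g"
    "cint N m (\<lambda>x. c * f x) = c * cint N m f"
    using int assms(1,2) by (auto simp: cint_def algebra_simps)
qed

lemma cint_sum:
  fixes f :: "'i \<Rightarrow> real \<Rightarrow> real" and c :: "'i \<Rightarrow> real"
  assumes "finite S" "\<And>i. i \<in> S \<Longrightarrow> f i \<in> L2m" "m < N"
  shows "cint N m (\<lambda>x. \<Sum>i\<in>S. c i * f i x) = (\<Sum>i\<in>S. c i * cint N m (f i))"
  using assms(1,2)
proof (induction S)
  case (insert i F)
  have "cint N m (\<lambda>x. c i * f i x + (\<Sum>i\<in>F. c i * f i x)) = c i * cint N m (f i) + (\<Sum>i\<in>F. c i * cint N m (f i))"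
    using insert assms(3)
    by (subst cint_add) (auto simp: cint_cmult[of "f i" "f i"] intro!: L2m_cmult L2m_sum)
  then show ?case using insert by simp
qed (simp add: cint_def)

lemma sqn_cells:
  assumes "f \<in> L2m" "0 < N"
  shows "sqn f = (\<Sum>m<N. \<integral>x. (f x)\<^sup>2 * indicator (dcell N m) x \<partial>unit_leb)"
proof -
  note [measurable] = L2mD(1)[OF assms(1)]
  have int: "integrable unit_leb (\<lambda>x. (f x)\<^sup>2 * indicator (dcell N m) x)" if "m < N" for m
    using L2mD(2)[OF assms(1)] that by (intro integrable_real_mult_indicator) auto
  have "sqn f = (\<integral>x. (\<Sum>m<N. (f x)\<^sup>2 * indicator (dcell N m) x) \<partial>unit_leb)"
    unfolding sqn_def
  proof (rule integral_cong_AE)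
    show "AE x in unit_leb. (f x)\<^sup>2 = (\<Sum>m<N. (f x)\<^sup>2 * indicator (dcell N m) x)"
      using AE_unit_leb_pos
    proof eventually_elim
      case (elim x)
      show ?case unfolding sum_distrib_left[symmetric] sum_indicator_dcell[OF elim assms(2)] by simp
    qed
    show "(\<lambda>x. \<Sum>m<N. (f x)\<^sup>2 * indicator (dcell N m) x) \<in> borel_measurable unit_leb"
      using int by (intro borel_measurable_sum) auto
  qed measurable
  also have "\<dots> = (\<Sum>m<N. \<integral>x. (f x)\<^sup>2 * indicator (dcell N m) x \<partial>unit_leb)"
    using int by (intro Bochner_Integration.integral_sum) auto
  finally show ?thesis .
qed

text \<open>The decomposition into variance and squared bias: \<open>N * cint N m f\<close> is the
  mean of f over the cell, whose measure is 1 / N.\<close>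

lemma cell_square_deviation:
  assumes f: "f \<in> L2m" and m: "m < N"
  shows "(\<integral>x. (f x - a)\<^sup>2 * indicator (dcell N m) x \<partial>unit_leb)
    = (\<integral>x. (f x)\<^sup>2 * indicator (dcell N m) x \<partial>unit_leb) - N * (cint N m f)\<^sup>2 + (N * cint N m f - a)\<^sup>2 / N"
proof -
  have N: "0 < N" using m by simp
  have i1: "integrable unit_leb (\<lambda>x. (f x)\<^sup>2 * indicator (dcell N m) x)"
    "integrable unit_leb (\<lambda>x. f x * indicator (dcell N m) x)"
    using L2mD(2,3)[OF f] m by (auto intro!: integrable_real_mult_indicator)
  have i2: "integrable unit_leb (\<lambda>x. indicator (dcell N m) x :: real)"
  proof -
    interpret prob_space unit_leb by (rule prob_space_unit_leb)
    show ?thesis using m by (intro integrable_real_indicator) (auto simp: emeasure_eq_measure)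
  qed
  have "(\<integral>x. (f x - a)\<^sup>2 * indicator (dcell N m) x \<partial>unit_leb)
    = (\<integral>x. (f x)\<^sup>2 * indicator (dcell N m) x - 2 * a * (f x * indicator (dcell N m) x)
        + a\<^sup>2 * indicator (dcell N m) x \<partial>unit_leb)"
    by (intro Bochner_Integration.integral_cong refl) (simp add: power2_eq_square algebra_simps)
  also have "\<dots> = (\<integral>x. (f x)\<^sup>2 * indicator (dcell N m) x \<partial>unit_leb) - 2 * a * cint N m f
      + a\<^sup>2 * measure unit_leb (dcell N m)"
    using i1 i2 sets.sets_into_space[OF sets_dcell[OF m]] by (simp add: cint_def Int_absorb1 Int_absorb2)
  also have "\<dots> = (\<integral>x. (f x)\<^sup>2 * indicator (dcell N m) x \<partial>unit_leb) - N * (cint N m f)\<^sup>2 + (N * cint N m f - a)\<^sup>2 / N"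
    using N m by (simp add: measure_dcell power2_eq_square field_simps)
  finally show ?thesis .
qed

text \<open>Cell means are the best constants in mean square, so any other values \<open>a\<close>
  give an upper bound for the projection error.\<close>

lemma sqn_minus_qproj_le:
  assumes f: "f \<in> L2m"
  shows "sqn f - qproj k f \<le> (\<Sum>m<2 ^ k. \<integral>x. (f x - a m)\<^sup>2 * indicator (dcell (2 ^ k) m) x \<partial>unit_leb)"
proof -
  have "sqn f - qproj k f = (\<Sum>m<2 ^ k. (\<integral>x. (f x)\<^sup>2 * indicator (dcell (2 ^ k) m) x \<partial>unit_leb) - (2 ^ k :: nat) * (cint (2 ^ k) m f)\<^sup>2)"
    unfolding qproj_def sum_subtractf using sqn_cells[OF f, of "2 ^ k"] by simp
  also have "\<dots> \<le> (\<Sum>m<2 ^ k. \<integral>x. (f x - a m)\<^sup>2 * indicator (dcell (2 ^ k) m) x \<partial>unit_leb)"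
    by (rule sum_mono) (subst cell_square_deviation[OF f], auto)
  finally show ?thesis .
qed

text \<open>Bessel's inequality: on each cell the difference is the squared deviation from the cell
  mean.\<close>

lemma qproj_le_sqn: assumes f: "f \<in> L2m" shows "qproj k f \<le> sqn f"
proof -
  have "sqn f - qproj k f = (\<Sum>m<2 ^ k. (\<integral>x. (f x)\<^sup>2 * indicator (dcell (2 ^ k) m) x \<partial>unit_leb) - (2 ^ k :: nat) * (cint (2 ^ k) m f)\<^sup>2)"
    unfolding qproj_def sum_subtractf using sqn_cells[OF f, of "2 ^ k"] by simp
  also have "\<dots> \<ge> 0"
  proof (rule sum_nonneg)
    fix m :: nat assume m: "m \<in> {..<2 ^ k}"
    have "0 \<le> (\<integral>x. (f x - 2 ^ k * cint (2 ^ k) m f)\<^sup>2 * indicator (dcell (2 ^ k) m) x \<partial>unit_leb)"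
      by (intro Bochner_Integration.integral_nonneg) simp
    also have "\<dots> = (\<integral>x. (f x)\<^sup>2 * indicator (dcell (2 ^ k) m) x \<partial>unit_leb) - (2 ^ k :: nat) * (cint (2 ^ k) m f)\<^sup>2"
      using m by (subst cell_square_deviation[OF f]) auto
    finally show "0 \<le> (\<integral>x. (f x)\<^sup>2 * indicator (dcell (2 ^ k) m) x \<partial>unit_leb) - (2 ^ k :: nat) * (cint (2 ^ k) m f)\<^sup>2" .
  qed
  finally show ?thesis by simp
qed

text \<open>Both \<open>sqn\<close> and \<open>qproj\<close> satisfy the parallelogram identity,
  hence so does the projection error; dropping the nonnegative error of f - g gives the
  bound.\<close>

lemma sqn_add_le:
  assumes f: "f \<in> L2m" and g: "g \<in> L2m"
  shows "sqn (\<lambda>x. f x + g x) - qproj k (\<lambda>x. f x + g x) \<le> 2 * (sqn f - qproj k f) + 2 * (sqn g - qproj k g)"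
proof -
  have par: "sqn (\<lambda>x. f x + g x) + sqn (\<lambda>x. f x - g x) = 2 * sqn f + 2 * sqn g"
  proof -
    have "sqn (\<lambda>x. f x + g x) + sqn (\<lambda>x. f x - g x) = (\<integral>x. (f x + g x)\<^sup>2 + (f x - g x)\<^sup>2 \<partial>unit_leb)"
      using L2mD(2)[OF L2m_add[OF f g]] L2mD(2)[OF L2m_diff[OF f g]] by (simp add: sqn_def)
    also have "\<dots> = (\<integral>x. 2 * (f x)\<^sup>2 + 2 * (g x)\<^sup>2 \<partial>unit_leb)"
      by (intro Bochner_Integration.integral_cong refl) (simp add: power2_eq_square algebra_simps)
    also have "\<dots> = 2 * sqn f + 2 * sqn g" using L2mD(2) f g by (simp add: sqn_def)
    finally show ?thesis .
  qed
  have "qproj k (\<lambda>x. f x + g x) + qproj k (\<lambda>x. f x - g x) = 2 * qproj k f + 2 * qproj k g"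
    unfolding qproj_def sum_distrib_left sum.distrib[symmetric]
    by (intro sum.cong refl) (simp add: cint_add[OF f g] cint_diff[OF f g] power2_eq_square algebra_simps)
  then show ?thesis using par qproj_le_sqn[OF L2m_diff[OF f g], of k] by (simp add: algebra_simps)
qed

lemma qproj_nonneg: "0 \<le> qproj k f" unfolding qproj_def by (intro sum_nonneg) auto

lemma qproj_tendsto_continuous:
  assumes g: "continuous_on UNIV g"
  shows "(\<lambda>k. sqn g - qproj k g) \<longlonglongrightarrow> 0"
proof (rule LIMSEQ_I)
  fix e :: real assume e: "0 < e"
  have gm: "g \<in> borel_measurable unit_leb"
    using borel_measurable_continuous_onI[OF g]
    by (intro measurable_restrict_space1) (simp add: measurable_completion)
  have cg: "continuous_on {0..1} g" using g continuous_on_subset by blast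
  obtain B where "\<And>x. x \<in> {0..1} \<Longrightarrow> \<bar>g x\<bar> \<le> B"
    using compact_imp_bounded[OF compact_continuous_image[OF cg compact_Icc]] unfolding bounded_iff
    by (metis imageI real_norm_def)
  then have gL: "g \<in> L2m" by (rule L2m_bounded[OF gm])
  have "uniformly_continuous_on {0..1} g" by (rule compact_uniformly_continuous[OF cg]) simp
  then obtain \<delta> where d: "0 < \<delta>" "\<And>x y. x \<in> {0..1} \<Longrightarrow> y \<in> {0..1} \<Longrightarrow> \<bar>y - x\<bar> < \<delta> \<Longrightarrow> \<bar>g y - g x\<bar> < sqrt (e / 2)"
  proof -
    assume u: "uniformly_continuous_on {0..1} g"
    have "0 < sqrt (e / 2)" using e by simp
    with u have "\<exists>d>0. \<forall>x\<in>{0..1}. \<forall>y\<in>{0..1}. dist y x < d \<longrightarrow> dist (g y) (g x) < sqrt (e / 2)"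
      unfolding uniformly_continuous_on_def by blast
    then show ?thesis using that by (auto simp: dist_real_def)
  qed
  obtain K where K: "1 / 2 ^ K < \<delta>"
    using real_arch_pow_inv[of \<delta> "1/2"] d by (auto simp: power_one_over)
  have "norm (sqn g - qproj k g - 0) < e" if k: "K \<le> k" for k
  proof -
    have "(2::real) ^ K \<le> 2 ^ k" using k by (intro power_increasing) auto
    then have "1 / 2 ^ k \<le> 1 / (2::real) ^ K" by (intro divide_left_mono) auto
    then have kd: "1 / 2 ^ k < \<delta>" using K by (rule le_less_trans)
    have "sqn g - qproj k g \<le> (\<Sum>m<2 ^ k. \<integral>x. (g x - g (real (Suc m) / (2 ^ k :: nat)))\<^sup>2 * indicator (dcell (2 ^ k) m) x \<partial>unit_leb)"
      by (rule sqn_minus_qproj_le[OF gL])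
    also have "\<dots> \<le> (\<Sum>m<(2 ^ k :: nat). e / 2 * (1 / (2 ^ k :: nat)))"
    proof (rule sum_mono)
      fix m :: nat assume m: "m \<in> {..<2 ^ k}"
      let ?t = "real (Suc m) / (2 ^ k :: nat)"
      interpret prob_space unit_leb by (rule prob_space_unit_leb)
      have mN: "m < 2 ^ k" using m by simp
      then have "Suc m \<le> 2 ^ k" by simp
      then have "real (Suc m) \<le> (2 ^ k :: nat)" by (rule of_nat_mono)
      then have t01: "?t \<in> {0..1}" by (auto simp: divide_le_eq)
      have "(\<integral>x. (g x - g ?t)\<^sup>2 * indicator (dcell (2 ^ k) m) x \<partial>unit_leb)
          \<le> (\<integral>x. e / 2 * indicator (dcell (2 ^ k) m) x \<partial>unit_leb)"
      proof (rule integral_mono)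
        have "(\<lambda>x. g x - g ?t) \<in> L2m" using gL L2m_bounded[of "\<lambda>_. g ?t" "\<bar>g ?t\<bar>"] by (intro L2m_diff) auto
        from L2mD(2)[OF this] show "integrable unit_leb (\<lambda>x. (g x - g ?t)\<^sup>2 * indicator (dcell (2 ^ k) m) x)"
          using mN by (intro integrable_real_mult_indicator) auto
        show "integrable unit_leb (\<lambda>x. e / 2 * indicator (dcell (2 ^ k) m) x)"
          using mN by (intro integrable_mult_right integrable_real_indicator) (auto simp: emeasure_eq_measure)
        fix x
        show "(g x - g ?t)\<^sup>2 * indicator (dcell (2 ^ k) m) x \<le> e / 2 * indicator (dcell (2 ^ k) m) x"
        proof (cases "x \<in> dcell (2 ^ k) m")
          case True
          then have "\<bar>x - ?t\<bar> < \<delta>" using kd by (auto simp: dcell_def add_divide_distrib)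
          then have "\<bar>g x - g ?t\<bar> < sqrt (e / 2)"
            using d(2)[OF t01, of x] True dcell_subset[OF mN] by blast
          then have "\<bar>g x - g ?t\<bar>\<^sup>2 \<le> (sqrt (e / 2))\<^sup>2" by (intro power_mono) auto
          then show ?thesis using True e by simp
        qed simp
      qed
      also have "\<dots> = e / 2 * measure unit_leb (dcell (2 ^ k) m)"
        using sets.sets_into_space[OF sets_dcell[OF mN]] by (simp add: Int_absorb1 Int_absorb2)
      also have "\<dots> = e / 2 * (1 / (2 ^ k :: nat))" using mN by (simp only: measure_dcell)
      finally show "(\<integral>x. (g x - g ?t)\<^sup>2 * indicator (dcell (2 ^ k) m) x \<partial>unit_leb) \<le> e / 2 * (1 / (2 ^ k :: nat))" .
    qed
    also have "\<dots> = e / 2" by simp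
    finally show ?thesis using qproj_le_sqn[OF gL, of k] e by simp
  qed
  then show "\<exists>K. \<forall>k\<ge>K. norm (sqn g - qproj k g - 0) < e" by blast
qed

lemma sqn_mono_AE:
  fixes w :: "real \<Rightarrow> real"
  assumes [measurable]: "\<And>n. h n \<in> borel_measurable unit_leb"
    and lim: "AE x in unit_leb. (\<lambda>n. h n x) \<longlonglongrightarrow> 0"
    and bd: "\<And>n x. x \<in> {0..1} \<Longrightarrow> (h n x)\<^sup>2 \<le> w x" and w: "integrable unit_leb w"
  shows "(\<lambda>n. sqn (h n)) \<longlonglongrightarrow> 0"
proof -
  have "(\<lambda>n. sqn (h n)) \<longlonglongrightarrow> (\<integral>x. 0 \<partial>unit_leb)"
    unfolding sqn_def
  proof (rule integral_dominated_convergence[where w = w])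
    show "AE x in unit_leb. (\<lambda>n. (h n x)\<^sup>2) \<longlonglongrightarrow> 0"
      using lim by eventually_elim (auto intro: tendsto_eq_intros)
    show "AE x in unit_leb. norm ((h n x)\<^sup>2) \<le> w x" for n
      using bd by (intro AE_I2) (auto simp: space_restrict_space)
  qed (use w in auto)
  then show ?thesis by simp
qed

lemma sqn_add_le2:
  assumes "f \<in> L2m" "g \<in> L2m" shows "sqn (\<lambda>x. f x + g x) \<le> 2 * sqn f + 2 * sqn g"
proof -
  have "sqn (\<lambda>x. f x + g x) \<le> (\<integral>x. 2 * (f x)\<^sup>2 + 2 * (g x)\<^sup>2 \<partial>unit_leb)"
    unfolding sqn_def
  proof (rule integral_mono)
    show "integrable unit_leb (\<lambda>x. (f x + g x)\<^sup>2)" using L2mD(2)[OF L2m_add[OF assms]] .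
    show "(f x + g x)\<^sup>2 \<le> 2 * (f x)\<^sup>2 + 2 * (g x)\<^sup>2" for x
      using zero_le_power2[of "f x - g x"] by (simp add: power2_eq_square algebra_simps)
  qed (use L2mD(2) assms in auto)
  also have "\<dots> = 2 * sqn f + 2 * sqn g" using L2mD(2) assms by (simp add: sqn_def)
  finally show ?thesis .
qed

text \<open>First f is clipped to a bounded range. Lebesgue measurability provides continuous
  functions that converge to f almost everywhere on the interval; clipping them as well keeps them
  continuous and yields a constant majorant for dominated convergence.\<close>

lemma continuous_dense_L2:
  assumes f: "f \<in> L2m" and e: "0 < e"
  shows "\<exists>g. continuous_on UNIV g \<and> g \<in> L2m \<and> sqn (\<lambda>x. f x - g x) < e"
proof -
  define cl where "cl c y = max (- c) (min c y)" for c y :: real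
  have cl_cont: "continuous_on UNIV (cl c)" for c unfolding cl_def by (intro continuous_intros)
  have cl_meas[measurable]: "cl c \<in> borel_measurable borel" for c
    using cl_cont by (rule borel_measurable_continuous_onI)
  have cl_bd: "\<bar>cl c y\<bar> \<le> c" if "0 \<le> c" for c y using that by (auto simp: cl_def)
  note fm[measurable] = L2mD(1)[OF f]
  have lim1: "(\<lambda>n. sqn (\<lambda>x. f x - cl (real n) (f x))) \<longlonglongrightarrow> 0"
  proof (rule sqn_mono_AE[where w = "\<lambda>x. (f x)\<^sup>2"])
    show "AE x in unit_leb. (\<lambda>n. f x - cl (real n) (f x)) \<longlonglongrightarrow> 0"
    proof (rule AE_I2)
      fix x
      obtain n0 where n0: "\<bar>f x\<bar> < real n0" using reals_Archimedean2 by blast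
      have "f x - cl (real n) (f x) = 0" if "n0 \<le> n" for n
      proof -
        have "\<bar>f x\<bar> < real n" using n0 that by (meson less_le_trans of_nat_mono)
        then show ?thesis by (auto simp: cl_def)
      qed
      then show "(\<lambda>n. f x - cl (real n) (f x)) \<longlonglongrightarrow> 0"
        by (intro tendsto_eventually eventually_sequentiallyI)
    qed
    fix n and x :: real
    have "\<bar>f x - cl (real n) (f x)\<bar> \<le> \<bar>f x\<bar>" by (auto simp: cl_def)
    then show "(f x - cl (real n) (f x))\<^sup>2 \<le> (f x)\<^sup>2" by (simp add: abs_le_square_iff)
  qed (use L2mD(2)[OF f] in auto)
  have "0 < e / 4" using e by simp
  from order_tendstoD(2)[OF lim1 this] obtain n where n: "sqn (\<lambda>x. f x - cl (real n) (f x)) < e / 4"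
    by (auto simp: eventually_sequentially)
  define c where "c = real n"
  define f' where "f' x = (if x \<in> {0..1} then f x else 0)" for x
  have "f' \<in> borel_measurable lebesgue" unfolding f'_def
    using borel_measurable_if[of "{0..1}" f] fm by auto
  then have "f' measurable_on UNIV" by (rule lebesgue_measurable_imp_measurable_on_real) simp
  then obtain N g where N: "negligible N" and g: "\<And>m. continuous_on UNIV (g m)"
    and gf: "\<And>x. x \<notin> N \<Longrightarrow> (\<lambda>m. g m x) \<longlonglongrightarrow> f' x"
    unfolding measurable_on_def by auto
  have gm: "(\<lambda>x. cl c (g m x)) \<in> borel_measurable unit_leb" for m
    using borel_measurable_continuous_onI[OF continuous_on_compose[OF g continuous_on_subset[OF cl_cont subset_UNIV]]]
    by (intro measurable_restrict_space1) (simp add: measurable_completion o_def)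
  have c0: "0 \<le> c" by (simp add: c_def)
  have gL: "(\<lambda>x. cl c (g m x)) \<in> L2m" for m using gm cl_bd[OF c0] by (rule L2m_bounded)
  have fL: "(\<lambda>x. cl c (f x)) \<in> L2m" using cl_bd[OF c0] by (intro L2m_bounded[of _ c]) auto
  have lim2: "(\<lambda>m. sqn (\<lambda>x. cl c (f x) - cl c (g m x))) \<longlonglongrightarrow> 0"
  proof (rule sqn_mono_AE[where w = "\<lambda>x. (2 * c)\<^sup>2"])
    have "AE x in lebesgue. x \<notin> N" using N by (simp add: AE_not_in negligible_iff_null_sets)
    then have "AE x in lebesgue. x \<in> {0..1} \<longrightarrow> (\<lambda>m. cl c (f x) - cl c (g m x)) \<longlonglongrightarrow> 0"
    proof eventually_elim
      case (elim x)
      have "isCont (cl c) (f' x)" using cl_cont by (simp add: continuous_on_eq_continuous_at)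
      from isCont_tendsto_compose[OF this gf[OF elim]]
      have "(\<lambda>m. cl c (f' x) - cl c (g m x)) \<longlonglongrightarrow> cl c (f' x) - cl c (f' x)" by (intro tendsto_intros)
      then show ?case by (auto simp: f'_def)
    qed
    then show "AE x in unit_leb. (\<lambda>m. cl c (f x) - cl c (g m x)) \<longlonglongrightarrow> 0"
      by (subst AE_restrict_space_iff) auto
    show "(cl c (f x) - cl c (g m x))\<^sup>2 \<le> (2 * c)\<^sup>2" for m x
    proof -
      have "\<bar>cl c (f x) - cl c (g m x)\<bar> \<le> 2 * c" using cl_bd[OF c0, of "f x"] cl_bd[OF c0, of "g m x"] by linarith
      then show ?thesis using power_mono[of "\<bar>cl c (f x) - cl c (g m x)\<bar>" "2 * c" 2] by simp
    qed
    show "(\<lambda>x. cl c (f x) - cl c (g m x)) \<in> borel_measurable unit_leb" for m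
      by (intro borel_measurable_diff gm L2mD(1)[OF fL])
    interpret prob_space unit_leb by (rule prob_space_unit_leb)
    show "integrable unit_leb (\<lambda>x. (2 * c)\<^sup>2)" by simp
  qed
  have "0 < e / 4" using e by simp
  from order_tendstoD(2)[OF lim2 this] obtain m where m: "sqn (\<lambda>x. cl c (f x) - cl c (g m x)) < e / 4"
    by (auto simp: eventually_sequentially)
  have "sqn (\<lambda>x. (f x - cl c (f x)) + (cl c (f x) - cl c (g m x)))
      \<le> 2 * sqn (\<lambda>x. f x - cl c (f x)) + 2 * sqn (\<lambda>x. cl c (f x) - cl c (g m x))"
    by (rule sqn_add_le2) (intro L2m_diff f fL gL)+
  then have "sqn (\<lambda>x. f x - cl c (g m x)) < e" using n m unfolding c_def by simp
  moreover have "continuous_on UNIV (\<lambda>x. cl c (g m x))"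
    by (rule continuous_on_compose2[OF cl_cont g]) auto
  ultimately show ?thesis using gL by blast
qed

text \<open>Completeness of the dyadic step functions: the projection error of f is at most twice
  that of f - g plus twice that of g, for a continuous g close to f in L2.\<close>

lemma qproj_tendsto:
  assumes f: "f \<in> L2m" shows "(\<lambda>k. qproj k f) \<longlonglongrightarrow> sqn f"
proof (rule LIMSEQ_I)
  fix e :: real assume e: "0 < e"
  then obtain g where g: "continuous_on UNIV g" "g \<in> L2m" "sqn (\<lambda>x. f x - g x) < e / 4"
    using continuous_dense_L2[OF f, of "e / 4"] by auto
  have "0 < e / 4" using e by simp
  from order_tendstoD(2)[OF qproj_tendsto_continuous[OF g(1)] this]
  obtain K where K: "\<And>k. K \<le> k \<Longrightarrow> sqn g - qproj k g < e / 4" by (auto simp: eventually_sequentially)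
  have "norm (qproj k f - sqn f) < e" if "K \<le> k" for k
  proof -
    have "sqn f - qproj k f \<le> 2 * (sqn (\<lambda>x. f x - g x) - qproj k (\<lambda>x. f x - g x)) + 2 * (sqn g - qproj k g)"
      using sqn_add_le[OF L2m_diff[OF f g(2)] g(2), of k] by simp
    then show ?thesis
      using qproj_nonneg[of k "\<lambda>x. f x - g x"] qproj_le_sqn[OF f, of k] g(3) K[OF that] by simp
  qed
  then show "\<exists>K. \<forall>k\<ge>K. norm (qproj k f - sqn f) < e" by blast
qed

section \<open>Haar coefficients and existence of the Gaussian family\<close>

primrec haar_index :: "nat \<Rightarrow> (nat \<times> nat) set" where
  "haar_index 0 = {(0, 0)}"
| "haar_index (Suc k) = haar_index k \<union> {Suc k} \<times> {..<2 ^ k}"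

text \<open>Inner products of f with the normalised Haar functions. The pair (0, m) stands for the
  constant function 1; the function of (Suc j, m) is supported on cell m of the grid with 2 ^ j
  cells, with value sqrt (2 ^ j) on the left half and the negative of it on the right half.\<close>

fun haar_coeff :: "(real \<Rightarrow> real) \<Rightarrow> nat \<times> nat \<Rightarrow> real" where
  "haar_coeff f (0, m) = cint 1 0 f"
| "haar_coeff f (Suc j, m) = sqrt (2 ^ j) * (cint (2 ^ Suc j) (2 * m) f - cint (2 ^ Suc j) (2 * m + 1) f)"

lemma haar_index_le: "(j, m) \<in> haar_index k \<Longrightarrow> j \<le> k \<and> m < 2 ^ (j - 1)"
  by (induction k) auto

lemma finite_haar_index: "finite (haar_index k)"
  by (induction k) auto

lemma haar_index_mono: "k \<le> l \<Longrightarrow> haar_index k \<subseteq> haar_index l"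
  by (rule lift_Suc_mono_le[of haar_index]) auto

lemma cint_split:
  assumes f: "f \<in> L2m" and m: "m < 2 ^ k"
  shows "cint (2 ^ k) m f = cint (2 ^ Suc k) (2 * m) f + cint (2 ^ Suc k) (2 * m + 1) f"
proof -
  have m': "2 * m < 2 ^ Suc k" "2 * m + 1 < 2 ^ Suc k" using m by auto
  have int: "integrable unit_leb (\<lambda>x. f x * indicator (dcell (2 ^ Suc k) l) x)" if "l < 2 ^ Suc k" for l
    using L2mD(3)[OF f] that by (intro integrable_real_mult_indicator) auto
  have mid: "real m / 2 ^ k \<le> (1 + 2 * real m) / (2 * 2 ^ k)" "(1 + 2 * real m) / (2 * 2 ^ k) \<le> (1 + real m) / 2 ^ k"
    by (auto simp: field_simps)
  have "indicator (dcell (2 ^ k) m) x = indicator (dcell (2 ^ Suc k) (2 * m)) x + (indicator (dcell (2 ^ Suc k) (2 * m + 1)) x :: real)" for x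
    using mid unfolding dcell_def by (auto simp: indicator_def field_simps)
  then have "cint (2 ^ k) m f = (\<integral>x. f x * indicator (dcell (2 ^ Suc k) (2 * m)) x + f x * indicator (dcell (2 ^ Suc k) (2 * m + 1)) x \<partial>unit_leb)"
    unfolding cint_def by (simp add: distrib_left)
  also have "\<dots> = cint (2 ^ Suc k) (2 * m) f + cint (2 ^ Suc k) (2 * m + 1) f"
    unfolding cint_def using int[OF m'(1)] int[OF m'(2)] by (rule Bochner_Integration.integral_add)
  finally show ?thesis .
qed

text \<open>Let x and y be the integrals over the two halves of a cell. Level k contributes
  \<open>2 ^ k * (x + y)\<^sup>2\<close> and the new Haar coefficient
  \<open>2 ^ k * (x - y)\<^sup>2\<close>; by the parallelogram identity they add up to what the two
  halves contribute at level Suc k.\<close>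

lemma sum_haar_coeff:
  assumes f: "f \<in> L2m" shows "(\<Sum>i\<in>haar_index k. (haar_coeff f i)\<^sup>2) = qproj k f"
proof (induction k)
  case 0
  then show ?case by (simp add: qproj_def)
next
  case (Suc k)
  let ?N = "2 ^ Suc k :: nat"
  let ?x = "\<lambda>m. cint ?N (2 * m) f" and ?y = "\<lambda>m. cint ?N (2 * m + 1) f"
  have "haar_index k \<inter> {Suc k} \<times> {..<2 ^ k} = {}" using haar_index_le by fastforce
  then have "(\<Sum>i\<in>haar_index (Suc k). (haar_coeff f i)\<^sup>2)
      = qproj k f + (\<Sum>i\<in>{Suc k} \<times> {..<2 ^ k}. (haar_coeff f i)\<^sup>2)"
    using Suc by (simp add: sum.union_disjoint finite_haar_index)
  also have "(\<Sum>i\<in>{Suc k} \<times> {..<2 ^ k}. (haar_coeff f i)\<^sup>2) = (\<Sum>m<2 ^ k. 2 ^ k * (?x m - ?y m)\<^sup>2)"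
  proof -
    have "{Suc k} \<times> {..<2 ^ k :: nat} = Pair (Suc k) ` {..<2 ^ k}" by auto
    then show ?thesis by (simp add: sum.reindex inj_on_def power_mult_distrib)
  qed
  also have "qproj k f = (\<Sum>m<2 ^ k. 2 ^ k * (?x m + ?y m)\<^sup>2)"
    unfolding qproj_def using cint_split[OF f] by (intro sum.cong) auto
  also have "(\<Sum>m<2 ^ k. 2 ^ k * (?x m + ?y m)\<^sup>2) + (\<Sum>m<2 ^ k. 2 ^ k * (?x m - ?y m)\<^sup>2)
      = (\<Sum>m<2 ^ k. 2 ^ Suc k * (?x m)\<^sup>2 + 2 ^ Suc k * (?y m)\<^sup>2)"
    unfolding sum.distrib[symmetric]
    by (intro sum.cong refl) (simp add: power2_eq_square algebra_simps)
  also have "\<dots> = (\<Sum>m<2 ^ k. \<Sum>l\<in>{m * 2..<m * 2 + 2}. 2 ^ Suc k * (cint ?N l f)\<^sup>2)"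
  proof (intro sum.cong refl)
    fix m :: nat
    have "{m * 2..<m * 2 + 2} = {2 * m, 2 * m + 1}" by auto
    then show "2 ^ Suc k * (?x m)\<^sup>2 + 2 ^ Suc k * (?y m)\<^sup>2 = (\<Sum>l\<in>{m * 2..<m * 2 + 2}. 2 ^ Suc k * (cint ?N l f)\<^sup>2)"
      by simp
  qed
  also have "\<dots> = (\<Sum>l<2 ^ k * 2. 2 ^ Suc k * (cint ?N l f)\<^sup>2)" by (rule sum.nat_group)
  also have "\<dots> = qproj (Suc k) f" by (simp add: qproj_def mult.commute)
  finally show ?case .
qed

lemma haar_coeff_sum:
  assumes "finite S" "\<And>t. t \<in> S \<Longrightarrow> t \<in> L2m" "i \<in> haar_index k"
  shows "haar_coeff (\<lambda>x. \<Sum>t\<in>S. c t * t x) i = (\<Sum>t\<in>S. c t * haar_coeff t i)"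
proof (cases i)
  case (Pair j m)
  have S: "cint N m (\<lambda>x. \<Sum>t\<in>S. c t * t x) = (\<Sum>t\<in>S. c t * cint N m t)" if "m < N" for N m
    using cint_sum[where c = c and f = "\<lambda>t. t", OF assms(1) assms(2) that] .
  show ?thesis
  proof (cases j)
    case 0
    then show ?thesis using Pair S[of 0 1] by simp
  next
    case (Suc j')
    then have "m < 2 ^ j'" using haar_index_le assms(3) Pair by fastforce
    then have m: "2 * m < 2 ^ Suc j'" "2 * m + 1 < 2 ^ Suc j'" by auto
    show ?thesis unfolding Pair Suc haar_coeff.simps using S[OF m(1)] S[OF m(2)]
      by (simp only: sum_subtractf[symmetric] sum_distrib_left right_diff_distrib mult.left_commute)
  qed
qed

lemma L2_unit_subset: "L2_unit \<subseteq> L2m" by (auto simp: L2_unit_def L2m_def)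

text \<open>
  The process is the Haar series with independent standard normal coefficients. The sample space
  is a product indexed by all functions rather than by a countable set only because its type is
  prescribed; the embedding selects countably many of the coordinates.
\<close>

theorem gaussian_family_exists:
  "\<exists>(N :: ((real \<Rightarrow> real) \<Rightarrow> real) measure) \<nu>. prob_space N \<and>
    (\<forall>S c. finite S \<and> S \<subseteq> L2_unit \<longrightarrow>
      normal0 N (\<lambda>\<omega>. \<Sum>t\<in>S. c t * \<nu> t \<omega>) (sqn (\<lambda>x. \<Sum>t\<in>S. c t * t x)))"
proof -
  define N where "N = (\<Pi>\<^sub>M (i :: real \<Rightarrow> real)\<in>UNIV. std_normal_distribution)"
  define emb :: "nat \<times> nat \<Rightarrow> real \<Rightarrow> real" where "emb p = (\<lambda>_. real (prod_encode p))" for p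
  define \<xi> where "\<xi> p \<omega> = \<omega> (emb p)" for p and \<omega> :: "(real \<Rightarrow> real) \<Rightarrow> real"
  have ps: "prob_space (std_normal_distribution)"
    using real_dist_normal_dist by (simp add: real_distribution_def)
  interpret N: prob_space N unfolding N_def by (rule prob_space_PiM) (rule ps)
  have inj: "inj emb" unfolding emb_def inj_def fun_eq_iff by simp
  have [measurable]: "\<xi> p \<in> borel_measurable N" for p
    unfolding \<xi>_def[abs_def] N_def by (rule measurable_compose[OF measurable_component_singleton]) auto
  have std: "distr N borel (\<xi> p) = std_normal_distribution" for p
  proof -
    have "distr N borel (\<xi> p) = distr N std_normal_distribution (\<lambda>\<omega>. \<omega> (emb p))"
      unfolding \<xi>_def[abs_def] by (rule distr_cong) auto
    also have "\<dots> = std_normal_distribution" unfolding N_def by (rule distr_PiM_component) (auto simp: ps)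
    finally show ?thesis .
  qed
  have ind: "N.indep_vars (\<lambda>_. borel) \<xi> UNIV"
  proof (subst N.indep_vars_iff_distr_eq_PiM)
    have "distr N (\<Pi>\<^sub>M i\<in>UNIV. borel) (\<lambda>x. \<lambda>i\<in>UNIV. \<xi> i x)
        = distr N (\<Pi>\<^sub>M i\<in>UNIV. std_normal_distribution) (\<lambda>\<omega>. \<lambda>p\<in>UNIV. \<omega> (emb p))"
      by (rule distr_cong) (auto simp: \<xi>_def intro!: sets_PiM_cong)
    also have "\<dots> = (\<Pi>\<^sub>M i\<in>UNIV. std_normal_distribution)"
      unfolding N_def using inj by (intro distr_PiM_reindex) (auto simp: ps)
    finally show "distr N (\<Pi>\<^sub>M i\<in>UNIV. borel) (\<lambda>x. \<lambda>i\<in>UNIV. \<xi> i x) = (\<Pi>\<^sub>M i\<in>UNIV. distr N borel (\<xi> i))"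
      by (simp add: std)
  qed auto
  define Y where "Y k f \<omega> = (\<Sum>i\<in>haar_index k. haar_coeff f i * \<xi> i \<omega>)" for k f \<omega>
  have Yn: "normal0 N (Y k f) (qproj k f)" if "f \<in> L2m" for k f
    unfolding Y_def[abs_def] sum_haar_coeff[OF that, symmetric]
    using N.indep_vars_subset[OF ind] by (intro N.normal0_sum finite_haar_index std) auto
  \<comment> \<open>Two partial sums differ by a normal combination of the new coefficients, whose
    variance is the difference of the values of \<open>qproj\<close>. Convergence of
    \<open>qproj\<close> thus makes the partial sums Cauchy in L1.\<close>
  have Yd: "N.expectation (\<lambda>\<omega>. \<bar>Y l f \<omega> - Y k f \<omega>\<bar>) \<le> sqrt (qproj l f - qproj k f)" if f: "f \<in> L2m" and kl: "k \<le> l" for k l f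
  proof -
    let ?D = "haar_index l - haar_index k"
    have eq: "Y l f \<omega> - Y k f \<omega> = (\<Sum>i\<in>?D. haar_coeff f i * \<xi> i \<omega>)" for \<omega>
      unfolding Y_def using sum_diff[OF finite_haar_index haar_index_mono[OF kl], of "\<lambda>i. haar_coeff f i * \<xi> i \<omega>"] by simp
    have "qproj l f - qproj k f = (\<Sum>i\<in>?D. (haar_coeff f i)\<^sup>2)"
      unfolding sum_haar_coeff[OF f, symmetric] using sum_diff[OF finite_haar_index haar_index_mono[OF kl], of "\<lambda>i. (haar_coeff f i)\<^sup>2"] by simp
    then have "normal0 N (\<lambda>\<omega>. Y l f \<omega> - Y k f \<omega>) (qproj l f - qproj k f)" "0 \<le> qproj l f - qproj k f"
      unfolding eq using N.indep_vars_subset[OF ind]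
      by (auto intro!: N.normal0_sum finite_haar_index std sum_nonneg)
    then show ?thesis by (rule N.normal0_abs_expectation)
  qed
  have Yi: "integrable N (Y k f)" if "f \<in> L2m" for k f
    using N.normal0_integrable[where k = 1, OF Yn[OF that] qproj_nonneg] by simp
  have "\<exists>Z. integrable N Z \<and> (\<lambda>n. N.expectation (\<lambda>\<omega>. \<bar>Y n f \<omega> - Z \<omega>\<bar>)) \<longlonglongrightarrow> 0" if f: "f \<in> L2m" for f
  proof (rule N.L1_complete[OF Yi[OF f]])
    fix e :: real assume e: "0 < e"
    have "Cauchy (\<lambda>k. qproj k f)" using qproj_tendsto[OF f] by (rule LIMSEQ_imp_Cauchy)
    from CauchyD[OF this, of "e\<^sup>2"] e
    obtain K where K: "\<And>i j. K \<le> i \<Longrightarrow> K \<le> j \<Longrightarrow> \<bar>qproj i f - qproj j f\<bar> < e\<^sup>2"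
      by auto
    have le: "N.expectation (\<lambda>\<omega>. \<bar>Y j f \<omega> - Y i f \<omega>\<bar>) < e" if "K \<le> i" "i \<le> j" for i j
    proof -
      have "sqrt (qproj j f - qproj i f) < e"
        using K[of j i] that e by (intro real_less_lsqrt) (auto simp: abs_less_iff)
      then show ?thesis using Yd[OF f that(2)] by linarith
    qed
    show "\<exists>K. \<forall>i\<ge>K. \<forall>j\<ge>K. N.expectation (\<lambda>\<omega>. \<bar>Y i f \<omega> - Y j f \<omega>\<bar>) < e"
    proof (intro exI[of _ K] allI impI)
      fix i j assume ij: "K \<le> i" "K \<le> j"
      show "N.expectation (\<lambda>\<omega>. \<bar>Y i f \<omega> - Y j f \<omega>\<bar>) < e"
      proof (cases "i \<le> j")
        case True
        show ?thesis using le[OF ij(1) True] by (simp add: abs_minus_commute)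
      next
        case False
        then show ?thesis using le[OF ij(2), of i] by simp
      qed
    qed
  qed
  then have "\<forall>f. \<exists>Z. f \<in> L2m \<longrightarrow> integrable N Z \<and> (\<lambda>n. N.expectation (\<lambda>\<omega>. \<bar>Y n f \<omega> - Z \<omega>\<bar>)) \<longlonglongrightarrow> 0"
    by blast
  from choice[OF this] obtain \<nu> where nu: "\<And>f. f \<in> L2m \<Longrightarrow> integrable N (\<nu> f)"
    "\<And>f. f \<in> L2m \<Longrightarrow> (\<lambda>n. N.expectation (\<lambda>\<omega>. \<bar>Y n f \<omega> - \<nu> f \<omega>\<bar>)) \<longlonglongrightarrow> 0" by blast
  have "normal0 N (\<lambda>\<omega>. \<Sum>t\<in>S. c t * \<nu> t \<omega>) (sqn (\<lambda>x. \<Sum>t\<in>S. c t * t x))"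
    if S: "finite S" "S \<subseteq> L2_unit" for S c
  proof -
    let ?F = "\<lambda>x. \<Sum>t\<in>S. c t * t x"
    have SL: "t \<in> L2m" if "t \<in> S" for t using S(2) L2_unit_subset that by blast
    have F: "?F \<in> L2m" using SL by (intro L2m_sum L2m_cmult)
    \<comment> \<open>Haar coefficients are linear, so a combination of limits is itself the limit
      of the Haar sums of one function; this identifies its variance.\<close>
    have YF: "Y k ?F \<omega> = (\<Sum>t\<in>S. c t * Y k t \<omega>)" for k \<omega>
    proof -
      have "Y k ?F \<omega> = (\<Sum>i\<in>haar_index k. \<Sum>t\<in>S. c t * (haar_coeff t i * \<xi> i \<omega>))"
        unfolding Y_def
        by (intro sum.cong refl) (simp add: haar_coeff_sum[OF S(1) SL] sum_distrib_right mult.assoc)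
      also have "\<dots> = (\<Sum>t\<in>S. c t * Y k t \<omega>)"
        unfolding Y_def sum_distrib_left by (rule sum.swap)
      finally show ?thesis .
    qed
    have int: "integrable N (\<lambda>\<omega>. \<Sum>t\<in>S. c t * \<nu> t \<omega>)"
      using nu(1)[OF SL] by auto
    show ?thesis
    proof (rule N.normal0_L1_limit[OF Yn[OF F]])
      show "(\<lambda>\<omega>. \<Sum>t\<in>S. c t * \<nu> t \<omega>) \<in> borel_measurable N" using int by auto
      show "integrable N (\<lambda>\<omega>. Y n ?F \<omega> - (\<Sum>t\<in>S. c t * \<nu> t \<omega>))" for n
        using Yi[OF F] int by auto
      show "(\<lambda>n. N.expectation (\<lambda>\<omega>. \<bar>Y n ?F \<omega> - (\<Sum>t\<in>S. c t * \<nu> t \<omega>)\<bar>)) \<longlonglongrightarrow> 0"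
      proof (rule Lim_null_comparison)
        show "(\<lambda>n. \<Sum>t\<in>S. \<bar>c t\<bar> * N.expectation (\<lambda>\<omega>. \<bar>Y n t \<omega> - \<nu> t \<omega>\<bar>)) \<longlonglongrightarrow> 0"
          using nu(2)[OF SL] by (intro tendsto_null_sum tendsto_mult_right_zero)
        show "\<forall>\<^sub>F n in sequentially. norm (N.expectation (\<lambda>\<omega>. \<bar>Y n ?F \<omega> - (\<Sum>t\<in>S. c t * \<nu> t \<omega>)\<bar>))
            \<le> (\<Sum>t\<in>S. \<bar>c t\<bar> * N.expectation (\<lambda>\<omega>. \<bar>Y n t \<omega> - \<nu> t \<omega>\<bar>))"
        proof (rule always_eventually, rule allI)
          fix n
          have iD: "integrable N (\<lambda>\<omega>. \<bar>Y n t \<omega> - \<nu> t \<omega>\<bar>)" if "t \<in> S" for t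
            using Yi nu(1) SL[OF that] by auto
          have "N.expectation (\<lambda>\<omega>. \<bar>Y n ?F \<omega> - (\<Sum>t\<in>S. c t * \<nu> t \<omega>)\<bar>)
              \<le> N.expectation (\<lambda>\<omega>. \<Sum>t\<in>S. \<bar>c t\<bar> * \<bar>Y n t \<omega> - \<nu> t \<omega>\<bar>)"
          proof (rule integral_mono)
            fix \<omega>
            have "Y n ?F \<omega> - (\<Sum>t\<in>S. c t * \<nu> t \<omega>) = (\<Sum>t\<in>S. c t * (Y n t \<omega> - \<nu> t \<omega>))"
              unfolding YF sum_subtractf[symmetric] by (simp add: right_diff_distrib)
            then show "\<bar>Y n ?F \<omega> - (\<Sum>t\<in>S. c t * \<nu> t \<omega>)\<bar> \<le> (\<Sum>t\<in>S. \<bar>c t\<bar> * \<bar>Y n t \<omega> - \<nu> t \<omega>\<bar>)"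
              by (simp add: order_trans[OF sum_abs] abs_mult)
          qed (use iD Yi[OF F] int in auto)
          also have "\<dots> = (\<Sum>t\<in>S. \<bar>c t\<bar> * N.expectation (\<lambda>\<omega>. \<bar>Y n t \<omega> - \<nu> t \<omega>\<bar>))"
            using iD by (simp add: Bochner_Integration.integral_sum)
          finally show "norm (N.expectation (\<lambda>\<omega>. \<bar>Y n ?F \<omega> - (\<Sum>t\<in>S. c t * \<nu> t \<omega>)\<bar>))
            \<le> (\<Sum>t\<in>S. \<bar>c t\<bar> * N.expectation (\<lambda>\<omega>. \<bar>Y n t \<omega> - \<nu> t \<omega>\<bar>))" by simp
        qed
      qed
      show "(\<lambda>k. qproj k ?F) \<longlonglongrightarrow> sqn ?F" by (rule qproj_tendsto[OF F])
    qed
  qed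
  then show ?thesis using N.prob_space_axioms by blast
qed

section \<open>Independence from factorising characteristic functions\<close>

text \<open>
  A characteristic function that factorises yields independence: the coordinates are split off one
  at a time, and the trigonometric factors of the others, shifted to be nonnegative, enter as weights.
\<close>

context prob_space
begin

text \<open>At s = 0 the hypothesis says that c is the mean of h. If c is positive, h / c is a
  probability density and the law of X under it keeps its characteristic function, hence is
  unchanged; if c = 0, then h vanishes almost surely.\<close>

lemma weighted_char_unique:
  fixes h X :: "'a \<Rightarrow> real"
  assumes hm[measurable]: "h \<in> borel_measurable M" and h: "\<And>\<omega>. 0 \<le> h \<omega>" "\<And>\<omega>. h \<omega> \<le> K"
    and X[measurable]: "X \<in> borel_measurable M"
    and char: "\<And>s. (CLINT \<omega>|M. h \<omega> * iexp (s * X \<omega>)) = c * char (distr M borel X) s"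
    and A[measurable]: "A \<in> sets borel"
  shows "expectation (\<lambda>\<omega>. h \<omega> * indicator A (X \<omega>)) = c * measure (distr M borel X) A"
proof -
  have hi: "integrable M h"
    by (rule integrable_const_bound[of _ K]) (use h in auto)
  have "char (distr M borel X) 0 = 1"
    by (intro real_distribution.char_zero real_distribution_distr) measurable
  then have "complex_of_real (expectation h) = complex_of_real c" using char[of 0] by simp
  then have Eh: "expectation h = c" by (simp only: of_real_eq_iff)
  then have c0: "0 \<le> c" using h by (metis Bochner_Integration.integral_nonneg)
  show ?thesis
  proof (cases "c = 0")
    case True
    then have "AE \<omega> in M. h \<omega> = 0" using integral_nonneg_eq_0_iff_AE[OF hi] Eh h by simp
    then have "expectation (\<lambda>\<omega>. h \<omega> * indicator A (X \<omega>)) = expectation (\<lambda>_. 0)"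
      by (intro integral_cong_AE) auto
    then show ?thesis using True by simp
  next
    case False
    then have c: "0 < c" using c0 by simp
    let ?M = "density M (\<lambda>\<omega>. ennreal (h \<omega> / c))"
    have ps: "prob_space ?M"
    proof (rule prob_spaceI)
      have "emeasure ?M (space ?M) = (\<integral>\<^sup>+\<omega>. ennreal (h \<omega> / c) \<partial>M)"
        by (simp add: emeasure_density cong: nn_integral_cong_simp)
      also have "\<dots> = ennreal (expectation (\<lambda>\<omega>. h \<omega> / c))"
        using hi h c by (intro nn_integral_eq_integral) auto
      also have "\<dots> = 1" using Eh c by simp
      finally show "emeasure ?M (space ?M) = 1" .
    qed
    have Xm: "X \<in> borel_measurable ?M" by simp
    have "distr ?M borel X = distr M borel X"
    proof (rule Levy_uniqueness)
      show "char (distr ?M borel X) = char (distr M borel X)"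
      proof
        fix s
        have "char (distr ?M borel X) s = (CLINT \<omega>|M. (h \<omega> / c) *\<^sub>R iexp (s * X \<omega>))"
          unfolding char_def using h c by (subst integral_distr) (auto simp: integral_density)
        also have "\<dots> = (CLINT \<omega>|M. (h \<omega> * iexp (s * X \<omega>)) / c)" by (simp add: scaleR_conv_of_real)
        also have "\<dots> = char (distr M borel X) s" using char c by simp
        finally show "char (distr ?M borel X) s = char (distr M borel X) s" .
      qed
      show "real_distribution (distr ?M borel X)"
        by (rule prob_space.real_distribution_distr[OF ps Xm])
      show "real_distribution (distr M borel X)" by (rule real_distribution_distr) measurable
    qed
    then have "measure (distr ?M borel X) A = measure (distr M borel X) A" by simp
    moreover have "measure (distr ?M borel X) A = expectation (\<lambda>\<omega>. h \<omega> / c * indicator A (X \<omega>))"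
    proof -
      have "measure (distr ?M borel X) A = (\<integral>x. indicator A x \<partial>distr ?M borel X)" by simp
      also have "\<dots> = (\<integral>\<omega>. indicator A (X \<omega>) \<partial>?M)" using Xm by (intro integral_distr) auto
      also have "\<dots> = expectation (\<lambda>\<omega>. (h \<omega> / c) *\<^sub>R indicator A (X \<omega>))"
        using h c by (intro integral_density) auto
      finally show ?thesis by simp
    qed
    ultimately show ?thesis using c by (simp add: field_simps)
  qed
qed

text \<open>When coordinate x is split off, its indicator joins the weight, and the factorisation
  has to be shown again for the new weight. To this end iexp of the remaining sum T is resolved into
  cos T and sin T; as 1 + cos T and 1 + sin T are bounded and nonnegative,
  \<open>weighted_char_unique\<close> applies to coordinate x with each of them as a factor of the
  weight.\<close>

lemma weighted_char_indep:
  fixes B :: "'i \<Rightarrow> 'a \<Rightarrow> real" and g :: "'a \<Rightarrow> real"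
  assumes "finite J" "\<And>j. j \<in> J \<Longrightarrow> B j \<in> borel_measurable M"
    and "g \<in> borel_measurable M" "\<And>\<omega>. 0 \<le> g \<omega>" "\<And>\<omega>. g \<omega> \<le> K"
    and "\<And>\<theta>. (CLINT \<omega>|M. g \<omega> * iexp (\<Sum>j\<in>J. \<theta> j * B j \<omega>)) = expectation g * (\<Prod>j\<in>J. char (distr M borel (B j)) (\<theta> j))"
    and "\<And>j. j \<in> J \<Longrightarrow> A j \<in> sets borel"
  shows "expectation (\<lambda>\<omega>. g \<omega> * (\<Prod>j\<in>J. indicator (A j) (B j \<omega>))) = expectation g * (\<Prod>j\<in>J. measure (distr M borel (B j)) (A j))"
  using assms
proof (induction J arbitrary: g rule: finite_induct)
  case (insert x F)
  note meas = insert.prems(1) and gm[measurable] = insert.prems(2) and g0 = insert.prems(3) and gK = insert.prems(4)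
    and char = insert.prems(5) and A = insert.prems(6)
  have [measurable]: "B x \<in> borel_measurable M" "A x \<in> sets borel" using meas A by auto
  have BF[measurable]: "\<And>j. j \<in> F \<Longrightarrow> B j \<in> borel_measurable M" using meas by auto
  have gb: "\<bar>g \<omega>\<bar> \<le> K" for \<omega> using g0[of \<omega>] gK[of \<omega>] by simp
  have gi: "integrable M g" by (rule integrable_const_bound[of _ K]) (use gb in auto)
  let ?\<phi> = "\<lambda>j. char (distr M borel (B j))"
  let ?p = "measure (distr M borel (B x)) (A x)"
  define T where "T \<theta> \<omega> = (\<Sum>j\<in>F. \<theta> j * B j \<omega>)" for \<theta> \<omega>
  define w where "w \<theta> = (\<Prod>j\<in>F. ?\<phi> j (\<theta> j))" for \<theta>
  have Tm[measurable]: "T \<theta> \<in> borel_measurable M" for \<theta> unfolding T_def[abs_def] by measurable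
  have ch: "(CLINT \<omega>|M. g \<omega> * iexp (s * B x \<omega> + T \<theta> \<omega>)) = expectation g * ?\<phi> x s * w \<theta>" for s \<theta>
  proof -
    have F: "(\<Sum>j\<in>F. (if j = x then s else \<theta> j) * B j \<omega>) = T \<theta> \<omega>" for \<omega>
      unfolding T_def using insert.hyps by (intro sum.cong) auto
    have G: "(\<Prod>j\<in>F. ?\<phi> j (if j = x then s else \<theta> j)) = w \<theta>"
      unfolding w_def using insert.hyps by (intro prod.cong) auto
    show ?thesis using char[of "\<lambda>j. if j = x then s else \<theta> j"] insert.hyps
      by (simp only: sum.insert prod.insert F G if_True simp_thms mult.assoc)
  qed
  have ie: "integrable M (\<lambda>\<omega>. g \<omega> * iexp (f \<omega>))" if [measurable]: "f \<in> borel_measurable M" for f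
    by (rule integrable_const_bound[of _ K]) (use gb in \<open>auto simp: norm_mult\<close>)
  have cos_eq: "complex_of_real (cos t) = (iexp t + iexp (- t)) / 2" for t
    using cos_exp_eq[of "complex_of_real t"] by (simp add: cos_of_real)
  have sin_eq: "complex_of_real (sin t) = (iexp t - iexp (- t)) / (2 * \<i>)" for t
    using sin_exp_eq[of "complex_of_real t"] by (simp add: sin_of_real)
  have wm: "w (\<lambda>j. - \<theta> j) = cnj (w \<theta>)" for \<theta>
  proof -
    have "?\<phi> j (- t) = cnj (?\<phi> j t)" if "j \<in> F" for j t
    proof -
      have "?\<phi> j (- t) = (CLINT \<omega>|M. cnj (iexp (t * B j \<omega>)))"
        using BF[OF that] by (simp add: char_def integral_distr exp_cnj)
      also have "\<dots> = cnj (CLINT \<omega>|M. iexp (t * B j \<omega>))" by (rule Bochner_Integration.integral_cnj)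
      finally show ?thesis using BF[OF that] by (simp add: char_def integral_distr)
    qed
    then show ?thesis unfolding w_def by (simp add: cnj_prod)
  qed
  have Tneg: "T (\<lambda>j. - \<theta> j) \<omega> = - T \<theta> \<omega>" for \<theta> \<omega> by (simp add: T_def sum_negf)
  have T0: "T (\<lambda>_. 0) \<omega> = 0" for \<omega> by (simp add: T_def)
  have w0: "w (\<lambda>_. 0) = 1"
    unfolding w_def
    by (intro prod.neutral ballI real_distribution.char_zero real_distribution_distr) (rule BF)
  have iexp_add: "iexp (a + b) = iexp a * iexp b" for a b
    by (simp add: distrib_left exp_add)
  \<comment> \<open>Cosine and sine are both of the form c1 * iexp t + c2 * iexp (- t). The
    factorisation at \<theta> and at - \<theta> evaluates the two parts, and \<open>r\<close> is the
    same combination of \<open>w \<theta>\<close> and its conjugate.\<close>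
  have comb: "(CLINT \<omega>|M. (g \<omega> * (1 + f (T \<theta> \<omega>))) * iexp (s * B x \<omega>)) = (expectation g * (1 + r)) * ?\<phi> x s"
    if f: "\<And>t. complex_of_real (f t) = iexp t * c1 + iexp (- t) * c2"
      and r: "complex_of_real r = w \<theta> * c1 + cnj (w \<theta>) * c2" for f r c1 c2 s \<theta>
  proof -
    have "(CLINT \<omega>|M. (g \<omega> * (1 + f (T \<theta> \<omega>))) * iexp (s * B x \<omega>))
      = (CLINT \<omega>|M. g \<omega> * iexp (s * B x \<omega> + T (\<lambda>_. 0) \<omega>) + (g \<omega> * iexp (s * B x \<omega> + T \<theta> \<omega>) * c1
          + g \<omega> * iexp (s * B x \<omega> + T (\<lambda>j. - \<theta> j) \<omega>) * c2))"
    proof (intro Bochner_Integration.integral_cong refl)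
      fix \<omega>
      have alg: "G * (1 + (P * c1 + Q * c2)) * E = G * E + (G * (E * P) * c1 + G * (E * Q) * c2)" for G P Q E :: complex
        by (simp add: algebra_simps)
      have "complex_of_real (g \<omega> * (1 + f (T \<theta> \<omega>))) * iexp (s * B x \<omega>)
        = complex_of_real (g \<omega>) * (1 + (iexp (T \<theta> \<omega>) * c1 + iexp (- T \<theta> \<omega>) * c2)) * iexp (s * B x \<omega>)"
        by (simp only: of_real_mult of_real_add of_real_1 f)
      then show "complex_of_real (g \<omega> * (1 + f (T \<theta> \<omega>))) * iexp (s * B x \<omega>) =
        complex_of_real (g \<omega>) * iexp (s * B x \<omega> + T (\<lambda>_. 0) \<omega>) +
        (complex_of_real (g \<omega>) * iexp (s * B x \<omega> + T \<theta> \<omega>) * c1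
          + complex_of_real (g \<omega>) * iexp (s * B x \<omega> + T (\<lambda>j. - \<theta> j) \<omega>) * c2)"
        unfolding alg Tneg T0 add_0_right iexp_add by simp
    qed
    also have "\<dots> = (CLINT \<omega>|M. g \<omega> * iexp (s * B x \<omega> + T (\<lambda>_. 0) \<omega>)) + ((CLINT \<omega>|M. g \<omega> * iexp (s * B x \<omega> + T \<theta> \<omega>)) * c1
          + (CLINT \<omega>|M. g \<omega> * iexp (s * B x \<omega> + T (\<lambda>j. - \<theta> j) \<omega>)) * c2)"
    proof -
      have "(CLINT \<omega>|M. F \<omega> + (G \<omega> * c1 + H \<omega> * c2)) = (CLINT \<omega>|M. F \<omega>) + ((CLINT \<omega>|M. G \<omega>) * c1 + (CLINT \<omega>|M. H \<omega>) * c2)"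
        if "integrable M F" "integrable M G" "integrable M H" for F G H :: "'a \<Rightarrow> complex"
        using that by simp
      note lin = this
      show ?thesis by (rule lin) (rule ie, measurable)+
    qed
    also have "\<dots> = expectation g * ?\<phi> x s * 1 + (expectation g * ?\<phi> x s * w \<theta> * c1 + expectation g * ?\<phi> x s * cnj (w \<theta>) * c2)"
      unfolding ch wm w0 ..
    also have "\<dots> = expectation g * (1 + (w \<theta> * c1 + cnj (w \<theta>) * c2)) * ?\<phi> x s" by (simp add: algebra_simps)
    also have "\<dots> = (expectation g * (1 + r)) * ?\<phi> x s" unfolding r[symmetric] by simp
    finally show ?thesis .
  qed
  have cosw: "(CLINT \<omega>|M. (g \<omega> * (1 + cos (T \<theta> \<omega>))) * iexp (s * B x \<omega>)) = (expectation g * (1 + Re (w \<theta>))) * ?\<phi> x s" for s \<theta>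
  proof (rule comb[of cos "1 / 2" "1 / 2" "Re (w \<theta>)" \<theta> s])
    show "complex_of_real (Re (w \<theta>)) = w \<theta> * (1 / 2) + cnj (w \<theta>) * (1 / 2)" by (simp add: complex_eq_iff)
  qed (simp add: cos_eq add_divide_distrib)
  have sinw: "(CLINT \<omega>|M. (g \<omega> * (1 + sin (T \<theta> \<omega>))) * iexp (s * B x \<omega>)) = (expectation g * (1 + Im (w \<theta>))) * ?\<phi> x s" for s \<theta>
  proof (rule comb[of sin "- \<i> / 2" "\<i> / 2" "Im (w \<theta>)" \<theta> s])
    show "complex_of_real (Im (w \<theta>)) = w \<theta> * (- \<i> / 2) + cnj (w \<theta>) * (\<i> / 2)" by (simp add: complex_eq_iff)
    show "complex_of_real (sin t) = iexp t * (- \<i> / 2) + iexp (- t) * (\<i> / 2)" for t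
      by (simp add: sin_eq field_simps)
  qed
  let ?I = "\<lambda>\<omega>. indicator (A x) (B x \<omega>) :: real"
  have bnd: "0 \<le> g \<omega> * (1 + t)" "g \<omega> * (1 + t) \<le> K * 2" if "\<bar>t\<bar> \<le> 1" for \<omega> t
    using that g0[of \<omega>] gK[of \<omega>] by (auto intro!: mult_mono mult_nonneg_nonneg)
  have EI: "expectation (\<lambda>\<omega>. (g \<omega> * (1 + cos (T \<theta> \<omega>))) * ?I \<omega>) = expectation g * (1 + Re (w \<theta>)) * ?p"
    "expectation (\<lambda>\<omega>. (g \<omega> * (1 + sin (T \<theta> \<omega>))) * ?I \<omega>) = expectation g * (1 + Im (w \<theta>)) * ?p" for \<theta>
    by (rule weighted_char_unique[where K = "K * 2"]; use bnd cosw sinw in simp)+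
  have iI: "integrable M (\<lambda>\<omega>. g \<omega> * ?I \<omega> * t \<omega>)" if [measurable]: "t \<in> borel_measurable M" and "\<And>\<omega>. \<bar>t \<omega>\<bar> \<le> 1" for t
  proof (rule integrable_const_bound[of _ K])
    show "AE \<omega> in M. norm (g \<omega> * ?I \<omega> * t \<omega>) \<le> K"
    proof (rule AE_I2)
      fix \<omega>
      have "\<bar>g \<omega> * ?I \<omega> * t \<omega>\<bar> \<le> g \<omega> * 1 * 1" unfolding abs_mult
        using g0[of \<omega>] that(2)[of \<omega>] by (intro mult_mono) (auto simp: indicator_def)
      then show "norm (g \<omega> * ?I \<omega> * t \<omega>) \<le> K" using gK[of \<omega>] by simp
    qed
  qed measurable
  have E0: "expectation (\<lambda>\<omega>. g \<omega> * ?I \<omega>) = expectation g * ?p"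
  proof (rule weighted_char_unique[OF gm g0 gK])
    show "(CLINT \<omega>|M. g \<omega> * iexp (s * B x \<omega>)) = expectation g * ?\<phi> x s" for s
      using ch[of s "\<lambda>_. 0"] by (simp add: T0 w0)
  qed measurable
  \<comment> \<open>Subtracting the identity for the weight g alone removes the 1 that made the
    trigonometric factors nonnegative.\<close>
  have Ecos: "expectation (\<lambda>\<omega>. g \<omega> * ?I \<omega> * cos (T \<theta> \<omega>)) = expectation g * ?p * Re (w \<theta>)"
    and Esin: "expectation (\<lambda>\<omega>. g \<omega> * ?I \<omega> * sin (T \<theta> \<omega>)) = expectation g * ?p * Im (w \<theta>)" for \<theta>
  proof -
    have i: "integrable M (\<lambda>\<omega>. g \<omega> * ?I \<omega>)" using iI[of "\<lambda>_. 1"] by simp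
    have ic: "integrable M (\<lambda>\<omega>. g \<omega> * ?I \<omega> * cos (T \<theta> \<omega>))" "integrable M (\<lambda>\<omega>. g \<omega> * ?I \<omega> * sin (T \<theta> \<omega>))"
      by (auto intro!: iI)
    have "expectation (\<lambda>\<omega>. (g \<omega> * (1 + cos (T \<theta> \<omega>))) * ?I \<omega>) = expectation (\<lambda>\<omega>. g \<omega> * ?I \<omega>) + expectation (\<lambda>\<omega>. g \<omega> * ?I \<omega> * cos (T \<theta> \<omega>))"
      using i ic(1) by (simp add: algebra_simps)
    then show "expectation (\<lambda>\<omega>. g \<omega> * ?I \<omega> * cos (T \<theta> \<omega>)) = expectation g * ?p * Re (w \<theta>)"
      using EI(1)[of \<theta>] E0 by (simp add: algebra_simps)
    have "expectation (\<lambda>\<omega>. (g \<omega> * (1 + sin (T \<theta> \<omega>))) * ?I \<omega>) = expectation (\<lambda>\<omega>. g \<omega> * ?I \<omega>) + expectation (\<lambda>\<omega>. g \<omega> * ?I \<omega> * sin (T \<theta> \<omega>))"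
      using i ic(2) by (simp add: algebra_simps)
    then show "expectation (\<lambda>\<omega>. g \<omega> * ?I \<omega> * sin (T \<theta> \<omega>)) = expectation g * ?p * Im (w \<theta>)"
      using EI(2)[of \<theta>] E0 by (simp add: algebra_simps)
  qed
  have "expectation (\<lambda>\<omega>. (g \<omega> * ?I \<omega>) * (\<Prod>j\<in>F. indicator (A j) (B j \<omega>)))
      = expectation (\<lambda>\<omega>. g \<omega> * ?I \<omega>) * (\<Prod>j\<in>F. measure (distr M borel (B j)) (A j))"
  proof (rule insert.IH)
    fix \<theta>
    have "(CLINT \<omega>|M. (g \<omega> * ?I \<omega>) * iexp (\<Sum>j\<in>F. \<theta> j * B j \<omega>))
      = (CLINT \<omega>|M. complex_of_real (g \<omega> * ?I \<omega> * cos (T \<theta> \<omega>)) + \<i> * complex_of_real (g \<omega> * ?I \<omega> * sin (T \<theta> \<omega>)))"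
      unfolding T_def[symmetric]
      by (intro Bochner_Integration.integral_cong refl) (simp add: exp_Euler cos_of_real sin_of_real algebra_simps)
    also have "\<dots> = complex_of_real (expectation g * ?p * Re (w \<theta>)) + \<i> * complex_of_real (expectation g * ?p * Im (w \<theta>))"
    proof -
      have "integrable M (\<lambda>\<omega>. complex_of_real (g \<omega> * ?I \<omega> * cos (T \<theta> \<omega>)))"
        "integrable M (\<lambda>\<omega>. \<i> * complex_of_real (g \<omega> * ?I \<omega> * sin (T \<theta> \<omega>)))"
        by (intro integrable_of_real integrable_mult_right iI; simp)+
      then show ?thesis unfolding Ecos[symmetric] Esin[symmetric]
        by (simp only: Bochner_Integration.integral_add integral_mult_right_zero integral_complex_of_real)
    qed
    also have "\<dots> = expectation g * ?p * w \<theta>" by (simp add: complex_eq_iff)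
    also have "\<dots> = expectation (\<lambda>\<omega>. g \<omega> * ?I \<omega>) * (\<Prod>j\<in>F. char (distr M borel (B j)) (\<theta> j))"
      by (simp add: E0 w_def)
    finally show "(CLINT \<omega>|M. (g \<omega> * ?I \<omega>) * iexp (\<Sum>j\<in>F. \<theta> j * B j \<omega>))
      = expectation (\<lambda>\<omega>. g \<omega> * ?I \<omega>) * (\<Prod>j\<in>F. char (distr M borel (B j)) (\<theta> j))" .
  next
    show "0 \<le> g \<omega> * ?I \<omega>" "g \<omega> * ?I \<omega> \<le> K" for \<omega>
      using g0[of \<omega>] gK[of \<omega>] by (auto simp: indicator_def)
  qed (use BF A in auto)
  then show ?case using insert.hyps E0 by (simp add: mult.assoc)
qed simp

theorem char_product_imp_distr_PiM:
  fixes B :: "'i \<Rightarrow> 'a \<Rightarrow> real"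
  assumes J: "finite J" and B: "\<And>j. j \<in> J \<Longrightarrow> B j \<in> borel_measurable M"
    and char: "\<And>\<theta>. (CLINT \<omega>|M. iexp (\<Sum>j\<in>J. \<theta> j * B j \<omega>)) = (\<Prod>j\<in>J. char (distr M borel (B j)) (\<theta> j))"
  shows "distr M (\<Pi>\<^sub>M j\<in>J. borel) (\<lambda>\<omega>. \<lambda>j\<in>J. B j \<omega>) = (\<Pi>\<^sub>M j\<in>J. distr M borel (B j))"
proof -
  \<comment> \<open>\<open>product_sigma_finite\<close> speaks about every index, so a point mass is
    placed outside J.\<close>
  define D where "D j = (if j \<in> J then distr M borel (B j) else return borel 0)" for j
  have D: "prob_space (D j)" for j
    unfolding D_def using B by (auto intro: prob_space_distr prob_space_return)
  interpret product_sigma_finite D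
    unfolding product_sigma_finite_def using D prob_space_imp_sigma_finite by blast
  have [measurable]: "(\<lambda>\<omega>. \<lambda>j\<in>J. B j \<omega>) \<in> measurable M (\<Pi>\<^sub>M j\<in>J. borel)"
    using B by (intro measurable_restrict) auto
  have "distr M (\<Pi>\<^sub>M j\<in>J. borel) (\<lambda>\<omega>. \<lambda>j\<in>J. B j \<omega>) = Pi\<^sub>M J D"
  proof (rule PiM_eqI[OF J])
    show "sets (distr M (\<Pi>\<^sub>M j\<in>J. borel) (\<lambda>\<omega>. \<lambda>j\<in>J. B j \<omega>)) = sets (Pi\<^sub>M J D)"
      by (simp add: D_def cong: sets_PiM_cong)
    fix A assume A: "\<And>i. i \<in> J \<Longrightarrow> A i \<in> sets (D i)"
    then have A': "\<And>i. i \<in> J \<Longrightarrow> A i \<in> sets borel" by (simp add: D_def)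
    have "emeasure (distr M (\<Pi>\<^sub>M j\<in>J. borel) (\<lambda>\<omega>. \<lambda>j\<in>J. B j \<omega>)) (Pi\<^sub>E J A)
        = emeasure M {\<omega>\<in>space M. \<forall>j\<in>J. B j \<omega> \<in> A j}"
      using A' J by (subst emeasure_distr) (auto intro!: arg_cong[where f = "emeasure M"] sets_PiM_I_finite simp: PiE_iff)
    also have "\<dots> = ennreal (expectation (\<lambda>\<omega>. 1 * (\<Prod>j\<in>J. indicator (A j) (B j \<omega>))))"
    proof -
      have "emeasure M {\<omega>\<in>space M. \<forall>j\<in>J. B j \<omega> \<in> A j} = ennreal (prob {\<omega>\<in>space M. \<forall>j\<in>J. B j \<omega> \<in> A j})"
        by (rule emeasure_eq_measure)
      also have "prob {\<omega>\<in>space M. \<forall>j\<in>J. B j \<omega> \<in> A j} = expectation (indicator {\<omega>\<in>space M. \<forall>j\<in>J. B j \<omega> \<in> A j})"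
        by (simp add: Int_absorb2 subset_eq)
      also have "\<dots> = expectation (\<lambda>\<omega>. 1 * (\<Prod>j\<in>J. indicator (A j) (B j \<omega>)))"
      proof (rule Bochner_Integration.integral_cong[OF refl])
        fix \<omega> assume "\<omega> \<in> space M"
        then show "indicator {\<omega>\<in>space M. \<forall>j\<in>J. B j \<omega> \<in> A j} \<omega> = 1 * (\<Prod>j\<in>J. indicator (A j) (B j \<omega>) :: real)"
          using J by (auto simp: indicator_def prod_zero_iff)
      qed
      finally show ?thesis .
    qed
    also have "expectation (\<lambda>\<omega>. 1 * (\<Prod>j\<in>J. indicator (A j) (B j \<omega>)))
        = expectation (\<lambda>_. 1) * (\<Prod>j\<in>J. measure (distr M borel (B j)) (A j))"
      by (rule weighted_char_indep[OF J B, where K = 1]) (use char A' in \<open>auto simp: prob_space\<close>)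
    also have "ennreal \<dots> = (\<Prod>j\<in>J. emeasure (D j) (A j))"
    proof -
      have "emeasure (D j) (A j) = ennreal (measure (distr M borel (B j)) (A j))" if "j \<in> J" for j
      proof -
        interpret D: prob_space "distr M borel (B j)" using B that by (intro prob_space_distr) auto
        show ?thesis using that by (simp add: D_def D.emeasure_eq_measure)
      qed
      then show ?thesis by (simp add: prob_space prod_ennreal)
    qed
    finally show "emeasure (distr M (\<Pi>\<^sub>M j\<in>J. borel) (\<lambda>\<omega>. \<lambda>j\<in>J. B j \<omega>)) (Pi\<^sub>E J A) = (\<Prod>j\<in>J. emeasure (D j) (A j))" .
  qed
  also have "Pi\<^sub>M J D = (\<Pi>\<^sub>M j\<in>J. distr M borel (B j))" by (rule PiM_cong) (auto simp: D_def)
  finally show ?thesis .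
qed

end

section \<open>Step approximation of functions of bounded variation\<close>

lemma dcell_unique: "x \<in> dcell N m \<Longrightarrow> x \<in> dcell N m' \<Longrightarrow> 0 < N \<Longrightarrow> m = m'"
proof (rule ccontr)
  assume x: "x \<in> dcell N m" "x \<in> dcell N m'" and N: "0 < N" and ne: "m \<noteq> m'"
  then have "real m < N * x" "N * x \<le> m + 1" "real m' < N * x" "N * x \<le> m' + 1"
    by (auto simp: dcell_def field_simps)
  then have "real m < m' + 1" "real m' < m + 1" by linarith+
  then show False using ne by linarith
qed

lemma dcell_exists:
  assumes "x \<in> {0<..1}" "0 < N" shows "\<exists>m<N. x \<in> dcell N m"
proof (rule ccontr)
  assume "\<not> ?thesis"
  then have "(\<Sum>m<N. indicator (dcell N m) x) = (0 :: real)" by (intro sum.neutral) auto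
  then show False using sum_indicator_dcell[OF assms] by simp
qed

definition tag_step :: "nat \<Rightarrow> (real \<Rightarrow> real) \<Rightarrow> real \<Rightarrow> real" where
  "tag_step k f x = (\<Sum>m<16 ^ k. f (tag k m) * indicator (dcell (16 ^ k) m) x)"

lemma tag_step_eq:
  assumes "x \<in> dcell (16 ^ k) m" "m < 16 ^ k" shows "tag_step k f x = f (tag k m)"
proof -
  have "tag_step k f x = (\<Sum>m'<16 ^ k. if m' = m then f (tag k m) else 0)"
    unfolding tag_step_def
  proof (rule sum.cong[OF refl])
    fix m' :: nat
    have "x \<in> dcell (16 ^ k) m' \<longleftrightarrow> m' = m"
      using dcell_unique[OF assms(1), of m'] assms(1) by auto
    then show "f (tag k m') * indicator (dcell (16 ^ k) m') x = (if m' = m then f (tag k m) else 0)"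
      by (simp add: indicator_def)
  qed
  also have "\<dots> = f (tag k m)" using assms(2) by (subst sum.delta) auto
  finally show ?thesis .
qed

lemma tag_in_unit: "m < 16 ^ k \<Longrightarrow> tag k m \<in> {0..1}"
proof -
  assume "m < 16 ^ k"
  then have "Suc m \<le> 16 ^ k" by simp
  then have "real (Suc m) \<le> 16 ^ k" by (metis of_nat_le_iff of_nat_numeral of_nat_power)
  then show ?thesis by auto
qed

lemma tag_step_measurable [measurable]: "tag_step k f \<in> borel_measurable unit_leb"
  unfolding tag_step_def[abs_def]
proof (intro borel_measurable_sum borel_measurable_times borel_measurable_const)
  fix m :: nat assume "m \<in> {..<16 ^ k}"
  then have "m < 16 ^ k" by simp
  then show "indicator (dcell (16 ^ k) m) \<in> borel_measurable unit_leb"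
    by (rule borel_measurable_indicator[OF sets_dcell])
qed

lemma finite_separated:
  fixes G :: "real set"
  assumes "finite G" shows "\<exists>K. \<forall>s\<in>G. \<forall>t\<in>G. s \<noteq> t \<longrightarrow> 1 / 16 ^ K < \<bar>s - t\<bar>"
proof -
  have "\<forall>\<^sub>F K in sequentially. s \<noteq> t \<longrightarrow> 1 / 16 ^ K < \<bar>s - t\<bar>" for s t :: real
  proof (cases "s = t")
    case False
    have "(\<lambda>K. (1 / 16 :: real) ^ K) \<longlonglongrightarrow> 0" by (rule LIMSEQ_power_zero) simp
    moreover have "0 < \<bar>s - t\<bar>" using False by simp
    ultimately have "\<forall>\<^sub>F K in sequentially. (1 / 16 :: real) ^ K < \<bar>s - t\<bar>" by (rule order_tendstoD(2))
    then show ?thesis by eventually_elim (simp only: power_one_over simp_thms)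
  qed simp
  then have "\<forall>\<^sub>F K in sequentially. \<forall>s\<in>G. \<forall>t\<in>G. s \<noteq> t \<longrightarrow> 1 / 16 ^ K < \<bar>s - t\<bar>"
    using assms by (intro eventually_ball_finite ballI)
  then show ?thesis by (auto simp: eventually_sequentially)
qed

text \<open>The tag of the cell of x lies at or to the right of x and tends to x, so convergence can
  fail only where f is not continuous from the right. Bounded q-variation allows only about (j + 1)
  powr q points at which a deviation of size 1 / (j + 1) recurs at arbitrarily fine levels; the
  exceptional points thus form a countable union of finite sets.\<close>

lemma tag_step_tendsto:
  assumes f: "f \<in> qvar_ball q" and q: "1 \<le> q"
  shows "\<exists>C. countable C \<and> (\<forall>x\<in>{0<..1} - C. (\<lambda>k. tag_step k f x) \<longlonglongrightarrow> f x)"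
proof -
  define E where "E j = {x\<in>{0<..1}. \<forall>K. \<exists>k\<ge>K. 1 / real (Suc j) \<le> \<bar>tag_step k f x - f x\<bar>}" for j
  have "finite (E j)" for j
  proof -
    have "card G \<le> nat \<lceil>real (Suc j) powr q\<rceil>" if G: "G \<subseteq> E j" "finite G" for G
    proof -
      obtain K where K: "\<And>s t. s \<in> G \<Longrightarrow> t \<in> G \<Longrightarrow> s \<noteq> t \<Longrightarrow> 1 / 16 ^ K < \<bar>s - t\<bar>"
        using finite_separated[OF G(2)] by blast
      let ?N = "16 ^ K :: nat"
      \<comment> \<open>Level K separates the points of G into different cells. A deviation at a
        finer level k supplies a second point y for the cell of x, since the cell of x at level k
        ends no later than its cell at level K.\<close>
      have "\<forall>x\<in>G. \<exists>m y. m < ?N \<and> x \<in> dcell ?N m \<and> y \<in> {x..real (Suc m) / ?N} \<and> 1 / real (Suc j) \<le> \<bar>f y - f x\<bar>"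
      proof
        fix x assume "x \<in> G"
        then have x: "x \<in> {0<..1}" "\<exists>k\<ge>K. 1 / real (Suc j) \<le> \<bar>tag_step k f x - f x\<bar>" using G by (auto simp: E_def)
        obtain m where m: "m < ?N" "x \<in> dcell ?N m" using dcell_exists[OF x(1), of ?N] by auto
        obtain k where k: "K \<le> k" "1 / real (Suc j) \<le> \<bar>tag_step k f x - f x\<bar>" using x(2) by blast
        obtain m' where m': "m' < 16 ^ k" "x \<in> dcell (16 ^ k) m'" using dcell_exists[OF x(1), of "16 ^ k"] by auto
        have kK: "(16::real) ^ k = 16 ^ (k - K) * 16 ^ K" using k(1) by (simp flip: power_add)
        have a: "real m' < 16 ^ k * x" "16 ^ K * x \<le> real (Suc m)" "x \<le> tag k m'"
          using m' m by (auto simp: dcell_def field_simps)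
        have "16 ^ (k - K) * (16 ^ K * x) \<le> 16 ^ (k - K) * real (Suc m)"
          by (rule mult_left_mono[OF a(2)]) simp
        with a(1) have "real m' < 16 ^ (k - K) * real (Suc m)" unfolding kK mult.assoc by (rule less_le_trans)
        also have "\<dots> = real (16 ^ (k - K) * Suc m)" by (simp only: of_nat_mult of_nat_power of_nat_numeral)
        finally have "real m' < real (16 ^ (k - K) * Suc m)" .
        then have "m' < 16 ^ (k - K) * Suc m" by (simp only: of_nat_less_iff)
        then have "Suc m' \<le> 16 ^ (k - K) * Suc m" by simp
        then have "real (Suc m') \<le> real (16 ^ (k - K) * Suc m)" by (simp only: of_nat_le_iff)
        also have "\<dots> = 16 ^ (k - K) * real (Suc m)" by (simp only: of_nat_mult of_nat_power of_nat_numeral)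
        finally have "real (Suc m') \<le> 16 ^ (k - K) * real (Suc m)" .
        then have "tag k m' \<le> 16 ^ (k - K) * real (Suc m) / 16 ^ k" by (rule divide_right_mono) simp
        also have "\<dots> = real (Suc m) / ?N" unfolding kK by simp
        finally have "tag k m' \<le> real (Suc m) / ?N" .
        then show "\<exists>m y. m < ?N \<and> x \<in> dcell ?N m \<and> y \<in> {x..real (Suc m) / ?N} \<and> 1 / real (Suc j) \<le> \<bar>f y - f x\<bar>"
          using m a(3) k(2) tag_step_eq[OF m'(2,1)] by (intro exI[of _ m] exI[of _ "tag k m'"]) auto
      qed
      then obtain m y where my: "\<And>x. x \<in> G \<Longrightarrow> m x < ?N" "\<And>x. x \<in> G \<Longrightarrow> x \<in> dcell ?N (m x)"
        "\<And>x. x \<in> G \<Longrightarrow> y x \<in> {x..real (Suc (m x)) / ?N}" "\<And>x. x \<in> G \<Longrightarrow> 1 / real (Suc j) \<le> \<bar>f (y x) - f x\<bar>"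
        by metis
      have inj: "inj_on m G"
      proof (rule inj_onI, rule ccontr)
        fix s t assume st: "s \<in> G" "t \<in> G" "m s = m t" "s \<noteq> t"
        have "s \<in> dcell ?N (m s)" "t \<in> dcell ?N (m s)" using my(2)[OF st(1)] my(2)[OF st(2)] st(3) by simp_all
        then have "\<bar>s - t\<bar> \<le> 1 / 16 ^ K" by (auto simp: dcell_def add_divide_distrib abs_le_iff)
        then show False using K[OF st(1,2,4)] by simp
      qed
      \<comment> \<open>Cells without a point of G get the same dummy point in \<open>X\<close> and
        \<open>Y\<close>, which contributes nothing.\<close>
      define X where "X l = (if l \<in> m ` G then inv_into G m l else real l / ?N)" for l
      define Y where "Y l = (if l \<in> m ` G then y (inv_into G m l) else real l / ?N)" for l
      have Xm: "X (m x) = x" "Y (m x) = y x" if "x \<in> G" for x using that inj by (auto simp: X_def Y_def)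
      have "card G * (1 / real (Suc j)) powr q = (\<Sum>x\<in>G. (1 / real (Suc j)) powr q)" by simp
      also have "\<dots> \<le> (\<Sum>x\<in>G. \<bar>f (Y (m x)) - f (X (m x))\<bar> powr q)"
        using my(4) q Xm by (intro sum_mono powr_mono2) auto
      also have "\<dots> = (\<Sum>l\<in>m ` G. \<bar>f (Y l) - f (X l)\<bar> powr q)" using inj by (simp add: sum.reindex)
      also have "\<dots> \<le> (\<Sum>l<?N. \<bar>f (Y l) - f (X l)\<bar> powr q)" using my(1) by (intro sum_mono2) auto
      also have "\<dots> \<le> 1"
      proof (rule qvar_ball_cells[OF f q])
        fix l assume "l < ?N"
        show "Y l \<in> {real l / ?N .. real (Suc l) / ?N}"
        proof (cases "l \<in> m ` G")
          case True
          then obtain x where x: "x \<in> G" "l = m x" by auto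
          then show ?thesis using my(2,3)[OF x(1)] Xm[OF x(1)] by (auto simp: dcell_def)
        qed (auto simp: Y_def field_simps)
        show "X l \<in> {real l / ?N .. real (Suc l) / ?N}"
        proof (cases "l \<in> m ` G")
          case True
          then obtain x where x: "x \<in> G" "l = m x" by auto
          then show ?thesis using my(2)[OF x(1)] Xm[OF x(1)] by (auto simp: dcell_def)
        qed (auto simp: X_def field_simps)
      qed simp
      finally have "card G \<le> real (Suc j) powr q" by (simp add: powr_divide field_simps)
      then show ?thesis by linarith
    qed
    then show ?thesis using finite_if_finite_subsets_card_bdd by blast
  qed
  then have "countable (E j)" for j by (rule countable_finite)
  then have "countable (\<Union>j. E j)" by simp
  moreover have "(\<lambda>k. tag_step k f x) \<longlonglongrightarrow> f x" if x: "x \<in> {0<..1} - (\<Union>j. E j)" for x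
  proof (rule LIMSEQ_I)
    fix e :: real assume "0 < e"
    then obtain j where j: "1 / real (Suc j) < e" using nat_approx_posE by metis
    from x have "\<not> (\<forall>K. \<exists>k\<ge>K. 1 / real (Suc j) \<le> \<bar>tag_step k f x - f x\<bar>)" unfolding E_def by blast
    then obtain K where "\<forall>k\<ge>K. \<bar>tag_step k f x - f x\<bar> < 1 / real (Suc j)" by (meson not_le)
    then show "\<exists>K. \<forall>k\<ge>K. norm (tag_step k f x - f x) < e" using j by (intro exI[of _ K]) fastforce
  qed
  ultimately show ?thesis by blast
qed

text \<open>Outside a countable set f is a limit of step functions, which gives measurability. On
  the interval f and the step functions are bounded by 1, so 4 dominates the squared
  differences.\<close>

lemma qvar_ball_L2:
  assumes f: "f \<in> qvar_ball q" and q: "1 \<le> q"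
  shows qvar_ball_L2_unit: "f \<in> L2_unit" and tag_step_L2m: "tag_step k f \<in> L2m"
    and sqn_tag_step: "(\<lambda>k. sqn (\<lambda>x. f x - tag_step k f x)) \<longlonglongrightarrow> 0"
proof -
  obtain C where C: "countable C" "\<And>x. x \<in> {0<..1} - C \<Longrightarrow> (\<lambda>k. tag_step k f x) \<longlonglongrightarrow> f x"
    using tag_step_tendsto[OF f q] by blast
  have fm: "f \<in> borel_measurable unit_leb"
  proof (rule measurable_discrete_difference[where X = "(C \<union> {0}) \<inter> {0..1}"])
    show "(\<lambda>x. lim (\<lambda>k. tag_step k f x)) \<in> borel_measurable unit_leb" by measurable
    show "countable ((C \<union> {0}) \<inter> {0..1})" using C(1) by (simp add: countable_Int1)
    show "{x} \<in> sets unit_leb" if "x \<in> (C \<union> {0}) \<inter> {0..1}" for x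
      using that by (subst sets_restrict_space_iff) auto
    show "lim (\<lambda>k. tag_step k f x) = f x" if "x \<in> space unit_leb" "x \<notin> (C \<union> {0}) \<inter> {0..1}" for x
      using that by (intro limI C(2)) (auto simp: space_restrict_space less_le)
  qed auto
  have f1: "\<bar>f x\<bar> \<le> 1" if "x \<in> {0..1}" for x using qvar_ball_abs_le[OF f q that] .
  have fL: "f \<in> L2m" using fm f1 by (rule L2m_bounded)
  then show "f \<in> L2_unit" using f fm by (auto simp: L2_unit_def L2m_def qvar_ball_def qvar_space_def)
  have t1: "\<bar>tag_step k f x\<bar> \<le> 1" if "x \<in> {0..1}" for x k
  proof (cases "x = 0")
    case True
    then have "tag_step k f x = 0" unfolding tag_step_def by (intro sum.neutral) (auto simp: dcell_def indicator_def field_simps)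
    then show ?thesis by simp
  next
    case False
    then have "x \<in> {0<..1}" using that by auto
    from dcell_exists[OF this, of "16 ^ k"] obtain m where "m < 16 ^ k" "x \<in> dcell (16 ^ k) m" by auto
    then show ?thesis using tag_step_eq[of x k m f] f1[OF tag_in_unit] by simp
  qed
  show "tag_step k f \<in> L2m" using tag_step_measurable t1 by (rule L2m_bounded)
  show "(\<lambda>k. sqn (\<lambda>x. f x - tag_step k f x)) \<longlonglongrightarrow> 0"
  proof (rule sqn_mono_AE[where w = "\<lambda>_. 4"])
    have "AE x in lborel. x \<notin> C" using C(1) by (intro AE_not_in countable_imp_null_set_lborel)
    then have "AE x in lebesgue. x \<notin> C" by (rule AE_completion)
    then have "AE x in unit_leb. x \<notin> C" by (subst AE_restrict_space_iff) auto
    with AE_unit_leb_pos show "AE x in unit_leb. (\<lambda>k. f x - tag_step k f x) \<longlonglongrightarrow> 0"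
    proof eventually_elim
      case (elim x)
      then have "(\<lambda>k. f x - tag_step k f x) \<longlonglongrightarrow> f x - f x" by (intro tendsto_intros C(2)) auto
      then show ?case by simp
    qed
    show "(f x - tag_step k f x)\<^sup>2 \<le> 4" if "x \<in> {0..1}" for k x
    proof -
      have "\<bar>f x - tag_step k f x\<bar> \<le> 2" using f1[OF that] t1[OF that, of k] by linarith
      from power_mono[OF this, of 2] show ?thesis by simp
    qed
    interpret prob_space unit_leb by (rule prob_space_unit_leb)
    show "integrable unit_leb (\<lambda>_. 4 :: real)" by simp
    show "(\<lambda>x. f x - tag_step k f x) \<in> borel_measurable unit_leb" for k
      by (rule borel_measurable_diff[OF fm tag_step_measurable])
  qed
qed

section \<open>Measurability in spaces of bounded functions\<close>

lemma linfty_mspace: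
  assumes "\<And>f. f \<in> F \<Longrightarrow> \<bar>g f\<bar> \<le> b"
  shows "(\<lambda>f\<in>F. g f) \<in> mspace (linfty F)"
proof -
  have "bounded ((\<lambda>f\<in>F. g f) ` F)" unfolding bounded_iff using assms by auto
  then show ?thesis by (simp add: Met_TC.fspace_def)
qed

lemma linfty_mdist_le:
  assumes "x \<in> mspace (linfty F)" "y \<in> mspace (linfty F)" "0 \<le> a" "\<And>f. f \<in> F \<Longrightarrow> \<bar>x f - y f\<bar> \<le> a"
  shows "mdist (linfty F) x y \<le> a"
proof (cases "F = {}")
  case True
  then show ?thesis using assms(3) by (simp add: Met_TC.fdist_def)
next
  case False
  then show ?thesis using funspace_mdist_le[OF assms(1,2) False] assms(4) by (simp add: dist_real_def)
qed

lemma rational_approx: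
  fixes v :: "nat \<Rightarrow> real"
  assumes "0 < e" shows "\<exists>w\<in>PiE {..<n} (\<lambda>_. \<rat>). (\<Sum>m<n. \<bar>v m - w m\<bar>) < e"
proof -
  have "\<exists>r. r \<in> \<rat> \<and> \<bar>v m - r\<bar> < e / Suc n" for m
  proof -
    have "v m < v m + e / Suc n" using assms by simp
    from Rats_dense_in_real[OF this] obtain r where "r \<in> \<rat>" "v m < r" "r < v m + e / Suc n" by blast
    then show ?thesis by (intro exI[of _ r]) auto
  qed
  then obtain r where r: "\<And>m. r m \<in> \<rat>" "\<And>m. \<bar>v m - r m\<bar> < e / Suc n" by metis
  have "(\<Sum>m<n. \<bar>v m - restrict r {..<n} m\<bar>) \<le> (\<Sum>m<n. e / Suc n)"
    using r(2) by (intro sum_mono) (auto intro: less_imp_le)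
  also have "\<dots> < e" using assms by (simp add: field_simps)
  finally show ?thesis using r(1) by (intro bexI[of _ "restrict r {..<n}"]) auto
qed

text \<open>A Lipschitz function is the infimum of its cones
  \<open>H w + L * (\<Sum>m<n. \<bar>v m - w m\<bar>)\<close>, and apexes w with rational
  coordinates suffice. A countable infimum of measurable functions is measurable.\<close>

lemma lipschitz_measurable:
  fixes H :: "(nat \<Rightarrow> real) \<Rightarrow> real"
  assumes H: "\<And>v w. \<bar>H v - H w\<bar> \<le> L * (\<Sum>m<n. \<bar>v m - w m\<bar>)" and L: "0 \<le> L"
    and V: "\<And>m. m < n \<Longrightarrow> (\<lambda>\<omega>. V \<omega> m) \<in> borel_measurable M"
  shows "(\<lambda>\<omega>. H (V \<omega>)) \<in> borel_measurable M"
proof -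
  let ?C = "PiE {..<n} (\<lambda>_. \<rat> :: real set)"
  let ?g = "\<lambda>v w. H w + L * (\<Sum>m<n. \<bar>v m - w m\<bar>)"
  have le: "H v \<le> ?g v w" for v w using H[of v w] by linarith
  have bdd: "bdd_below ((\<lambda>w. ?g v w) ` ?C)" for v using le by (intro bdd_belowI2) auto
  have eq: "H v = (INF w\<in>?C. ?g v w)" for v
  proof (rule antisym)
    show "H v \<le> (INF w\<in>?C. ?g v w)"
      using le rational_approx[of 1 n v] by (intro cINF_greatest) auto
    show "(INF w\<in>?C. ?g v w) \<le> H v"
    proof (rule field_le_epsilon)
      fix e :: real assume e: "0 < e"
      \<comment> \<open>The cone at w exceeds H v by at most 2 * L times the distance from v to w;
        the added 1 covers L = 0.\<close>
      then have "0 < e / (2 * L + 1)" using L by simp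
      from rational_approx[OF this, of n v] obtain w where w: "w \<in> ?C" "(\<Sum>m<n. \<bar>v m - w m\<bar>) < e / (2 * L + 1)" by blast
      have "(INF w\<in>?C. ?g v w) \<le> ?g v w" by (rule cINF_lower[OF bdd w(1)])
      also have "\<dots> \<le> H v + 2 * L * (\<Sum>m<n. \<bar>v m - w m\<bar>)" using H[of w v] by (simp add: abs_minus_commute)
      also have "\<dots> \<le> H v + 2 * L * (e / (2 * L + 1))" using w(2) L by (intro add_left_mono mult_left_mono) auto
      also have "\<dots> \<le> H v + e" using L e by (simp add: field_simps)
      finally show "(INF w\<in>?C. ?g v w) \<le> H v + e" .
    qed
  qed
  have "countable ?C" by (intro countable_PiE) (auto simp: countable_rat)
  then have "(\<lambda>\<omega>. INF w\<in>?C. ?g (V \<omega>) w) \<in> borel_measurable M"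
    using V bdd by (intro borel_measurable_cINF) (auto intro!: borel_measurable_add borel_measurable_times borel_measurable_sum borel_measurable_abs borel_measurable_diff)
  then show ?thesis unfolding eq[symmetric] .
qed

section \<open>Step approximations and the limit process\<close>

definition step_functional :: "real \<Rightarrow> nat \<Rightarrow> (nat \<Rightarrow> real) \<Rightarrow> (real \<Rightarrow> real) \<Rightarrow> real" where
  "step_functional q k v = (\<lambda>f\<in>qvar_ball q. \<Sum>m<16 ^ k. f (tag k m) * v m)"

lemma step_functional:
  assumes q: "1 \<le> q"
  shows step_functional_mspace: "step_functional q k v \<in> mspace (linfty (qvar_ball q))"
    and step_functional_lipschitz:
      "mdist (linfty (qvar_ball q)) (step_functional q k v) (step_functional q k w) \<le> (\<Sum>m<16 ^ k. \<bar>v m - w m\<bar>)"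
proof -
  have bd: "\<bar>\<Sum>m<16 ^ k. f (tag k m) * v m\<bar> \<le> (\<Sum>m<16 ^ k. \<bar>v m\<bar>)" if "f \<in> qvar_ball q" for f v
  proof (rule order_trans[OF sum_abs], rule sum_mono)
    fix m :: nat assume "m \<in> {..<16 ^ k}"
    then have "\<bar>f (tag k m)\<bar> \<le> 1" using qvar_ball_abs_le[OF that q tag_in_unit] by simp
    then show "\<bar>f (tag k m) * v m\<bar> \<le> \<bar>v m\<bar>" by (simp add: abs_mult mult_left_le_one_le)
  qed
  show m: "step_functional q k v \<in> mspace (linfty (qvar_ball q))" for v
    unfolding step_functional_def using bd by (rule linfty_mspace)
  show "mdist (linfty (qvar_ball q)) (step_functional q k v) (step_functional q k w) \<le> (\<Sum>m<16 ^ k. \<bar>v m - w m\<bar>)"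
  proof (rule linfty_mdist_le[OF m m])
    fix f assume f: "f \<in> qvar_ball q"
    have "step_functional q k v f - step_functional q k w f = (\<Sum>m<16 ^ k. f (tag k m) * (v m - w m))"
      using f by (simp add: step_functional_def sum_subtractf right_diff_distrib)
    then show "\<bar>step_functional q k v f - step_functional q k w f\<bar> \<le> (\<Sum>m<16 ^ k. \<bar>v m - w m\<bar>)"
      using bd[OF f, of "\<lambda>m. v m - w m"] by simp
  qed (simp add: sum_nonneg)
qed

lemma step_functional_compose_measurable:
  assumes q: "1 \<le> q"
    and h: "\<And>x y. x \<in> mspace (linfty (qvar_ball q)) \<Longrightarrow> y \<in> mspace (linfty (qvar_ball q)) \<Longrightarrow>
      \<bar>h x - h y\<bar> \<le> L * mdist (linfty (qvar_ball q)) x y" and L: "0 \<le> L"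
    and V: "\<And>m. m < 16 ^ k \<Longrightarrow> (\<lambda>\<omega>. V \<omega> m) \<in> borel_measurable M"
  shows "(\<lambda>\<omega>. h (step_functional q k (V \<omega>))) \<in> borel_measurable M"
proof (rule lipschitz_measurable[where n = "16 ^ k" and H = "\<lambda>v. h (step_functional q k v)", OF _ L V])
  fix v w
  show "\<bar>h (step_functional q k v) - h (step_functional q k w)\<bar> \<le> L * (\<Sum>m<16 ^ k. \<bar>v m - w m\<bar>)"
    using h[OF step_functional_mspace[OF q] step_functional_mspace[OF q], of k v k w]
      mult_left_mono[OF step_functional_lipschitz[OF q, of k v w] L] by linarith
qed

text \<open>The distance to the complement of U is 1-Lipschitz and, on the space, positive exactly
  on U. An empty complement is treated apart, since the infimum over it has no meaning.\<close>

lemma open_measurable_from_lipschitz: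
  assumes h: "\<And>h L. (\<And>x y. x \<in> mspace E \<Longrightarrow> y \<in> mspace E \<Longrightarrow> \<bar>h x - h y\<bar> \<le> L * mdist E x y) \<Longrightarrow> 0 \<le> L \<Longrightarrow>
      (\<lambda>\<omega>. h (Z \<omega>)) \<in> borel_measurable P"
    and Z: "\<And>\<omega>. \<omega> \<in> space P \<Longrightarrow> Z \<omega> \<in> mspace E" and U: "openin (mtopology_of E) U"
  shows "Z -` U \<inter> space P \<in> sets P"
proof (cases "mspace E - U = {}")
  case True
  then have "Z -` U \<inter> space P = space P" using Z by auto
  then show ?thesis by simp
next
  case False
  interpret Metric_space "mspace E" "mdist E" by simp
  define d where "d x = (INF y\<in>mspace E - U. mdist E x y)" for x
  have bdd: "bdd_below ((\<lambda>y. mdist E x y) ` (mspace E - U))" for x by (rule bdd_belowI2[of _ 0]) simp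
  have tri: "d x \<le> d y + mdist E x y" if "x \<in> mspace E" "y \<in> mspace E" for x y
  proof -
    have "d x - mdist E x y \<le> d y" unfolding d_def[of y]
    proof (rule cINF_greatest[OF False])
      fix z assume z: "z \<in> mspace E - U"
      then have "d x \<le> mdist E x z" unfolding d_def by (rule cINF_lower[OF bdd])
      also have "\<dots> \<le> mdist E x y + mdist E y z" using that z by (intro triangle) auto
      finally show "d x - mdist E x y \<le> mdist E y z" by simp
    qed
    then show ?thesis by simp
  qed
  have "(\<lambda>\<omega>. d (Z \<omega>)) \<in> borel_measurable P"
  proof (rule h[where L = 1])
    show "\<bar>d x - d y\<bar> \<le> 1 * mdist E x y" if "x \<in> mspace E" "y \<in> mspace E" for x y
      using tri[OF that] tri[OF that(2,1)] by (simp add: commute abs_le_iff)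
  qed simp
  then have "{\<omega>\<in>space P. 0 < d (Z \<omega>)} \<in> sets P" by measurable
  moreover have "x \<in> U \<longleftrightarrow> 0 < d x" if x: "x \<in> mspace E" for x
  proof
    assume "x \<in> U"
    then obtain r where r: "0 < r" "mball x r \<subseteq> U"
      using U unfolding mtopology_of_def openin_mtopology by auto
    have "r \<le> d x" unfolding d_def
    proof (rule cINF_greatest[OF False])
      fix y assume "y \<in> mspace E - U"
      then show "r \<le> mdist E x y" using r x by (auto simp: mball_def subset_iff not_le[symmetric])
    qed
    then show "0 < d x" using r by simp
  next
    assume "0 < d x"
    moreover have "d x \<le> mdist E x x" if "x \<notin> U" unfolding d_def using x that by (intro cINF_lower[OF bdd]) auto
    ultimately show "x \<in> U" using x by fastforce
  qed
  then have "Z -` U \<inter> space P = {\<omega>\<in>space P. 0 < d (Z \<omega>)}" using Z by auto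
  ultimately show ?thesis by simp
qed

lemma increments_summable:
  fixes a d :: "nat \<Rightarrow> real"
  assumes ad: "\<And>k. \<bar>a (Suc k) - a k\<bar> \<le> d (Suc k)" and d: "summable d"
  shows "a \<longlonglongrightarrow> lim a" and "\<bar>lim a - a k\<bar> \<le> (\<Sum>j. d (Suc (j + k)))"
proof -
  have sd: "summable (\<lambda>j. d (Suc (j + k)))" for k
    using summable_ignore_initial_segment[OF d, of "Suc k"] by simp
  have sa: "summable (\<lambda>j. a (Suc (j + k)) - a (j + k))" for k
    by (rule summable_comparison_test'[OF sd[of k], of 0]) (use ad in auto)
  have tel: "(\<Sum>j<n. a (Suc (j + k)) - a (j + k)) = a (n + k) - a k" for n k
    by (induction n) auto
  have lm: "(\<lambda>n. a (n + k)) \<longlonglongrightarrow> a k + (\<Sum>j. a (Suc (j + k)) - a (j + k))" for k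
    using tendsto_add[OF tendsto_const[of "a k"] summable_LIMSEQ[OF sa[of k]]] by (simp add: tel)
  show lim: "a \<longlonglongrightarrow> lim a" using lm[of 0] by (simp add: limI)
  have "lim a = a k + (\<Sum>j. a (Suc (j + k)) - a (j + k))"
    using LIMSEQ_unique[OF LIMSEQ_ignore_initial_segment[OF lim, of k] lm[of k]] .
  moreover have "\<bar>\<Sum>j. a (Suc (j + k)) - a (j + k)\<bar> \<le> (\<Sum>j. d (Suc (j + k)))"
    using norm_suminf_le[of "\<lambda>j. a (Suc (j + k)) - a (j + k)" "\<lambda>j. d (Suc (j + k))"] ad sd by simp
  ultimately show "\<bar>lim a - a k\<bar> \<le> (\<Sum>j. d (Suc (j + k)))" by simp
qed

lemma sqn_cong: "(\<And>x. x \<in> {0..1} \<Longrightarrow> f x = g x) \<Longrightarrow> sqn f = sqn g"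
  unfolding sqn_def by (intro Bochner_Integration.integral_cong) (auto simp: space_restrict_space)

lemma indicator_dcell_L2m: "m < N \<Longrightarrow> indicator (dcell N m) \<in> L2m"
  by (rule L2m_bounded[where B = 1]) (auto simp: indicator_def intro: borel_measurable_indicator[OF sets_dcell])

definition cell_fun :: "nat \<Rightarrow> nat \<Rightarrow> real \<Rightarrow> real" where
  "cell_fun k m = restrict (indicator (dcell (16 ^ k) m)) {0..1}"

lemma cell_fun_eq: "x \<in> {0..1} \<Longrightarrow> cell_fun k m x = indicator (dcell (16 ^ k) m) x"
  by (simp add: cell_fun_def)

lemma cell_fun_L2_unit: assumes "m < 16 ^ k" shows "cell_fun k m \<in> L2_unit"
proof -
  note L = L2mD[OF indicator_dcell_L2m[OF assms]]
  have "cell_fun k m \<in> borel_measurable unit_leb"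
    using L(1) by (rule measurable_cong[THEN iffD1, rotated]) (simp add: cell_fun_def space_restrict_space)
  moreover have "integrable unit_leb (\<lambda>x. (cell_fun k m x)\<^sup>2)"
    using L(2) by (rule Bochner_Integration.integrable_cong[THEN iffD1, rotated 2]) (auto simp: cell_fun_def space_restrict_space)
  ultimately show ?thesis by (auto simp: L2_unit_def cell_fun_def)
qed

lemma sqn_step:
  assumes N: "0 < N"
  shows "sqn (\<lambda>x. \<Sum>m<N. \<theta> m * indicator (dcell N m) x) = (\<Sum>m<N. (\<theta> m)\<^sup>2) / N"
proof -
  let ?f = "\<lambda>x. \<Sum>m<N. \<theta> m * indicator (dcell N m) x"
  have L: "?f \<in> L2m" by (intro L2m_sum L2m_cmult indicator_dcell_L2m) auto
  have val: "?f x * indicator (dcell N m) x = \<theta> m * indicator (dcell N m) x" if "m < N" for m x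
  proof (cases "x \<in> dcell N m")
    case True
    have "?f x = (\<Sum>m'<N. if m' = m then \<theta> m else 0)"
    proof (rule sum.cong[OF refl])
      fix m'
      have "x \<in> dcell N m' \<longleftrightarrow> m' = m" using dcell_unique[OF True, of m'] True N by auto
      then show "\<theta> m' * indicator (dcell N m') x = (if m' = m then \<theta> m else 0)" by (simp add: indicator_def)
    qed
    also have "\<dots> = \<theta> m" using that by (subst sum.delta) auto
    finally show ?thesis by simp
  qed simp
  have "sqn ?f = (\<Sum>m<N. \<integral>x. (?f x)\<^sup>2 * indicator (dcell N m) x \<partial>unit_leb)" by (rule sqn_cells[OF L N])
  also have "\<dots> = (\<Sum>m<N. (\<theta> m)\<^sup>2 * (1 / N))"
  proof (rule sum.cong[OF refl])
    fix m assume "m \<in> {..<N}"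
    then have m: "m < N" by simp
    have "(?f x)\<^sup>2 * indicator (dcell N m) x = (\<theta> m)\<^sup>2 * indicator (dcell N m) x" for x
      using val[OF m, of x] by (auto simp: indicator_def)
    then have "(\<integral>x. (?f x)\<^sup>2 * indicator (dcell N m) x \<partial>unit_leb) = (\<integral>x. (\<theta> m)\<^sup>2 * indicator (dcell N m) x \<partial>unit_leb)"
      by (intro Bochner_Integration.integral_cong refl)
    also have "\<dots> = (\<theta> m)\<^sup>2 * measure unit_leb (dcell N m)"
      using sets.sets_into_space[OF sets_dcell[OF m]] by (simp add: Int_absorb1 Int_absorb2)
    finally show "(\<integral>x. (?f x)\<^sup>2 * indicator (dcell N m) x \<partial>unit_leb) = (\<theta> m)\<^sup>2 * (1 / N)"
      using measure_dcell[OF m] by simp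
  qed
  finally show ?thesis by (simp add: sum_divide_distrib)
qed

lemma dcell_parent:
  assumes "x \<in> dcell (16 ^ Suc k) l" shows "x \<in> dcell (16 ^ k) (l div 16)"
proof -
  have a: "real l < 16 * 16 ^ k * x" "16 * 16 ^ k * x \<le> real l + 1"
    using assms by (auto simp: dcell_def field_simps)
  have "16 * (l div 16) \<le> l" "l + 1 \<le> 16 * (l div 16) + 16" by linarith+
  then have "real (16 * (l div 16)) \<le> real l" "real (l + 1) \<le> real (16 * (l div 16) + 16)"
    unfolding of_nat_le_iff by auto
  then have "16 * real (l div 16) \<le> real l" "real l + 1 \<le> 16 * real (l div 16) + 16" by simp_all
  then have "real (l div 16) < 16 ^ k * x" "16 ^ k * x \<le> real (l div 16) + 1" using a by linarith+
  then show ?thesis by (simp add: dcell_def field_simps)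
qed

lemma indicator_dcell_children:
  assumes x: "x \<in> {0..1}" and m: "m < 16 ^ k"
  shows "indicator (dcell (16 ^ k) m) x = (\<Sum>l\<in>{m * 16..<m * 16 + 16}. indicator (dcell (16 ^ Suc k) l) x :: real)"
proof (cases "x = 0")
  case True
  then show ?thesis by (auto simp: dcell_def indicator_def field_simps intro!: sum.neutral[symmetric])
next
  case False
  then have "x \<in> {0<..1}" using x by auto
  from dcell_exists[OF this, of "16 ^ Suc k"] obtain l0 where l0: "x \<in> dcell (16 ^ Suc k) l0" by auto
  have "x \<in> dcell (16 ^ k) m \<longleftrightarrow> m = l0 div 16"
    using dcell_unique[OF dcell_parent[OF l0], of m] dcell_parent[OF l0] by auto
  then have "indicator (dcell (16 ^ k) m) x = (if m = l0 div 16 then 1 else 0 :: real)" by (simp add: indicator_def)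
  also have "\<dots> = (if l0 \<in> {m * 16..<m * 16 + 16} then 1 else 0)" by auto
  also have "\<dots> = (\<Sum>l\<in>{m * 16..<m * 16 + 16}. if l = l0 then 1 else 0)" by simp
  also have "\<dots> = (\<Sum>l\<in>{m * 16..<m * 16 + 16}. indicator (dcell (16 ^ Suc k) l) x)"
  proof (rule sum.cong[OF refl])
    fix l
    have "x \<in> dcell (16 ^ Suc k) l \<longleftrightarrow> l = l0" using dcell_unique[OF l0, of l] l0 by auto
    then show "(if l = l0 then 1 else 0) = (indicator (dcell (16 ^ Suc k) l) x :: real)" by (simp add: indicator_def)
  qed
  finally show ?thesis .
qed

section \<open>A version of the Gaussian process with regular paths\<close>

locale gaussian_family = prob_space N for N :: "'b measure" +
  fixes \<nu> :: "(real \<Rightarrow> real) \<Rightarrow> 'b \<Rightarrow> real" and q :: real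
  assumes family: "\<And>S c. finite S \<Longrightarrow> S \<subseteq> L2_unit \<Longrightarrow>
      normal0 N (\<lambda>\<omega>. \<Sum>t\<in>S. c t * \<nu> t \<omega>) (sqn (\<lambda>x. \<Sum>t\<in>S. c t * t x))"
    and q: "1 \<le> q" "q < 2"
begin

text \<open>\<open>family\<close> speaks of sets of functions, whereas an indexed family may list a
  function twice; coefficients of equal functions are therefore added up first.\<close>

lemma family_indexed:
  assumes I: "finite I" "\<And>i. i \<in> I \<Longrightarrow> t i \<in> L2_unit"
  shows "normal0 N (\<lambda>\<omega>. \<Sum>i\<in>I. c i * \<nu> (t i) \<omega>) (sqn (\<lambda>x. \<Sum>i\<in>I. c i * t i x))"
proof -
  define c' where "c' s = (\<Sum>i\<in>{i\<in>I. t i = s}. c i)" for s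
  have eq: "(\<Sum>i\<in>I. c i * F (t i)) = (\<Sum>s\<in>t ` I. c' s * F s)" for F :: "(real \<Rightarrow> real) \<Rightarrow> real"
  proof -
    have "(\<Sum>i\<in>I. c i * F (t i)) = (\<Sum>s\<in>t ` I. \<Sum>i\<in>{i\<in>I. t i = s}. c i * F (t i))"
      by (rule sum.image_gen[OF I(1)])
    also have "\<dots> = (\<Sum>s\<in>t ` I. c' s * F s)"
      unfolding c'_def sum_distrib_right by (intro sum.cong refl) auto
    finally show ?thesis .
  qed
  have "normal0 N (\<lambda>\<omega>. \<Sum>s\<in>t ` I. c' s * \<nu> s \<omega>) (sqn (\<lambda>x. \<Sum>s\<in>t ` I. c' s * s x))"
    using I by (intro family) auto
  moreover have "(\<Sum>s\<in>t ` I. c' s * \<nu> s \<omega>) = (\<Sum>i\<in>I. c i * \<nu> (t i) \<omega>)" for \<omega>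
    using eq[of "\<lambda>s. \<nu> s \<omega>"] by simp
  moreover have "(\<Sum>s\<in>t ` I. c' s * s x) = (\<Sum>i\<in>I. c i * t i x)" for x
    using eq[of "\<lambda>s. s x"] by simp
  ultimately show ?thesis by simp
qed

lemma family_difference:
  assumes f: "f \<in> L2_unit" and I: "finite I" "\<And>i. i \<in> I \<Longrightarrow> t i \<in> L2_unit"
  shows "normal0 N (\<lambda>\<omega>. \<nu> f \<omega> - (\<Sum>i\<in>I. c i * \<nu> (t i) \<omega>)) (sqn (\<lambda>x. f x - (\<Sum>i\<in>I. c i * t i x)))"
proof -
  \<comment> \<open>\<open>None\<close> indexes f and \<open>Some i\<close> indexes
    \<open>t i\<close>. These functions may coincide, which \<open>family_indexed\<close>
    permits.\<close>
  let ?t = "case_option f t" and ?c = "case_option 1 (\<lambda>i. - c i)"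
  have "normal0 N (\<lambda>\<omega>. \<Sum>i\<in>insert None (Some ` I). ?c i * \<nu> (?t i) \<omega>) (sqn (\<lambda>x. \<Sum>i\<in>insert None (Some ` I). ?c i * ?t i x))"
    using f I by (intro family_indexed) auto
  then show ?thesis using I(1) by (simp add: sum.reindex sum_negf)
qed

definition B :: "nat \<Rightarrow> nat \<Rightarrow> 'b \<Rightarrow> real" where "B k m = \<nu> (cell_fun k m)"

lemma B_sum: "normal0 N (\<lambda>\<omega>. \<Sum>m<16 ^ k. \<theta> m * B k m \<omega>) ((\<Sum>m<16 ^ k. (\<theta> m)\<^sup>2) / 16 ^ k)"
proof -
  have "normal0 N (\<lambda>\<omega>. \<Sum>m<16 ^ k. \<theta> m * B k m \<omega>) (sqn (\<lambda>x. \<Sum>m<16 ^ k. \<theta> m * cell_fun k m x))"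
    unfolding B_def by (rule family_indexed) (auto intro: cell_fun_L2_unit)
  moreover have "sqn (\<lambda>x. \<Sum>m<16 ^ k. \<theta> m * cell_fun k m x) = (\<Sum>m<16 ^ k. (\<theta> m)\<^sup>2) / (16 ^ k :: nat)"
    by (subst sqn_step[symmetric]) (auto intro!: sqn_cong simp: cell_fun_eq)
  ultimately show ?thesis by simp
qed

lemma B_normal0: assumes m: "m < 16 ^ k" shows "normal0 N (B k m) (1 / 16 ^ k)"
proof -
  have "(\<Sum>m'<16 ^ k. (if m' = m then 1 else 0) * B k m' \<omega>) = B k m \<omega>" for \<omega>
    using m by (simp add: if_distrib[of "\<lambda>c. c * _"] cong: if_cong)
  moreover have "(\<Sum>m'<16 ^ k. (if m' = m then 1 else 0 :: real)\<^sup>2) = 1"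
    using m by (simp add: if_distrib[of "\<lambda>c. c\<^sup>2"] cong: if_cong)
  ultimately show ?thesis using B_sum[where k = k and \<theta> = "\<lambda>m'. if m' = m then 1 else 0"] by simp
qed

lemma B_measurable [measurable]: "m < 16 ^ k \<Longrightarrow> B k m \<in> borel_measurable N"
  using B_normal0 by (simp add: normal0_def)

text \<open>The cells are disjoint, so the variance of a linear combination is a weighted sum of
  squares and its characteristic function factorises.\<close>

lemma B_joint_law:
  "distr N (\<Pi>\<^sub>M m\<in>{..<16 ^ k}. borel) (\<lambda>\<omega>. \<lambda>m\<in>{..<16 ^ k}. B k m \<omega>) = (\<Pi>\<^sub>M m\<in>{..<16 ^ k}. distr N borel (B k m))"
proof (rule char_product_imp_distr_PiM)
  fix \<theta>
  have Sm: "(\<lambda>\<omega>. \<Sum>m<16 ^ k. \<theta> m * B k m \<omega>) \<in> borel_measurable N" using B_sum by (simp add: normal0_def)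
  have "(CLINT \<omega>|N. iexp (\<Sum>m<16 ^ k. \<theta> m * B k m \<omega>)) = char (distr N borel (\<lambda>\<omega>. \<Sum>m<16 ^ k. \<theta> m * B k m \<omega>)) 1"
    by (subst char_distr_eq[OF Sm]) simp
  also have "\<dots> = complex_of_real (exp (- ((\<Sum>m<16 ^ k. (\<theta> m)\<^sup>2) / 16 ^ k) / 2))"
    using B_sum[where k = k and \<theta> = \<theta>] by (simp add: normal0_def)
  also have "\<dots> = (\<Prod>m<16 ^ k. complex_of_real (exp (- ((\<theta> m)\<^sup>2 * (1 / 16 ^ k)) / 2)))"
    using exp_sum[of "{..<16 ^ k :: nat}" "\<lambda>m. - ((\<theta> m)\<^sup>2 * (1 / 16 ^ k)) / 2"]
    by (simp add: sum_divide_distrib sum_negf flip: of_real_prod)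
  also have "\<dots> = (\<Prod>m<16 ^ k. char (distr N borel (B k m)) (\<theta> m))"
    using B_normal0 by (intro prod.cong refl) (auto simp: normal0_def)
  finally show "(CLINT \<omega>|N. iexp (\<Sum>m<16 ^ k. \<theta> m * B k m \<omega>)) = (\<Prod>m<16 ^ k. char (distr N borel (B k m)) (\<theta> m))" .
qed auto

text \<open>The indicator of a cell is the sum of those of its children at every point of the
  interval, so the difference has variance 0. Additivity of \<nu> is thus available almost surely,
  for countably many cells at once.\<close>

lemma B_children:
  assumes m: "m < 16 ^ k"
  shows "AE \<omega> in N. B k m \<omega> = (\<Sum>l\<in>{m * 16..<m * 16 + 16}. B (Suc k) l \<omega>)"
proof -
  have l: "l < 16 ^ Suc k" if "l \<in> {m * 16..<m * 16 + 16}" for l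
  proof -
    have "(m + 1) * 16 \<le> 16 ^ k * 16" using m by (intro mult_right_mono) auto
    then show ?thesis using that by auto
  qed
  have "normal0 N (\<lambda>\<omega>. \<nu> (cell_fun k m) \<omega> - (\<Sum>l\<in>{m * 16..<m * 16 + 16}. 1 * \<nu> (cell_fun (Suc k) l) \<omega>))
    (sqn (\<lambda>x. cell_fun k m x - (\<Sum>l\<in>{m * 16..<m * 16 + 16}. 1 * cell_fun (Suc k) l x)))"
    using m l by (intro family_difference cell_fun_L2_unit) auto
  moreover have "sqn (\<lambda>x. cell_fun k m x - (\<Sum>l\<in>{m * 16..<m * 16 + 16}. 1 * cell_fun (Suc k) l x)) = sqn (\<lambda>x. 0)"
    by (rule sqn_cong) (simp only: cell_fun_eq indicator_dcell_children[OF _ m] mult_1 diff_self)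
  moreover have "sqn (\<lambda>x. 0) = 0" by (simp add: sqn_def)
  ultimately have "normal0 N (\<lambda>\<omega>. B k m \<omega> - (\<Sum>l\<in>{m * 16..<m * 16 + 16}. B (Suc k) l \<omega>)) 0"
    unfolding B_def by simp
  from normal0_zero[OF this] show ?thesis by simp
qed

definition approx :: "nat \<Rightarrow> (real \<Rightarrow> real) \<Rightarrow> 'b \<Rightarrow> real" where
  "approx k f \<omega> = (\<Sum>m<16 ^ k. f (tag k m) * B k m \<omega>)"

definition increment_bound :: "nat \<Rightarrow> 'b \<Rightarrow> real" where
  "increment_bound k \<omega> = chain_bound q 16 (chain_ratio q ^ k) {..<16 ^ k} (\<lambda>m. B k m \<omega>)"

text \<open>An upper bound for the sum over j > k of 17 * chain_ratio q ^ j + 3 / 2 ^ j, the bounds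
  in \<open>increment_bound\<close>. Here 17 is the variation constant 16 plus the total variance 1,
  and 3 comes from the normal fourth moment \<open>3 * v\<^sup>2\<close>.\<close>

definition gaussian_tail :: "nat \<Rightarrow> real" where
  "gaussian_tail k = 17 * chain_ratio q ^ k / (1 - chain_ratio q) + 6 / 2 ^ k"

lemma increment_bound:
  shows "integrable N (increment_bound k)" "expectation (increment_bound k) \<le> 17 * chain_ratio q ^ k + 3 / 2 ^ k"
    and "0 \<le> increment_bound k \<omega>"
proof -
  have p: "0 \<le> 1 / (16 :: real) ^ k" by simp
  have int: "integrable N (\<lambda>\<omega>. B k m \<omega> ^ i)" if "m \<in> {..<16 ^ k}" for m i
    using normal0_integrable[OF B_normal0 p] that by auto
  have "(\<Sum>m<16 ^ k. expectation (\<lambda>\<omega>. (B k m \<omega>)\<^sup>2)) = (\<Sum>m<(16 ^ k :: nat). 1 / 16 ^ k)"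
    using normal0_variance[OF B_normal0 p] by (intro sum.cong) auto
  then have S2: "(\<Sum>m<16 ^ k. expectation (\<lambda>\<omega>. (B k m \<omega>)\<^sup>2)) \<le> 1" by simp
  have "(\<Sum>m<16 ^ k. expectation (\<lambda>\<omega>. B k m \<omega> ^ 4)) = (\<Sum>m<(16 ^ k :: nat). 3 * (1 / 16 ^ k)\<^sup>2)"
    using normal0_fourth[OF B_normal0 p] by (intro sum.cong) auto
  also have "\<dots> = 3 / 16 ^ k" by (simp add: power2_eq_square)
  also have "\<dots> \<le> 3 / 4 ^ k" by (intro divide_left_mono power_mono) auto
  finally have S4: "(\<Sum>m<16 ^ k. expectation (\<lambda>\<omega>. B k m \<omega> ^ 4)) \<le> 3 / 4 ^ k" .
  show "integrable N (increment_bound k)" unfolding increment_bound_def[abs_def]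
    by (rule chain_bound_expectation(1)[OF q int S2 S4])
  show "expectation (increment_bound k) \<le> 17 * chain_ratio q ^ k + 3 / 2 ^ k" unfolding increment_bound_def[abs_def]
    using chain_bound_expectation(2)[OF q int S2 S4, of 16] by simp
  show "0 \<le> increment_bound k \<omega>" unfolding increment_bound_def chain_bound_def
    using chain_ratio[OF q] by (intro add_nonneg_nonneg mult_nonneg_nonneg divide_nonneg_nonneg sum_nonneg) auto
qed

lemma increment_bound_measurable [measurable]: "increment_bound k \<in> borel_measurable N"
  using increment_bound(1) by (rule borel_measurable_integrable)

lemma approx_increment:
  assumes f: "f \<in> qvar_ball q" and \<omega>: "\<And>m. m < 16 ^ k \<Longrightarrow> B k m \<omega> = (\<Sum>l\<in>{m * 16..<m * 16 + 16}. B (Suc k) l \<omega>)"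
  shows "\<bar>approx (Suc k) f \<omega> - approx k f \<omega>\<bar> \<le> increment_bound (Suc k) \<omega>"
proof -
  have "approx k f \<omega> = (\<Sum>m<16 ^ k. \<Sum>l\<in>{m * 16..<m * 16 + 16}. f (tag k (l div 16)) * B (Suc k) l \<omega>)"
    unfolding approx_def
  proof (rule sum.cong[OF refl])
    fix m :: nat assume "m \<in> {..<16 ^ k}"
    then have m: "m < 16 ^ k" by simp
    have "f (tag k m) * B k m \<omega> = (\<Sum>l\<in>{m * 16..<m * 16 + 16}. f (tag k m) * B (Suc k) l \<omega>)"
      unfolding \<omega>[OF m] by (rule sum_distrib_left)
    also have "\<dots> = (\<Sum>l\<in>{m * 16..<m * 16 + 16}. f (tag k (l div 16)) * B (Suc k) l \<omega>)"
    proof (rule sum.cong[OF refl])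
      fix l assume "l \<in> {m * 16..<m * 16 + 16}"
      then have "l div 16 = m" by auto
      then show "f (tag k m) * B (Suc k) l \<omega> = f (tag k (l div 16)) * B (Suc k) l \<omega>" by simp
    qed
    finally show "f (tag k m) * B k m \<omega> = (\<Sum>l\<in>{m * 16..<m * 16 + 16}. f (tag k (l div 16)) * B (Suc k) l \<omega>)" .
  qed
  also have "\<dots> = (\<Sum>l<16 ^ k * 16. f (tag k (l div 16)) * B (Suc k) l \<omega>)" by (rule sum.nat_group)
  also have "16 ^ k * 16 = (16 ^ Suc k :: nat)" by simp
  finally have "approx (Suc k) f \<omega> - approx k f \<omega> = (\<Sum>l<16 ^ Suc k. (f (tag (Suc k) l) - f (tag k (l div 16))) * B (Suc k) l \<omega>)"
    unfolding approx_def by (simp only: sum_subtractf[symmetric] left_diff_distrib)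
  also have "\<bar>\<dots>\<bar> \<le> increment_bound (Suc k) \<omega>" unfolding increment_bound_def
    using chain_ratio(1,2)[OF q] by (intro chain_step_fine[OF f q] zero_less_power power_le_one) auto
  finally show ?thesis .
qed

text \<open>Taken in \<open>ennreal\<close>, where the series makes sense before it is known to
  converge; the finite integral then yields summability almost surely.\<close>

definition tail_bound :: "nat \<Rightarrow> 'b \<Rightarrow> ennreal" where
  "tail_bound k \<omega> = (\<Sum>j. ennreal (increment_bound (Suc (j + k)) \<omega>))"

lemma tail_bound_measurable [measurable]: "tail_bound k \<in> borel_measurable N"
  unfolding tail_bound_def[abs_def] by measurable

lemma tail_bound_integral: "(\<integral>\<^sup>+\<omega>. tail_bound k \<omega> \<partial>N) \<le> ennreal (gaussian_tail k)"
proof -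
  let ?\<rho> = "chain_ratio q"
  note \<rho> = chain_ratio(1,2)[OF q]
  have geo: "(\<lambda>j. x ^ Suc (j + k)) sums (x ^ Suc k / (1 - x))" if "0 < x" "x < 1" for x :: real
  proof -
    have "(\<lambda>j. x ^ Suc k * x ^ j) sums (x ^ Suc k * (1 / (1 - x)))"
      using that by (intro sums_mult geometric_sums) auto
    then show ?thesis by (simp add: power_add mult_ac)
  qed
  have "(\<lambda>j. 17 * ?\<rho> ^ Suc (j + k) + 3 * (1 / 2) ^ Suc (j + k)) sums
      (17 * (?\<rho> ^ Suc k / (1 - ?\<rho>)) + 3 * ((1 / 2) ^ Suc k / (1 - 1 / 2)))"
    using \<rho> by (intro sums_add sums_mult geo) auto
  then have sums: "(\<lambda>j. 17 * ?\<rho> ^ Suc (j + k) + 3 / 2 ^ Suc (j + k)) sums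
      (17 * (?\<rho> ^ Suc k / (1 - ?\<rho>)) + 3 * ((1 / 2) ^ Suc k / (1 - 1 / 2)))"
    by (simp only: power_one_over times_divide_eq_right mult_1_right)
  have "(\<integral>\<^sup>+\<omega>. tail_bound k \<omega> \<partial>N) = (\<Sum>j. \<integral>\<^sup>+\<omega>. ennreal (increment_bound (Suc (j + k)) \<omega>) \<partial>N)"
    unfolding tail_bound_def by (intro nn_integral_suminf) measurable
  also have "\<dots> \<le> (\<Sum>j. ennreal (17 * ?\<rho> ^ Suc (j + k) + 3 / 2 ^ Suc (j + k)))"
  proof (intro suminf_le allI)
    fix j
    show "(\<integral>\<^sup>+\<omega>. ennreal (increment_bound (Suc (j + k)) \<omega>) \<partial>N) \<le> ennreal (17 * ?\<rho> ^ Suc (j + k) + 3 / 2 ^ Suc (j + k))"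
      using increment_bound(1,3) increment_bound(2)[of "Suc (j + k)"]
      by (subst nn_integral_eq_integral) (auto intro!: ennreal_leI simp del: power_Suc)
  qed auto
  also have "\<dots> = ennreal (17 * (?\<rho> ^ Suc k / (1 - ?\<rho>)) + 3 * ((1 / 2) ^ Suc k / (1 - 1 / 2)))"
    using sums \<rho> by (intro suminf_ennreal_eq) auto
  also have "\<dots> \<le> ennreal (gaussian_tail k)"
  proof (rule ennreal_leI)
    have "?\<rho> ^ Suc k \<le> ?\<rho> ^ k" using \<rho> by (intro power_decreasing) auto
    then have "17 * (?\<rho> ^ Suc k / (1 - ?\<rho>)) \<le> 17 * (?\<rho> ^ k / (1 - ?\<rho>))"
      using \<rho> by (intro mult_left_mono divide_right_mono) auto
    moreover have "3 * ((1 / 2) ^ Suc k / (1 - 1 / 2)) \<le> 6 / (2::real) ^ k" by (simp add: power_one_over divide_right_mono)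
    ultimately show "17 * (?\<rho> ^ Suc k / (1 - ?\<rho>)) + 3 * ((1 / 2) ^ Suc k / (1 - 1 / 2)) \<le> gaussian_tail k"
      unfolding gaussian_tail_def by simp
  qed
  finally show ?thesis .
qed

lemma gaussian_tail_tendsto: "gaussian_tail \<longlonglongrightarrow> 0"
proof -
  note \<rho> = chain_ratio(1,2)[OF q]
  have "(\<lambda>k. 17 * chain_ratio q ^ k / (1 - chain_ratio q) + 6 * (1 / 2) ^ k) \<longlonglongrightarrow> 17 * 0 / (1 - chain_ratio q) + 6 * 0"
    using \<rho> by (intro tendsto_intros LIMSEQ_power_zero) auto
  then show ?thesis unfolding gaussian_tail_def[abs_def] by (simp add: power_one_over)
qed

lemma null_set_exists:
  "\<exists>S. S \<in> null_sets N \<and> (\<forall>\<omega>\<in>space N - S. summable (\<lambda>k. increment_bound k \<omega>) \<and>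
    (\<forall>k m. m < 16 ^ k \<longrightarrow> B k m \<omega> = (\<Sum>l\<in>{m * 16..<m * 16 + 16}. B (Suc k) l \<omega>)))"
proof -
  have "(\<integral>\<^sup>+\<omega>. tail_bound 0 \<omega> \<partial>N) \<noteq> \<infinity>" using tail_bound_integral[of 0] by (auto simp: top_unique)
  then have "AE \<omega> in N. tail_bound 0 \<omega> \<noteq> \<infinity>" by (intro nn_integral_PInf_AE) measurable
  then have "AE \<omega> in N. summable (\<lambda>k. increment_bound k \<omega>)"
  proof eventually_elim
    case (elim \<omega>)
    have "summable (\<lambda>j. increment_bound (Suc j) \<omega>)"
      using elim increment_bound(3) by (intro summable_suminf_not_top) (auto simp: tail_bound_def)
    then show ?case using summable_Suc_iff[of "\<lambda>k. increment_bound k \<omega>"] by blast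
  qed
  moreover have "AE \<omega> in N. \<forall>k m. m < 16 ^ k \<longrightarrow> B k m \<omega> = (\<Sum>l\<in>{m * 16..<m * 16 + 16}. B (Suc k) l \<omega>)"
    unfolding AE_all_countable using B_children by (auto intro: AE_I2)
  ultimately have "AE \<omega> in N. summable (\<lambda>k. increment_bound k \<omega>) \<and>
    (\<forall>k m. m < 16 ^ k \<longrightarrow> B k m \<omega> = (\<Sum>l\<in>{m * 16..<m * 16 + 16}. B (Suc k) l \<omega>))" by (rule AE_conjI)
  then show ?thesis by (elim AE_E) (auto intro!: exI simp: null_sets_def)
qed

text \<open>Chosen once, so that a single null set serves all functions f and all levels.\<close>

definition exceptional :: "'b set" where
  "exceptional = (SOME S. S \<in> null_sets N \<and> (\<forall>\<omega>\<in>space N - S. summable (\<lambda>k. increment_bound k \<omega>) \<and>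
    (\<forall>k m. m < 16 ^ k \<longrightarrow> B k m \<omega> = (\<Sum>l\<in>{m * 16..<m * 16 + 16}. B (Suc k) l \<omega>))))"

lemma exceptional:
  shows "exceptional \<in> null_sets N"
    and "\<omega> \<in> space N - exceptional \<Longrightarrow> summable (\<lambda>k. increment_bound k \<omega>)"
    and "\<omega> \<in> space N - exceptional \<Longrightarrow> m < 16 ^ k \<Longrightarrow> B k m \<omega> = (\<Sum>l\<in>{m * 16..<m * 16 + 16}. B (Suc k) l \<omega>)"
  using someI_ex[OF null_set_exists] unfolding exceptional_def[symmetric] by auto

text \<open>Off the exceptional null set the chaining increments are summable, so the limit exists.\<close>

definition \<nu>' :: "(real \<Rightarrow> real) \<Rightarrow> 'b \<Rightarrow> real" where
  "\<nu>' f \<omega> = (if \<omega> \<in> exceptional then 0 else lim (\<lambda>k. approx k f \<omega>))"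

lemma \<nu>'_approx:
  assumes \<omega>: "\<omega> \<in> space N - exceptional" and f: "f \<in> qvar_ball q"
  shows "(\<lambda>k. approx k f \<omega>) \<longlonglongrightarrow> \<nu>' f \<omega>"
    and "\<bar>\<nu>' f \<omega> - approx k f \<omega>\<bar> \<le> (\<Sum>j. increment_bound (Suc (j + k)) \<omega>)"
    and "ennreal (\<Sum>j. increment_bound (Suc (j + k)) \<omega>) = tail_bound k \<omega>"
proof -
  have inc: "\<bar>approx (Suc k) f \<omega> - approx k f \<omega>\<bar> \<le> increment_bound (Suc k) \<omega>" for k
    by (rule approx_increment[OF f exceptional(3)[OF \<omega>]])
  have nu: "\<nu>' f \<omega> = lim (\<lambda>k. approx k f \<omega>)" using \<omega> by (simp add: \<nu>'_def)
  note I = increments_summable[of "\<lambda>k. approx k f \<omega>" "\<lambda>k. increment_bound k \<omega>", OF inc exceptional(2)[OF \<omega>]]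
  show "(\<lambda>k. approx k f \<omega>) \<longlonglongrightarrow> \<nu>' f \<omega>" unfolding nu by (rule I(1))
  show "\<bar>\<nu>' f \<omega> - approx k f \<omega>\<bar> \<le> (\<Sum>j. increment_bound (Suc (j + k)) \<omega>)" unfolding nu by (rule I(2))
  have "summable (\<lambda>j. increment_bound (Suc (j + k)) \<omega>)"
    using summable_ignore_initial_segment[OF exceptional(2)[OF \<omega>], of "Suc k"] by simp
  then show "ennreal (\<Sum>j. increment_bound (Suc (j + k)) \<omega>) = tail_bound k \<omega>"
    unfolding tail_bound_def using increment_bound(3) by (intro suminf_ennreal2[symmetric]) auto
qed

lemma approx_measurable [measurable]: "approx k f \<in> borel_measurable N"
  unfolding approx_def[abs_def] by (intro borel_measurable_sum borel_measurable_times) auto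

lemma \<nu>'_measurable [measurable]: "\<nu>' f \<in> borel_measurable N"
proof -
  have [measurable]: "exceptional \<in> sets N" using exceptional(1) by auto
  show ?thesis unfolding \<nu>'_def[abs_def] by measurable
qed

lemma AE_not_exceptional: "AE \<omega> in N. \<omega> \<notin> exceptional"
  using exceptional(1) by (rule AE_not_in)

text \<open>The difference of \<nu> f and \<open>approx k f\<close> is normal, with variance the
  squared L2 distance of f to its step function. The approximations thus tend to \<nu> f in L1 and
  almost surely along a subsequence, while pathwise they tend to \<nu>' f.\<close>

lemma \<nu>'_version: "version_on N (qvar_ball q) \<nu> \<nu>'"
  unfolding version_on_def
proof (intro ballI conjI \<nu>'_measurable)
  fix f assume f: "f \<in> qvar_ball q"
  note fL = qvar_ball_L2_unit[OF f q(1)]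
  have nm: "normal0 N (\<lambda>\<omega>. \<nu> f \<omega> - approx k f \<omega>) (sqn (\<lambda>x. f x - tag_step k f x))" for k
  proof -
    have "normal0 N (\<lambda>\<omega>. \<nu> f \<omega> - (\<Sum>m<16 ^ k. f (tag k m) * \<nu> (cell_fun k m) \<omega>))
      (sqn (\<lambda>x. f x - (\<Sum>m<16 ^ k. f (tag k m) * cell_fun k m x)))"
      by (rule family_difference[OF fL]) (auto intro: cell_fun_L2_unit)
    moreover have "sqn (\<lambda>x. f x - (\<Sum>m<16 ^ k. f (tag k m) * cell_fun k m x)) = sqn (\<lambda>x. f x - tag_step k f x)"
      by (rule sqn_cong) (simp add: tag_step_def cell_fun_eq)
    ultimately show ?thesis unfolding approx_def B_def by simp
  qed
  have s0: "0 \<le> sqn g" for g unfolding sqn_def by (intro Bochner_Integration.integral_nonneg) simp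
  have int: "integrable N (\<lambda>\<omega>. \<nu> f \<omega> - approx k f \<omega>)" for k
    using normal0_integrable[where k = 1, OF nm s0] by simp
  have "(\<lambda>k. \<integral>\<omega>. norm (\<nu> f \<omega> - approx k f \<omega>) \<partial>N) \<longlonglongrightarrow> 0"
  proof (rule Lim_null_comparison)
    show "\<forall>\<^sub>F k in sequentially. norm (\<integral>\<omega>. norm (\<nu> f \<omega> - approx k f \<omega>) \<partial>N) \<le> sqrt (sqn (\<lambda>x. f x - tag_step k f x))"
      using normal0_abs_expectation[OF nm s0] by (intro always_eventually) simp
    show "(\<lambda>k. sqrt (sqn (\<lambda>x. f x - tag_step k f x))) \<longlonglongrightarrow> 0"
      using tendsto_real_sqrt[OF sqn_tag_step[OF f q(1)]] by simp
  qed
  from tendsto_L1_AE_subseq[OF int this]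
  obtain r where r: "strict_mono r" "AE \<omega> in N. (\<lambda>n. \<nu> f \<omega> - approx (r n) f \<omega>) \<longlonglongrightarrow> 0" by blast
  from r(2) AE_not_exceptional AE_space show "AE \<omega> in N. \<nu>' f \<omega> = \<nu> f \<omega>"
  proof eventually_elim
    case (elim \<omega>)
    have "(\<lambda>n. approx (r n) f \<omega>) \<longlonglongrightarrow> \<nu>' f \<omega>"
      using LIMSEQ_subseq_LIMSEQ[OF \<nu>'_approx(1)[OF _ f] r(1), of \<omega>] elim by (simp add: o_def)
    then have "(\<lambda>n. \<nu> f \<omega> - approx (r n) f \<omega>) \<longlonglongrightarrow> \<nu> f \<omega> - \<nu>' f \<omega>" by (intro tendsto_intros)
    from LIMSEQ_unique[OF this elim(1)] show ?case by simp
  qed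
qed

definition limit_path :: "real \<Rightarrow> 'b \<Rightarrow> (real \<Rightarrow> real) \<Rightarrow> real" where
  "limit_path c \<omega> = (\<lambda>f\<in>qvar_ball q. c * \<nu>' f \<omega>)"

text \<open>Set to 0 on the exceptional set, so that it approximates \<open>limit_path\<close> at every point.\<close>

definition approx_vec :: "real \<Rightarrow> nat \<Rightarrow> 'b \<Rightarrow> nat \<Rightarrow> real" where
  "approx_vec c k \<omega> m = (if \<omega> \<in> exceptional \<or> 16 ^ k \<le> m then 0 else c * B k m \<omega>)"

lemma step_functional_approx:
  assumes "f \<in> qvar_ball q"
  shows "step_functional q k (approx_vec c k \<omega>) f = (if \<omega> \<in> exceptional then 0 else c * approx k f \<omega>)"
  using assms by (auto simp: step_functional_def approx_vec_def approx_def sum_distrib_left mult_ac intro!: sum.cong)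

lemma limit_path_mspace:
  assumes \<omega>: "\<omega> \<in> space N" shows "limit_path c \<omega> \<in> mspace (linfty (qvar_ball q))"
proof (cases "\<omega> \<in> exceptional")
  case True
  then show ?thesis unfolding limit_path_def by (intro linfty_mspace[where b = 0]) (simp add: \<nu>'_def)
next
  case False
  then have w: "\<omega> \<in> space N - exceptional" using \<omega> by simp
  have "\<bar>c * \<nu>' f \<omega>\<bar> \<le> \<bar>c\<bar> * ((\<Sum>j. increment_bound (Suc (j + 0)) \<omega>) + \<bar>B 0 0 \<omega>\<bar>)" if f: "f \<in> qvar_ball q" for f
  proof -
    \<comment> \<open>Level 0 has a single cell, with tag 1. Its term is bounded uniformly over the
      ball, and the sum of all later increments is finite.\<close>
    have "approx 0 f \<omega> = f 1 * B 0 0 \<omega>" by (simp add: approx_def)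
    then have "\<bar>approx 0 f \<omega>\<bar> \<le> \<bar>B 0 0 \<omega>\<bar>"
      using qvar_ball_abs_le[OF f q(1), of 1] by (simp add: abs_mult mult_left_le_one_le)
    then have "\<bar>\<nu>' f \<omega>\<bar> \<le> (\<Sum>j. increment_bound (Suc (j + 0)) \<omega>) + \<bar>B 0 0 \<omega>\<bar>"
      using \<nu>'_approx(2)[OF w f, of 0] by linarith
    then show ?thesis unfolding abs_mult by (rule mult_left_mono) simp
  qed
  then show ?thesis unfolding limit_path_def by (rule linfty_mspace)
qed

lemma limit_path_dist:
  assumes \<omega>: "\<omega> \<in> space N"
  shows "mdist (linfty (qvar_ball q)) (step_functional q k (approx_vec c k \<omega>)) (limit_path c \<omega>)
    \<le> (if \<omega> \<in> exceptional then 0 else \<bar>c\<bar> * (\<Sum>j. increment_bound (Suc (j + k)) \<omega>))" (is "_ \<le> ?r")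
proof (rule linfty_mdist_le[OF step_functional_mspace[OF q(1)] limit_path_mspace[OF \<omega>]])
  show "0 \<le> ?r"
  proof (cases "\<omega> \<in> exceptional")
    case False
    then have "summable (\<lambda>j. increment_bound (Suc (j + k)) \<omega>)"
      using summable_ignore_initial_segment[OF exceptional(2), of \<omega> "Suc k"] \<omega> by simp
    then show ?thesis using increment_bound(3) by (auto intro!: mult_nonneg_nonneg suminf_nonneg)
  qed simp
  fix f assume f: "f \<in> qvar_ball q"
  show "\<bar>step_functional q k (approx_vec c k \<omega>) f - limit_path c \<omega> f\<bar> \<le> ?r"
  proof (cases "\<omega> \<in> exceptional")
    case True
    then show ?thesis using f by (simp add: step_functional_approx limit_path_def \<nu>'_def)
  next
    case False
    then have w: "\<omega> \<in> space N - exceptional" using \<omega> by simp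
    have "\<bar>c * approx k f \<omega> - c * \<nu>' f \<omega>\<bar> = \<bar>c\<bar> * \<bar>\<nu>' f \<omega> - approx k f \<omega>\<bar>"
      by (simp add: abs_mult[symmetric] right_diff_distrib abs_minus_commute)
    also have "\<dots> \<le> \<bar>c\<bar> * (\<Sum>j. increment_bound (Suc (j + k)) \<omega>)"
      using \<nu>'_approx(2)[OF w f, of k] by (intro mult_left_mono) auto
    finally show ?thesis using f False by (simp add: step_functional_approx limit_path_def)
  qed
qed

lemma approx_vec_measurable: "(\<lambda>\<omega>. approx_vec c k \<omega> m) \<in> borel_measurable N"
proof -
  have [measurable]: "exceptional \<in> sets N" using exceptional(1) by auto
  show ?thesis
  proof (cases "m < 16 ^ k")
    case True
    note [measurable] = B_measurable[OF True]
    show ?thesis unfolding approx_vec_def[abs_def] using True by simp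
  qed (simp add: approx_vec_def[abs_def])
qed

text \<open>Step functionals with rational values form a countable set that approximates every step
  approximation of the path. The step approximations are Lipschitz in finitely many measurable
  coordinates, which gives measurable preimages of open sets.\<close>

lemma limit_path_separable: "separable_borel_valued N (linfty (qvar_ball q)) (limit_path c)"
proof (rule separable_borel_valued_limit[where Zk = "\<lambda>k \<omega>. step_functional q k (approx_vec c k \<omega>)"
      and C = "\<Union>k. step_functional q k ` (PiE {..<16 ^ k} (\<lambda>_. \<rat>))"])
  show "limit_path c \<omega> \<in> mspace (linfty (qvar_ball q))" if "\<omega> \<in> space N" for \<omega>
    by (rule limit_path_mspace[OF that])
  show "step_functional q k (approx_vec c k \<omega>) \<in> mspace (linfty (qvar_ball q))" for k \<omega>
    by (rule step_functional_mspace[OF q(1)])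
  show "(\<lambda>\<omega>. step_functional q k (approx_vec c k \<omega>)) -` U \<inter> space N \<in> sets N"
    if "openin (mtopology_of (linfty (qvar_ball q))) U" for k U
    by (rule open_measurable_from_lipschitz[OF _ step_functional_mspace[OF q(1)] that],
        rule step_functional_compose_measurable[OF q(1) _ _ approx_vec_measurable])
  show "(\<lambda>k. mdist (linfty (qvar_ball q)) (step_functional q k (approx_vec c k \<omega>)) (limit_path c \<omega>)) \<longlonglongrightarrow> 0"
    if \<omega>: "\<omega> \<in> space N" for \<omega>
  proof (rule Lim_null_comparison)
    show "\<forall>\<^sub>F k in sequentially. norm (mdist (linfty (qvar_ball q)) (step_functional q k (approx_vec c k \<omega>)) (limit_path c \<omega>))
      \<le> (if \<omega> \<in> exceptional then 0 else \<bar>c\<bar> * (\<Sum>j. increment_bound (Suc (j + k)) \<omega>))"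
      using limit_path_dist[OF \<omega>, of _ c] by (intro always_eventually allI) (simp only: real_norm_def abs_of_nonneg mdist_nonneg)
    show "(\<lambda>k. if \<omega> \<in> exceptional then 0 else \<bar>c\<bar> * (\<Sum>j. increment_bound (Suc (j + k)) \<omega>)) \<longlonglongrightarrow> 0"
    proof (cases "\<omega> \<in> exceptional")
      case False
      then have "summable (\<lambda>j. increment_bound (Suc j) \<omega>)" 
        using exceptional(2)[of \<omega>] \<omega> summable_Suc_iff[of "\<lambda>k. increment_bound k \<omega>"] by blast
      from suminf_exist_split2[OF this] have "(\<lambda>k. \<Sum>j. increment_bound (Suc (j + k)) \<omega>) \<longlonglongrightarrow> 0" .
      from tendsto_mult_right_zero[OF this, of "\<bar>c\<bar>"] show ?thesis using False by simp
    qed simp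
  qed
  show "countable (\<Union>k. step_functional q k ` (PiE {..<16 ^ k} (\<lambda>_. \<rat>)))"
    by (intro countable_UN countable_image countable_PiE) (auto simp: countable_rat)
  show "(\<Union>k. step_functional q k ` (PiE {..<16 ^ k} (\<lambda>_. \<rat>))) \<subseteq> mspace (linfty (qvar_ball q))"
    using step_functional_mspace[OF q(1)] by blast
  show "\<exists>s\<in>\<Union>k. step_functional q k ` (PiE {..<16 ^ k} (\<lambda>_. \<rat>)).
      mdist (linfty (qvar_ball q)) (step_functional q k (approx_vec c k \<omega>)) s < e" if e: "0 < e" for k \<omega> e
  proof -
    obtain w where w: "w \<in> PiE {..<16 ^ k} (\<lambda>_. \<rat>)" "(\<Sum>m<16 ^ k. \<bar>approx_vec c k \<omega> m - w m\<bar>) < e"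
      using rational_approx[OF e] by blast
    then have "mdist (linfty (qvar_ball q)) (step_functional q k (approx_vec c k \<omega>)) (step_functional q k w) < e"
      using step_functional_lipschitz[OF q(1), of k "approx_vec c k \<omega>" w] by linarith
    then show ?thesis using w(1) by blast
  qed
qed

text \<open>The price of stopping the limit path at level k. It is uniform over all tests with
  Lipschitz constant L, and it reduces the limit law to finitely many normal variables.\<close>

lemma limit_path_expectation:
  assumes h: "\<And>x y. x \<in> mspace (linfty (qvar_ball q)) \<Longrightarrow> y \<in> mspace (linfty (qvar_ball q)) \<Longrightarrow>
      \<bar>h x - h y\<bar> \<le> L * mdist (linfty (qvar_ball q)) x y" and L: "0 \<le> L"
    and bd: "\<And>x. x \<in> mspace (linfty (qvar_ball q)) \<Longrightarrow> \<bar>h x\<bar> \<le> K"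
  shows "\<bar>expectation (\<lambda>\<omega>. h (step_functional q k (\<lambda>m. c * B k m \<omega>))) - expectation (\<lambda>\<omega>. h (limit_path c \<omega>))\<bar>
    \<le> L * \<bar>c\<bar> * gaussian_tail k"
proof -
  let ?Y = "\<lambda>\<omega>. h (step_functional q k (\<lambda>m. c * B k m \<omega>))" and ?Z = "\<lambda>\<omega>. h (limit_path c \<omega>)"
  have Ym: "?Y \<in> borel_measurable N"
    by (rule step_functional_compose_measurable[OF q(1) h L]) auto
  have Zm: "?Z \<in> borel_measurable N"
    by (rule separable_borel_valued_measurable[OF limit_path_separable lipschitz_continuous_map[OF h]])
  have Yi: "integrable N ?Y"
    by (rule integrable_const_bound[of _ K]) (use bd[OF step_functional_mspace[OF q(1)]] Ym in auto)
  have Zi: "integrable N ?Z"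
    by (rule integrable_const_bound[of _ K]) (use bd[OF limit_path_mspace] Zm in auto)
  have "ennreal (expectation (\<lambda>\<omega>. \<bar>?Y \<omega> - ?Z \<omega>\<bar>)) = (\<integral>\<^sup>+\<omega>. ennreal \<bar>?Y \<omega> - ?Z \<omega>\<bar> \<partial>N)"
    using Yi Zi by (intro nn_integral_eq_integral[symmetric]) auto
  also have "\<dots> \<le> (\<integral>\<^sup>+\<omega>. ennreal (L * \<bar>c\<bar>) * tail_bound k \<omega> \<partial>N)"
  proof (rule nn_integral_mono_AE)
    show "AE \<omega> in N. ennreal \<bar>?Y \<omega> - ?Z \<omega>\<bar> \<le> ennreal (L * \<bar>c\<bar>) * tail_bound k \<omega>"
      using AE_not_exceptional AE_space
    proof eventually_elim
      case (elim \<omega>)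
      then have w: "\<omega> \<in> space N - exceptional" by simp
      have eq: "step_functional q k (\<lambda>m. c * B k m \<omega>) = step_functional q k (approx_vec c k \<omega>)"
        unfolding step_functional_def using elim by (auto simp: approx_vec_def intro!: restrict_ext sum.cong)
      have s: "summable (\<lambda>j. increment_bound (Suc (j + k)) \<omega>)"
        using summable_ignore_initial_segment[OF exceptional(2)[OF w], of "Suc k"] by simp
      have s0: "0 \<le> (\<Sum>j. increment_bound (Suc (j + k)) \<omega>)" using s increment_bound(3) by (intro suminf_nonneg)
      have "\<bar>?Y \<omega> - ?Z \<omega>\<bar> \<le> L * mdist (linfty (qvar_ball q)) (step_functional q k (approx_vec c k \<omega>)) (limit_path c \<omega>)"
        unfolding eq by (rule h[OF step_functional_mspace[OF q(1)] limit_path_mspace[OF elim(2)]])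
      also have "\<dots> \<le> L * (\<bar>c\<bar> * (\<Sum>j. increment_bound (Suc (j + k)) \<omega>))"
        using limit_path_dist[OF elim(2), of k c] elim(1) L by (intro mult_left_mono) auto
      finally have "ennreal \<bar>?Y \<omega> - ?Z \<omega>\<bar> \<le> ennreal (L * \<bar>c\<bar> * (\<Sum>j. increment_bound (Suc (j + k)) \<omega>))"
        by (intro ennreal_leI) (simp add: mult.assoc)
      also have "\<dots> = ennreal (L * \<bar>c\<bar>) * ennreal (\<Sum>j. increment_bound (Suc (j + k)) \<omega>)"
        using L s0 by (intro ennreal_mult) auto
      also have "ennreal (\<Sum>j. increment_bound (Suc (j + k)) \<omega>) = tail_bound k \<omega>"
        unfolding tail_bound_def using s increment_bound(3) by (intro suminf_ennreal2[symmetric]) auto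
      finally show ?case .
    qed
  qed
  also have "\<dots> = ennreal (L * \<bar>c\<bar>) * (\<integral>\<^sup>+\<omega>. tail_bound k \<omega> \<partial>N)" by (rule nn_integral_cmult) measurable
  also have "\<dots> \<le> ennreal (L * \<bar>c\<bar>) * ennreal (gaussian_tail k)" by (intro mult_left_mono tail_bound_integral) auto
  also have "\<dots> = ennreal (L * \<bar>c\<bar> * gaussian_tail k)" using L by (simp add: ennreal_mult')
  finally have "ennreal (expectation (\<lambda>\<omega>. \<bar>?Y \<omega> - ?Z \<omega>\<bar>)) \<le> ennreal (L * \<bar>c\<bar> * gaussian_tail k)" .
  moreover have "0 \<le> L * \<bar>c\<bar> * gaussian_tail k" using L chain_ratio(1,2)[OF q] by (simp add: gaussian_tail_def)
  ultimately have "expectation (\<lambda>\<omega>. \<bar>?Y \<omega> - ?Z \<omega>\<bar>) \<le> L * \<bar>c\<bar> * gaussian_tail k"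
    by (simp add: ennreal_le_iff)
  moreover have "\<bar>expectation ?Y - expectation ?Z\<bar> \<le> expectation (\<lambda>\<omega>. \<bar>?Y \<omega> - ?Z \<omega>\<bar>)"
    using integral_abs_bound[of N "\<lambda>\<omega>. ?Y \<omega> - ?Z \<omega>"] Yi Zi by simp
  ultimately show ?thesis by linarith
qed

end

section \<open>Block sums and linear processes\<close>

context prob_space
begin

lemma indep_vars_reindex:
  assumes inj: "inj_on g I" and ind: "indep_vars (\<lambda>_. N) X (g ` I)"
  shows "indep_vars (\<lambda>_. N) (\<lambda>i. X (g i)) I"
proof -
  let ?F = "\<lambda>i. {X i -` A \<inter> space M | A. A \<in> sets N}"
  have rv: "\<And>i. i \<in> g ` I \<Longrightarrow> random_variable N (X i)" and isets: "indep_sets ?F (g ` I)"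
    using ind unfolding indep_vars_def2 by auto
  have "indep_sets (\<lambda>i. ?F (g i)) I"
  proof (rule indep_setsI)
    show "?F (g i) \<subseteq> events" if "i \<in> I" for i using isets that unfolding indep_sets_def by auto
    fix A J assume J: "J \<noteq> {}" "J \<subseteq> I" "finite J" and A: "\<forall>j\<in>J. A j \<in> ?F (g j)"
    have inv: "inv_into I g (g j) = j" if "j \<in> J" for j using that J inj by (auto intro: inv_into_f_f)
    have "prob (\<Inter>j\<in>g ` J. A (inv_into I g j)) = (\<Prod>j\<in>g ` J. prob (A (inv_into I g j)))"
      by (rule indep_setsD[OF isets]) (use J A inv in auto)
    moreover have "(\<Inter>j\<in>g ` J. A (inv_into I g j)) = (\<Inter>j\<in>J. A j)" using inv by auto
    moreover have "(\<Prod>j\<in>g ` J. prob (A (inv_into I g j))) = (\<Prod>j\<in>J. prob (A j))"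
      using inj J inv by (subst prod.reindex) (auto intro: inj_on_subset)
    ultimately show "prob (\<Inter>j\<in>J. A j) = (\<Prod>j\<in>J. prob (A j))" by simp
  qed
  then show ?thesis using rv unfolding indep_vars_def2 by auto
qed

text \<open>The variance of a centred independent sum under square integrability alone, whereas
  \<open>centred_sum_moments\<close> is about bounded terms.\<close>

lemma sum_square_expectation:
  fixes c :: "'i \<Rightarrow> 'a \<Rightarrow> real" and v :: real
  assumes "finite J" "indep_vars (\<lambda>_. borel) c J" "\<And>j. j \<in> J \<Longrightarrow> integrable M (\<lambda>\<omega>. (c j \<omega>)\<^sup>2)"
    "\<And>j. j \<in> J \<Longrightarrow> expectation (c j) = 0" "\<And>j. j \<in> J \<Longrightarrow> expectation (\<lambda>\<omega>. (c j \<omega>)\<^sup>2) = v"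
  shows "integrable M (\<lambda>\<omega>. \<Sum>j\<in>J. c j \<omega>) \<and> integrable M (\<lambda>\<omega>. (\<Sum>j\<in>J. c j \<omega>)\<^sup>2) \<and>
    expectation (\<lambda>\<omega>. (\<Sum>j\<in>J. c j \<omega>)\<^sup>2) = card J * v"
  using assms
proof (induction J rule: finite_induct)
  case (insert x F)
  let ?S = "\<lambda>\<omega>. \<Sum>j\<in>F. c j \<omega>"
  have meas: "c j \<in> borel_measurable M" if "j \<in> insert x F" for j
    using insert.prems(1) that unfolding indep_vars_def by auto
  have ci: "integrable M (c x)"
    by (rule square_integrable_imp_integrable[OF meas]) (use insert.prems in auto)
  have IH: "integrable M ?S" "integrable M (\<lambda>\<omega>. (?S \<omega>)\<^sup>2)" "expectation (\<lambda>\<omega>. (?S \<omega>)\<^sup>2) = card F * v"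
    using insert.IH insert.prems indep_vars_subset[OF insert.prems(1), of F] by auto
  have ind: "indep_var borel (c x) borel ?S"
    using insert.hyps insert.prems(1) by (intro indep_vars_sum) auto
  have i: "integrable M (\<lambda>\<omega>. c x \<omega> * ?S \<omega>)" by (rule indep_var_integrable[OF ind ci IH(1)])
  have E: "expectation (\<lambda>\<omega>. c x \<omega> * ?S \<omega>) = 0"
    using indep_var_lebesgue_integral[OF ind ci IH(1)] insert.prems(3) by simp
  have cx: "integrable M (\<lambda>\<omega>. (c x \<omega>)\<^sup>2)" "expectation (\<lambda>\<omega>. (c x \<omega>)\<^sup>2) = v" using insert.prems by auto
  have eq: "(\<Sum>j\<in>insert x F. c j \<omega>)\<^sup>2 = (c x \<omega>)\<^sup>2 + 2 * (c x \<omega> * ?S \<omega>) + (?S \<omega>)\<^sup>2" for \<omega>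
    using insert.hyps by (simp add: power2_sum)
  have "integrable M (\<lambda>\<omega>. (\<Sum>j\<in>insert x F. c j \<omega>)\<^sup>2)" unfolding eq
    by (intro Bochner_Integration.integrable_add integrable_mult_right cx i IH)
  moreover have "expectation (\<lambda>\<omega>. (\<Sum>j\<in>insert x F. c j \<omega>)\<^sup>2) = v + 2 * 0 + card F * v"
    unfolding eq using cx i IH E by simp
  moreover have "integrable M (\<lambda>\<omega>. \<Sum>j\<in>insert x F. c j \<omega>)" using insert.hyps ci IH(1) by simp
  ultimately show ?case using insert.hyps by (simp add: distrib_right)
qed simp

lemma abs_expectation_le_sqrt:
  fixes v :: real
  assumes "integrable M Z" "integrable M (\<lambda>\<omega>. (Z \<omega>)\<^sup>2)" "expectation (\<lambda>\<omega>. (Z \<omega>)\<^sup>2) \<le> v"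
  shows "expectation (\<lambda>\<omega>. \<bar>Z \<omega>\<bar>) \<le> sqrt v"
proof (rule real_le_rsqrt)
  have "0 \<le> variance (\<lambda>\<omega>. \<bar>Z \<omega>\<bar>)" by (intro Bochner_Integration.integral_nonneg) simp
  also have "\<dots> = expectation (\<lambda>\<omega>. (Z \<omega>)\<^sup>2) - (expectation (\<lambda>\<omega>. \<bar>Z \<omega>\<bar>))\<^sup>2"
    using assms by (subst variance_eq) auto
  finally show "(expectation (\<lambda>\<omega>. \<bar>Z \<omega>\<bar>))\<^sup>2 \<le> v" using assms(3) by simp
qed

text \<open>Both characteristic functions are the same power of the common one, so the law depends
  on the number of summands only.\<close>

lemma distr_sum_iid:
  fixes X :: "'i \<Rightarrow> 'a \<Rightarrow> real" and X' :: "'j \<Rightarrow> 'a \<Rightarrow> real"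
  assumes "indep_vars (\<lambda>_. borel) X J" "indep_vars (\<lambda>_. borel) X' J'" "card J = card J'"
    and "\<And>j. j \<in> J \<Longrightarrow> distr M borel (X j) = D" "\<And>j. j \<in> J' \<Longrightarrow> distr M borel (X' j) = D"
  shows "distr M borel (\<lambda>\<omega>. (\<Sum>j\<in>J. X j \<omega>) / s) = distr M borel (\<lambda>\<omega>. (\<Sum>j\<in>J'. X' j \<omega>) / s)"
proof (rule Levy_uniqueness)
  have m: "(\<lambda>\<omega>. \<Sum>j\<in>J. X j \<omega>) \<in> borel_measurable M" "(\<lambda>\<omega>. \<Sum>j\<in>J'. X' j \<omega>) \<in> borel_measurable M"
    using assms(1,2) unfolding indep_vars_def by (auto intro!: borel_measurable_sum)
  show "real_distribution (distr M borel (\<lambda>\<omega>. (\<Sum>j\<in>J. X j \<omega>) / s))"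
    "real_distribution (distr M borel (\<lambda>\<omega>. (\<Sum>j\<in>J'. X' j \<omega>) / s))"
    using m by (auto intro!: real_distribution_distr borel_measurable_divide)
  have scale: "char (distr M borel (\<lambda>\<omega>. Z \<omega> / s)) t = char (distr M borel Z) (t / s)"
    if "Z \<in> borel_measurable M" for Z t
    using that by (subst (1 2) char_distr_eq) auto
  show "char (distr M borel (\<lambda>\<omega>. (\<Sum>j\<in>J. X j \<omega>) / s)) = char (distr M borel (\<lambda>\<omega>. (\<Sum>j\<in>J'. X' j \<omega>) / s))"
    using assms by (simp add: fun_eq_iff scale[OF m(1)] scale[OF m(2)] char_distr_sum)
qed

end

section \<open>Joint laws of block sums and the central limit theorem\<close>

lemma measurable_component_compose:
  fixes f :: "'b \<Rightarrow> real"
  assumes "f \<in> borel_measurable \<Omega>" "m \<in> J"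
  shows "(\<lambda>x. f (x m)) \<in> borel_measurable (\<Pi>\<^sub>M m\<in>J. \<Omega>)"
  by (rule measurable_compose[of "\<lambda>x. x m" _ \<Omega> f, OF measurable_component_singleton assms(1)]) (rule assms(2))

lemma distr_PiM_components:
  fixes f :: "'i \<Rightarrow> 'b \<Rightarrow> real"
  assumes J: "finite J" and \<Omega>: "prob_space \<Omega>" and f: "\<And>m. m \<in> J \<Longrightarrow> f m \<in> borel_measurable \<Omega>"
  shows "distr (\<Pi>\<^sub>M m\<in>J. \<Omega>) (\<Pi>\<^sub>M m\<in>J. borel) (\<lambda>x. \<lambda>m\<in>J. f m (x m)) = (\<Pi>\<^sub>M m\<in>J. distr \<Omega> borel (f m))"
proof -
  define D where "D j = (if j \<in> J then distr \<Omega> borel (f j) else return borel 0)" for j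
  have D: "prob_space (D j)" for j
    unfolding D_def using f by (auto intro: prob_space.prob_space_distr[OF \<Omega>] prob_space_return)
  interpret D: product_sigma_finite D
    unfolding product_sigma_finite_def using D prob_space_imp_sigma_finite by blast
  interpret O: product_sigma_finite "\<lambda>_ :: 'i. \<Omega>"
    unfolding product_sigma_finite_def using \<Omega> prob_space_imp_sigma_finite by blast
  have fm: "(\<lambda>x. \<lambda>m\<in>J. f m (x m)) \<in> measurable (\<Pi>\<^sub>M m\<in>J. \<Omega>) (\<Pi>\<^sub>M m\<in>J. borel)"
    by (rule measurable_restrict, rule measurable_component_compose[OF f])
  have "distr (\<Pi>\<^sub>M m\<in>J. \<Omega>) (\<Pi>\<^sub>M m\<in>J. borel) (\<lambda>x. \<lambda>m\<in>J. f m (x m)) = Pi\<^sub>M J D"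
  proof (rule D.PiM_eqI[OF J])
    show "sets (distr (\<Pi>\<^sub>M m\<in>J. \<Omega>) (\<Pi>\<^sub>M m\<in>J. borel) (\<lambda>x. \<lambda>m\<in>J. f m (x m))) = sets (Pi\<^sub>M J D)"
      by (simp add: D_def cong: sets_PiM_cong)
    fix A assume A: "\<And>i. i \<in> J \<Longrightarrow> A i \<in> sets (D i)"
    then have A': "\<And>i. i \<in> J \<Longrightarrow> A i \<in> sets borel" by (simp add: D_def)
    have "emeasure (distr (\<Pi>\<^sub>M m\<in>J. \<Omega>) (\<Pi>\<^sub>M m\<in>J. borel) (\<lambda>x. \<lambda>m\<in>J. f m (x m))) (Pi\<^sub>E J A)
        = emeasure (\<Pi>\<^sub>M m\<in>J. \<Omega>) ((\<lambda>x. \<lambda>m\<in>J. f m (x m)) -` Pi\<^sub>E J A \<inter> space (\<Pi>\<^sub>M m\<in>J. \<Omega>))"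
      using A' J by (intro emeasure_distr[OF fm] sets_PiM_I_finite) auto
    also have "(\<lambda>x. \<lambda>m\<in>J. f m (x m)) -` Pi\<^sub>E J A \<inter> space (\<Pi>\<^sub>M m\<in>J. \<Omega>) = Pi\<^sub>E J (\<lambda>m. f m -` A m \<inter> space \<Omega>)"
      by (auto simp: space_PiM PiE_iff)
    also have "emeasure (\<Pi>\<^sub>M m\<in>J. \<Omega>) \<dots> = (\<Prod>m\<in>J. emeasure \<Omega> (f m -` A m \<inter> space \<Omega>))"
      using A' f by (intro O.emeasure_PiM J measurable_sets) auto
    also have "\<dots> = (\<Prod>m\<in>J. emeasure (D m) (A m))"
      using A' f by (intro prod.cong refl) (simp add: D_def emeasure_distr)
    finally show "emeasure (distr (\<Pi>\<^sub>M m\<in>J. \<Omega>) (\<Pi>\<^sub>M m\<in>J. borel) (\<lambda>x. \<lambda>m\<in>J. f m (x m))) (Pi\<^sub>E J A) = (\<Prod>m\<in>J. emeasure (D m) (A m))" .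
  qed
  also have "Pi\<^sub>M J D = (\<Pi>\<^sub>M m\<in>J. distr \<Omega> borel (f m))" by (rule PiM_cong) (auto simp: D_def)
  finally show ?thesis .
qed

lemma integral_eq_of_joint_law:
  fixes U :: "nat \<Rightarrow> 'a \<Rightarrow> real" and V :: "nat \<Rightarrow> 'b \<Rightarrow> real" and F :: "(nat \<Rightarrow> real) \<Rightarrow> real"
  assumes law: "distr P (\<Pi>\<^sub>M m\<in>{..<n}. borel) (\<lambda>\<omega>. \<lambda>m\<in>{..<n}. U m \<omega>) = distr Q (\<Pi>\<^sub>M m\<in>{..<n}. borel) (\<lambda>\<omega>. \<lambda>m\<in>{..<n}. V m \<omega>)"
    and U: "\<And>m. m < n \<Longrightarrow> U m \<in> borel_measurable P" and V: "\<And>m. m < n \<Longrightarrow> V m \<in> borel_measurable Q"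
    and H: "\<And>v w. \<bar>H v - H w\<bar> \<le> L * (\<Sum>m<n. \<bar>v m - w m\<bar>)" and L: "0 \<le> L"
  shows "(\<integral>\<omega>. H (\<lambda>m. a m * U m \<omega>) \<partial>P) = (\<integral>\<omega>. H (\<lambda>m. a m * V m \<omega>) \<partial>Q)"
proof -
  let ?F = "\<lambda>u. H (\<lambda>m. a m * u m)"
  \<comment> \<open>The Lipschitz bound involves only the coordinates below n, so H factors through
    the restricted tuple, on which the product sigma-algebra lives.\<close>
  have Fr: "?F (\<lambda>m\<in>{..<n}. u m) = ?F u" for u
    using H[of "\<lambda>m. a m * (\<lambda>m\<in>{..<n}. u m) m" "\<lambda>m. a m * u m"] by simp
  have Fm: "?F \<in> borel_measurable (\<Pi>\<^sub>M m\<in>{..<n}. borel)"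
  proof (rule lipschitz_measurable[where H = H, OF H L])
    show "(\<lambda>u. a m * u m) \<in> borel_measurable (\<Pi>\<^sub>M m\<in>{..<n}. borel)" if "m < n" for m
      using that by (intro borel_measurable_times borel_measurable_const measurable_component_singleton) simp
  qed
  have "(\<integral>\<omega>. H (\<lambda>m. a m * U m \<omega>) \<partial>P) = (\<integral>\<omega>. ?F (\<lambda>m\<in>{..<n}. U m \<omega>) \<partial>P)"
    using Fr[of "\<lambda>m. U m _"] by simp
  also have "\<dots> = (\<integral>u. ?F u \<partial>distr P (\<Pi>\<^sub>M m\<in>{..<n}. borel) (\<lambda>\<omega>. \<lambda>m\<in>{..<n}. U m \<omega>))"
    using U by (intro integral_distr[symmetric] Fm measurable_restrict) auto
  also have "\<dots> = (\<integral>\<omega>. ?F (\<lambda>m\<in>{..<n}. V m \<omega>) \<partial>Q)"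
    unfolding law using V by (intro integral_distr Fm measurable_restrict) auto
  also have "\<dots> = (\<integral>\<omega>. H (\<lambda>m. a m * V m \<omega>) \<partial>Q)" using Fr[of "\<lambda>m. V m _"] by simp
  finally show ?thesis .
qed

lemma card_blk_ratio:
  assumes m: "m < N" shows "(\<lambda>n. real (card (blk N n m)) / n) \<longlonglongrightarrow> 1 / N"
proof (rule LIM_zero_cancel, rule Lim_null_comparison)
  have N: "0 < N" using m by simp
  have "\<bar>real (card (blk N n m)) / n - 1 / N\<bar> \<le> 1 / n" if n: "0 < n" for n
  proof -
    have "m * n div N \<le> Suc m * n div N" by (intro div_le_mono) simp
    then have c: "real (card (blk N n m)) = real (Suc m * n div N) - real (m * n div N)"
      using m N by (simp add: blk_eq of_nat_diff)
    have e: "real (Suc m * n) / N = real (m * n) / N + n / N" using N by (simp add: field_simps)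
    have "\<bar>real (card (blk N n m)) - n / N\<bar> \<le> 1" unfolding c
      using real_div_bounds[OF N, of "Suc m * n"] real_div_bounds[OF N, of "m * n"] e by linarith
    then have "\<bar>real (card (blk N n m)) - n / N\<bar> / n \<le> 1 / n" by (intro divide_right_mono) auto
    moreover have "\<bar>real (card (blk N n m)) / n - 1 / N\<bar> = \<bar>real (card (blk N n m)) - n / N\<bar> / n"
    proof -
      have "real (card (blk N n m)) / n - 1 / N = (real (card (blk N n m)) - n / N) / n"
        using n N by (simp add: field_simps)
      then show ?thesis by simp
    qed
    ultimately show ?thesis by simp
  qed
  then show "\<forall>\<^sub>F n in sequentially. norm (real (card (blk N n m)) / n - 1 / N) \<le> 1 / real n"
    by (intro eventually_sequentiallyI[of 1]) simp
  show "(\<lambda>n. 1 / real n) \<longlonglongrightarrow> 0" by (rule lim_1_over_n)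
qed

lemma card_blk_at_top:
  assumes m: "m < N" shows "filterlim (\<lambda>n. card (blk N n m)) sequentially sequentially"
proof -
  have "filterlim (\<lambda>n. real (card (blk N n m)) / n * real n) at_top sequentially"
    using m by (intro filterlim_tendsto_pos_mult_at_top[OF card_blk_ratio[OF m]] filterlim_real_sequentially) auto
  moreover have "\<forall>\<^sub>F n in sequentially. real (card (blk N n m)) / n * real n = real (card (blk N n m))"
    by (intro eventually_sequentiallyI[of 1]) simp
  ultimately have "filterlim (\<lambda>n. real (card (blk N n m))) at_top sequentially"
    by (simp cong: filterlim_cong)
  then show ?thesis by (simp add: filterlim_sequentially_iff_filterlim_real)
qed

text \<open>
  By Skorohod's representation theorem the normalised sums have copies that converge pointwise; a
  product of such representations has the joint law of the independent block sums.
\<close>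

lemma (in prob_space) block_sums_clt:
  fixes \<eta> :: "int \<Rightarrow> 'a \<Rightarrow> real" and B :: "nat \<Rightarrow> 'b \<Rightarrow> real"
  assumes ind: "indep_vars (\<lambda>_. borel) \<eta> UNIV" and dist: "\<And>j. distr M borel (\<eta> j) = D"
    and sq: "\<And>j. integrable M (\<lambda>\<omega>. (\<eta> j \<omega>)\<^sup>2)" and mean: "\<And>j. expectation (\<eta> j) = 0"
    and var: "\<And>j. expectation (\<lambda>\<omega>. (\<eta> j \<omega>)\<^sup>2) = \<sigma>\<^sup>2" and \<sigma>: "0 < \<sigma>" and N: "0 < N"
    and B: "\<And>m. m < N \<Longrightarrow> B m \<in> borel_measurable P0"
    and law: "distr P0 (\<Pi>\<^sub>M m\<in>{..<N}. borel) (\<lambda>\<omega>. \<lambda>m\<in>{..<N}. B m \<omega> * sqrt N) = (\<Pi>\<^sub>M m\<in>{..<N}. std_normal_distribution)"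
    and H: "\<And>v w. \<bar>H v - H w\<bar> \<le> L * (\<Sum>m<N. \<bar>v m - w m\<bar>)" and L: "0 \<le> L" and bd: "\<And>v. \<bar>H v\<bar> \<le> K"
  shows "(\<lambda>n. expectation (\<lambda>\<omega>. H (\<lambda>m. c * ((\<Sum>j\<in>blk N n m. \<eta> (int j) \<omega>) / sqrt n))))
    \<longlonglongrightarrow> (\<integral>\<omega>. H (\<lambda>m. c * \<sigma> * B m \<omega>) \<partial>P0)"
proof -
  have \<eta>m: "\<eta> j \<in> borel_measurable M" for j using ind unfolding indep_vars_def by auto
  \<comment> \<open>The central limit theorem is about initial segments. By identical distribution a
    block of k points, wherever it lies, has the law \<mu> k; see \<open>Ulaw\<close>.\<close>
  define \<mu> where "\<mu> k = distr M borel (\<lambda>\<omega>. (\<Sum>i<k. \<eta> (int i) \<omega>) / sqrt (k * \<sigma>\<^sup>2))" for k :: nat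
  have indn: "indep_vars (\<lambda>_. borel) (\<lambda>i. \<eta> (int i)) I" for I :: "nat set"
    by (rule indep_vars_reindex[OF _ indep_vars_subset[OF ind]]) auto
  have wc: "weak_conv_m \<mu> std_normal_distribution"
    unfolding \<mu>_def
    by (rule central_limit_theorem_zero_mean[where X = "\<lambda>i. \<eta> (int i)" and \<mu> = D, OF indn])
      (use mean sq \<sigma> var dist in auto)
  have \<mu>d: "real_distribution (\<mu> k)" for k
    unfolding \<mu>_def by (intro real_distribution_distr borel_measurable_divide borel_measurable_sum \<eta>m borel_measurable_const)
  obtain \<Omega> :: "real measure" and Y Z where \<Omega>: "prob_space \<Omega>" and Y: "\<And>k. Y k \<in> borel_measurable \<Omega>"
    "\<And>k. distr \<Omega> borel (Y k) = \<mu> k" and Z: "Z \<in> measurable \<Omega> lborel" "distr \<Omega> borel Z = std_normal_distribution"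
    and lim: "\<And>x. x \<in> space \<Omega> \<Longrightarrow> (\<lambda>k. Y k x) \<longlonglongrightarrow> Z x"
    using Skorohod[OF \<mu>d real_dist_normal_dist wc] by metis
  have Zm: "Z \<in> borel_measurable \<Omega>" using Z(1) by simp
  let ?J = "{..<N}"
  define Q where "Q = (\<Pi>\<^sub>M m\<in>?J. \<Omega>)"
  interpret Q: prob_space Q unfolding Q_def by (rule prob_space_PiM) (rule \<Omega>)
  have comp: "(\<lambda>x. f (x m)) \<in> borel_measurable Q" if "f \<in> borel_measurable \<Omega>" "m < N" for f :: "real \<Rightarrow> real" and m
    unfolding Q_def using that by (intro measurable_component_compose) auto
  define U where "U n m \<omega> = (\<Sum>j\<in>blk N n m. \<eta> (int j) \<omega>) / sqrt (card (blk N n m) * \<sigma>\<^sup>2)" for n m \<omega>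
  have Um: "U n m \<in> borel_measurable M" for n m
    unfolding U_def by (intro borel_measurable_divide borel_measurable_sum \<eta>m borel_measurable_const)
  have finb: "finite (blk N n m)" for n m by (auto simp: blk_def)
  have Ulaw: "distr M borel (U n m) = \<mu> (card (blk N n m))" for n m
    unfolding U_def \<mu>_def by (rule distr_sum_iid[OF indn indn, where D = D]) (auto simp: dist)
  have Uind: "indep_vars (\<lambda>_. borel) (U n) ?J" for n
  proof -
    have "indep_vars (\<lambda>m. PiM (blk N n m) (\<lambda>_. borel)) (\<lambda>m \<omega>. restrict (\<lambda>j. \<eta> (int j) \<omega>) (blk N n m)) ?J"
      by (rule indep_vars_restrict[OF indn[of UNIV]]) (auto simp: disjoint_family_on_def blk_def)
    note ind' = this
    define g where "g m u = (\<Sum>j\<in>blk N n m. u j) / sqrt (card (blk N n m) * \<sigma>\<^sup>2)" for m and u :: "nat \<Rightarrow> real"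
    have "indep_vars (\<lambda>_. borel) (\<lambda>m \<omega>. g m (restrict (\<lambda>j. \<eta> (int j) \<omega>) (blk N n m))) ?J"
    proof (rule indep_vars_compose2[OF ind'])
      show "g m \<in> measurable (PiM (blk N n m) (\<lambda>_. borel)) borel" for m unfolding g_def
        by (intro borel_measurable_divide borel_measurable_sum measurable_component_singleton borel_measurable_const)
    qed
    then show ?thesis unfolding U_def[abs_def] g_def by simp
  qed
  have joint: "distr M (\<Pi>\<^sub>M m\<in>?J. borel) (\<lambda>\<omega>. \<lambda>m\<in>?J. U n m \<omega>)
      = distr Q (\<Pi>\<^sub>M m\<in>?J. borel) (\<lambda>x. \<lambda>m\<in>?J. Y (card (blk N n m)) (x m))" for n
  proof -
    have "distr M (\<Pi>\<^sub>M m\<in>?J. borel) (\<lambda>\<omega>. \<lambda>m\<in>?J. U n m \<omega>) = (\<Pi>\<^sub>M m\<in>?J. distr M borel (U n m))"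
      using indep_vars_iff_distr_eq_PiM'[where I = ?J and X = "U n" and M' = "\<lambda>_. borel"] Um Uind N by auto
    also have "\<dots> = (\<Pi>\<^sub>M m\<in>?J. distr \<Omega> borel (Y (card (blk N n m))))" by (simp add: Ulaw Y(2))
    also have "\<dots> = distr Q (\<Pi>\<^sub>M m\<in>?J. borel) (\<lambda>x. \<lambda>m\<in>?J. Y (card (blk N n m)) (x m))"
      unfolding Q_def using \<Omega> Y(1) by (intro distr_PiM_components[symmetric]) auto
    finally show ?thesis .
  qed
  \<comment> \<open>The constant c times the ratio of the standard deviation of the block sum to
    sqrt n; it tends to c * \<sigma> / sqrt N. For an empty block both sides of \<open>a_eq\<close>
    are 0.\<close>
  define a where "a n m = c * (sqrt (real (card (blk N n m)) / n) * \<sigma>)" for n m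
  have a_eq: "c * ((\<Sum>j\<in>blk N n m. \<eta> (int j) \<omega>) / sqrt n) = a n m * U n m \<omega>" for n m \<omega>
  proof (cases "blk N n m = {}")
    case False
    then have "0 < card (blk N n m)" using finb by (simp add: card_gt_0_iff)
    then show ?thesis using \<sigma> by (simp add: a_def U_def real_sqrt_mult real_sqrt_divide)
  qed (simp add: a_def)
  have eqn: "expectation (\<lambda>\<omega>. H (\<lambda>m. c * ((\<Sum>j\<in>blk N n m. \<eta> (int j) \<omega>) / sqrt n)))
      = (\<integral>x. H (\<lambda>m. a n m * Y (card (blk N n m)) (x m)) \<partial>Q)" for n
    unfolding a_eq by (rule integral_eq_of_joint_law[OF joint Um comp[OF Y(1)] H L])
  have "(\<lambda>n. \<integral>x. H (\<lambda>m. a n m * Y (card (blk N n m)) (x m)) \<partial>Q)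
      \<longlonglongrightarrow> (\<integral>x. H (\<lambda>m. c * \<sigma> * (1 / sqrt N) * Z (x m)) \<partial>Q)"
  proof (rule integral_dominated_convergence[where w = "\<lambda>_. K"])
    show "(\<lambda>x. H (\<lambda>m. c * \<sigma> * (1 / sqrt N) * Z (x m))) \<in> borel_measurable Q"
      by (rule lipschitz_measurable[where H = H, OF H L]) (intro borel_measurable_times borel_measurable_const comp Zm)
    show "(\<lambda>x. H (\<lambda>m. a n m * Y (card (blk N n m)) (x m))) \<in> borel_measurable Q" for n
      by (rule lipschitz_measurable[where H = H, OF H L]) (intro borel_measurable_times borel_measurable_const comp Y(1))
    show "AE x in Q. norm (H (\<lambda>m. a n m * Y (card (blk N n m)) (x m))) \<le> K" for n using bd by simp
    show "AE x in Q. (\<lambda>n. H (\<lambda>m. a n m * Y (card (blk N n m)) (x m))) \<longlonglongrightarrow> H (\<lambda>m. c * \<sigma> * (1 / sqrt N) * Z (x m))"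
    proof (rule AE_I2)
      fix x assume "x \<in> space Q"
      then have x: "x m \<in> space \<Omega>" if "m < N" for m using that by (auto simp: Q_def space_PiM)
      have conv: "(\<lambda>n. a n m * Y (card (blk N n m)) (x m)) \<longlonglongrightarrow> c * (sqrt (1 / N) * \<sigma>) * Z (x m)" if m: "m < N" for m
        unfolding a_def
        by (intro tendsto_intros card_blk_ratio[OF m] filterlim_compose[OF lim[OF x[OF m]] card_blk_at_top[OF m]])
      show "(\<lambda>n. H (\<lambda>m. a n m * Y (card (blk N n m)) (x m))) \<longlonglongrightarrow> H (\<lambda>m. c * \<sigma> * (1 / sqrt N) * Z (x m))"
      proof (rule LIM_zero_cancel, rule Lim_null_comparison[OF always_eventually], intro allI)
        show "norm (H (\<lambda>m. a n m * Y (card (blk N n m)) (x m)) - H (\<lambda>m. c * \<sigma> * (1 / sqrt N) * Z (x m)))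
          \<le> L * (\<Sum>m<N. \<bar>a n m * Y (card (blk N n m)) (x m) - c * \<sigma> * (1 / sqrt N) * Z (x m)\<bar>)" for n
          using H by simp
        have "(\<lambda>n. L * (\<Sum>m<N. \<bar>a n m * Y (card (blk N n m)) (x m) - c * \<sigma> * (1 / sqrt N) * Z (x m)\<bar>)) \<longlonglongrightarrow> L * (\<Sum>m<N. 0)"
        proof (intro tendsto_mult tendsto_const tendsto_sum)
          fix m assume "m \<in> {..<N}"
          then have "(\<lambda>n. a n m * Y (card (blk N n m)) (x m)) \<longlonglongrightarrow> c * \<sigma> * (1 / sqrt N) * Z (x m)"
            using conv[of m] by (simp add: real_sqrt_divide mult_ac)
          from tendsto_rabs_zero[OF LIM_zero[OF this]]
          show "(\<lambda>n. \<bar>a n m * Y (card (blk N n m)) (x m) - c * \<sigma> * (1 / sqrt N) * Z (x m)\<bar>) \<longlonglongrightarrow> 0" .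
        qed
        then show "(\<lambda>n. L * (\<Sum>m<N. \<bar>a n m * Y (card (blk N n m)) (x m) - c * \<sigma> * (1 / sqrt N) * Z (x m)\<bar>)) \<longlonglongrightarrow> 0" by simp
      qed
    qed
  qed simp
  also have "(\<integral>x. H (\<lambda>m. c * \<sigma> * (1 / sqrt N) * Z (x m)) \<partial>Q) = (\<integral>\<omega>. H (\<lambda>m. c * \<sigma> * (1 / sqrt N) * (B m \<omega> * sqrt N)) \<partial>P0)"
  proof (rule integral_eq_of_joint_law[OF _ comp[OF Zm] _ H L])
    show "distr Q (\<Pi>\<^sub>M m\<in>?J. borel) (\<lambda>x. \<lambda>m\<in>?J. Z (x m)) = distr P0 (\<Pi>\<^sub>M m\<in>?J. borel) (\<lambda>\<omega>. \<lambda>m\<in>?J. B m \<omega> * sqrt N)"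
      unfolding law Q_def Z(2)[symmetric] using \<Omega> Zm by (intro distr_PiM_components) auto
    show "(\<lambda>\<omega>. B m \<omega> * sqrt N) \<in> borel_measurable P0" if "m < N" for m
      by (intro borel_measurable_times borel_measurable_const B that)
  qed
  finally show ?thesis unfolding eqn using N by (simp add: mult.assoc)
qed

text \<open>The triangle inequality for a series that may converge only conditionally, in which case
  the right-hand side is infinite.\<close>

lemma ennreal_abs_sums_le:
  fixes y :: "nat \<Rightarrow> real"
  assumes "y sums s" shows "ennreal \<bar>s\<bar> \<le> (\<Sum>i. ennreal \<bar>y i\<bar>)"
proof (cases "(\<Sum>i. ennreal \<bar>y i\<bar>) = \<infinity>")
  case False
  then have sm: "summable (\<lambda>i. \<bar>y i\<bar>)" by (intro summable_suminf_not_top) (auto simp: infinity_ennreal_def)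
  then have "ennreal \<bar>s\<bar> \<le> ennreal (\<Sum>i. \<bar>y i\<bar>)"
    using summable_rabs[OF sm] sums_unique[OF assms] by (intro ennreal_leI) simp
  also have "\<dots> = (\<Sum>i. ennreal \<bar>y i\<bar>)" by (rule suminf_ennreal2[symmetric, OF _ sm]) simp
  finally show ?thesis .
qed simp

lemma nn_integral_weighted_series_le:
  fixes w e :: "nat \<Rightarrow> real" and Z :: "nat \<Rightarrow> 'a \<Rightarrow> real"
  assumes Z: "\<And>i. integrable M (Z i)" "\<And>i \<omega>. 0 \<le> Z i \<omega>" "\<And>i. (\<integral>\<omega>. Z i \<omega> \<partial>M) \<le> e i"
    and w: "\<And>i. 0 \<le> w i" and sm: "summable (\<lambda>i. w i * e i)"
  shows "(\<integral>\<^sup>+\<omega>. (\<Sum>i. ennreal (w i * Z i \<omega>)) \<partial>M) \<le> ennreal (\<Sum>i. w i * e i)"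
proof -
  have [measurable]: "Z i \<in> borel_measurable M" for i using Z(1) by auto
  have e: "0 \<le> e i" for i using order_trans[OF Bochner_Integration.integral_nonneg Z(3)] Z(2) by blast
  have "(\<integral>\<^sup>+\<omega>. (\<Sum>i. ennreal (w i * Z i \<omega>)) \<partial>M) = (\<Sum>i. \<integral>\<^sup>+\<omega>. ennreal (w i * Z i \<omega>) \<partial>M)"
    by (rule nn_integral_suminf) measurable
  also have "\<dots> \<le> (\<Sum>i. ennreal (w i * e i))"
  proof (rule suminf_le)
    show "(\<integral>\<^sup>+\<omega>. ennreal (w i * Z i \<omega>) \<partial>M) \<le> ennreal (w i * e i)" for i
      using Z w by (subst nn_integral_eq_integral) (auto intro!: ennreal_leI mult_left_mono AE_I2 mult_nonneg_nonneg)
  qed auto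
  also have "\<dots> = ennreal (\<Sum>i. w i * e i)" by (rule suminf_ennreal2[OF _ sm]) (use w e in simp)
  finally show ?thesis .
qed

text \<open>Shifting an interval by one changes its sum by one term at each end, so i shifts leave 2
  * i boundary terms, however long the interval is.\<close>

lemma sum_shift_diff_abs_le:
  fixes x :: "int \<Rightarrow> real"
  assumes ab: "a \<le> b"
  shows "\<bar>\<Sum>j\<in>{a<..b}. x (int j - int i) - x (int j)\<bar> \<le> (\<Sum>l<i. \<bar>x (int a - int l)\<bar> + \<bar>x (int b - int l)\<bar>)"
proof (induction i)
  case (Suc i)
  have tele: "(\<Sum>j\<in>{a<..b}. x (int j - int (Suc i)) - x (int j - int i)) = x (int a - int i) - x (int b - int i)"
    using ab
  proof (induction b rule: dec_induct)
    case (step b)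
    have "{a<..Suc b} = insert (Suc b) {a<..b}" using step by auto
    moreover have "int (Suc b) - int (Suc i) = int b - int i" by simp
    ultimately show ?case using step.IH by simp
  qed simp
  have "(\<Sum>j\<in>{a<..b}. x (int j - int (Suc i)) - x (int j))
      = (\<Sum>j\<in>{a<..b}. x (int j - int (Suc i)) - x (int j - int i)) + (\<Sum>j\<in>{a<..b}. x (int j - int i) - x (int j))"
    by (simp add: sum.distrib[symmetric] del: of_nat_Suc)
  then show ?case using Suc tele by (simp del: of_nat_Suc)
qed simp

lemma lse_identity:
  assumes "is_lse n f (\<lambda>j. \<beta> * f (real j / real n) + x j) b"
  shows "(\<Sum>j=1..n. (f (real j / real n))\<^sup>2 * (b - \<beta>)) = (\<Sum>j=1..n. f (real j / real n) * x j)"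
proof -
  let ?S = "\<Sum>j=1..n. (f (real j / real n))\<^sup>2"
  have eq: "(\<Sum>j=1..n. (\<beta> * f (real j / real n) + x j) * f (real j / real n)) = \<beta> * ?S + (\<Sum>j=1..n. f (real j / real n) * x j)"
    by (simp add: sum_distrib_left sum.distrib[symmetric] algebra_simps power2_eq_square)
  show ?thesis
  proof (cases "?S = 0")
    \<comment> \<open>A vanishing design leaves \<open>b\<close> arbitrary, but then every summand
      on either side is 0.\<close>
    case True
    then have "f (real j / real n) = 0" if "j \<in> {1..n}" for j
      using that by (subst (asm) sum_nonneg_eq_0_iff) auto
    then show ?thesis by simp
  next
    case False
    then have b: "?S * b = \<beta> * ?S + (\<Sum>j=1..n. f (real j / real n) * x j)"
      using assms unfolding is_lse_def eq by simp
    have "(\<Sum>j=1..n. (f (real j / real n))\<^sup>2 * (b - \<beta>)) = ?S * (b - \<beta>)" by (rule sum_distrib_right[symmetric])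
    also have "\<dots> = ?S * b - \<beta> * ?S" by (simp only: right_diff_distrib mult.commute[of \<beta>])
    finally show ?thesis unfolding b by simp
  qed
qed

section \<open>Linear processes: chaining and shifted block sums\<close>

locale linear_process = prob_space M for M :: "'a measure" +
  fixes \<eta> X :: "int \<Rightarrow> 'a \<Rightarrow> real" and \<sigma> :: real and \<psi> :: "nat \<Rightarrow> real"
  assumes smlp: "short_memory_linear_process M \<eta> \<sigma> \<psi> X"
begin

lemma ind: "indep_vars (\<lambda>_. borel) \<eta> UNIV"
  and distr_eq: "distr M borel (\<eta> j) = distr M borel (\<eta> 1)"
  and \<sigma>_pos: "0 < \<sigma>"
  and summable_\<psi>: "summable (\<lambda>j. \<bar>\<psi> j\<bar>)"
  and X_measurable [measurable]: "X i \<in> borel_measurable M"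
  and X_sums: "AE \<omega> in M. (\<lambda>j. \<psi> j * \<eta> (i - int j) \<omega>) sums X i \<omega>"
  using smlp unfolding short_memory_linear_process_def by auto

lemma \<eta>_measurable [measurable]: "\<eta> j \<in> borel_measurable M"
  using ind unfolding indep_vars_def by auto

lemma
  fixes g :: "real \<Rightarrow> real"
  assumes g: "g \<in> borel_measurable borel"
  shows integrable_innovation: "integrable M (\<lambda>\<omega>. g (\<eta> j \<omega>)) \<longleftrightarrow> integrable M (\<lambda>\<omega>. g (\<eta> 1 \<omega>))"
    and expectation_innovation: "expectation (\<lambda>\<omega>. g (\<eta> j \<omega>)) = expectation (\<lambda>\<omega>. g (\<eta> 1 \<omega>))"
  using integrable_distr_eq[OF \<eta>_measurable g, of j] integrable_distr_eq[OF \<eta>_measurable g, of 1]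
    integral_distr[OF \<eta>_measurable g, of j] integral_distr[OF \<eta>_measurable g, of 1] distr_eq[of j] by auto

lemma \<eta>_integrable: "integrable M (\<eta> j)" and \<eta>_mean: "expectation (\<eta> j) = 0"
  and \<eta>_square: "integrable M (\<lambda>\<omega>. (\<eta> j \<omega>)\<^sup>2)" and \<eta>_var: "expectation (\<lambda>\<omega>. (\<eta> j \<omega>)\<^sup>2) = \<sigma>\<^sup>2"
  using smlp integrable_innovation[of "\<lambda>x. x" j] expectation_innovation[of "\<lambda>x. x" j]
    integrable_innovation[of "\<lambda>x. x\<^sup>2" j] expectation_innovation[of "\<lambda>x. x\<^sup>2" j]
  unfolding short_memory_linear_process_def by auto

lemma \<eta>_abs: "expectation (\<lambda>\<omega>. \<bar>\<eta> j \<omega>\<bar>) \<le> \<sigma>"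
  using abs_expectation_le_sqrt[OF \<eta>_integrable \<eta>_square, of j "\<sigma>\<^sup>2"] \<eta>_var[of j] \<sigma>_pos by simp

lemma ind_shift: "indep_vars (\<lambda>_. borel) (\<lambda>j. \<eta> (int j - i)) I"
  by (rule indep_vars_reindex[OF _ indep_vars_subset[OF ind]]) (auto simp: inj_on_def)

definition truncated_var :: "real \<Rightarrow> real" where
  "truncated_var s = expectation (\<lambda>\<omega>. (\<eta> 1 \<omega>)\<^sup>2 * indicator {x. s < \<bar>x\<bar>} (\<eta> 1 \<omega>))"

lemma truncated_var_tendsto: "(\<lambda>n. truncated_var (sqrt (real n) / 2 ^ K)) \<longlonglongrightarrow> 0"
proof -
  have "(\<lambda>n. expectation (\<lambda>\<omega>. (\<eta> 1 \<omega>)\<^sup>2 * indicator {x. sqrt (real n) / 2 ^ K < \<bar>x\<bar>} (\<eta> 1 \<omega>))) \<longlonglongrightarrow> expectation (\<lambda>\<omega>. 0)"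
  proof (rule integral_dominated_convergence[OF _ _ \<eta>_square[of 1]])
    show "AE \<omega> in M. (\<lambda>n. (\<eta> 1 \<omega>)\<^sup>2 * indicator {x. sqrt (real n) / 2 ^ K < \<bar>x\<bar>} (\<eta> 1 \<omega>)) \<longlonglongrightarrow> 0"
    proof (intro AE_I2 tendsto_eventually)
      fix \<omega>
      have "filterlim (\<lambda>n. sqrt (real n)) at_top sequentially"
        by (rule filterlim_compose[OF sqrt_at_top filterlim_real_sequentially])
      then have "\<forall>\<^sub>F n in sequentially. 2 ^ K * \<bar>\<eta> 1 \<omega>\<bar> \<le> sqrt (real n)"
        unfolding filterlim_at_top by blast
      then show "\<forall>\<^sub>F n in sequentially. (\<eta> 1 \<omega>)\<^sup>2 * indicator {x. sqrt (real n) / 2 ^ K < \<bar>x\<bar>} (\<eta> 1 \<omega>) = 0"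
        by eventually_elim (auto simp: field_simps)
    qed
  qed (auto simp: indicator_def)
  then show ?thesis by (simp add: truncated_var_def)
qed

text \<open>For fixed K the first summand tends to 0 as n grows, since 2 ^ K stays constant; the
  second does not depend on n and becomes small for large K.\<close>

definition chain_error :: "real \<Rightarrow> nat \<Rightarrow> nat \<Rightarrow> real" where
  "chain_error q K n = 2 ^ K * truncated_var (sqrt n / 2 ^ K)
    + 2 * chain_const (\<sigma>\<^sup>2) * (chain_ratio q ^ K / (1 - chain_ratio q) + 2 / 2 ^ K)"

text \<open>Every shift of the innovations is again i.i.d. with the same law, so the bound does not
  depend on i. The majorants are chosen separately for each i and are later summed with the weights
  \<bar>\<psi> i\<bar>.\<close>

lemma shifted_chaining:
  assumes q: "1 \<le> q" "q < 2" and nK: "16 ^ K \<le> n"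
  shows "\<exists>\<Xi>. integrable M \<Xi> \<and> (\<forall>\<omega>. 0 \<le> \<Xi> \<omega>) \<and>
    (\<forall>\<omega>\<in>space M. \<forall>f\<in>qvar_ball q.
      \<bar>\<Sum>j=1..n. (f (real j / n) - f (tag K (cidx (16 ^ K) n j))) * \<eta> (int j - int i) \<omega>\<bar> / sqrt n \<le> \<Xi> \<omega>) \<and>
    expectation \<Xi> \<le> chain_error q K n"
  unfolding chain_error_def
proof (rule iid_chaining[OF q nK ind_shift])
  fix j
  have m: "(\<lambda>x. x\<^sup>2 * indicator {x. sqrt n / 2 ^ K < \<bar>x\<bar>} x) \<in> borel_measurable (borel :: real measure)"
    by (intro borel_measurable_times borel_measurable_power borel_measurable_indicator) measurable
  show "expectation (\<lambda>\<omega>. (\<eta> (int j - int i) \<omega>)\<^sup>2 * indicator {x. sqrt n / 2 ^ K < \<bar>x\<bar>} (\<eta> (int j - int i) \<omega>))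
      \<le> truncated_var (sqrt n / 2 ^ K)"
    unfolding truncated_var_def using expectation_innovation[OF m, of "int j - int i"] by simp
qed (auto simp: \<eta>_square \<eta>_mean \<eta>_var)

text \<open>
  The two arguments of the minimum bound the normalised difference between a block sum and its shift
  by \<open>i\<close>: through the second moments of both, and through the \<open>2 * i\<close> innovations left after telescoping.
\<close>

definition shift_error :: "nat \<Rightarrow> real" where
  "shift_error n = (\<Sum>i. \<bar>\<psi> i\<bar> * min (2 * \<sigma>) (2 * \<sigma> * i / sqrt n))"

text \<open>Tannery's theorem: the first argument of the minimum gives the summable majorant 2 *
  \<sigma> * \<bar>\<psi> i\<bar>, and the second sends each single term to 0.\<close>

lemma shift_error_tendsto: "shift_error \<longlonglongrightarrow> 0"
proof -
  let ?a = "\<lambda>i n. \<bar>\<psi> i\<bar> * min (2 * \<sigma>) (2 * \<sigma> * real i / sqrt (real n))"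
  have a: "0 \<le> ?a i n" "?a i n \<le> \<bar>\<psi> i\<bar> * (2 * \<sigma>)" for i n
    using \<sigma>_pos by (auto intro!: mult_nonneg_nonneg mult_left_mono)
  have "(\<lambda>n. \<Sum>i. ?a i n) \<longlonglongrightarrow> (\<Sum>i. 0)"
  proof (rule tannerys_theorem[THEN conjunct2, THEN conjunct2])
    show "(\<lambda>n. ?a i n) \<longlonglongrightarrow> 0" for i
    proof (rule Lim_null_comparison)
      show "\<forall>\<^sub>F n in sequentially. norm (?a i n) \<le> \<bar>\<psi> i\<bar> * (2 * \<sigma> * real i / sqrt (real n))"
        unfolding real_norm_def abs_of_nonneg[OF a(1)]
        by (intro always_eventually allI mult_left_mono min.cobounded2 abs_ge_zero)
      have "filterlim (\<lambda>n. sqrt (real n)) at_top sequentially"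
        by (rule filterlim_compose[OF sqrt_at_top filterlim_real_sequentially])
      then have "(\<lambda>n. 2 * \<sigma> * real i / sqrt (real n)) \<longlonglongrightarrow> 0"
        by (intro real_tendsto_divide_at_top[OF tendsto_const])
      from tendsto_mult_right_zero[OF this, of "\<bar>\<psi> i\<bar>"]
      show "(\<lambda>n. \<bar>\<psi> i\<bar> * (2 * \<sigma> * real i / sqrt (real n))) \<longlonglongrightarrow> 0" .
    qed
    show "\<forall>\<^sub>F (i, n) in sequentially \<times>\<^sub>F sequentially. norm (?a i n) \<le> \<bar>\<psi> i\<bar> * (2 * \<sigma>)"
      using a by (intro always_eventually) (auto simp del: abs_mult simp: abs_of_nonneg)
    show "summable (\<lambda>i. \<bar>\<psi> i\<bar> * (2 * \<sigma>))" by (intro summable_mult2 summable_\<psi>)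
  qed simp
  then show ?thesis by (simp add: shift_error_def[abs_def])
qed

definition block_shift :: "nat \<Rightarrow> nat \<Rightarrow> nat \<Rightarrow> nat \<Rightarrow> 'a \<Rightarrow> real" where
  "block_shift N n m i \<omega> = (\<Sum>j\<in>blk N n m. \<eta> (int j - int i) \<omega> - \<eta> (int j) \<omega>) / sqrt n"

lemma block_shift_integrable: "integrable M (block_shift N n m i)"
  unfolding block_shift_def[abs_def] by (intro integrable_divide Bochner_Integration.integrable_sum Bochner_Integration.integrable_diff \<eta>_integrable)

lemma block_shift_expectation:
  assumes N: "0 < N" "m < N" and n: "0 < n"
  shows "expectation (\<lambda>\<omega>. \<bar>block_shift N n m i \<omega>\<bar>) \<le> min (2 * \<sigma>) (2 * \<sigma> * i / sqrt n)"
proof -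
  let ?S = "\<lambda>i \<omega>. \<Sum>j\<in>blk N n m. \<eta> (int j - int i) \<omega>"
  let ?D = "\<lambda>\<omega>. \<Sum>j\<in>blk N n m. \<eta> (int j - int i) \<omega> - \<eta> (int j) \<omega>"
  have sub: "blk N n m \<subseteq> {1..n}" by (auto simp: blk_def)
  have fin: "finite (blk N n m)" by (rule finite_subset[OF sub]) simp
  have card: "card (blk N n m) \<le> n" using card_mono[OF _ sub] by simp
  have S: "integrable M (?S i) \<and> expectation (\<lambda>\<omega>. \<bar>?S i \<omega>\<bar>) \<le> sqrt n * \<sigma>" for i
  proof -
    have *: "integrable M (?S i) \<and> integrable M (\<lambda>\<omega>. (?S i \<omega>)\<^sup>2) \<and> expectation (\<lambda>\<omega>. (?S i \<omega>)\<^sup>2) = card (blk N n m) * \<sigma>\<^sup>2"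
      by (rule sum_square_expectation[where J = "blk N n m" and c = "\<lambda>j. \<eta> (int j - int i)" and v = "\<sigma>\<^sup>2"])
        (simp_all add: fin ind_shift \<eta>_square \<eta>_mean \<eta>_var)
    have "expectation (\<lambda>\<omega>. \<bar>?S i \<omega>\<bar>) \<le> sqrt (n * \<sigma>\<^sup>2)"
      using * card by (intro abs_expectation_le_sqrt) (auto intro!: mult_right_mono)
    then show ?thesis using * \<sigma>_pos by (simp add: real_sqrt_mult)
  qed
  have Di: "integrable M ?D" by (intro Bochner_Integration.integrable_sum Bochner_Integration.integrable_diff \<eta>_integrable)
  have "expectation (\<lambda>\<omega>. \<bar>?D \<omega>\<bar>) \<le> expectation (\<lambda>\<omega>. \<bar>?S i \<omega>\<bar> + \<bar>?S 0 \<omega>\<bar>)"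
  proof (rule integral_mono)
    show "\<bar>?D \<omega>\<bar> \<le> \<bar>?S i \<omega>\<bar> + \<bar>?S 0 \<omega>\<bar>" for \<omega> by (simp add: sum_subtractf)
  qed (use S[of i] S[of 0] Di in auto)
  also have "\<dots> = expectation (\<lambda>\<omega>. \<bar>?S i \<omega>\<bar>) + expectation (\<lambda>\<omega>. \<bar>?S 0 \<omega>\<bar>)"
    using S[of i] S[of 0] by (intro Bochner_Integration.integral_add integrable_abs) auto
  finally have D1: "expectation (\<lambda>\<omega>. \<bar>?D \<omega>\<bar>) \<le> 2 * \<sigma> * sqrt n"
    using S[of i] S[of 0] by (simp add: mult.assoc mult.commute[of \<sigma>])
  let ?a = "m * n div N" and ?b = "Suc m * n div N"
  have ab: "?a \<le> ?b" by (intro div_le_mono) simp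
  have "expectation (\<lambda>\<omega>. \<bar>?D \<omega>\<bar>) \<le> expectation (\<lambda>\<omega>. \<Sum>l<i. \<bar>\<eta> (int ?a - int l) \<omega>\<bar> + \<bar>\<eta> (int ?b - int l) \<omega>\<bar>)"
  proof (rule integral_mono)
    show "\<bar>?D \<omega>\<bar> \<le> (\<Sum>l<i. \<bar>\<eta> (int ?a - int l) \<omega>\<bar> + \<bar>\<eta> (int ?b - int l) \<omega>\<bar>)" for \<omega>
      unfolding blk_eq[OF N] by (rule sum_shift_diff_abs_le[OF ab, of "\<lambda>j. \<eta> j \<omega>"])
  qed (auto intro!: integrable_abs Di Bochner_Integration.integrable_sum Bochner_Integration.integrable_add \<eta>_integrable)
  also have "\<dots> = (\<Sum>l<i. expectation (\<lambda>\<omega>. \<bar>\<eta> (int ?a - int l) \<omega>\<bar>) + expectation (\<lambda>\<omega>. \<bar>\<eta> (int ?b - int l) \<omega>\<bar>))"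
    by (simp add: Bochner_Integration.integral_sum \<eta>_integrable)
  also have "\<dots> \<le> (\<Sum>l<i. \<sigma> + \<sigma>)" by (intro sum_mono add_mono \<eta>_abs)
  finally have D2: "expectation (\<lambda>\<omega>. \<bar>?D \<omega>\<bar>) \<le> 2 * \<sigma> * i" by (simp add: algebra_simps)
  have eq: "expectation (\<lambda>\<omega>. \<bar>block_shift N n m i \<omega>\<bar>) = expectation (\<lambda>\<omega>. \<bar>?D \<omega>\<bar>) / sqrt n"
    unfolding block_shift_def by (simp add: abs_divide)
  have "expectation (\<lambda>\<omega>. \<bar>?D \<omega>\<bar>) / sqrt n \<le> 2 * \<sigma>" using D1 n by (simp add: divide_le_eq)
  moreover have "expectation (\<lambda>\<omega>. \<bar>?D \<omega>\<bar>) / sqrt n \<le> 2 * \<sigma> * i / sqrt n" using D2 by (intro divide_right_mono) auto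
  ultimately show ?thesis unfolding eq by simp
qed

definition empirical_path :: "real \<Rightarrow> nat \<Rightarrow> 'a \<Rightarrow> (real \<Rightarrow> real) \<Rightarrow> real" where
  "empirical_path q n \<omega> = (\<lambda>f\<in>qvar_ball q. (\<Sum>j=1..n. f (real j / real n) * X (int j) \<omega>) / sqrt (real n))"

lemma empirical_path_mspace:
  assumes q: "1 \<le> q" shows "empirical_path q n \<omega> \<in> mspace (linfty (qvar_ball q))"
  unfolding empirical_path_def
proof (rule linfty_mspace[where b = "(\<Sum>j=1..n. \<bar>X (int j) \<omega>\<bar>) / sqrt (real n)"])
  fix f assume f: "f \<in> qvar_ball q"
  have "\<bar>\<Sum>j=1..n. f (real j / real n) * X (int j) \<omega>\<bar> \<le> (\<Sum>j=1..n. \<bar>X (int j) \<omega>\<bar>)"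
  proof (rule order_trans[OF sum_abs], rule sum_mono)
    fix j assume "j \<in> {1..n}"
    then have "\<bar>f (real j / real n)\<bar> \<le> 1" by (intro qvar_ball_abs_le[OF f q]) (auto simp: divide_le_eq)
    then show "\<bar>f (real j / real n) * X (int j) \<omega>\<bar> \<le> \<bar>X (int j) \<omega>\<bar>"
      by (simp add: abs_mult mult_left_le_one_le)
  qed
  then show "\<bar>(\<Sum>j=1..n. f (real j / real n) * X (int j) \<omega>) / sqrt (real n)\<bar> \<le> (\<Sum>j=1..n. \<bar>X (int j) \<omega>\<bar>) / sqrt (real n)"
    by (simp add: divide_right_mono)
qed

text \<open>Two replacements are made: values of f by values at tags, at the cost \<open>R1\<close>,
  and block sums of X by those of the innovations times the sum of \<psi>, at the cost of the
  \<open>S m\<close>. The path itself may fail to be measurable, but \<open>R\<close> is built from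
  series of measurable variables and is uniform over the ball.\<close>

lemma empirical_path_approx:
  assumes q: "1 \<le> q" "q < 2" and nK: "16 ^ K \<le> n"
  shows "\<exists>R. R \<in> borel_measurable M \<and>
    (\<integral>\<^sup>+\<omega>. R \<omega> \<partial>M) \<le> ennreal ((\<Sum>i. \<bar>\<psi> i\<bar>) * chain_error q K n + 16 ^ K * shift_error n) \<and>
    (AE \<omega> in M. ennreal (mdist (linfty (qvar_ball q)) (empirical_path q n \<omega>)
      (step_functional q K (\<lambda>m. (\<Sum>i. \<psi> i) * ((\<Sum>j\<in>blk (16 ^ K) n m. \<eta> (int j) \<omega>) / sqrt n)))) \<le> R \<omega>)"
proof -
  let ?N = "16 ^ K :: nat" and ?A = "\<Sum>i. \<psi> i" and ?E = "linfty (qvar_ball q)"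
  let ?t = "\<lambda>j. tag K (cidx ?N n j)"
  have n: "0 < n" using nK by (meson less_le_trans zero_less_numeral zero_less_power)
  define Q where "Q i \<Xi> \<longleftrightarrow> integrable M \<Xi> \<and> (\<forall>\<omega>. 0 \<le> \<Xi> \<omega>) \<and>
    (\<forall>\<omega>\<in>space M. \<forall>f\<in>qvar_ball q.
      \<bar>\<Sum>j=1..n. (f (real j / n) - f (?t j)) * \<eta> (int j - int i) \<omega>\<bar> / sqrt n \<le> \<Xi> \<omega>) \<and>
    expectation \<Xi> \<le> chain_error q K n" for i \<Xi>
  have "\<forall>i. \<exists>\<Xi>. Q i \<Xi>" unfolding Q_def by (intro allI shifted_chaining[OF q nK])
  then obtain \<Xi> where "\<forall>i. Q i (\<Xi> i)" using choice[of Q] by blast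
  then have Q: "Q i (\<Xi> i)" for i by simp
  have \<Xi>: "\<And>i. integrable M (\<Xi> i)" "\<And>i \<omega>. 0 \<le> \<Xi> i \<omega>" "\<And>i. expectation (\<Xi> i) \<le> chain_error q K n"
    and \<Xi>b: "\<And>i \<omega> f. \<omega> \<in> space M \<Longrightarrow> f \<in> qvar_ball q \<Longrightarrow>
      \<bar>\<Sum>j=1..n. (f (real j / n) - f (?t j)) * \<eta> (int j - int i) \<omega>\<bar> / sqrt n \<le> \<Xi> i \<omega>"
    using Q unfolding Q_def by auto
  have [measurable]: "\<Xi> i \<in> borel_measurable M" for i using \<Xi>(1) by auto
  define R1 where "R1 \<omega> = (\<Sum>i. ennreal (\<bar>\<psi> i\<bar> * \<Xi> i \<omega>))" for \<omega>
  define S where "S m \<omega> = (\<Sum>i. ennreal (\<bar>\<psi> i\<bar> * \<bar>block_shift ?N n m i \<omega>\<bar>))" for m \<omega>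
  define R where "R \<omega> = R1 \<omega> + (\<Sum>m<?N. S m \<omega>)" for \<omega>
  have bsm [measurable]: "block_shift ?N n m i \<in> borel_measurable M" for m i using block_shift_integrable by auto
  have R1m [measurable]: "R1 \<in> borel_measurable M" unfolding R1_def[abs_def] by measurable
  have Sm [measurable]: "S m \<in> borel_measurable M" for m unfolding S_def[abs_def] by measurable
  have Rm: "R \<in> borel_measurable M" unfolding R_def[abs_def] by measurable
  have ce: "0 \<le> chain_error q K n"
    by (rule order_trans[OF Bochner_Integration.integral_nonneg \<Xi>(3)]) (rule \<Xi>(2))
  have "(\<integral>\<^sup>+\<omega>. R1 \<omega> \<partial>M) \<le> ennreal (\<Sum>i. \<bar>\<psi> i\<bar> * chain_error q K n)"
    unfolding R1_def by (rule nn_integral_weighted_series_le[OF \<Xi>]) (auto intro: summable_mult2 summable_\<psi>)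
  also have "(\<Sum>i. \<bar>\<psi> i\<bar> * chain_error q K n) = (\<Sum>i. \<bar>\<psi> i\<bar>) * chain_error q K n"
    by (rule suminf_mult2[symmetric, OF summable_\<psi>])
  finally have R1i: "(\<integral>\<^sup>+\<omega>. R1 \<omega> \<partial>M) \<le> ennreal ((\<Sum>i. \<bar>\<psi> i\<bar>) * chain_error q K n)" .
  have mn: "0 \<le> min (2 * \<sigma>) (2 * \<sigma> * real i / sqrt (real n))" for i using \<sigma>_pos by simp
  have sms: "summable (\<lambda>i. \<bar>\<psi> i\<bar> * min (2 * \<sigma>) (2 * \<sigma> * real i / sqrt (real n)))"
  proof (rule summable_comparison_test'[OF summable_mult2[OF summable_\<psi>, of "2 * \<sigma>"]])
    show "norm (\<bar>\<psi> i\<bar> * min (2 * \<sigma>) (2 * \<sigma> * real i / sqrt (real n))) \<le> \<bar>\<psi> i\<bar> * (2 * \<sigma>)" for i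
      unfolding real_norm_def abs_of_nonneg[OF mult_nonneg_nonneg[OF abs_ge_zero mn]]
      by (intro mult_left_mono min.cobounded1 abs_ge_zero)
  qed
  have se: "0 \<le> shift_error n"
    unfolding shift_error_def by (intro suminf_nonneg sms mult_nonneg_nonneg abs_ge_zero mn)
  have Si: "(\<integral>\<^sup>+\<omega>. S m \<omega> \<partial>M) \<le> ennreal (shift_error n)" if "m < ?N" for m
    unfolding S_def shift_error_def
  proof (rule nn_integral_weighted_series_le[OF integrable_abs[OF block_shift_integrable] abs_ge_zero _ abs_ge_zero sms])
    show "expectation (\<lambda>\<omega>. \<bar>block_shift ?N n m i \<omega>\<bar>) \<le> min (2 * \<sigma>) (2 * \<sigma> * real i / sqrt (real n))" for i
      by (rule block_shift_expectation) (use that n in auto)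
  qed
  have "(\<integral>\<^sup>+\<omega>. R \<omega> \<partial>M) = (\<integral>\<^sup>+\<omega>. R1 \<omega> \<partial>M) + (\<Sum>m<?N. \<integral>\<^sup>+\<omega>. S m \<omega> \<partial>M)"
    unfolding R_def by (subst nn_integral_add) (auto simp: nn_integral_sum)
  also have "\<dots> \<le> ennreal ((\<Sum>i. \<bar>\<psi> i\<bar>) * chain_error q K n) + (\<Sum>m<?N. ennreal (shift_error n))"
    using Si by (intro add_mono R1i sum_mono) auto
  also have "(\<Sum>m<?N. ennreal (shift_error n)) = ennreal (16 ^ K * shift_error n)"
    using se by (simp add: sum_ennreal del: sum_constant) simp
  also have "ennreal ((\<Sum>i. \<bar>\<psi> i\<bar>) * chain_error q K n) + ennreal (16 ^ K * shift_error n)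
      = ennreal ((\<Sum>i. \<bar>\<psi> i\<bar>) * chain_error q K n + 16 ^ K * shift_error n)"
    using ce se by (intro ennreal_plus[symmetric] mult_nonneg_nonneg suminf_nonneg summable_\<psi>) auto
  finally have Ri: "(\<integral>\<^sup>+\<omega>. R \<omega> \<partial>M) \<le> ennreal ((\<Sum>i. \<bar>\<psi> i\<bar>) * chain_error q K n + 16 ^ K * shift_error n)" .
  have all: "AE \<omega> in M. \<forall>i. (\<lambda>j. \<psi> j * \<eta> (i - int j) \<omega>) sums X i \<omega>"
    unfolding AE_all_countable using X_sums by blast
  have "AE \<omega> in M. ennreal (mdist ?E (empirical_path q n \<omega>)
      (step_functional q K (\<lambda>m. ?A * ((\<Sum>j\<in>blk ?N n m. \<eta> (int j) \<omega>) / sqrt n)))) \<le> R \<omega>"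
    using all
  proof (rule AE_mp, intro AE_I2 impI)
    fix \<omega> assume \<omega>: "\<omega> \<in> space M" and sums: "\<forall>i. (\<lambda>j. \<psi> j * \<eta> (i - int j) \<omega>) sums X i \<omega>"
    let ?V = "\<lambda>m. (\<Sum>j\<in>blk ?N n m. X (int j) \<omega>) / sqrt n"
    let ?G = "\<lambda>m. ?A * ((\<Sum>j\<in>blk ?N n m. \<eta> (int j) \<omega>) / sqrt n)"
    \<comment> \<open>Inserting the series for X and for the sum of \<psi> turns the difference into
      the series of \<open>\<psi> i * block_shift ?N n m i \<omega>\<close>.\<close>
    have V: "ennreal \<bar>?V m - ?G m\<bar> \<le> S m \<omega>" for m
    proof -
      let ?b = "blk ?N n m"
      have \<psi>s: "\<psi> sums ?A" using summable_rabs_cancel[OF summable_\<psi>] by (rule summable_sums)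
      have "(\<lambda>i. (\<Sum>j\<in>?b. \<psi> i * \<eta> (int j - int i) \<omega>) / sqrt n - \<psi> i * ((\<Sum>j\<in>?b. \<eta> (int j) \<omega>) / sqrt n)) sums (?V m - ?G m)"
        using sums by (intro sums_diff sums_divide sums_sum sums_mult2 \<psi>s) auto
      also have "(\<lambda>i. (\<Sum>j\<in>?b. \<psi> i * \<eta> (int j - int i) \<omega>) / sqrt n - \<psi> i * ((\<Sum>j\<in>?b. \<eta> (int j) \<omega>) / sqrt n))
          = (\<lambda>i. \<psi> i * block_shift ?N n m i \<omega>)"
        by (simp add: block_shift_def sum_subtractf sum_distrib_left[symmetric] right_diff_distrib diff_divide_distrib)
      finally show ?thesis unfolding S_def abs_mult[symmetric] by (rule ennreal_abs_sums_le)
    qed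
    have D: "ennreal \<bar>empirical_path q n \<omega> f - step_functional q K ?V f\<bar> \<le> R1 \<omega>" if f: "f \<in> qvar_ball q" for f
    proof -
      let ?d = "\<lambda>j. f (real j / real n) - f (?t j)"
      have "(\<Sum>m<?N. f (tag K m) * ?V m) = (\<Sum>m<?N. \<Sum>j\<in>blk ?N n m. f (?t j) * X (int j) \<omega>) / sqrt n"
        by (simp add: sum_divide_distrib sum_distrib_left blk_def)
      also have "\<dots> = (\<Sum>j=1..n. f (?t j) * X (int j) \<omega>) / sqrt n"
        by (subst sum_blk[where N = ?N]) auto
      finally have eq: "empirical_path q n \<omega> f - step_functional q K ?V f = (\<Sum>j=1..n. ?d j * X (int j) \<omega>) / sqrt n"
        using f by (simp add: empirical_path_def step_functional_def left_diff_distrib sum_subtractf diff_divide_distrib)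
      have "(\<lambda>i. (\<Sum>j=1..n. ?d j * (\<psi> i * \<eta> (int j - int i) \<omega>)) / sqrt n) sums ((\<Sum>j=1..n. ?d j * X (int j) \<omega>) / sqrt n)"
        using sums by (intro sums_divide sums_sum sums_mult) auto
      from ennreal_abs_sums_le[OF this]
      have "ennreal \<bar>empirical_path q n \<omega> f - step_functional q K ?V f\<bar>
          \<le> (\<Sum>i. ennreal \<bar>(\<Sum>j=1..n. ?d j * (\<psi> i * \<eta> (int j - int i) \<omega>)) / sqrt n\<bar>)"
        unfolding eq .
      also have "\<dots> \<le> R1 \<omega>" unfolding R1_def
      proof (rule suminf_le)
        fix i
        have "(\<Sum>j=1..n. ?d j * (\<psi> i * \<eta> (int j - int i) \<omega>)) = \<psi> i * (\<Sum>j=1..n. ?d j * \<eta> (int j - int i) \<omega>)"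
          by (simp add: sum_distrib_left mult_ac)
        then have "\<bar>(\<Sum>j=1..n. ?d j * (\<psi> i * \<eta> (int j - int i) \<omega>)) / sqrt n\<bar>
            = \<bar>\<psi> i\<bar> * (\<bar>\<Sum>j=1..n. ?d j * \<eta> (int j - int i) \<omega>\<bar> / sqrt n)"
          by (simp add: abs_mult abs_divide)
        also have "\<dots> \<le> \<bar>\<psi> i\<bar> * \<Xi> i \<omega>" by (intro mult_left_mono \<Xi>b \<omega> f abs_ge_zero)
        finally show "ennreal \<bar>(\<Sum>j=1..n. ?d j * (\<psi> i * \<eta> (int j - int i) \<omega>)) / sqrt n\<bar> \<le> ennreal (\<bar>\<psi> i\<bar> * \<Xi> i \<omega>)"
          by (rule ennreal_leI)
      qed auto
      finally show ?thesis .
    qed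
    have em: "empirical_path q n \<omega> \<in> mspace ?E" by (rule empirical_path_mspace[OF q(1)])
    have sm: "step_functional q K v \<in> mspace ?E" for v by (rule step_functional_mspace[OF q(1)])
    \<comment> \<open>\<open>R1\<close> dominates the difference at every f, hence the supremum
      distance; where it is infinite the bound is trivial.\<close>
    have d1: "ennreal (mdist ?E (empirical_path q n \<omega>) (step_functional q K ?V)) \<le> R1 \<omega>"
    proof (cases "R1 \<omega>")
      case (real r)
      then have "mdist ?E (empirical_path q n \<omega>) (step_functional q K ?V) \<le> r"
        using D by (intro linfty_mdist_le em sm) auto
      then show ?thesis using real by (auto intro: ennreal_leI)
    qed simp
    have d2: "ennreal (mdist ?E (step_functional q K ?V) (step_functional q K ?G)) \<le> (\<Sum>m<?N. S m \<omega>)"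
    proof -
      have "ennreal (mdist ?E (step_functional q K ?V) (step_functional q K ?G)) \<le> ennreal (\<Sum>m<?N. \<bar>?V m - ?G m\<bar>)"
        by (intro ennreal_leI step_functional_lipschitz q(1))
      also have "\<dots> = (\<Sum>m<?N. ennreal \<bar>?V m - ?G m\<bar>)" by (rule sum_ennreal[symmetric]) simp
      also have "\<dots> \<le> (\<Sum>m<?N. S m \<omega>)" by (intro sum_mono V)
      finally show ?thesis .
    qed
    have "ennreal (mdist ?E (empirical_path q n \<omega>) (step_functional q K ?G))
        \<le> ennreal (mdist ?E (empirical_path q n \<omega>) (step_functional q K ?V) + mdist ?E (step_functional q K ?V) (step_functional q K ?G))"
      by (intro ennreal_leI mdist_triangle em sm)
    also have "\<dots> = ennreal (mdist ?E (empirical_path q n \<omega>) (step_functional q K ?V))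
        + ennreal (mdist ?E (step_functional q K ?V) (step_functional q K ?G))"
      by (rule ennreal_plus[OF mdist_nonneg mdist_nonneg])
    also have "\<dots> \<le> R \<omega>" unfolding R_def by (rule add_mono[OF d1 d2])
    finally show "ennreal (mdist ?E (empirical_path q n \<omega>) (step_functional q K ?G)) \<le> R \<omega>" .
  qed
  with Rm Ri show ?thesis by blast
qed

lemma outer_expectation_empirical_path:
  assumes q: "1 \<le> q" "q < 2" and nK: "16 ^ K \<le> n"
    and h: "\<And>x y. x \<in> mspace (linfty (qvar_ball q)) \<Longrightarrow> y \<in> mspace (linfty (qvar_ball q)) \<Longrightarrow>
      \<bar>h x - h y\<bar> \<le> L * mdist (linfty (qvar_ball q)) x y" and L: "0 \<le> L"
    and bd: "\<And>x. x \<in> mspace (linfty (qvar_ball q)) \<Longrightarrow> \<bar>h x\<bar> \<le> C"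
  defines "y \<equiv> expectation (\<lambda>\<omega>. h (step_functional q K (\<lambda>m. (\<Sum>i. \<psi> i) * ((\<Sum>j\<in>blk (16 ^ K) n m. \<eta> (int j) \<omega>) / sqrt n))))"
    and "r \<equiv> L * ((\<Sum>i. \<bar>\<psi> i\<bar>) * chain_error q K n + 16 ^ K * shift_error n)"
  shows "\<exists>t. outer_expectation M (\<lambda>\<omega>. h (empirical_path q n \<omega>)) = ereal t \<and> \<bar>t - y\<bar> \<le> max 0 r"
proof -
  let ?s = "\<lambda>\<omega>. step_functional q K (\<lambda>m. (\<Sum>i. \<psi> i) * ((\<Sum>j\<in>blk (16 ^ K) n m. \<eta> (int j) \<omega>) / sqrt n))"
  let ?T = "\<lambda>\<omega>. h (empirical_path q n \<omega>)" and ?e = "(\<Sum>i. \<bar>\<psi> i\<bar>) * chain_error q K n + 16 ^ K * shift_error n"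
  have em: "empirical_path q n \<omega> \<in> mspace (linfty (qvar_ball q))" for \<omega> by (rule empirical_path_mspace[OF q(1)])
  have sm: "?s \<omega> \<in> mspace (linfty (qvar_ball q))" for \<omega> by (rule step_functional_mspace[OF q(1)])
  obtain R where R: "R \<in> borel_measurable M" "(\<integral>\<^sup>+\<omega>. R \<omega> \<partial>M) \<le> ennreal ?e"
    "AE \<omega> in M. ennreal (mdist (linfty (qvar_ball q)) (empirical_path q n \<omega>) (?s \<omega>)) \<le> R \<omega>"
    using empirical_path_approx[OF q nK] by blast
  have sM: "(\<lambda>\<omega>. h (?s \<omega>)) \<in> borel_measurable M"
    by (rule step_functional_compose_measurable[OF q(1) h L]) measurable
  \<comment> \<open>\<open>outer_expectation_approx\<close> takes a nonnegative bound;
    \<open>max 0 r\<close> supplies one whatever the sign of r.\<close>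
  have Li: "(\<integral>\<^sup>+\<omega>. ennreal L * R \<omega> \<partial>M) \<le> ennreal (max 0 r)"
  proof -
    have "(\<integral>\<^sup>+\<omega>. ennreal L * R \<omega> \<partial>M) = ennreal L * (\<integral>\<^sup>+\<omega>. R \<omega> \<partial>M)" using R(1) by (rule nn_integral_cmult)
    also have "\<dots> \<le> ennreal L * ennreal ?e" by (intro mult_left_mono R(2)) simp
    also have "\<dots> = ennreal r" unfolding r_def using L by (simp add: ennreal_mult')
    also have "\<dots> \<le> ennreal (max 0 r)" by (intro ennreal_leI) simp
    finally show ?thesis .
  qed
  have TY: "AE \<omega> in M. ennreal \<bar>?T \<omega> - h (?s \<omega>)\<bar> \<le> ennreal L * R \<omega>"
    using R(3)
  proof (rule AE_mp, intro AE_I2 impI)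
    fix \<omega> assume d: "ennreal (mdist (linfty (qvar_ball q)) (empirical_path q n \<omega>) (?s \<omega>)) \<le> R \<omega>"
    have "ennreal \<bar>?T \<omega> - h (?s \<omega>)\<bar> \<le> ennreal (L * mdist (linfty (qvar_ball q)) (empirical_path q n \<omega>) (?s \<omega>))"
      by (intro ennreal_leI h em sm)
    also have "\<dots> = ennreal L * ennreal (mdist (linfty (qvar_ball q)) (empirical_path q n \<omega>) (?s \<omega>))"
      using L by (simp add: ennreal_mult')
    also have "\<dots> \<le> ennreal L * R \<omega>" by (intro mult_left_mono d) simp
    finally show "ennreal \<bar>?T \<omega> - h (?s \<omega>)\<bar> \<le> ennreal L * R \<omega>" .
  qed
  have lo: "ereal (y - max 0 r) \<le> outer_expectation M ?T" and hi: "outer_expectation M ?T \<le> ereal (y + max 0 r)"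
    using outer_expectation_approx[OF bd[OF em] sM bd[OF sm] _ Li _ TY] R(1) unfolding y_def by auto
  then show ?thesis by (cases "outer_expectation M ?T") (auto simp: abs_le_iff)
qed

end

section \<open>Convergence of the empirical process\<close>

context gaussian_family
begin

lemma B_standardized_law:
  "distr N (\<Pi>\<^sub>M m\<in>{..<16 ^ k}. borel) (\<lambda>\<omega>. \<lambda>m\<in>{..<16 ^ k}. B k m \<omega> * sqrt (real (16 ^ k)))
    = (\<Pi>\<^sub>M m\<in>{..<16 ^ k}. std_normal_distribution)"
proof -
  let ?J = "{..<16 ^ k} :: nat set" and ?c = "sqrt (real (16 ^ k))"
  have ne: "?J \<noteq> {}" by (auto simp: lessThan_empty_iff)
  have "indep_vars (\<lambda>_. borel) (B k) ?J"
    using indep_vars_iff_distr_eq_PiM'[where I = ?J and X = "B k" and M' = "\<lambda>_. borel"] ne B_measurable B_joint_law by auto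
  then have "indep_vars (\<lambda>_. borel) (\<lambda>m \<omega>. B k m \<omega> * ?c) ?J"
    by (rule indep_vars_compose2) measurable
  moreover have "(\<lambda>\<omega>. B k m \<omega> * ?c) \<in> borel_measurable N" if "m \<in> ?J" for m
    using that by (intro borel_measurable_times B_measurable) auto
  ultimately have "distr N (\<Pi>\<^sub>M m\<in>?J. borel) (\<lambda>\<omega>. \<lambda>m\<in>?J. B k m \<omega> * ?c) = (\<Pi>\<^sub>M m\<in>?J. distr N borel (\<lambda>\<omega>. B k m \<omega> * ?c))"
    using indep_vars_iff_distr_eq_PiM'[where I = ?J and X = "\<lambda>m \<omega>. B k m \<omega> * ?c" and M' = "\<lambda>_. borel"] ne by blast
  also have "\<dots> = (\<Pi>\<^sub>M m\<in>?J. std_normal_distribution)"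
  proof (rule PiM_cong)
    fix m assume "m \<in> ?J"
    then show "distr N borel (\<lambda>\<omega>. B k m \<omega> * ?c) = std_normal_distribution"
      using normal0_standardize[OF B_normal0[of m k]] by (simp add: real_sqrt_divide)
  qed simp
  finally show ?thesis .
qed

lemma isonormal: "isonormal_process N \<nu>"
proof -
  have sq0: "0 \<le> sqn f" for f unfolding sqn_def by (intro Bochner_Integration.integral_nonneg) simp
  have one: "normal0 N (\<nu> f) (sqn f)" if f: "f \<in> L2_unit" for f
    using family[of "{f}" "\<lambda>_. 1"] f by simp
  have cov: "expectation (\<lambda>\<omega>. \<nu> f \<omega> * \<nu> g \<omega>) = (\<integral>x. f x * g x \<partial>lebesgue_on {0..1})"
    if f: "f \<in> L2_unit" and g: "g \<in> L2_unit" for f g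
  \<comment> \<open>Polarisation uses the variance of the sum, which \<open>family\<close> yields
    for the set {f, g} only if f and g are distinct.\<close>
  proof (cases "f = g")
    case True
    then show ?thesis using normal0_variance[OF one[OF f] sq0] by (simp add: sqn_def power2_eq_square)
  next
    case False
    note V = normal0_variance[OF one[OF f] sq0] normal0_variance[OF one[OF g] sq0]
      and I = normal0_integrable[OF one[OF f] sq0, of 2] normal0_integrable[OF one[OF g] sq0, of 2]
    have n: "normal0 N (\<lambda>\<omega>. \<nu> f \<omega> + \<nu> g \<omega>) (sqn (\<lambda>x. f x + g x))"
      using family[of "{f, g}" "\<lambda>_. 1"] f g False by simp
    note V' = normal0_variance[OF n sq0] and I' = normal0_integrable[OF n sq0, of 2]
    have pol: "a * b = ((a + b)\<^sup>2 - a\<^sup>2 - b\<^sup>2) / 2" for a b :: real by (simp add: power2_eq_square algebra_simps)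
    have "expectation (\<lambda>\<omega>. \<nu> f \<omega> * \<nu> g \<omega>)
        = expectation (\<lambda>\<omega>. ((\<nu> f \<omega> + \<nu> g \<omega>)\<^sup>2 - (\<nu> f \<omega>)\<^sup>2 - (\<nu> g \<omega>)\<^sup>2) / 2)"
      by (rule Bochner_Integration.integral_cong[OF refl pol])
    also have "\<dots> = (sqn (\<lambda>x. f x + g x) - sqn f - sqn g) / 2"
      using V V' I I' by simp
    also have "\<dots> = (\<integral>x. ((f x + g x)\<^sup>2 - (f x)\<^sup>2 - (g x)\<^sup>2) / 2 \<partial>unit_leb)"
    proof -
      have L: "f \<in> L2m" "g \<in> L2m" using f g by (auto simp: L2_unit_def L2m_def)
      show ?thesis unfolding sqn_def using L2m_add[OF L] L by (simp add: L2m_def)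
    qed
    also have "\<dots> = (\<integral>x. f x * g x \<partial>unit_leb)"
      by (rule Bochner_Integration.integral_cong[OF refl pol[symmetric]])
    finally show ?thesis .
  qed
  show ?thesis unfolding isonormal_process_def centred_gaussian_process_def
    using prob_space_axioms cov normal0_gaussian_rv[OF family sq0] normal0_mean[OF one sq0] by auto
qed

end

context linear_process
begin

text \<open>A Lipschitz test meets three errors: from the path to the block sums of level K
  (\<open>r\<close>), from the block sums to their normal limit at fixed K (\<open>y\<close> to
  \<open>y'\<close>), and from level K of the Gaussian process to its limit path (\<open>g\<close>).
  First K is fixed so that \<open>g\<close> and the limit of \<open>r\<close> are small together,
  and then n grows.\<close>

lemma empirical_path_converges:
  assumes G: "gaussian_family N \<nu> q"
  shows "converges_outer_distr (linfty (qvar_ball q)) (\<lambda>_. M) (empirical_path q)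
    N (gaussian_family.limit_path N \<nu> q (\<sigma> * (\<Sum>i. \<psi> i)))"
proof -
  interpret G: gaussian_family N \<nu> q by (rule G)
  note q = G.q
  let ?E = "linfty (qvar_ball q)" and ?A = "\<Sum>i. \<psi> i"
  show ?thesis
  proof (rule converges_outer_distrI_lipschitz)
    show "prob_space M" by (rule prob_space_axioms)
    show "empirical_path q n ` space M \<subseteq> mspace ?E" for n using empirical_path_mspace[OF q(1)] by auto
    show "prob_space N" by (rule G.prob_space_axioms)
    show "separable_borel_valued N ?E (G.limit_path (\<sigma> * ?A))" by (rule G.limit_path_separable)
    fix h L C
    assume h: "\<And>x y. x \<in> mspace ?E \<Longrightarrow> y \<in> mspace ?E \<Longrightarrow> \<bar>h x - h y\<bar> \<le> L * mdist ?E x y"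
      and bd: "\<And>x. x \<in> mspace ?E \<Longrightarrow> \<bar>h x\<bar> \<le> C" and L: "0 \<le> L"
    let ?o = "\<lambda>n. outer_expectation M (\<lambda>\<omega>. h (empirical_path q n \<omega>))"
    define e where "e = G.expectation (\<lambda>\<omega>. h (G.limit_path (\<sigma> * ?A) \<omega>))"
    define y where "y K n = expectation (\<lambda>\<omega>. h (step_functional q K (\<lambda>m. ?A * ((\<Sum>j\<in>blk (16 ^ K) n m. \<eta> (int j) \<omega>) / sqrt n))))" for K n :: nat
    define y' where "y' K = G.expectation (\<lambda>\<omega>. h (step_functional q K (\<lambda>m. ?A * \<sigma> * G.B K m \<omega>)))" for K
    define r where "r K n = L * ((\<Sum>i. \<bar>\<psi> i\<bar>) * chain_error q K n + 16 ^ K * shift_error n)" for K n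
    define r' where "r' K = L * ((\<Sum>i. \<bar>\<psi> i\<bar>) * (2 * chain_const (\<sigma>\<^sup>2) * (chain_ratio q ^ K / (1 - chain_ratio q) + 2 * (1 / 2) ^ K)))" for K
    define g where "g K = L * \<bar>\<sigma> * ?A\<bar> * G.gaussian_tail K" for K
    have y: "y K \<longlonglongrightarrow> y' K" for K
      unfolding y_def[abs_def] y'_def
    proof (rule block_sums_clt[OF ind distr_eq \<eta>_square \<eta>_mean \<eta>_var \<sigma>_pos _ _ _ _ L, where N = "16 ^ K" and K = C])
      show "\<bar>h (step_functional q K v) - h (step_functional q K w)\<bar> \<le> L * (\<Sum>m<16 ^ K. \<bar>v m - w m\<bar>)" for v w
        by (rule order_trans[OF h[OF step_functional_mspace step_functional_mspace] mult_left_mono[OF step_functional_lipschitz L]]) (rule q(1))+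
      show "\<bar>h (step_functional q K v)\<bar> \<le> C" for v by (intro bd step_functional_mspace q(1))
    qed (use G.B_standardized_law G.B_measurable in auto)
    have r: "r K \<longlonglongrightarrow> r' K" for K
    proof -
      have "r K \<longlonglongrightarrow> L * ((\<Sum>i. \<bar>\<psi> i\<bar>) * (2 ^ K * 0 + 2 * chain_const (\<sigma>\<^sup>2) * (chain_ratio q ^ K / (1 - chain_ratio q) + 2 / 2 ^ K)) + 16 ^ K * 0)"
        unfolding r_def[abs_def] chain_error_def by (intro tendsto_intros truncated_var_tendsto shift_error_tendsto)
      then show ?thesis by (simp add: r'_def power_one_over)
    qed
    have gr: "(\<lambda>K. max 0 (r' K) + g K) \<longlonglongrightarrow> 0"
    proof -
      have "(\<lambda>K. max 0 (r' K) + g K) \<longlonglongrightarrow> max 0 (L * ((\<Sum>i. \<bar>\<psi> i\<bar>) * (2 * chain_const (\<sigma>\<^sup>2) * (0 / (1 - chain_ratio q) + 2 * 0)))) + L * \<bar>\<sigma> * ?A\<bar> * 0"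
        unfolding r'_def g_def using chain_ratio(1,2)[OF q]
        by (intro tendsto_intros G.gaussian_tail_tendsto LIMSEQ_power_zero) auto
      then show ?thesis by simp
    qed
    have yg: "\<bar>y' K - e\<bar> \<le> g K" for K
      unfolding y'_def e_def g_def using G.limit_path_expectation[OF h L bd, of K "\<sigma> * ?A"] by (simp add: mult.commute[of ?A])
    have ex: "\<exists>t. ?o n = ereal t \<and> \<bar>t - y K n\<bar> \<le> max 0 (r K n)" if "16 ^ K \<le> n" for K n
      unfolding y_def r_def by (rule outer_expectation_empirical_path[OF q that h L bd])
    \<comment> \<open>By the case K = 0 the outer expectations are finite from n = 1 on, so
      convergence is proved for real numbers and transferred back.\<close>
    have "(\<lambda>n. real_of_ereal (?o n)) \<longlonglongrightarrow> e"
    proof (rule tendstoI)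
      fix \<epsilon> :: real assume "0 < \<epsilon>"
      then have "\<forall>\<^sub>F K in sequentially. max 0 (r' K) + g K < \<epsilon>" by (rule order_tendstoD(2)[OF gr])
      then obtain K where K: "max 0 (r' K) + g K < \<epsilon>" using eventually_happens'[OF sequentially_bot] by blast
      have "(\<lambda>n. \<bar>y K n - y' K\<bar> + max 0 (r K n) + g K) \<longlonglongrightarrow> \<bar>y' K - y' K\<bar> + max 0 (r' K) + g K"
        by (intro tendsto_intros y r)
      then have "\<forall>\<^sub>F n in sequentially. \<bar>y K n - y' K\<bar> + max 0 (r K n) + g K < \<epsilon>"
        using K by (intro order_tendstoD(2)) auto
      then show "\<forall>\<^sub>F n in sequentially. dist (real_of_ereal (?o n)) e < \<epsilon>"
        using eventually_ge_at_top[of "16 ^ K"]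
      proof eventually_elim
        case (elim n)
        obtain t where t: "?o n = ereal t" "\<bar>t - y K n\<bar> \<le> max 0 (r K n)" using ex[OF elim(2)] by blast
        have "\<bar>t - e\<bar> < \<epsilon>" using t(2) elim(1) yg[of K] by linarith
        then show ?case using t(1) by (simp add: dist_real_def)
      qed
    qed
    then have "(\<lambda>n. ereal (real_of_ereal (?o n))) \<longlonglongrightarrow> ereal e" by simp
    moreover have "\<forall>\<^sub>F n in sequentially. ereal (real_of_ereal (?o n)) = ?o n"
    proof (rule eventually_sequentiallyI[of 1])
      fix n :: nat assume "1 \<le> n"
      then obtain t where "?o n = ereal t" using ex[of 0 n] by auto
      then show "ereal (real_of_ereal (?o n)) = ?o n" by simp
    qed
    ultimately show "?o \<longlonglongrightarrow> ereal (G.expectation (\<lambda>\<omega>. h (G.limit_path (\<sigma> * ?A) \<omega>)))"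
      unfolding e_def by (rule Lim_transform_eventually)
  qed
qed

end

theorem corollary12:
  fixes M :: "'a measure"
    and \<eta> X :: "int \<Rightarrow> 'a \<Rightarrow> real"
    and \<psi> :: "nat \<Rightarrow> real"
    and \<sigma> \<beta> q :: real
    and betahat :: "nat \<Rightarrow> (real \<Rightarrow> real) \<Rightarrow> 'a \<Rightarrow> real"
    and W :: "nat \<Rightarrow> 'a \<Rightarrow> (real \<Rightarrow> real) \<Rightarrow> real"
  assumes "1 \<le> q" and "q < 2"
    and "short_memory_linear_process M \<eta> \<sigma> \<psi> X"
    and "\<And>n f \<omega>. 1 \<le> n \<Longrightarrow> f \<in> qvar_ball q \<Longrightarrow> \<omega> \<in> space M \<Longrightarrow>
           is_lse n f (\<lambda>j. \<beta> * f (real j / real n) + X (int j) \<omega>) (betahat n f \<omega>)"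
    and "\<And>n \<omega>. W n \<omega> = (\<lambda>f\<in>qvar_ball q.
           1 / sqrt (real n) * (\<Sum>j=1..n. (f (real j / real n))\<^sup>2 * (betahat n f \<omega> - \<beta>)))"
  shows "\<exists>(N :: ((real \<Rightarrow> real) \<Rightarrow> real) measure) \<nu> \<nu>'.
           isonormal_process N \<nu> \<and>
           version_on N (qvar_ball q) \<nu> \<nu>' \<and>
           separable_borel_valued N (linfty (qvar_ball q)) (\<lambda>\<omega>. \<lambda>f\<in>qvar_ball q. \<nu>' f \<omega>) \<and>
           converges_outer_distr (linfty (qvar_ball q)) (\<lambda>_. M) W
             N (\<lambda>\<omega>. \<lambda>f\<in>qvar_ball q. \<sigma> * (\<Sum>j. \<psi> j) * \<nu>' f \<omega>)"
proof -
  interpret linear_process M \<eta> X \<sigma> \<psi>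
    by (rule linear_process.intro[OF _ linear_process_axioms.intro[OF assms(3)]])
      (use assms(3) in \<open>simp add: short_memory_linear_process_def\<close>)
  obtain N :: "((real \<Rightarrow> real) \<Rightarrow> real) measure" and \<nu> where N: "prob_space N \<and>
    (\<forall>S c. finite S \<and> S \<subseteq> L2_unit \<longrightarrow>
      normal0 N (\<lambda>\<omega>. \<Sum>t\<in>S. c t * \<nu> t \<omega>) (sqn (\<lambda>x. \<Sum>t\<in>S. c t * t x)))"
    by (rule exE[OF gaussian_family_exists], erule exE)
  have family: "normal0 N (\<lambda>\<omega>. \<Sum>t\<in>S. c t * \<nu> t \<omega>) (sqn (\<lambda>x. \<Sum>t\<in>S. c t * t x))"
    if "finite S" "S \<subseteq> L2_unit" for S c using N that by simp
  have G: "gaussian_family N \<nu> q"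
    by (intro gaussian_family.intro gaussian_family_axioms.intro N[THEN conjunct1] family assms(1,2))
  interpret G: gaussian_family N \<nu> q by (rule G)
  \<comment> \<open>The condition on the estimator starts at n = 1. At n = 0 both sides are empty
    sums, hence 0 on the ball.\<close>
  have W: "W n \<omega> = empirical_path q n \<omega>" if \<omega>: "\<omega> \<in> space M" for n \<omega>
  proof (cases "n = 0")
    case False
    have "(\<Sum>j=1..n. (f (real j / real n))\<^sup>2 * (betahat n f \<omega> - \<beta>)) = (\<Sum>j=1..n. f (real j / real n) * X (int j) \<omega>)"
      if f: "f \<in> qvar_ball q" for f
      using False by (intro lse_identity assms(4) f \<omega>) simp
    then show ?thesis unfolding assms(5) empirical_path_def by (intro restrict_ext) simp
  qed (simp add: assms(5) empirical_path_def)
  have outer: "outer_expectation M (\<lambda>\<omega>. h (W n \<omega>)) = outer_expectation M (\<lambda>\<omega>. h (empirical_path q n \<omega>))"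
    for h :: "((real \<Rightarrow> real) \<Rightarrow> real) \<Rightarrow> real" and n
    unfolding outer_expectation_def by (simp add: W cong: ball_cong)
  have "W n ` space M = empirical_path q n ` space M" for n by (intro image_cong refl W)
  then have "converges_outer_distr (linfty (qvar_ball q)) (\<lambda>_. M) W N (G.limit_path (\<sigma> * (\<Sum>j. \<psi> j)))"
    using empirical_path_converges[OF G] unfolding converges_outer_distr_def outer by simp
  \<comment> \<open>The version itself is the limit path with factor c = 1.\<close>
  then show ?thesis
    using G.isonormal G.\<nu>'_version G.limit_path_separable[of 1]
    unfolding G.limit_path_def[abs_def] by (intro exI[of _ N] exI[of _ \<nu>] exI[of _ G.\<nu>'] conjI) simp_all
qed

end
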